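(* Let $m\ge 0$ and $T>0$, and consider the initial value problem $$i\partial_t u=\sqrt{-\Delta+m^2}\,u-(|x|^{-1}\ast|u|^2)u \quad\text{on }\mathbb{R}^3,\qquad u(0,\cdot)=\phi .$$ If the flow map $\phi\mapsto u$ exists as a map from $L^2_{rad}(\mathbb{R}^3)$ to $C([0,T],L^2_{rad}(\mathbb{R}^3))$, then it fails to be locally uniformly continuous, i.e. it is not the case that it is uniformly continuous on every ball of $L^2_{rad}(\mathbb{R}^3)$.
   Context: $\sqrt{-\Delta+m^2}$ is the Fourier multiplier with symbol $\sqrt{|\xi|^2+m^2}$, and $\ast$ is convolution in $x\in\mathbb{R}^3$. $L^2_{rad}(\mathbb{R}^3)$ is the closed subspace of radial functions in the complex space $L^2(\mathbb{R}^3)$. A flow map is a map $\Phi$ assigning to each $\phi$ the solution $u$ with initial datum $\phi$; in particular, whenever $\phi\in H^{1/2}(\mathbb{R}^3)$ and the (unique) solution $u\in C([0,T],H^{1/2}(\mathbb{R}^3))$ with datum $\phi$ exists on $[0,T]$, $\Phi(\phi)$ is equal to that solution. *)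

theory Defs
  imports "HOL-Analysis.Analysis"
begin

text \<open>
  Elements of $L^2(\mathbb{R}^3)$ are represented by Borel functions; two representatives denote
  the same element iff they agree almost everywhere.
\<close>

definition L2 :: "(real^3 \<Rightarrow> complex) set" where
  "L2 = {f \<in> borel_measurable lborel. integrable lborel (\<lambda>x. (cmod (f x))\<^sup>2)}"

definition L2_dist :: "(real^3 \<Rightarrow> complex) \<Rightarrow> (real^3 \<Rightarrow> complex) \<Rightarrow> real" where
  "L2_dist f g = sqrt (LINT x|lborel. (cmod (f x - g x))\<^sup>2)"

definition L2_rad :: "(real^3 \<Rightarrow> complex) set" where
  "L2_rad = {f \<in> L2. \<exists>g :: real \<Rightarrow> complex. AE x in lborel. f x = g (norm x)}"

definition fourier_L1 :: "(real^3 \<Rightarrow> complex) \<Rightarrow> real^3 \<Rightarrow> complex" where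
  "fourier_L1 f \<xi> = of_real ((2 * pi) powr (-(3/2))) * (LINT x|lborel. cis (-(x \<bullet> \<xi>)) * f x)"

text \<open>
  The Fourier--Plancherel transform of \<open>f \<in> L2\<close> is the limit in $L^2$ of the Fourier integrals of
  the truncations of \<open>f\<close> to the balls of radius \<open>n\<close> (which are integrable). It is determined up to
  a null set. The squared norm is taken in \<^typ>\<open>ennreal\<close>, so that convergence to 0 does not rely
  on the convention that the integral of a non-integrable function is 0.
\<close>

definition fourier_L2 :: "(real^3 \<Rightarrow> complex) \<Rightarrow> real^3 \<Rightarrow> complex" where
  "fourier_L2 f = (SOME g. g \<in> L2 \<and>
     (\<lambda>n. \<integral>\<^sup>+\<xi>. ennreal ((cmod (fourier_L1 (\<lambda>x. indicator (cball 0 (real n)) x * f x) \<xi> - g \<xi>))\<^sup>2)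
        \<partial>lborel) \<longlonglongrightarrow> 0)"

text \<open>
  The squared $H^s$ norm, as a functional of the Fourier transform \<open>v\<close>. Elements of $H^s$ with
  $s < 0$ need not be functions, but their Fourier transforms are.
\<close>

definition sobolev_sq :: "real \<Rightarrow> (real^3 \<Rightarrow> complex) \<Rightarrow> ennreal" where
  "sobolev_sq s v = (\<integral>\<^sup>+\<xi>. ennreal ((1 + (norm \<xi>)\<^sup>2) powr s * (cmod (v \<xi>))\<^sup>2) \<partial>lborel)"

definition H_half :: "(real^3 \<Rightarrow> complex) set" where
  "H_half = {f \<in> L2. sobolev_sq (1/2) (fourier_L2 f) < \<infinity>}"

definition sqrt_symbol :: "real \<Rightarrow> real^3 \<Rightarrow> real" where
  "sqrt_symbol m \<xi> = sqrt ((norm \<xi>)\<^sup>2 + m\<^sup>2)"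

definition hartree_potential :: "(real^3 \<Rightarrow> complex) \<Rightarrow> real^3 \<Rightarrow> real" where
  "hartree_potential f x = (LINT y|lborel. (cmod (f y))\<^sup>2 / norm (x - y))"

definition hartree_term :: "(real^3 \<Rightarrow> complex) \<Rightarrow> real^3 \<Rightarrow> complex" where
  "hartree_term f x = of_real (hartree_potential f x) * f x"

text \<open>
  \<open>u\<close> is in $C([0,T],H^{1/2})$, has initial datum \<open>\<phi>\<close>, and at every time in $[0,T]$ satisfies
  $i\partial_t u = \sqrt{-\Delta+m^2}\,u - (|x|^{-1}\ast|u|^2)u$, the time derivative (one-sided at
  the endpoints) being taken in $H^{-1/2}$, where the right-hand side lies for $u \in H^{1/2}$.
  The equation is written for the Fourier transforms; since $|x|^{-1}\ast|u|^2$ is bounded for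
  $u \in H^{1/2}$, the nonlinear term lies in $L^2$.
\<close>

definition H_half_solution ::
    "real \<Rightarrow> real \<Rightarrow> (real^3 \<Rightarrow> complex) \<Rightarrow> (real \<Rightarrow> real^3 \<Rightarrow> complex) \<Rightarrow> bool" where
  "H_half_solution m T \<phi> u \<longleftrightarrow>
     (\<forall>t\<in>{0..T}. u t \<in> H_half) \<and>
     (\<forall>t\<in>{0..T}. ((\<lambda>s. sobolev_sq (1/2) (\<lambda>\<xi>. fourier_L2 (u s) \<xi> - fourier_L2 (u t) \<xi>)) \<longlongrightarrow> 0)
        (at t within {0..T})) \<and>
     (\<forall>t\<in>{0..T}. ((\<lambda>s. sobolev_sq (-(1/2)) (\<lambda>\<xi>.
          \<i> * ((fourier_L2 (u s) \<xi> - fourier_L2 (u t) \<xi>) / of_real (s - t))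
          - (of_real (sqrt_symbol m \<xi>) * fourier_L2 (u t) \<xi> - fourier_L2 (hartree_term (u t)) \<xi>))) \<longlongrightarrow> 0)
        (at t within {0..T})) \<and>
     (AE x in lborel. u 0 x = \<phi> x)"

definition C_L2_rad :: "real \<Rightarrow> (real \<Rightarrow> real^3 \<Rightarrow> complex) set" where
  "C_L2_rad T = {u. (\<forall>t\<in>{0..T}. u t \<in> L2_rad) \<and>
     (\<forall>t\<in>{0..T}. ((\<lambda>s. L2_dist (u s) (u t)) \<longlongrightarrow> 0) (at t within {0..T}))}"

definition C_L2_dist ::
    "real \<Rightarrow> (real \<Rightarrow> real^3 \<Rightarrow> complex) \<Rightarrow> (real \<Rightarrow> real^3 \<Rightarrow> complex) \<Rightarrow> real" where
  "C_L2_dist T u v = (SUP t\<in>{0..T}. L2_dist (u t) (v t))"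

text \<open>
  No notion of solution is imposed on data outside $H^{1/2}$, beyond taking the initial value. The
  second conjunct says that \<open>\<Phi>\<close> is a map on almost-everywhere equivalence classes.
\<close>

definition flow_map ::
    "real \<Rightarrow> real \<Rightarrow> ((real^3 \<Rightarrow> complex) \<Rightarrow> real \<Rightarrow> real^3 \<Rightarrow> complex) \<Rightarrow> bool" where
  "flow_map m T \<Phi> \<longleftrightarrow>
     (\<forall>\<phi>\<in>L2_rad. \<Phi> \<phi> \<in> C_L2_rad T) \<and>
     (\<forall>\<phi>\<in>L2_rad. \<forall>\<psi>\<in>L2_rad. (AE x in lborel. \<phi> x = \<psi> x) \<longrightarrow>
        (\<forall>t\<in>{0..T}. AE x in lborel. \<Phi> \<phi> t x = \<Phi> \<psi> t x)) \<and>
     (\<forall>\<phi>\<in>L2_rad. AE x in lborel. \<Phi> \<phi> 0 x = \<phi> x) \<and>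
     (\<forall>\<phi>\<in>L2_rad \<inter> H_half. \<forall>u. H_half_solution m T \<phi> u \<longrightarrow>
        (\<forall>t\<in>{0..T}. AE x in lborel. \<Phi> \<phi> t x = u t x))"

definition L2_rad_ball :: "(real^3 \<Rightarrow> complex) \<Rightarrow> real \<Rightarrow> (real^3 \<Rightarrow> complex) set" where
  "L2_rad_ball \<phi> R = {f \<in> L2_rad. L2_dist \<phi> f < R}"

definition uniformly_continuous_flow_on ::
    "real \<Rightarrow> (real^3 \<Rightarrow> complex) set \<Rightarrow> ((real^3 \<Rightarrow> complex) \<Rightarrow> real \<Rightarrow> real^3 \<Rightarrow> complex) \<Rightarrow> bool" where
  "uniformly_continuous_flow_on T B \<Phi> \<longleftrightarrow>
     (\<forall>\<epsilon>>0. \<exists>\<delta>>0. \<forall>f\<in>B. \<forall>g\<in>B. L2_dist f g < \<delta> \<longrightarrow> C_L2_dist T (\<Phi> f) (\<Phi> g) < \<epsilon>)"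

definition locally_uniformly_continuous_flow ::
    "real \<Rightarrow> ((real^3 \<Rightarrow> complex) \<Rightarrow> real \<Rightarrow> real^3 \<Rightarrow> complex) \<Rightarrow> bool" where
  "locally_uniformly_continuous_flow T \<Phi> \<longleftrightarrow>
     (\<forall>\<phi>\<in>L2_rad. \<forall>R>0. uniformly_continuous_flow_on T (L2_rad_ball \<phi> R) \<Phi>)"

end

theory Submission
  imports Defs "HOL-Probability.Characteristic_Functions" "HOL-Library.Diagonal_Subsequence"
    "HOL-Real_Asymp.Real_Asymp"
begin

text \<open>
  For $\kappa \ge \max(1, m)$ there is a solitary wave $e^{i\kappa t} Q_\kappa$ with
  $Q_\kappa(x) = \kappa^{3/2} P(\kappa x)$, where the radially decreasing $P > 0$ solves
  $(\sqrt{-\Delta + \mu^2} + 1) P = (|x|^{-1} * P^2) P$ with $\mu = m/\kappa$. Such a $P$ comes from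
  maximising the Coulomb energy of $((\sqrt{-\Delta + \mu^2} + 1)^{-1} f)^2$; both kernels are mixtures of
  Gaussians, which makes all the bilinear forms involved positive and the maximisers radially decreasing.
  The profiles $P$ for $0 \le \mu \le 1$ form a precompact set in $L^2$ that stays away from 0.

  Let $\kappa_k = k\pi/T$. By precompactness there is, for every large $n$, a pair
  $n \le k < k' \le n + N$ of frequencies with nearby profiles, where $N$ does not depend on $n$. As
  $\kappa_{k'}/\kappa_k \to 1$, the dilations hardly differ either, so the initial data are as close as
  we like. But at time $T/(k' - k) \le T$ the two phases are opposite, and there the distance of the solutions is
  $\|Q_{\kappa_k} + Q_{\kappa_{k'}}\| \ge \|Q_{\kappa_k}\|$, which is bounded below.
\<close>

section \<open>The heat kernel\<close>

text \<open>For m > 0 the equation is not scale invariant: the profile depends on \<mu>, and the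
  variational construction picks one for each \<mu> without controlling how it varies.
  Precompactness of the whole family and a pigeonhole argument take the place of continuity in
  \<mu>. Dilation preserves the L2 norm, so all the solitary waves lie in one ball although their
  frequencies are unbounded. The maximisation runs over radially decreasing f only. This class is
  closed under convolution with radially decreasing kernels and under the Hartree nonlinearity, so
  Euler-Lagrange iterates remain competitors, and Helly's theorem supplies limits. The pointwise
  bound for \<open>conv (res_kernel \<mu>) f\<close> is only |x|^(-3/2) at infinity, which just
  fails to be square integrable. Compactness is therefore first proved for the Hartree term and the
  quartic energy, where the Coulomb potential adds decay; an L2 majorant of the profiles comes
  afterwards from the equation. Working in \<open>ennreal\<close> makes every convolution and
  bilinear form defined, so that finiteness is a conclusion and not a side condition.\<close>

lemma nn_integral_Cauchy_Schwarz:
  assumes [measurable]: "f \<in> borel_measurable M" "g \<in> borel_measurable M"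
  shows "(\<integral>\<^sup>+x. f x * g x \<partial>M)\<^sup>2 \<le> (\<integral>\<^sup>+x. (f x)\<^sup>2 \<partial>M) * (\<integral>\<^sup>+x. (g x)\<^sup>2 \<partial>M)"
proof -
  have am_gm: "2 * (a * b) \<le> a\<^sup>2 + b\<^sup>2" for a b :: ennreal
  proof (cases a; cases b)
    fix r s assume *: "0 \<le> r" "a = ennreal r" "0 \<le> s" "b = ennreal s"
    have "2 * (r * s) \<le> r\<^sup>2 + s\<^sup>2" using sum_squares_bound[of r s] by simp
    then have "ennreal (2 * (r * s)) \<le> ennreal (r\<^sup>2 + s\<^sup>2)" by (rule ennreal_leI)
    then show ?thesis using * by (simp add: ennreal_mult ennreal_power)
  qed (auto simp: power2_eq_square)
  let ?I = "\<integral>\<^sup>+x. f x * g x \<partial>M" and ?F = "\<integral>\<^sup>+x. (f x)\<^sup>2 \<partial>M" and ?G = "\<integral>\<^sup>+x. (g x)\<^sup>2 \<partial>M"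
  \<comment> \<open>The square becomes an iterated integral symmetric in x and y, and AM-GM is
    applied to f(x) g(y) and f(y) g(x). The order of integration is never interchanged, so the
    argument covers every measure.\<close>
  have "2 * ?I\<^sup>2 = (\<integral>\<^sup>+x. \<integral>\<^sup>+y. 2 * ((f x * g y) * (f y * g x)) \<partial>M \<partial>M)"
  proof -
    have "(\<integral>\<^sup>+x. \<integral>\<^sup>+y. 2 * ((f x * g y) * (f y * g x)) \<partial>M \<partial>M)
        = (\<integral>\<^sup>+x. \<integral>\<^sup>+y. (2 * (f x * g x)) * (f y * g y) \<partial>M \<partial>M)"
      by (simp add: mult_ac)
    also have "\<dots> = (\<integral>\<^sup>+x. (2 * (f x * g x)) * ?I \<partial>M)"
      by (intro nn_integral_cong nn_integral_cmult) simp
    also have "\<dots> = (\<integral>\<^sup>+x. 2 * (f x * g x) \<partial>M) * ?I"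
      by (rule nn_integral_multc) simp
    also have "(\<integral>\<^sup>+x. 2 * (f x * g x) \<partial>M) = 2 * ?I"
      by (rule nn_integral_cmult) simp
    finally show ?thesis by (simp add: power2_eq_square mult.assoc)
  qed
  also have "\<dots> \<le> (\<integral>\<^sup>+x. \<integral>\<^sup>+y. (f x * g y)\<^sup>2 + (f y * g x)\<^sup>2 \<partial>M \<partial>M)"
    by (intro nn_integral_mono am_gm)
  also have "\<dots> = (\<integral>\<^sup>+x. (f x)\<^sup>2 * ?G + ?F * (g x)\<^sup>2 \<partial>M)"
    by (intro nn_integral_cong)
       (simp add: power_mult_distrib nn_integral_add nn_integral_cmult nn_integral_multc)
  also have "\<dots> = 2 * (?F * ?G)"
    by (simp add: nn_integral_add nn_integral_cmult nn_integral_multc mult_2)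
  finally show ?thesis
    by (simp add: ennreal_mult_le_mult_iff)
qed

text \<open>The kernel of exp(u Laplacian) on R^3. The value 0 for u <= 0 lets mixtures of these
  kernels be integrated over the whole real line.\<close>

definition heat :: "real \<Rightarrow> real^3 \<Rightarrow> real" where
  "heat u z = (if u > 0 then exp (- (norm z)\<^sup>2 / (4 * u)) / sqrt (4 * pi * u) ^ 3 else 0)"

lemma heat_nonneg [simp]: "0 \<le> heat u z"
  by (simp add: heat_def)

lemma heat_pos: "u > 0 \<Longrightarrow> 0 < heat u z"
  by (simp add: heat_def)

lemma heat_neg [simp]: "u \<le> 0 \<Longrightarrow> heat u z = 0"
  by (simp add: heat_def)

lemma heat_antimono: "norm x \<le> norm y \<Longrightarrow> heat u y \<le> heat u x"
  by (auto simp: heat_def intro!: divide_right_mono)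

lemma measurable_heat [measurable]:
  assumes [measurable]: "f \<in> borel_measurable M" "g \<in> borel_measurable M"
  shows "(\<lambda>x. heat (f x) (g x)) \<in> borel_measurable M"
  unfolding heat_def by measurable

text \<open>The coordinates are independent centred Gaussians of variance 2u. This reduces the mass
  and the Fourier transform to one dimension.\<close>

lemma heat_eq_prod:
  assumes "u > 0"
  shows "heat u z = (\<Prod>b\<in>Basis. normal_density 0 (sqrt (2 * u)) (z \<bullet> b))"
proof -
  have "(\<Prod>b\<in>Basis. exp (- (z \<bullet> b)\<^sup>2 / (4 * u))) = exp (- (norm z)\<^sup>2 / (4 * u))"
    by (simp add: exp_sum[symmetric] sum_negf sum_divide_distrib[symmetric] norm_eq_sqrt_inner
        euclidean_inner[of z z] power2_eq_square sum_nonneg)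
  then show ?thesis using assms
    by (simp add: heat_def normal_density_def prod.distrib prod_dividef power_one_over mult_ac)
qed

lemma integral_lborel_prod:
  fixes f :: "'a::euclidean_space \<Rightarrow> real \<Rightarrow> complex"
  assumes int: "\<And>b. b \<in> Basis \<Longrightarrow> integrable lborel (f b)"
  shows "(LINT x|lborel. (\<Prod>b\<in>Basis. f b (x \<bullet> b))) = (\<Prod>b\<in>Basis. LINT t|lborel. f b t)"
    and "integrable lborel (\<lambda>x. \<Prod>b\<in>Basis. f b (x \<bullet> b))"
proof -
  interpret product_sigma_finite "\<lambda>_::'a. lborel :: real measure"
    by standard
  have [measurable]: "b \<in> Basis \<Longrightarrow> f b \<in> borel_measurable borel" for b
    using int[of b] by auto
  have inner: "(\<Sum>b\<in>Basis. g b *\<^sub>R b) \<bullet> c = g c" if "c \<in> Basis" for g and c :: 'a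
    using that by (simp add: inner_sum_left_Basis)
  have meas: "(\<lambda>x::'a. \<Prod>b\<in>Basis. f b (x \<bullet> b)) \<in> borel_measurable borel"
    by measurable
  have sum_meas: "(\<lambda>g. \<Sum>b\<in>(Basis::'a set). g b *\<^sub>R b) \<in> measurable (Pi\<^sub>M Basis (\<lambda>_. lborel)) borel"
    by measurable
  show "(LINT x|lborel. (\<Prod>b\<in>Basis. f b (x \<bullet> b))) = (\<Prod>b\<in>Basis. LINT t|lborel. f b t)"
    by (subst lborel_eq, subst integral_distr[OF sum_meas meas])
       (simp add: inner product_integral_prod int)
  show "integrable lborel (\<lambda>x. \<Prod>b\<in>Basis. f b (x \<bullet> b))"
    by (subst lborel_eq, subst integrable_distr_eq[OF sum_meas meas])
       (simp add: inner product_integrable_prod int)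
qed

lemma nn_integral_normal_density:
  "\<sigma> > 0 \<Longrightarrow> (\<integral>\<^sup>+x. ennreal (normal_density \<mu> \<sigma> x) \<partial>lborel) = 1"
  using prob_space.emeasure_space_1[OF prob_space_normal_density[of \<sigma> \<mu>]]
  by (simp add: emeasure_density)

lemma nn_integral_heat: "u > 0 \<Longrightarrow> (\<integral>\<^sup>+z. ennreal (heat u z) \<partial>lborel) = 1"
  by (simp add: heat_eq_prod prod_ennreal[symmetric] nn_integral_normal_density
      nn_integral_lborel_prod[of "\<lambda>_ x. ennreal (normal_density 0 (sqrt (2 * u)) x)"])

lemma measurable_cis [measurable]:
  assumes [measurable]: "f \<in> borel_measurable M"
  shows "(\<lambda>x. cis (f x)) \<in> borel_measurable M"
proof -
  have "cis \<in> borel_measurable borel"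
    by (intro borel_measurable_continuous_onI continuous_intros)
  then show ?thesis by measurable
qed

text \<open>Rescaling by \<sigma> leads to the characteristic function of the standard normal
  distribution, evaluated at \<open>- (\<sigma> * t)\<close>.\<close>

lemma fourier_normal_density:
  assumes "\<sigma> > 0"
  shows "(LINT x|lborel. cis (- (x * t)) * of_real (normal_density 0 \<sigma> x)) = of_real (exp (- (\<sigma> * t)\<^sup>2 / 2))"
    and "integrable lborel (\<lambda>x. cis (- (x * t)) * of_real (normal_density 0 \<sigma> x))"
proof -
  have "(LINT x|lborel. cis (- (x * t)) * of_real (normal_density 0 \<sigma> x))
      = \<bar>\<sigma>\<bar> *\<^sub>R (LINT x|lborel. cis (- ((0 + \<sigma> * x) * t)) * of_real (normal_density 0 \<sigma> (0 + \<sigma> * x)))"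
    using assms by (intro lborel_integral_real_affine) auto
  also have "\<dots> = (LINT x|lborel. std_normal_density x *\<^sub>R iexp ((- (\<sigma> * t)) * x))"
    using assms
    by (subst integral_scaleR_right[symmetric], intro Bochner_Integration.integral_cong refl)
       (auto simp: normal_density_def real_sqrt_mult power_mult_distrib cis_conv_exp scaleR_conv_of_real mult_ac)
  also have "\<dots> = char std_normal_distribution (- (\<sigma> * t))"
    unfolding char_def by (subst integral_density) (auto simp: normal_density_nonneg)
  also have "\<dots> = of_real (exp (- (\<sigma> * t)\<^sup>2 / 2))"
    by (simp add: char_std_normal_distribution)
  finally show "(LINT x|lborel. cis (- (x * t)) * of_real (normal_density 0 \<sigma> x)) = of_real (exp (- (\<sigma> * t)\<^sup>2 / 2))" .
  show "integrable lborel (\<lambda>x. cis (- (x * t)) * of_real (normal_density 0 \<sigma> x))"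
  proof (rule Bochner_Integration.integrable_bound)
    show "integrable lborel (normal_density 0 \<sigma>)" using assms by simp
  qed (auto simp: norm_mult)
qed

lemma cis_sum: "finite A \<Longrightarrow> cis (\<Sum>x\<in>A. f x) = (\<Prod>x\<in>A. cis (f x))"
  by (induction A rule: finite_induct) (auto simp: cis_mult[symmetric])

lemma fourier_heat:
  assumes "u > 0"
  shows "(LINT x|lborel. cis (- (x \<bullet> \<xi>)) * of_real (heat u x)) = of_real (exp (- u * (norm \<xi>)\<^sup>2))"
proof -
  have *: "cis (- (x \<bullet> \<xi>)) * of_real (heat u x)
    = (\<Prod>b\<in>Basis. cis (- ((x \<bullet> b) * (\<xi> \<bullet> b))) * of_real (normal_density 0 (sqrt (2 * u)) (x \<bullet> b)))" for x
    by (subst euclidean_inner[of x \<xi>])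
       (simp add: prod.distrib heat_eq_prod[OF assms] cis_sum[symmetric] sum_negf)
  have "(LINT x|lborel. cis (- (x \<bullet> \<xi>)) * of_real (heat u x))
     = (\<Prod>b\<in>Basis. complex_of_real (exp (- (sqrt (2 * u) * (\<xi> \<bullet> b))\<^sup>2 / 2)))"
    unfolding * using assms
    by (subst integral_lborel_prod) (auto simp: fourier_normal_density)
  also have "\<dots> = of_real (\<Prod>b\<in>Basis. exp (- u * (\<xi> \<bullet> b)\<^sup>2))"
    using assms by (simp add: power_mult_distrib)
  also have "(\<Prod>b\<in>Basis. exp (- u * (\<xi> \<bullet> b)\<^sup>2)) = exp (- u * (norm \<xi>)\<^sup>2)"
    by (simp add: exp_sum[symmetric] sum_negf sum_distrib_left[symmetric] norm_eq_sqrt_inner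
        euclidean_inner[of \<xi> \<xi>] power2_eq_square sum_nonneg)
  finally show ?thesis .
qed

text \<open>Parallelogram law: the product of the two Gaussians is a Gaussian in \<open>z\<close> centred at the midpoint.\<close>

lemma heat_semigroup_half:
  "(\<integral>\<^sup>+z. ennreal (heat (u / 2) (z - x)) * ennreal (heat (u / 2) (z - y)) \<partial>lborel) = ennreal (heat u (x - y))"
proof (cases "u > 0")
  case True
  let ?m = "(1/2) *\<^sub>R (x + y)"
  have norm_eq: "(norm (z - x))\<^sup>2 + (norm (z - y))\<^sup>2 = 2 * (norm (- ?m + z))\<^sup>2 + (norm (x - y))\<^sup>2 / 2" for z
    by (simp add: power2_norm_eq_inner inner_diff_left inner_diff_right
        inner_add_left inner_add_right inner_commute field_simps)
  have *: "heat (u / 2) (z - x) * heat (u / 2) (z - y) = heat u (x - y) * heat (u / 4) (- ?m + z)" for z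
  proof -
    have e: "exp (- (norm (z - x))\<^sup>2 / (2*u)) * exp (- (norm (z - y))\<^sup>2 / (2*u))
         = exp (- (norm (x - y))\<^sup>2 / (4 * u)) * exp (- (norm (- ?m + z))\<^sup>2 / u)"
    proof -
      have "exp (- (norm (z - x))\<^sup>2 / (2*u)) * exp (- (norm (z - y))\<^sup>2 / (2*u))
          = exp (- ((norm (z - x))\<^sup>2 + (norm (z - y))\<^sup>2) / (2*u))"
        by (simp add: exp_add[symmetric] diff_divide_distrib add_divide_distrib)
      also have "\<dots> = exp (- (norm (x - y))\<^sup>2 / (4 * u) + - (norm (- ?m + z))\<^sup>2 / u)"
        unfolding norm_eq using True by (simp add: field_simps)
      finally show ?thesis by (simp only: exp_add)
    qed
    have s: "sqrt (2 * pi * u) ^ 3 * sqrt (2 * pi * u) ^ 3 = sqrt (4 * pi * u) ^ 3 * sqrt (pi * u) ^ 3"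
    proof -
      have "sqrt (4 * pi * u) = 2 * sqrt (pi * u)" by (simp add: real_sqrt_mult)
      then have "sqrt (2 * pi * u) * sqrt (2 * pi * u) = sqrt (4 * pi * u) * sqrt (pi * u)"
        using True by (simp add: mult_ac)
      then show ?thesis by (simp only: power_mult_distrib[symmetric])
    qed
    show ?thesis
      using True e s by (simp add: heat_def field_simps)
  qed
  have "(\<integral>\<^sup>+z. ennreal (heat (u / 2) (z - x)) * ennreal (heat (u / 2) (z - y)) \<partial>lborel)
     = (\<integral>\<^sup>+z. ennreal (heat u (x - y)) * ennreal (heat (u / 4) (- ?m + z)) \<partial>lborel)"
    by (simp only: * ennreal_mult[symmetric] heat_nonneg)
  also have "\<dots> = ennreal (heat u (x - y)) * (\<integral>\<^sup>+z. ennreal (heat (u / 4) (- ?m + z)) \<partial>lborel)"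
    by (rule nn_integral_cmult) simp
  also have "(\<integral>\<^sup>+z. ennreal (heat (u / 4) (- ?m + z)) \<partial>lborel) = (\<integral>\<^sup>+z. ennreal (heat (u / 4) z) \<partial>distr lborel borel ((+) (- ?m)))"
    by (subst nn_integral_distr) auto
  also have "\<dots> = 1"
    using True by (simp add: lborel_distr_plus nn_integral_heat)
  finally show ?thesis by simp
qed simp

section \<open>Convolution with mixtures of heat kernels\<close>

lemma nn_integral_swap:
  fixes f :: "'a::euclidean_space \<Rightarrow> 'b::euclidean_space \<Rightarrow> ennreal"
  assumes "case_prod f \<in> borel_measurable (borel \<Otimes>\<^sub>M borel)"
  shows "(\<integral>\<^sup>+x. \<integral>\<^sup>+y. f x y \<partial>lborel \<partial>lborel) = (\<integral>\<^sup>+y. \<integral>\<^sup>+x. f x y \<partial>lborel \<partial>lborel)"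
  by (rule lborel_pair.Fubini'[symmetric]) (use assms in simp)

lemma nn_integral_lborel_pair:
  fixes f :: "'a::euclidean_space \<times> 'b::euclidean_space \<Rightarrow> ennreal"
  assumes [measurable]: "f \<in> borel_measurable borel"
  shows "(\<integral>\<^sup>+p. f p \<partial>lborel) = (\<integral>\<^sup>+x. \<integral>\<^sup>+y. f (x, y) \<partial>lborel \<partial>lborel)"
proof -
  have "f \<in> borel_measurable (lborel \<Otimes>\<^sub>M lborel)"
    by (simp add: lborel_prod)
  from lborel.nn_integral_fst[OF this] show ?thesis
    by (simp add: lborel_prod)
qed

lemma nn_integral_shift:
  fixes f :: "'a::euclidean_space \<Rightarrow> ennreal"
  assumes [measurable]: "f \<in> borel_measurable borel"
  shows "(\<integral>\<^sup>+y. f (c + y) \<partial>lborel) = (\<integral>\<^sup>+y. f y \<partial>lborel)"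
proof -
  have "(\<integral>\<^sup>+y. f (c + y) \<partial>lborel) = (\<integral>\<^sup>+y. f y \<partial>distr lborel borel ((+) c))"
    by (subst nn_integral_distr) auto
  then show ?thesis by (simp add: lborel_distr_plus)
qed

lemma nn_integral_scale:
  fixes f :: "'a::euclidean_space \<Rightarrow> ennreal"
  assumes [measurable]: "f \<in> borel_measurable borel" and "c \<noteq> 0"
  shows "(\<integral>\<^sup>+y. f y \<partial>lborel) = ennreal (\<bar>c\<bar> ^ DIM('a)) * (\<integral>\<^sup>+y. f (c *\<^sub>R y) \<partial>lborel)"
  by (subst lborel_affine[OF \<open>c \<noteq> 0\<close>, of 0])
     (simp add: nn_integral_density nn_integral_distr nn_integral_cmult)

lemma nn_integral_reflect:
  fixes f :: "'a::euclidean_space \<Rightarrow> ennreal"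
  assumes [measurable]: "f \<in> borel_measurable borel"
  shows "(\<integral>\<^sup>+y. f (c - y) \<partial>lborel) = (\<integral>\<^sup>+y. f y \<partial>lborel)"
proof -
  have "(\<integral>\<^sup>+y. f y \<partial>lborel) = (\<integral>\<^sup>+y. f (c + y) \<partial>lborel)"
    by (rule nn_integral_shift[symmetric]) simp
  also have "\<dots> = (\<integral>\<^sup>+y. f (c - y) \<partial>lborel)"
    by (subst nn_integral_scale[where c = "-1"]) auto
  finally show ?thesis ..
qed

lemma ennreal_square_le_imp_le:
  fixes a b :: ennreal
  assumes "a\<^sup>2 \<le> b\<^sup>2"
  shows "a \<le> b"
proof (cases a; cases b)
  fix r s assume *: "0 \<le> r" "a = ennreal r" "0 \<le> s" "b = ennreal s"
  have "ennreal (r\<^sup>2) \<le> ennreal (s\<^sup>2)" using assms * by (simp only: ennreal_power)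
  then have "r\<^sup>2 \<le> s\<^sup>2" by (subst (asm) ennreal_le_iff) auto
  then have "r \<le> s" using * by (auto intro: power2_le_imp_le)
  then show ?thesis using * by (simp add: ennreal_leI)
next
  fix s assume "a = top" "0 \<le> s" "b = ennreal s"
  then show ?thesis using assms by (simp add: ennreal_power top_unique)
qed auto

lemma nn_integral_weighted_Cauchy_Schwarz:
  assumes [measurable]: "k \<in> borel_measurable M" "f \<in> borel_measurable M" "g \<in> borel_measurable M"
  shows "(\<integral>\<^sup>+x. k x * (f x * g x) \<partial>M)\<^sup>2 \<le> (\<integral>\<^sup>+x. k x * (f x)\<^sup>2 \<partial>M) * (\<integral>\<^sup>+x. k x * (g x)\<^sup>2 \<partial>M)"
  using nn_integral_Cauchy_Schwarz[of f "density M k" g] by (simp add: nn_integral_density)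

definition conv :: "('a::euclidean_space \<Rightarrow> ennreal) \<Rightarrow> ('a \<Rightarrow> ennreal) \<Rightarrow> 'a \<Rightarrow> ennreal" where
  "conv k f x = (\<integral>\<^sup>+y. k (x - y) * f y \<partial>lborel)"

lemma measurable_conv [measurable]:
  assumes [measurable]: "k \<in> borel_measurable borel" "f \<in> borel_measurable borel"
  shows "conv k f \<in> borel_measurable borel"
  unfolding conv_def by measurable

lemma conv_mono: "(\<And>x. k x \<le> l x) \<Longrightarrow> (\<And>x. f x \<le> g x) \<Longrightarrow> conv k f x \<le> conv l g x"
  unfolding conv_def by (intro nn_integral_mono mult_mono) auto

lemma conv_mono_AE: "(AE x in lborel. f x \<le> g x) \<Longrightarrow> conv k f x \<le> conv k g x"
  unfolding conv_def by (intro nn_integral_mono_AE) (auto elim!: eventually_mono intro: mult_left_mono)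

lemma conv_cmult:
  assumes [measurable]: "k \<in> borel_measurable borel" "f \<in> borel_measurable borel"
  shows "conv k (\<lambda>x. c * f x) x = c * conv k f x"
  unfolding conv_def by (subst nn_integral_cmult[symmetric]) (auto simp: mult_ac)

lemma conv_add:
  assumes [measurable]: "k \<in> borel_measurable borel" "f \<in> borel_measurable borel" "g \<in> borel_measurable borel"
  shows "conv k (\<lambda>x. f x + g x) x = conv k f x + conv k g x"
  unfolding conv_def by (simp add: nn_integral_add distrib_left)

lemma nn_integral_conv:
  assumes [measurable]: "k \<in> borel_measurable borel" "f \<in> borel_measurable borel"
  shows "(\<integral>\<^sup>+x. conv k f x \<partial>lborel) = (\<integral>\<^sup>+x. k x \<partial>lborel) * (\<integral>\<^sup>+x. f x \<partial>lborel)"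
proof -
  have "(\<integral>\<^sup>+x. conv k f x \<partial>lborel) = (\<integral>\<^sup>+y. \<integral>\<^sup>+x. k (x - y) * f y \<partial>lborel \<partial>lborel)"
    unfolding conv_def by (rule nn_integral_swap) measurable
  also have "\<dots> = (\<integral>\<^sup>+y. (\<integral>\<^sup>+x. k x \<partial>lborel) * f y \<partial>lborel)"
  proof (intro nn_integral_cong)
    fix y
    have "(\<integral>\<^sup>+x. k (x - y) * f y \<partial>lborel) = (\<integral>\<^sup>+x. k (- y + x) \<partial>lborel) * f y"
      by (subst nn_integral_multc[symmetric]) auto
    also have "(\<integral>\<^sup>+x. k (- y + x) \<partial>lborel) = (\<integral>\<^sup>+x. k x \<partial>lborel)"
      by (rule nn_integral_shift) simp
    finally show "(\<integral>\<^sup>+x. k (x - y) * f y \<partial>lborel) = (\<integral>\<^sup>+x. k x \<partial>lborel) * f y" .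
  qed
  finally show ?thesis by (simp add: nn_integral_cmult)
qed

text \<open>Young's inequality for L1 * L2: Cauchy-Schwarz with weight \<open>k (x - y)\<close>
  bounds the square pointwise by the mass of k times the convolution of k with the square of f, and
  integration in x gives the second factor of the mass.\<close>

lemma nn_integral_conv_square_le:
  assumes [measurable]: "k \<in> borel_measurable borel" "f \<in> borel_measurable borel"
  shows "(\<integral>\<^sup>+x. (conv k f x)\<^sup>2 \<partial>lborel) \<le> (\<integral>\<^sup>+x. k x \<partial>lborel)\<^sup>2 * (\<integral>\<^sup>+x. (f x)\<^sup>2 \<partial>lborel)"
proof -
  have "(conv k f x)\<^sup>2 \<le> (\<integral>\<^sup>+x. k x \<partial>lborel) * conv k (\<lambda>x. (f x)\<^sup>2) x" for x
    using nn_integral_weighted_Cauchy_Schwarz[of "\<lambda>y. k (x - y)" lborel "\<lambda>_. 1" f]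
    by (simp add: conv_def nn_integral_reflect)
  then have "(\<integral>\<^sup>+x. (conv k f x)\<^sup>2 \<partial>lborel) \<le> (\<integral>\<^sup>+x. (\<integral>\<^sup>+x. k x \<partial>lborel) * conv k (\<lambda>x. (f x)\<^sup>2) x \<partial>lborel)"
    by (rule nn_integral_mono)
  also have "\<dots> = (\<integral>\<^sup>+x. k x \<partial>lborel)\<^sup>2 * (\<integral>\<^sup>+x. (f x)\<^sup>2 \<partial>lborel)"
    by (simp add: nn_integral_cmult nn_integral_conv power2_eq_square mult_ac)
  finally show ?thesis .
qed

text \<open>Convolution with this kernel is the Fourier multiplier given by the Laplace transform of
  w at the squared frequency (\<open>khat_mix\<close>), so a choice of w is a choice of a function
  of the Laplacian.\<close>

definition mix :: "(real \<Rightarrow> ennreal) \<Rightarrow> real^3 \<Rightarrow> ennreal" where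
  "mix w z = (\<integral>\<^sup>+u. w u * ennreal (heat u z) \<partial>lborel)"

lemma measurable_mix [measurable]:
  assumes [measurable]: "w \<in> borel_measurable borel"
  shows "mix w \<in> borel_measurable borel"
  unfolding mix_def by measurable

lemma nn_integral_mix:
  assumes [measurable]: "w \<in> borel_measurable borel"
  shows "(\<integral>\<^sup>+z. mix w z \<partial>lborel) = (\<integral>\<^sup>+u. w u * indicator {0<..} u \<partial>lborel)"
proof -
  have "(\<integral>\<^sup>+z. mix w z \<partial>lborel) = (\<integral>\<^sup>+u. \<integral>\<^sup>+z. w u * ennreal (heat u z) \<partial>lborel \<partial>lborel)"
    unfolding mix_def by (rule nn_integral_swap) measurable
  also have "\<dots> = (\<integral>\<^sup>+u. w u * indicator {0<..} u \<partial>lborel)"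
    by (intro nn_integral_cong) (auto simp: nn_integral_cmult nn_integral_heat split: split_indicator)
  finally show ?thesis .
qed

text \<open>
  The Gram representation \<open>conv (mix w) = J\<^sup>* J\<close> (by the heat semigroup property) with
  \<open>J = smoothing\<close> mapping into \<open>L\<^sup>2\<close> of the weighted half space.
\<close>

definition wmeas :: "(real \<Rightarrow> ennreal) \<Rightarrow> (real \<times> (real^3)) measure" where
  "wmeas w = density lborel (\<lambda>p. w (fst p))"

definition smoothing :: "(real^3 \<Rightarrow> ennreal) \<Rightarrow> real \<times> (real^3) \<Rightarrow> ennreal" where
  "smoothing f p = (\<integral>\<^sup>+y. ennreal (heat (fst p / 2) (snd p - y)) * f y \<partial>lborel)"

definition smoothing_adj :: "(real \<Rightarrow> ennreal) \<Rightarrow> (real \<times> (real^3) \<Rightarrow> ennreal) \<Rightarrow> real^3 \<Rightarrow> ennreal" where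
  "smoothing_adj w \<psi> x = (\<integral>\<^sup>+p. ennreal (heat (fst p / 2) (snd p - x)) * \<psi> p \<partial>wmeas w)"

text \<open>The quadratic form of convolution with \<open>mix w\<close>, defined as an inner product
  of smoothed functions: symmetry and Cauchy-Schwarz are then immediate, and
  \<open>energy_eq\<close> recovers the usual double integral.\<close>

definition energy :: "(real \<Rightarrow> ennreal) \<Rightarrow> (real^3 \<Rightarrow> ennreal) \<Rightarrow> (real^3 \<Rightarrow> ennreal) \<Rightarrow> ennreal" where
  "energy w f g = (\<integral>\<^sup>+p. smoothing f p * smoothing g p \<partial>wmeas w)"

lemma sets_wmeas [measurable_cong, simp]: "sets (wmeas w) = sets borel"
  by (simp add: wmeas_def)

lemma space_wmeas [simp]: "space (wmeas w) = UNIV"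
  by (simp add: wmeas_def)

lemma nn_integral_wmeas:
  assumes [measurable]: "w \<in> borel_measurable borel" "f \<in> borel_measurable borel"
  shows "(\<integral>\<^sup>+p. f p \<partial>wmeas w) = (\<integral>\<^sup>+p. w (fst p) * f p \<partial>lborel)"
proof -
  have [measurable]: "(\<lambda>p::real \<times> (real^3). w (fst p)) \<in> borel_measurable borel"
    using measurable_compose[OF borel_measurable_continuous_onI[OF continuous_on_fst[OF continuous_on_id]] assms(1)] .
  show ?thesis
    unfolding wmeas_def by (subst nn_integral_density) auto
qed

lemma measurable_smoothing [measurable]:
  assumes [measurable]: "f \<in> borel_measurable borel"
  shows "smoothing f \<in> borel_measurable borel"
proof -
  have "smoothing f \<in> borel_measurable (borel \<Otimes>\<^sub>M borel)"
    unfolding smoothing_def by measurable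
  then show ?thesis by (simp add: borel_prod)
qed

lemma measurable_heat_pair [measurable]:
  "(\<lambda>p::real \<times> (real^3). heat (fst p / 2) (snd p - x)) \<in> borel_measurable borel"
proof -
  have "(\<lambda>p::real \<times> (real^3). heat (fst p / 2) (snd p - x)) \<in> borel_measurable (borel \<Otimes>\<^sub>M borel)"
    by measurable
  then show ?thesis by (simp add: borel_prod)
qed

lemma nn_integral_smoothing_adj:
  assumes [measurable]: "w \<in> borel_measurable borel" "f \<in> borel_measurable borel" "\<psi> \<in> borel_measurable borel"
  shows "(\<integral>\<^sup>+p. smoothing f p * \<psi> p \<partial>wmeas w) = (\<integral>\<^sup>+x. f x * smoothing_adj w \<psi> x \<partial>lborel)"
proof -
  have [measurable]: "(\<lambda>p::real \<times> (real^3). w (fst p)) \<in> borel_measurable borel"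
    using measurable_compose[OF borel_measurable_continuous_onI[OF continuous_on_fst[OF continuous_on_id]] assms(1)] .
  have [measurable]: "(\<lambda>q::(real \<times> (real^3)) \<times> (real^3). heat (fst (fst q) / 2) (snd (fst q) - snd q))
      \<in> borel_measurable (borel \<Otimes>\<^sub>M borel)"
    unfolding borel_prod[symmetric] by measurable
  have "(\<integral>\<^sup>+p. smoothing f p * \<psi> p \<partial>wmeas w) = (\<integral>\<^sup>+p. w (fst p) * (smoothing f p * \<psi> p) \<partial>lborel)"
    by (rule nn_integral_wmeas) auto
  also have "\<dots> = (\<integral>\<^sup>+p. \<integral>\<^sup>+y. w (fst p) * (ennreal (heat (fst p / 2) (snd p - y)) * f y * \<psi> p) \<partial>lborel \<partial>lborel)"
    unfolding smoothing_def
    by (intro nn_integral_cong, subst nn_integral_multc[symmetric], measurable, subst nn_integral_cmult[symmetric]) auto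
  also have "\<dots> = (\<integral>\<^sup>+y. \<integral>\<^sup>+p. w (fst p) * (ennreal (heat (fst p / 2) (snd p - y)) * f y * \<psi> p) \<partial>lborel \<partial>lborel)"
    by (rule nn_integral_swap) (simp add: case_prod_beta)
  also have "\<dots> = (\<integral>\<^sup>+y. f y * (\<integral>\<^sup>+p. w (fst p) * (ennreal (heat (fst p / 2) (snd p - y)) * \<psi> p) \<partial>lborel) \<partial>lborel)"
    by (intro nn_integral_cong, subst nn_integral_cmult[symmetric]) (auto simp: mult_ac)
  also have "\<dots> = (\<integral>\<^sup>+x. f x * smoothing_adj w \<psi> x \<partial>lborel)"
    unfolding smoothing_adj_def by (simp add: nn_integral_wmeas)
  finally show ?thesis .
qed

lemma smoothing_adj_smoothing:
  assumes [measurable]: "w \<in> borel_measurable borel" "f \<in> borel_measurable borel"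
  shows "smoothing_adj w (smoothing f) x = conv (mix w) f x"
proof -
  have [measurable]: "(\<lambda>p::real \<times> (real^3). w (fst p)) \<in> borel_measurable borel"
    using measurable_compose[OF borel_measurable_continuous_onI[OF continuous_on_fst[OF continuous_on_id]] assms(1)] .
  have "smoothing_adj w (smoothing f) x
      = (\<integral>\<^sup>+p. w (fst p) * (ennreal (heat (fst p / 2) (snd p - x)) * smoothing f p) \<partial>lborel)"
    unfolding smoothing_adj_def by (rule nn_integral_wmeas) auto
  also have "\<dots> = (\<integral>\<^sup>+u. \<integral>\<^sup>+z. w u * (ennreal (heat (u / 2) (z - x)) * smoothing f (u, z)) \<partial>lborel \<partial>lborel)"
    by (subst nn_integral_lborel_pair) auto
  also have "\<dots> = (\<integral>\<^sup>+u. \<integral>\<^sup>+z. \<integral>\<^sup>+y. w u * f y * (ennreal (heat (u / 2) (z - x)) * ennreal (heat (u / 2) (z - y))) \<partial>lborel \<partial>lborel \<partial>lborel)"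
    unfolding smoothing_def
    by (intro nn_integral_cong, subst nn_integral_cmult[symmetric], measurable, subst nn_integral_cmult[symmetric])
       (auto simp: mult_ac)
  \<comment> \<open>Integrating over z first composes two heat kernels of time u/2 into one of time
    u.\<close>
  also have "\<dots> = (\<integral>\<^sup>+u. \<integral>\<^sup>+y. \<integral>\<^sup>+z. w u * f y * (ennreal (heat (u / 2) (z - x)) * ennreal (heat (u / 2) (z - y))) \<partial>lborel \<partial>lborel \<partial>lborel)"
    by (intro nn_integral_cong nn_integral_swap) measurable
  also have "\<dots> = (\<integral>\<^sup>+u. \<integral>\<^sup>+y. w u * f y * ennreal (heat u (x - y)) \<partial>lborel \<partial>lborel)"
    by (intro nn_integral_cong) (subst nn_integral_cmult, auto simp: heat_semigroup_half)
  also have "\<dots> = (\<integral>\<^sup>+y. \<integral>\<^sup>+u. w u * f y * ennreal (heat u (x - y)) \<partial>lborel \<partial>lborel)"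
    by (rule nn_integral_swap) measurable
  also have "\<dots> = conv (mix w) f x"
    unfolding conv_def mix_def
    by (intro nn_integral_cong, subst nn_integral_multc[symmetric]) (auto simp: mult_ac)
  finally show ?thesis .
qed

lemma energy_eq:
  assumes [measurable]: "w \<in> borel_measurable borel" "f \<in> borel_measurable borel" "g \<in> borel_measurable borel"
  shows "energy w f g = (\<integral>\<^sup>+x. f x * conv (mix w) g x \<partial>lborel)"
  unfolding energy_def by (simp add: nn_integral_smoothing_adj smoothing_adj_smoothing)

lemma energy_commute: "energy w f g = energy w g f"
  unfolding energy_def by (simp add: mult.commute)

lemma energy_Cauchy_Schwarz:
  assumes [measurable]: "w \<in> borel_measurable borel" "f \<in> borel_measurable borel" "g \<in> borel_measurable borel"
  shows "(energy w f g)\<^sup>2 \<le> energy w f f * energy w g g"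
  using nn_integral_Cauchy_Schwarz[of "smoothing f" "wmeas w" "smoothing g"]
  by (simp add: energy_def power2_eq_square)

text \<open>Schur test with constant test functions: the smoothing operator maps 1 to a function at
  most 1, its adjoint maps 1 to the mass of \<open>mix w\<close>, and Cauchy-Schwarz with the heat
  kernel as weight combines the two. It brings estimates on the half space back to R^3.\<close>

lemma nn_integral_smoothing_adj_square_le:
  assumes [measurable]: "w \<in> borel_measurable borel" "\<psi> \<in> borel_measurable borel"
    and mass: "(\<integral>\<^sup>+z. mix w z \<partial>lborel) \<le> 1"
  shows "(\<integral>\<^sup>+x. (smoothing_adj w \<psi> x)\<^sup>2 \<partial>lborel) \<le> (\<integral>\<^sup>+p. (\<psi> p)\<^sup>2 \<partial>wmeas w)"
proof -
  have "smoothing (\<lambda>_. 1) p = indicator {0<..} (fst p)" for p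
    using nn_integral_reflect[of "\<lambda>y. ennreal (heat (fst p / 2) y)" "snd p"]
    by (auto simp: smoothing_def nn_integral_heat split: split_indicator)
  then have one: "smoothing (\<lambda>_. 1) p \<le> 1" for p by (simp add: indicator_def)
  have [measurable]: "(\<lambda>p::real \<times> (real^3). w (fst p)) \<in> borel_measurable borel"
    using measurable_compose[OF borel_measurable_continuous_onI[OF continuous_on_fst[OF continuous_on_id]] assms(1)] .
  have adj_one: "smoothing_adj w (\<lambda>_. 1) x \<le> 1" for x
  proof -
    have "smoothing_adj w (\<lambda>_. 1) x = (\<integral>\<^sup>+p. w (fst p) * ennreal (heat (fst p / 2) (snd p - x)) \<partial>lborel)"
      unfolding smoothing_adj_def by (simp add: nn_integral_wmeas)
    also have "\<dots> = (\<integral>\<^sup>+u. \<integral>\<^sup>+z. w u * ennreal (heat (u / 2) (z - x)) \<partial>lborel \<partial>lborel)"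
      by (subst nn_integral_lborel_pair) auto
    also have "\<dots> = (\<integral>\<^sup>+u. w u * indicator {0<..} u \<partial>lborel)"
    proof (rule nn_integral_cong)
      fix u
      have "(\<integral>\<^sup>+z. ennreal (heat (u / 2) (- x + z)) \<partial>lborel) = indicator {0<..} u"
        by (subst nn_integral_shift) (auto simp: nn_integral_heat split: split_indicator)
      then show "(\<integral>\<^sup>+z. w u * ennreal (heat (u / 2) (z - x)) \<partial>lborel) = w u * indicator {0<..} u"
        by (simp add: nn_integral_cmult)
    qed
    finally show ?thesis
      using mass by (simp add: nn_integral_mix)
  qed
  have "(smoothing_adj w \<psi> x)\<^sup>2 \<le> smoothing_adj w (\<lambda>p. (\<psi> p)\<^sup>2) x" for x
  proof -
    have "(smoothing_adj w \<psi> x)\<^sup>2 \<le> smoothing_adj w (\<lambda>_. 1) x * smoothing_adj w (\<lambda>p. (\<psi> p)\<^sup>2) x"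
      using nn_integral_weighted_Cauchy_Schwarz[of "\<lambda>p. ennreal (heat (fst p / 2) (snd p - x))" "wmeas w" "\<lambda>_. 1" \<psi>]
      by (simp add: smoothing_adj_def)
    also have "\<dots> \<le> 1 * smoothing_adj w (\<lambda>p. (\<psi> p)\<^sup>2) x"
      by (intro mult_right_mono adj_one) simp
    finally show ?thesis by simp
  qed
  then have "(\<integral>\<^sup>+x. (smoothing_adj w \<psi> x)\<^sup>2 \<partial>lborel) \<le> (\<integral>\<^sup>+x. 1 * smoothing_adj w (\<lambda>p. (\<psi> p)\<^sup>2) x \<partial>lborel)"
    by (intro nn_integral_mono) simp
  also have "\<dots> = (\<integral>\<^sup>+p. smoothing (\<lambda>_. 1) p * (\<psi> p)\<^sup>2 \<partial>wmeas w)"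
    by (rule nn_integral_smoothing_adj[symmetric]) auto
  also have "\<dots> \<le> (\<integral>\<^sup>+p. 1 * (\<psi> p)\<^sup>2 \<partial>wmeas w)"
    by (intro nn_integral_mono mult_right_mono one) simp
  finally show ?thesis by simp
qed

text \<open>Cauchy-Schwarz followed by Young's inequality; comparing squares avoids taking roots in
  \<open>ennreal\<close>.\<close>

lemma energy_le:
  assumes [measurable]: "w \<in> borel_measurable borel" "f \<in> borel_measurable borel"
    and mass: "(\<integral>\<^sup>+z. mix w z \<partial>lborel) \<le> 1"
  shows "energy w f f \<le> (\<integral>\<^sup>+x. (f x)\<^sup>2 \<partial>lborel)"
proof (rule ennreal_square_le_imp_le)
  have "(energy w f f)\<^sup>2 \<le> (\<integral>\<^sup>+x. (f x)\<^sup>2 \<partial>lborel) * (\<integral>\<^sup>+x. (conv (mix w) f x)\<^sup>2 \<partial>lborel)"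
    by (simp add: energy_eq nn_integral_Cauchy_Schwarz)
  also have "(\<integral>\<^sup>+x. (conv (mix w) f x)\<^sup>2 \<partial>lborel) \<le> (\<integral>\<^sup>+z. mix w z \<partial>lborel)\<^sup>2 * (\<integral>\<^sup>+x. (f x)\<^sup>2 \<partial>lborel)"
    by (rule nn_integral_conv_square_le) auto
  also have "(\<integral>\<^sup>+z. mix w z \<partial>lborel)\<^sup>2 \<le> 1"
    using mass by (simp add: power_le_one)
  finally show "(energy w f f)\<^sup>2 \<le> (\<integral>\<^sup>+x. (f x)\<^sup>2 \<partial>lborel)\<^sup>2"
    by (simp add: power2_eq_square mult_left_mono mult_right_mono)
qed

section \<open>Radially decreasing functions\<close>

text \<open>It suffices to measure boxes. The preimage of a box is its image under the inverse,
  which is orthogonal too and preserves volume.\<close>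

lemma distr_orthogonal_transformation:
  fixes T :: "real^'n::{finite,wellorder} \<Rightarrow> real^'n::_"
  assumes T: "orthogonal_transformation T"
  shows "distr lborel borel T = lborel"
proof (rule lborel_eqI[symmetric])
  have [measurable]: "T \<in> borel_measurable borel"
    by (intro borel_measurable_continuous_onI linear_continuous_on linear_linear[THEN iffD2]
        orthogonal_transformation_linear T)
  show "sets (distr lborel borel T) = sets borel" by simp
  fix l u :: "real^'n::_"
  assume *: "\<And>b. b \<in> Basis \<Longrightarrow> l \<bullet> b \<le> u \<bullet> b"
  have inv: "orthogonal_transformation (inv T)"
    using T by (rule orthogonal_transformation_inv)
  have eq: "T -` box l u = inv T ` box l u"
    using bij_vimage_eq_inv_image[OF orthogonal_transformation_bij[OF T]] by simp
  have "emeasure (distr lborel borel T) (box l u) = emeasure lborel (T -` box l u)"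
    by (subst emeasure_distr) auto
  also have "\<dots> = emeasure lebesgue (T -` box l u)"
  proof -
    have "T -` box l u \<inter> space borel \<in> sets borel"
      by (rule measurable_sets[of T borel borel]) auto
    then show ?thesis by simp
  qed
  also have "\<dots> = ennreal (measure lebesgue (inv T ` box l u))"
    unfolding eq by (rule emeasure_eq_measure2) (rule measurable_orthogonal_image[OF inv], simp)
  also have "\<dots> = ennreal (measure lebesgue (box l u))"
    by (subst measure_orthogonal_image[OF inv]) auto
  also have "\<dots> = emeasure lborel (box l u)"
    by (simp add: emeasure_eq_measure2)
  finally show "emeasure (distr lborel borel T) (box l u) = ennreal (\<Prod>b\<in>Basis. (u - l) \<bullet> b)"
    using * by (simp add: emeasure_lborel_box inner_diff_left)
qed

text \<open>Comparing all pairs of points by their norms encodes radial symmetry and monotonicity at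
  once; points of equal norm are compared in both directions (\<open>rdec_eq\<close>).\<close>

definition rdec :: "('a::euclidean_space \<Rightarrow> ennreal) \<Rightarrow> bool" where
  "rdec f \<longleftrightarrow> (\<forall>x y. norm x \<le> norm y \<longrightarrow> f y \<le> f x)"

lemma rdecI: "(\<And>x y. norm x \<le> norm y \<Longrightarrow> f y \<le> f x) \<Longrightarrow> rdec f"
  by (simp add: rdec_def)

lemma rdecD: "rdec f \<Longrightarrow> norm x \<le> norm y \<Longrightarrow> f y \<le> f x"
  by (simp add: rdec_def)

lemma rdec_mult: "rdec f \<Longrightarrow> rdec g \<Longrightarrow> rdec (\<lambda>x. f x * g x)"
  by (auto simp: rdec_def intro!: mult_mono)

lemma rdec_power2: "rdec f \<Longrightarrow> rdec (\<lambda>x. (f x)\<^sup>2)"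
  unfolding power2_eq_square by (rule rdec_mult)

lemma rdec_const: "rdec (\<lambda>_. c)"
  by (simp add: rdec_def)

lemma rdec_indicator_cball: "rdec (indicator (cball 0 r))"
  by (auto simp: rdec_def split: split_indicator)

lemma rdec_mix: "rdec (mix w)"
  unfolding mix_def by (intro rdecI nn_integral_mono mult_left_mono ennreal_leI heat_antimono) auto

text \<open>A superlevel set is the preimage under the norm of a downward closed set of radii. Such
  a set is empty, the whole half line, or an interval starting at 0 that is closed or half open at
  its right end, hence Borel.\<close>

lemma rdec_measurable:
  fixes f :: "'a::euclidean_space \<Rightarrow> ennreal"
  assumes "rdec f"
  shows "f \<in> borel_measurable borel"
proof (rule borel_measurableI_greater)
  fix c
  let ?D = "norm ` {x::'a. c < f x}"
  have mem: "c < f x \<longleftrightarrow> norm x \<in> ?D" for x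
  proof
    assume "norm x \<in> ?D"
    then obtain y where "c < f y" "norm x = norm y" by auto
    moreover have "f y \<le> f x" using assms \<open>norm x = norm y\<close> by (auto intro: rdecD)
    ultimately show "c < f x" by simp
  qed auto
  have down: "r \<in> ?D" if "0 \<le> r" "r \<le> s" "s \<in> ?D" for r s
  proof -
    obtain b :: 'a where b: "b \<in> Basis" using SOME_Basis by blast
    from that obtain y where "c < f y" "s = norm y" by auto
    moreover have "f y \<le> f (r *\<^sub>R b)" using assms that b \<open>s = norm y\<close> by (auto intro!: rdecD)
    ultimately have "c < f (r *\<^sub>R b)" by simp
    then show ?thesis using that b by (auto intro!: image_eqI[of _ _ "r *\<^sub>R b"])
  qed
  have nonneg: "0 \<le> r" if "r \<in> ?D" for r using that by auto
  have "?D = {} \<or> ?D = {0..} \<or> (\<exists>r. ?D = {0..r} \<or> ?D = {0..<r})"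
  proof (cases "bdd_above ?D")
    case True
    show ?thesis
    proof (cases "?D = {}")
      case False
      let ?s = "Sup ?D"
      have "?D = {0..?s} \<or> ?D = {0..<?s}"
      proof (cases "?s \<in> ?D")
        case s: True
        have "r \<in> ?D \<longleftrightarrow> 0 \<le> r \<and> r \<le> ?s" for r
          using nonneg[of r] cSup_upper[OF _ True, of r] down[of r, OF _ _ s] by blast
        then have "?D = {0..?s}" by (intro set_eqI) simp
        then show ?thesis ..
      next
        case s: False
        have "r \<in> {0..<?s}" if "r \<in> ?D" for r
        proof -
          have "r \<noteq> ?s" using that s by blast
          then show ?thesis using nonneg[OF that] cSup_upper[OF that True] by simp
        qed
        moreover have "r \<in> ?D" if "r \<in> {0..<?s}" for r
        proof -
          have "r < ?s" using that by simp
          then obtain t where "t \<in> ?D" "r < t"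
            unfolding less_cSup_iff[OF False True] by blast
          then show ?thesis using down[of r t] that by auto
        qed
        ultimately have "?D = {0..<?s}" by blast
        then show ?thesis ..
      qed
      then show ?thesis by blast
    qed blast
  next
    case False
    have "r \<in> ?D" if "0 \<le> r" for r
    proof -
      obtain s where "s \<in> ?D" "r < s"
        using False unfolding bdd_above_def by (meson not_le)
      then show ?thesis using down[of r s] that by auto
    qed
    then have "r \<in> ?D \<longleftrightarrow> 0 \<le> r" for r using nonneg[of r] by blast
    then have "?D = {0..}" by (intro set_eqI) simp
    then show ?thesis by blast
  qed
  then have "?D \<in> sets borel"
    by (elim disjE exE) (simp_all only: sets.empty_sets atLeast_borel atLeastAtMost_borel atLeastLessThan_borel)
  then have "norm -` ?D \<inter> space borel \<in> sets (borel :: 'a measure)"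
    by (intro measurable_sets[OF borel_measurable_norm]) auto
  also have "norm -` ?D \<inter> space borel = {x \<in> space (borel :: 'a measure). c < f x}"
    by (simp only: vimage_def space_borel Int_UNIV_right mem[symmetric] UNIV_I simp_thms)
  finally show "{x \<in> space borel. c < f x} \<in> sets borel" .
qed

lemma norm_le_square_iff: "(norm x)\<^sup>2 \<le> (norm y)\<^sup>2 \<longleftrightarrow> norm x \<le> norm y"
  using abs_le_square_iff[of "norm x" "norm y"] by simp

text \<open>This is (a - a')(b - b') >= 0, freed of subtractions: the surplus of the right-hand side
  is the product of the two increments.\<close>

lemma ennreal_rearrangement:
  fixes a b :: ennreal
  assumes "a' \<le> a" "b' \<le> b"
  shows "a' * b + a * b' \<le> a * b + a' * b'"
proof -
  obtain c d where "a = a' + c" "b = b' + d"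
    using assms by (auto simp: le_iff_add)
  then have "a * b + a' * b' = a' * b + a * b' + c * d"
    by (simp add: algebra_simps)
  then show ?thesis by (simp add: le_iff_add)
qed

text \<open>
  Reflect in the bisecting hyperplane of \<open>x\<close> and \<open>x'\<close>: on the side of \<open>x\<close>, which contains the origin,
  both \<open>k (x - y) \<ge> k (x' - y)\<close> and \<open>f y \<ge> f (\<sigma> y)\<close>.
\<close>

lemma rdec_conv:
  fixes k f :: "real^'n::{finite,wellorder} \<Rightarrow> ennreal"
  assumes k: "rdec k" and f: "rdec f"
  shows "rdec (conv k f)"
proof (rule rdecI)
  fix x x' :: "real^'n::_"
  assume le: "norm x \<le> norm x'"
  note [measurable] = rdec_measurable[OF k] rdec_measurable[OF f]
  show "conv k f x' \<le> conv k f x"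
  proof (cases "x = x'")
    case False
    define n where "n = (1 / norm (x' - x)) *\<^sub>R (x' - x)"
    define c where "c = (1/2) *\<^sub>R (x + x')"
    define a where "a y = (y - c) \<bullet> n" for y
    \<comment> \<open>T is the linear part of the affine reflection \<sigma>. They differ by a
      translation along n, so \<sigma> preserves Lebesgue measure because rotations and translations
      do.\<close>
    define T where "T y = y - (2 * (y \<bullet> n)) *\<^sub>R n" for y
    define \<sigma> where "\<sigma> y = y - (2 * a y) *\<^sub>R n" for y
    have nn: "n \<bullet> n = 1"
      using False by (simp add: n_def power2_norm_eq_inner[symmetric] power2_eq_square)
    have d: "x' - x = norm (x' - x) *\<^sub>R n"
      using False by (simp add: n_def)
    have "linear T"
      unfolding T_def by (rule linearI) (simp_all add: inner_add_left algebra_simps)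
    moreover have "T v \<bullet> T w = v \<bullet> w" for v w
      unfolding T_def by (simp add: inner_diff_left inner_diff_right nn inner_commute algebra_simps)
    ultimately have T: "orthogonal_transformation T"
      by (simp add: orthogonal_transformation_def)
    have [measurable]: "T \<in> borel_measurable borel"
      unfolding T_def by measurable
    have [measurable]: "\<sigma> \<in> borel_measurable borel"
      unfolding \<sigma>_def a_def by measurable
    have \<sigma>_T: "\<sigma> y = (2 * (c \<bullet> n)) *\<^sub>R n + T y" for y
      by (simp add: \<sigma>_def a_def T_def inner_diff_left algebra_simps)
    have invariant: "(\<integral>\<^sup>+y. h (\<sigma> y) \<partial>lborel) = (\<integral>\<^sup>+y. h y \<partial>lborel)"
      if [measurable]: "h \<in> borel_measurable borel" for h :: "real^'n::_ \<Rightarrow> ennreal"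
    proof -
      have "(\<integral>\<^sup>+y. h (\<sigma> y) \<partial>lborel) = (\<integral>\<^sup>+y. h ((2 * (c \<bullet> n)) *\<^sub>R n + y) \<partial>distr lborel borel T)"
        unfolding \<sigma>_T by (subst nn_integral_distr) auto
      then show ?thesis
        by (simp add: distr_orthogonal_transformation[OF T] nn_integral_shift)
    qed
    have norm_\<sigma>: "(norm (\<sigma> y))\<^sup>2 = (norm y)\<^sup>2 - 4 * a y * (c \<bullet> n)" for y
    proof -
      have "(norm (\<sigma> y))\<^sup>2 = y \<bullet> y - 4 * a y * (y \<bullet> n) + 4 * (a y * a y)"
        unfolding power2_norm_eq_inner \<sigma>_def
        by (simp add: inner_diff_left inner_diff_right nn inner_commute algebra_simps)
      moreover have "y \<bullet> n = a y + c \<bullet> n"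
        by (simp add: a_def inner_diff_left)
      ultimately show ?thesis by (simp add: power2_norm_eq_inner algebra_simps)
    qed
    \<comment> \<open>The origin lies on the side of x, since \<open>a 0 = - (c \<bullet> n)\<close>
      and that side is where a is nonpositive.\<close>
    have cn: "c \<bullet> n \<ge> 0"
    proof -
      have "norm (x' - x) * (2 * (c \<bullet> n)) = (x + x') \<bullet> (x' - x)"
        by (subst d) (simp add: c_def)
      also have "\<dots> = (norm x')\<^sup>2 - (norm x)\<^sup>2"
        by (simp add: power2_norm_eq_inner inner_commute algebra_simps)
      also have "\<dots> \<ge> 0" using le by (simp add: power_mono)
      finally show ?thesis using False by (simp add: zero_le_mult_iff)
    qed
    have dist_diff: "(norm (x' - y))\<^sup>2 - (norm (x - y))\<^sup>2 = - 2 * norm (x' - x) * a y" for y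
    proof -
      have "(norm (x' - y))\<^sup>2 - (norm (x - y))\<^sup>2 = - 2 * ((y - c) \<bullet> (x' - x))"
        by (simp add: c_def power2_norm_eq_inner inner_commute algebra_simps)
      also have "(y - c) \<bullet> (x' - x) = norm (x' - x) * a y"
        by (subst d) (simp add: a_def)
      finally show ?thesis by simp
    qed
    have \<sigma>x: "norm (x - \<sigma> y) = norm (x' - y)" "norm (x' - \<sigma> y) = norm (x - y)" for y
    proof -
      have ax: "(y - c) \<bullet> n = a y" "(x' - x) \<bullet> n = norm (x' - x)"
        unfolding a_def by (simp, subst d, simp add: nn)
      have xn: "x \<bullet> n = c \<bullet> n - norm (x' - x) / 2" "x' \<bullet> n = c \<bullet> n + norm (x' - x) / 2"
        using ax(2) by (simp_all add: c_def inner_diff_left inner_add_left field_simps)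
      have e: "(norm (z - \<sigma> y))\<^sup>2 = (norm (z - y))\<^sup>2 + 4 * a y * (z \<bullet> n - c \<bullet> n)" for z
      proof -
        have z: "z - \<sigma> y = (z - y) + (2 * a y) *\<^sub>R n" by (simp add: \<sigma>_def)
        have "(norm (z - \<sigma> y))\<^sup>2 = (norm (z - y))\<^sup>2 + 4 * a y * ((z - y) \<bullet> n) + 4 * (a y * a y)"
          unfolding power2_norm_eq_inner z
          by (simp add: inner_add_left inner_add_right nn inner_commute distrib_left distrib_right)
        also have "(z - y) \<bullet> n = z \<bullet> n - c \<bullet> n - a y"
          by (simp add: a_def inner_diff_left)
        finally show ?thesis by (simp add: algebra_simps)
      qed
      have xn': "x \<bullet> n - c \<bullet> n = - (norm (x' - x) / 2)" "x' \<bullet> n - c \<bullet> n = norm (x' - x) / 2"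
        using xn by simp_all
      have q: "4 * a y * - (norm (x' - x) / 2) = - 2 * norm (x' - x) * a y"
        "4 * a y * (norm (x' - x) / 2) = - (- 2 * norm (x' - x) * a y)"
        by simp_all
      have "(norm (x - \<sigma> y))\<^sup>2 = (norm (x' - y))\<^sup>2"
        using e[of x, unfolded xn'] dist_diff[of y] q by linarith
      moreover have "(norm (x' - \<sigma> y))\<^sup>2 = (norm (x - y))\<^sup>2"
        using e[of x', unfolded xn'] dist_diff[of y] q by linarith
      ultimately show "norm (x - \<sigma> y) = norm (x' - y)" "norm (x' - \<sigma> y) = norm (x - y)"
        by simp_all
    qed
    have k\<sigma>: "k (x - \<sigma> y) = k (x' - y)" "k (x' - \<sigma> y) = k (x - y)" for y
      by (rule antisym; rule rdecD[OF k]; simp only: \<sigma>x)+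
    \<comment> \<open>Pairing y with its mirror image \<sigma> y reduces the claim to a pointwise
      rearrangement inequality for each pair.\<close>
    have double: "2 * conv k f z = (\<integral>\<^sup>+y. k (z - y) * f y + k (z - \<sigma> y) * f (\<sigma> y) \<partial>lborel)" for z
      unfolding conv_def
    proof (subst nn_integral_add)
      show "2 * (\<integral>\<^sup>+y. k (z - y) * f y \<partial>lborel)
        = (\<integral>\<^sup>+y. k (z - y) * f y \<partial>lborel) + (\<integral>\<^sup>+y. k (z - \<sigma> y) * f (\<sigma> y) \<partial>lborel)"
        using invariant[of "\<lambda>y. k (z - y) * f y"] by (simp add: mult_2)
    qed simp_all
    have "2 * conv k f x' \<le> 2 * conv k f x"
      unfolding double k\<sigma>
    proof (intro nn_integral_mono)
      fix y
      show "k (x' - y) * f y + k (x - y) * f (\<sigma> y) \<le> k (x - y) * f y + k (x' - y) * f (\<sigma> y)"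
      proof (cases "a y \<le> 0")
        case True
        then have "2 * norm (x' - x) * a y \<le> 0" "4 * a y * (c \<bullet> n) \<le> 0"
          using cn by (auto simp: mult_le_0_iff)
        then have "(norm (x - y))\<^sup>2 \<le> (norm (x' - y))\<^sup>2" "(norm y)\<^sup>2 \<le> (norm (\<sigma> y))\<^sup>2"
          using dist_diff[of y] norm_\<sigma>[of y] by linarith+
        then have "norm (x - y) \<le> norm (x' - y)" "norm y \<le> norm (\<sigma> y)"
          by (simp_all only: norm_le_square_iff)
        then show ?thesis by (intro ennreal_rearrangement rdecD[OF k] rdecD[OF f])
      next
        case False
        have *: "norm (x' - y) \<le> norm (x - y)" "norm (\<sigma> y) \<le> norm y"
        proof -
          have "0 \<le> 2 * norm (x' - x) * a y" "0 \<le> 4 * a y * (c \<bullet> n)" using False cn by auto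
          then have "(norm (x' - y))\<^sup>2 \<le> (norm (x - y))\<^sup>2" "(norm (\<sigma> y))\<^sup>2 \<le> (norm y)\<^sup>2"
            using dist_diff[of y] norm_\<sigma>[of y] by linarith+
          then show "norm (x' - y) \<le> norm (x - y)" "norm (\<sigma> y) \<le> norm y"
            by (simp_all only: norm_le_square_iff)
        qed
        have "k (x - y) * f (\<sigma> y) + k (x' - y) * f y \<le> k (x' - y) * f (\<sigma> y) + k (x - y) * f y"
          by (intro ennreal_rearrangement rdecD[OF k] rdecD[OF f] *)
        then show ?thesis by (simp add: add.commute)
      qed
    qed
    then show ?thesis by (simp add: ennreal_mult_le_mult_iff)
  qed simp
qed

text \<open>Helly's selection theorem for the radial profiles. Since \<open>ennreal\<close> is
  compact, a diagonal subsequence converges at every nonnegative rational radius. Monotonicity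
  extends this to every positive radius at which the limit does not jump; the exceptional radii are
  countable, and their spheres are null sets.\<close>

lemma rdec_Helly:
  fixes F :: "nat \<Rightarrow> 'a::euclidean_space \<Rightarrow> ennreal"
  assumes F: "\<And>n. rdec (F n)"
  obtains s G where "strict_mono s" "rdec G" "AE x in lborel. (\<lambda>n. F (s n) x) \<longlonglongrightarrow> G x"
proof -
  obtain b :: 'a where b: "b \<in> Basis" using SOME_Basis by blast
  define p where "p n r = F n (r *\<^sub>R b)" for n r
  \<comment> \<open>An enumeration of the nonnegative rationals; negative ones are clamped to 0,
    where the profiles are still monotone.\<close>
  define q where "q k = max 0 (real_of_rat (nat_to_rat_surj k))" for k
  have F_p: "F n x = p n (norm x)" for n x
    unfolding p_def using F[of n] b by (intro antisym rdecD) auto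
  have p_anti: "p n t \<le> p n r" if "0 \<le> r" "r \<le> t" for n r t
    unfolding p_def using F[of n] b that by (intro rdecD) auto
  have q_dense: "\<exists>k. r < q k \<and> q k < t" if "0 \<le> r" "r < t" for r t
  proof -
    obtain a where "r < real_of_rat a" "real_of_rat a < t"
      using of_rat_dense[OF \<open>r < t\<close>] by blast
    moreover obtain k where "a = nat_to_rat_surj k"
      using surj_nat_to_rat_surj by (metis surjD)
    ultimately show ?thesis using that by (intro exI[of _ k]) (auto simp: q_def)
  qed
  interpret subseqs "\<lambda>k s. \<exists>l. (\<lambda>i. p (s i) (q k)) \<longlonglongrightarrow> l"
  proof
    fix n and s :: "nat \<Rightarrow> nat"
    show "\<exists>r'. strict_mono r' \<and> (\<exists>l. (\<lambda>i. p ((s \<circ> r') i) (q n)) \<longlonglongrightarrow> l)"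
      using compact_complete_linorder[of "\<lambda>i. p (s i) (q n)"] by (auto simp: o_def)
  qed
  define s where "s = diagseq"
  have "\<exists>l. (\<lambda>i. p (s i) (q k)) \<longlonglongrightarrow> l" for k
  proof -
    have "\<exists>l. (\<lambda>i. p ((diagseq \<circ> (+) (Suc k)) i) (q k)) \<longlonglongrightarrow> l"
    proof (rule diagseq_holds)
      fix r s :: "nat \<Rightarrow> nat" and n
      assume "strict_mono r" "\<exists>l. (\<lambda>i. p (s i) (q n)) \<longlonglongrightarrow> l"
      then show "\<exists>l. (\<lambda>i. p ((s \<circ> r) i) (q n)) \<longlonglongrightarrow> l"
        using LIMSEQ_subseq_LIMSEQ[of "\<lambda>i. p (s i) (q n)" _ r] by (auto simp: o_def)
    qed
    then obtain l where "(\<lambda>i. p (s (i + Suc k)) (q k)) \<longlonglongrightarrow> l"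
      by (auto simp: s_def o_def add.commute)
    then show ?thesis by (intro exI) (rule LIMSEQ_offset)
  qed
  then obtain L where L: "\<And>k. (\<lambda>i. p (s i) (q k)) \<longlonglongrightarrow> L k" by metis
  \<comment> \<open>As L decreases along the rational radii, U is its left limit and W its right
    limit, and E is the set of jumps. Away from E the value of the profile is squeezed between
    rational radii on both sides.\<close>
  define U where "U r = (INF k\<in>{k. q k < r}. L k)" for r
  define W where "W r = (SUP k\<in>{k. r < q k}. L k)" for r
  define E where "E = {r. 0 < r \<and> W r < U r}"
  have conv: "(\<lambda>n. p (s n) r) \<longlonglongrightarrow> U r" if "0 < r" "r \<notin> E" for r
  proof (rule order_tendstoI)
    fix a assume "a < U r"
    then have "a < W r" using that by (auto simp: E_def)
    then obtain k where k: "r < q k" "a < L k" by (auto simp: W_def less_SUP_iff)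
    have "\<forall>\<^sub>F n in sequentially. a < p (s n) (q k)"
      using L k by (auto dest: order_tendstoD)
    then show "\<forall>\<^sub>F n in sequentially. a < p (s n) r"
      by eventually_elim (use p_anti[of r "q k"] k that in \<open>force intro: less_le_trans\<close>)
  next
    fix a assume "U r < a"
    then obtain k where k: "q k < r" "L k < a" by (auto simp: U_def INF_less_iff)
    have "\<forall>\<^sub>F n in sequentially. p (s n) (q k) < a"
      using L k by (auto dest: order_tendstoD)
    then show "\<forall>\<^sub>F n in sequentially. p (s n) r < a"
      by eventually_elim (use p_anti[of "q k" r] k in \<open>force simp: q_def intro: le_less_trans\<close>)
  qed
  \<comment> \<open>Each jump contains a point of a countable dense set, and the jumps at different
    radii are disjoint, so the choice of such a point is injective.\<close>
  have "countable E"
  proof -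
    obtain D :: "ennreal set" where D: "countable D" "\<And>X. open X \<Longrightarrow> X \<noteq> {} \<Longrightarrow> \<exists>d\<in>D. d \<in> X"
      using countable_dense_setE by blast
    have "\<exists>d. d \<in> D \<and> W r < d \<and> d < U r" if "r \<in> E" for r
    proof -
      have "{W r<..<U r} \<noteq> {}" using that dense[of "W r" "U r"] by (auto simp: E_def)
      then show ?thesis using D(2)[of "{W r<..<U r}"] by auto
    qed
    then obtain c where c: "\<And>r. r \<in> E \<Longrightarrow> c r \<in> D \<and> W r < c r \<and> c r < U r" by metis
    have lt: "c t < c r" if rt: "r \<in> E" "t \<in> E" "r < t" for r t
    proof -
      obtain k where k: "r < q k" "q k < t" using q_dense[of r t] rt by (auto simp: E_def)
      have "c t < U t" using c rt by blast
      also have "U t \<le> L k" unfolding U_def using k by (intro INF_lower) auto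
      also have "L k \<le> W r" unfolding W_def using k by (intro SUP_upper) auto
      also have "W r < c r" using c rt by blast
      finally show ?thesis .
    qed
    have "inj_on c E"
      by (rule linorder_inj_onI) (use lt in force, auto)
    moreover have "countable (c ` E)"
      using c D(1) by (auto intro: countable_subset)
    ultimately show ?thesis by (blast dest: countable_image_inj_on)
  qed
  define G where "G x = U (norm x)" for x :: 'a
  have "rdec G"
    unfolding G_def U_def by (intro rdecI INF_superset_mono) auto
  moreover have "AE x in lborel. (\<lambda>n. F (s n) x) \<longlonglongrightarrow> G x"
  proof -
    have "(\<Union>r\<in>E. sphere (0::'a) r) \<in> null_sets lborel"
      using \<open>countable E\<close> negligible_sphere
      by (intro null_sets_UN') (auto simp: negligible_iff_null_sets null_sets_completion_iff)
    then have "AE x in lborel. x \<notin> (\<Union>r\<in>E. sphere (0::'a) r)" by (rule AE_not_in)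
    with AE_lborel_singleton[of 0] show ?thesis
      by eventually_elim (auto simp: F_p G_def intro!: conv)
  qed
  ultimately show ?thesis
    using that subseq_diagseq unfolding s_def by blast
qed

section \<open>The Coulomb kernel\<close>

lemma nn_integral_powr_from_0:
  assumes "a > -1" "c \<ge> 0"
  shows "(\<integral>\<^sup>+t. ennreal (t powr a) * indicator {0..c} t \<partial>lborel) = ennreal (c powr (a + 1) / (a + 1))"
proof -
  have "((\<lambda>t. t powr a * indicator {0..c} t) has_integral c powr (a + 1) / (a + 1)) UNIV"
    using has_integral_powr_from_0[OF assms] unfolding has_integral_restrict_UNIV[of "{0..c}", symmetric]
    by (rule has_integral_eq[rotated]) auto
  then have "(\<integral>\<^sup>+t. ennreal (t powr a * indicator {0..c} t) \<partial>lborel) = ennreal (c powr (a + 1) / (a + 1))"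
    by (intro nn_integral_has_integral_lborel) auto
  then show ?thesis by (simp add: ennreal_mult' ennreal_indicator)
qed

lemma nn_integral_powr_to_inf:
  assumes "a < -1" "c > 0"
  shows "(\<integral>\<^sup>+t. ennreal (t powr a) * indicator {c..} t \<partial>lborel) = ennreal (- (c powr (a + 1)) / (a + 1))"
proof -
  have "((\<lambda>t. t powr a * indicator {c..} t) has_integral - (c powr (a + 1)) / (a + 1)) UNIV"
    using has_integral_powr_to_inf[OF assms] unfolding has_integral_restrict_UNIV[of "{c..}", symmetric]
    by (rule has_integral_eq[rotated]) auto
  then have "(\<integral>\<^sup>+t. ennreal (t powr a * indicator {c..} t) \<partial>lborel) = ennreal (- (c powr (a + 1)) / (a + 1))"
    by (intro nn_integral_has_integral_lborel) auto
  then show ?thesis by (simp add: ennreal_mult' ennreal_indicator)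
qed

text \<open>The value at the origin has to be \<open>\<infinity>\<close>, where \<open>powr\<close> would give 0.\<close>

definition npow :: "real \<Rightarrow> real^3 \<Rightarrow> ennreal" where
  "npow p x = (if x = 0 then \<infinity> else ennreal (norm x powr - p))"

lemma rdec_npow: "p \<ge> 0 \<Longrightarrow> rdec (npow p)"
  by (auto simp: rdec_def npow_def intro!: ennreal_leI powr_mono2')

lemma measurable_npow [measurable]: "npow p \<in> borel_measurable borel"
  unfolding npow_def by measurable

lemma npow_mult: "npow p x * npow q x = npow (p + q) x"
  by (auto simp: npow_def ennreal_mult[symmetric] powr_add[symmetric])

lemma npow_scale: "c > 0 \<Longrightarrow> npow p (c *\<^sub>R x) = ennreal (c powr - p) * npow p x"
  by (auto simp: npow_def powr_mult ennreal_mult ennreal_mult_top)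

lemma emeasure_cball_3: "r \<ge> 0 \<Longrightarrow> emeasure lborel (cball (0::real^3) r) = ennreal (unit_ball_vol 3 * r ^ 3)"
  by (simp add: emeasure_cball)

text \<open>From $|x|^{-p} = \int_{|x|}^\infty p\,t^{-p-1}\,dt$.\<close>

lemma nn_integral_npow:
  assumes "p > 0" and [measurable]: "S \<in> sets borel"
  shows "(\<integral>\<^sup>+x. npow p x * indicator S x \<partial>lborel)
    = (\<integral>\<^sup>+t. ennreal (p * t powr (- p - 1)) * indicator {0<..} t * emeasure lborel (S \<inter> cball 0 t) \<partial>lborel)"
proof -
  have eq: "npow p x = (\<integral>\<^sup>+t. ennreal (p * t powr (- p - 1)) * (indicator {0<..} t * indicator {norm x..} t) \<partial>lborel)" if "x \<noteq> 0" for x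
  proof -
    have "(\<integral>\<^sup>+t. ennreal (p * t powr (- p - 1)) * (indicator {0<..} t * indicator {norm x..} t) \<partial>lborel)
      = (\<integral>\<^sup>+t. ennreal p * (ennreal (t powr (- p - 1)) * indicator {norm x..} t) \<partial>lborel)"
      using that assms by (intro nn_integral_cong) (auto simp: ennreal_mult not_less split: split_indicator dest: order_trans)
    also have "\<dots> = ennreal (p * (norm x powr (- p) / p))"
      using that assms
      by (subst nn_integral_cmult) (simp_all add: nn_integral_powr_to_inf ennreal_mult[symmetric])
    finally show ?thesis using that assms by (simp add: npow_def)
  qed
  have "(\<integral>\<^sup>+x. npow p x * indicator S x \<partial>lborel)
     = (\<integral>\<^sup>+x. (\<integral>\<^sup>+t. ennreal (p * t powr (- p - 1)) * (indicator {0<..} t * indicator {norm x..} t) \<partial>lborel) * indicator S x \<partial>lborel)"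
    using AE_lborel_singleton[of 0] by (intro nn_integral_cong_AE) (auto elim!: eventually_mono simp: eq)
  also have "\<dots> = (\<integral>\<^sup>+x. \<integral>\<^sup>+t. ennreal (p * t powr (- p - 1)) * (indicator {0<..} t * indicator (S \<inter> cball 0 t) x) \<partial>lborel \<partial>lborel)"
    by (intro nn_integral_cong, subst nn_integral_multc[symmetric], measurable)
       (auto intro!: nn_integral_cong split: split_indicator)
  also have "\<dots> = (\<integral>\<^sup>+t. \<integral>\<^sup>+x. ennreal (p * t powr (- p - 1)) * (indicator {0<..} t * indicator (S \<inter> cball 0 t) x) \<partial>lborel \<partial>lborel)"
  proof (rule nn_integral_swap)
    have *: "indicator (S \<inter> cball 0 t) x = (indicator S x * indicator {norm x..} t :: ennreal)" for x t
      by (auto split: split_indicator)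
    have "(\<lambda>(x::real^3, t). indicator {norm x..} t :: ennreal) = (\<lambda>p. if norm (fst p) \<le> snd p then 1 else 0)"
      by (auto simp: fun_eq_iff split: split_indicator)
    then have [measurable]: "(\<lambda>(x::real^3, t). indicator {norm x..} t :: ennreal) \<in> borel_measurable (borel \<Otimes>\<^sub>M borel)"
      by simp
    show "(\<lambda>(x, t). ennreal (p * t powr (- p - 1)) * (indicator {0<..} t * indicator (S \<inter> cball 0 t) x))
        \<in> borel_measurable (borel \<Otimes>\<^sub>M borel)"
      unfolding * by measurable
  qed
  also have "\<dots> = (\<integral>\<^sup>+t. ennreal (p * t powr (- p - 1)) * indicator {0<..} t * emeasure lborel (S \<inter> cball 0 t) \<partial>lborel)"
  proof (intro nn_integral_cong)
    fix t
    have "(\<integral>\<^sup>+x. ennreal (p * t powr (- p - 1)) * (indicator {0<..} t * indicator (S \<inter> cball 0 t) x) \<partial>lborel)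
      = (\<integral>\<^sup>+x. (ennreal (p * t powr (- p - 1)) * indicator {0<..} t) * indicator (S \<inter> cball 0 t) x \<partial>lborel)"
      by (simp add: mult.assoc)
    also have "\<dots> = ennreal (p * t powr (- p - 1)) * indicator {0<..} t * emeasure lborel (S \<inter> cball 0 t)"
      by (rule nn_integral_cmult_indicator) simp
    finally show "(\<integral>\<^sup>+x. ennreal (p * t powr (- p - 1)) * (indicator {0<..} t * indicator (S \<inter> cball 0 t) x) \<partial>lborel)
      = ennreal (p * t powr (- p - 1)) * indicator {0<..} t * emeasure lborel (S \<inter> cball 0 t)" .
  qed
  finally show ?thesis .
qed

lemma nn_integral_npow_outside:
  assumes "q > 3"
  shows "(\<integral>\<^sup>+x. npow q x * indicator (- cball 0 1) x \<partial>lborel) < \<infinity>"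
proof -
  have "(\<integral>\<^sup>+x. npow q x * indicator (- cball 0 1) x \<partial>lborel)
     = (\<integral>\<^sup>+t. ennreal (q * t powr (- q - 1)) * indicator {0<..} t * emeasure lborel (- cball 0 1 \<inter> cball (0::real^3) t) \<partial>lborel)"
    using assms by (intro nn_integral_npow) auto
  also have "\<dots> \<le> (\<integral>\<^sup>+t. ennreal (q * unit_ball_vol 3) * (ennreal (t powr (2 - q)) * indicator {1..} t) \<partial>lborel)"
  proof (intro nn_integral_mono)
    fix t :: real
    show "ennreal (q * t powr (- q - 1)) * indicator {0<..} t * emeasure lborel (- cball 0 1 \<inter> cball (0::real^3) t)
       \<le> ennreal (q * unit_ball_vol 3) * (ennreal (t powr (2 - q)) * indicator {1..} t)"
    proof (cases "t \<ge> 1")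
      case True
      have "emeasure lborel (- cball 0 1 \<inter> cball (0::real^3) t) \<le> emeasure lborel (cball (0::real^3) t)"
        by (rule emeasure_mono) auto
      also have "\<dots> = ennreal (unit_ball_vol 3 * t ^ 3)" using True by (simp add: emeasure_cball_3)
      finally have "ennreal (q * t powr (- q - 1)) * emeasure lborel (- cball 0 1 \<inter> cball (0::real^3) t)
          \<le> ennreal (q * t powr (- q - 1)) * ennreal (unit_ball_vol 3 * t ^ 3)"
        by (rule mult_left_mono) simp
      also have "\<dots> = ennreal (q * unit_ball_vol 3 * t powr (2 - q))"
      proof -
        have "t powr (- q - 1) * t ^ 3 = t powr (- q - 1) * t powr 3"
          using True by simp
        also have "\<dots> = t powr (2 - q)" by (simp add: powr_add[symmetric])
        finally show ?thesis using assms True by (simp add: ennreal_mult[symmetric] mult_ac)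
      qed
      finally show ?thesis using True assms by (simp add: ennreal_mult)
    next
      case False
      then have "- cball 0 1 \<inter> cball (0::real^3) t = {}" by auto
      then show ?thesis by simp
    qed
  qed
  also have "\<dots> < \<infinity>"
    using assms by (simp add: nn_integral_cmult nn_integral_powr_to_inf ennreal_mult_less_top)
  finally show ?thesis .
qed

lemma nn_integral_npow_inside:
  assumes "0 < p" "p < 3"
  shows "(\<integral>\<^sup>+x. npow p x * indicator (cball 0 1) x \<partial>lborel) < \<infinity>"
proof -
  have "(\<integral>\<^sup>+x. npow p x * indicator (cball 0 1) x \<partial>lborel)
     = (\<integral>\<^sup>+t. ennreal (p * t powr (- p - 1)) * indicator {0<..} t * emeasure lborel (cball 0 1 \<inter> cball (0::real^3) t) \<partial>lborel)"
    using assms by (intro nn_integral_npow) auto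
  also have "\<dots> \<le> (\<integral>\<^sup>+t. ennreal (p * unit_ball_vol 3) * (ennreal (t powr (2 - p)) * indicator {0..1} t
      + ennreal (t powr (- p - 1)) * indicator {1..} t) \<partial>lborel)"
  proof (intro nn_integral_mono)
    fix t :: real
    show "ennreal (p * t powr (- p - 1)) * indicator {0<..} t * emeasure lborel (cball 0 1 \<inter> cball (0::real^3) t)
       \<le> ennreal (p * unit_ball_vol 3) * (ennreal (t powr (2 - p)) * indicator {0..1} t
          + ennreal (t powr (- p - 1)) * indicator {1..} t)"
    proof (cases "t > 0")
      case t: True
      show ?thesis
      proof (cases "t \<ge> 1")
        case True
        have "emeasure lborel (cball 0 1 \<inter> cball (0::real^3) t) \<le> emeasure lborel (cball (0::real^3) 1)"
          by (rule emeasure_mono) auto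
        also have "\<dots> = ennreal (unit_ball_vol 3)" by (simp add: emeasure_cball_3)
        finally have "ennreal (p * t powr (- p - 1)) * emeasure lborel (cball 0 1 \<inter> cball (0::real^3) t)
            \<le> ennreal (p * t powr (- p - 1)) * ennreal (unit_ball_vol 3)"
          by (rule mult_left_mono) simp
        also have "\<dots> = ennreal (p * unit_ball_vol 3) * ennreal (t powr (- p - 1))"
          using assms by (simp add: ennreal_mult[symmetric] mult_ac)
        finally show ?thesis using True t
          by (simp add: distrib_left) (meson add_increasing order_trans zero_le)
      next
        case False
        have "emeasure lborel (cball 0 1 \<inter> cball (0::real^3) t) \<le> emeasure lborel (cball (0::real^3) t)"
          by (rule emeasure_mono) auto
        also have "\<dots> = ennreal (unit_ball_vol 3 * t ^ 3)" using t by (simp add: emeasure_cball_3)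
        finally have "ennreal (p * t powr (- p - 1)) * emeasure lborel (cball 0 1 \<inter> cball (0::real^3) t)
            \<le> ennreal (p * t powr (- p - 1)) * ennreal (unit_ball_vol 3 * t ^ 3)"
          by (rule mult_left_mono) simp
        also have "\<dots> = ennreal (p * unit_ball_vol 3) * ennreal (t powr (2 - p))"
        proof -
          have "t powr (- p - 1) * t ^ 3 = t powr (- p - 1) * t powr 3"
            using t by simp
          also have "\<dots> = t powr (2 - p)" by (simp add: powr_add[symmetric])
          finally show ?thesis using assms t by (simp add: ennreal_mult[symmetric] mult_ac)
        qed
        finally show ?thesis using False t by simp
      qed
    qed simp
  qed
  also have "\<dots> < \<infinity>"
    using assms by (simp add: nn_integral_cmult nn_integral_add nn_integral_powr_to_inf nn_integral_powr_from_0 ennreal_mult_less_top)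
  finally show ?thesis .
qed

lemma sets_cball [measurable]: "cball (a::'a::euclidean_space) r \<in> sets borel"
  by (simp add: borel_closed)

definition e3 :: "real^3" where "e3 = axis 1 1"

lemma norm_e3 [simp]: "norm e3 = 1"
  by (simp add: e3_def norm_axis_1)

text \<open>The integral of the heat kernel over time is the Green function of the negative
  Laplacian; at distance 1 it is 1 / (4 pi). Positivity and finiteness are what is proved about
  it.\<close>

definition coulomb_mass :: ennreal where
  "coulomb_mass = (\<integral>\<^sup>+u. ennreal (heat u e3) \<partial>lborel)"

lemma coulomb_mass_finite: "coulomb_mass < \<infinity>"
proof -
  \<comment> \<open>For large u the Gaussian factor is at most 1. For small u the bound exp(x) >=
    x^2 / 2 at x = 1 / (4u) gives exp(-1 / (4u)) <= 32 u^2, which tames the power u^(-3/2).\<close>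
  have "coulomb_mass \<le> (\<integral>\<^sup>+u. 32 * (ennreal (u powr (1/2)) * indicator {0..1} u) + ennreal (u powr (- 3/2)) * indicator {1..} u \<partial>lborel)"
    unfolding coulomb_mass_def
  proof (intro nn_integral_mono)
    fix u :: real
    show "ennreal (heat u e3) \<le> 32 * (ennreal (u powr (1/2)) * indicator {0..1} u) + ennreal (u powr (- 3/2)) * indicator {1..} u"
    proof (cases "u > 0")
      case u: True
      have pw: "u powr (3/2) \<le> sqrt (4 * pi * u) ^ 3"
      proof -
        have "u powr (3/2) = (u powr (1/2)) powr 3" by (simp only: powr_powr) simp
        also have "\<dots> = sqrt u ^ 3" using u by (simp add: powr_half_sqrt)
        also have "\<dots> \<le> sqrt (4 * pi * u) ^ 3"
          using u pi_gt3 by (intro power_mono) auto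
        finally show ?thesis .
      qed
      have le: "heat u e3 \<le> exp (- 1 / (4 * u)) / u powr (3/2)"
        using u pw unfolding heat_def by (auto intro!: divide_left_mono)
      show ?thesis
      proof (cases "u \<ge> 1")
        case True
        have "exp (- 1 / (4 * u)) / u powr (3/2) \<le> 1 / u powr (3/2)"
          using u by (intro divide_right_mono) auto
        with le have "heat u e3 \<le> u powr (- 3/2)"
          using u by (simp add: powr_minus_divide[of u "3/2"])
        then have "ennreal (heat u e3) \<le> ennreal (u powr (- 3/2))" by (rule ennreal_leI)
        also have "\<dots> \<le> 32 * (ennreal (u powr (1/2)) * indicator {0..1} u) + ennreal (u powr (- 3/2)) * indicator {1..} u"
          using True by (simp add: add_increasing)
        finally show ?thesis .
      next
        case False
        have "(1 / (4 * u))\<^sup>2 / 2 \<le> exp (1 / (4 * u))"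
        proof -
          have "0 \<le> 1 / (4 * u)" using u by simp
          with exp_lower_Taylor_quadratic[OF this] show ?thesis by linarith
        qed
        then have "1 / (32 * u\<^sup>2) \<le> exp (1 / (4 * u))"
          by (simp add: power_divide power_mult_distrib)
        then have "inverse (exp (1 / (4 * u))) \<le> inverse (1 / (32 * u\<^sup>2))"
          using u by (intro le_imp_inverse_le) auto
        then have "exp (- 1 / (4 * u)) \<le> 32 * u\<^sup>2"
          by (simp add: exp_minus)
        then have "exp (- 1 / (4 * u)) / u powr (3/2) \<le> 32 * u\<^sup>2 / u powr (3/2)"
          by (intro divide_right_mono) auto
        also have "\<dots> = 32 * (u powr 2 / u powr (3/2))" using u by simp
        also have "\<dots> = 32 * u powr (1/2)" by (simp only: powr_diff[symmetric]) simp
        finally have "heat u e3 \<le> 32 * u powr (1/2)" using le by simp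
        then have "ennreal (heat u e3) \<le> ennreal (32 * u powr (1/2))" by (rule ennreal_leI)
        then show ?thesis using False u by (simp add: ennreal_mult)
      qed
    qed simp
  qed
  also have "\<dots> < \<infinity>"
    by (simp add: nn_integral_add nn_integral_cmult nn_integral_powr_from_0 nn_integral_powr_to_inf ennreal_mult_less_top)
  finally show ?thesis .
qed

lemma coulomb_mass_pos: "0 < coulomb_mass"
proof -
  have "coulomb_mass \<noteq> 0"
  proof
    assume "coulomb_mass = 0"
    then have "AE u in lborel. ennreal (heat u e3) = 0"
      unfolding coulomb_mass_def by (subst (asm) nn_integral_0_iff_AE) auto
    then have "AE u in lborel. \<not> (u \<in> {0<..<1::real})"
      by (rule eventually_mono) (metis ennreal_eq_0_iff greaterThanLessThan_iff heat_pos not_less)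
    then have "{0<..<1::real} \<in> null_sets lborel"
      by (subst AE_iff_null_sets) auto
    then have "emeasure lborel {0<..<1::real} = 0"
      by (rule null_setsD1)
    then show False by simp
  qed
  then show ?thesis by (simp add: zero_less_iff_neq_zero)
qed

text \<open>The kernel 1/|z| away from the origin: dividing by \<open>coulomb_mass\<close>
  normalises the value at \<open>e3\<close> to 1, and scaling and radial symmetry fix the rest. As a
  mixture of heat kernels it is radially decreasing, and its form obeys Cauchy-Schwarz.\<close>

definition coulomb :: "real^3 \<Rightarrow> ennreal" where
  "coulomb = mix (\<lambda>_. inverse coulomb_mass)"

lemma measurable_coulomb [measurable]: "coulomb \<in> borel_measurable borel"
  unfolding coulomb_def by measurable

lemma rdec_coulomb: "rdec coulomb"
  unfolding coulomb_def by (rule rdec_mix)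

lemma heat_scale: "c > 0 \<Longrightarrow> heat (c\<^sup>2 * u) (c *\<^sub>R z) = heat u z / c ^ 3"
  by (auto simp: heat_def real_sqrt_mult power_mult_distrib zero_less_mult_iff)

lemma coulomb_scale:
  assumes "c > 0"
  shows "coulomb (c *\<^sub>R z) = ennreal (1 / c) * coulomb z"
proof -
  have "coulomb (c *\<^sub>R z) = ennreal \<bar>c\<^sup>2\<bar> * (\<integral>\<^sup>+u. inverse coulomb_mass * ennreal (heat (0 + c\<^sup>2 * u) (c *\<^sub>R z)) \<partial>lborel)"
    unfolding coulomb_def mix_def using assms by (subst nn_integral_real_affine[of _ "c\<^sup>2" 0]) auto
  also have "\<dots> = ennreal (c\<^sup>2) * (\<integral>\<^sup>+u. ennreal (1 / c ^ 3) * (inverse coulomb_mass * ennreal (heat u z)) \<partial>lborel)"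
  proof -
    have "ennreal (heat (0 + c\<^sup>2 * u) (c *\<^sub>R z)) = ennreal (1 / c ^ 3) * ennreal (heat u z)" for u
      using assms by (simp add: heat_scale ennreal_mult[symmetric])
    then show ?thesis by (simp add: mult_ac)
  qed
  also have "\<dots> = ennreal (c\<^sup>2) * ennreal (1 / c ^ 3) * coulomb z"
    unfolding coulomb_def mix_def by (subst nn_integral_cmult) (auto simp: mult.assoc)
  also have "ennreal (c\<^sup>2) * ennreal (1 / c ^ 3) = ennreal (1 / c)"
    using assms by (simp add: ennreal_mult[symmetric] power2_eq_square power3_eq_cube)
  finally show ?thesis .
qed

lemma coulomb_e3: "coulomb e3 = 1"
proof -
  have "coulomb e3 = coulomb_mass / coulomb_mass"
    unfolding coulomb_def mix_def
    by (subst nn_integral_cmult) (simp_all add: coulomb_mass_def[symmetric] divide_ennreal_def mult.commute)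
  then show ?thesis
    using coulomb_mass_pos coulomb_mass_finite by (simp add: ennreal_divide_self less_top)
qed

lemma rdec_eq: "rdec f \<Longrightarrow> norm x = norm y \<Longrightarrow> f x = f y"
  by (intro antisym rdecD) auto

lemma coulomb_eq: "z \<noteq> 0 \<Longrightarrow> coulomb z = ennreal (1 / norm z)"
  using coulomb_scale[of "norm z" e3] rdec_eq[OF rdec_coulomb, of z "norm z *\<^sub>R e3"]
  by (simp add: coulomb_e3)

lemma coulomb_npow: "z \<noteq> 0 \<Longrightarrow> coulomb z = npow 1 z"
  by (simp add: coulomb_eq npow_def powr_minus_divide)

lemma conv_coulomb_scale:
  assumes [measurable]: "f \<in> borel_measurable borel" and c: "c > 0"
  shows "conv coulomb f (c *\<^sub>R x) = ennreal (c\<^sup>2) * conv coulomb (\<lambda>y. f (c *\<^sub>R y)) x"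
proof -
  have "conv coulomb f (c *\<^sub>R x) = ennreal (\<bar>c\<bar> ^ DIM(real^3)) * (\<integral>\<^sup>+y. coulomb (c *\<^sub>R x - c *\<^sub>R y) * f (c *\<^sub>R y) \<partial>lborel)"
    unfolding conv_def using c by (subst nn_integral_scale[where c = c]) auto
  also have "\<dots> = ennreal (c ^ 3) * (\<integral>\<^sup>+y. ennreal (1 / c) * (coulomb (x - y) * f (c *\<^sub>R y)) \<partial>lborel)"
    using c by (simp add: scaleR_diff_right[symmetric] coulomb_scale mult_ac)
  also have "\<dots> = ennreal (c ^ 3) * ennreal (1 / c) * conv coulomb (\<lambda>y. f (c *\<^sub>R y)) x"
    unfolding conv_def by (subst nn_integral_cmult) (auto simp: mult.assoc)
  also have "ennreal (c ^ 3) * ennreal (1 / c) = ennreal (c\<^sup>2)"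
    using c by (simp add: ennreal_mult[symmetric] power2_eq_square power3_eq_cube)
  finally show ?thesis .
qed

text \<open>Finiteness is shown first on average over the unit ball. By symmetry of the Coulomb form
  that average is the integral of \<open>npow p\<close> against the potential of the ball, which is
  bounded and decays like 1/|y|; p < 3 handles the origin and p + 1 > 3 infinity. Hence the
  potential is finite at some nonzero point of the ball, and by monotonicity at
  \<open>e3\<close>.\<close>

lemma conv_coulomb_npow_finite:
  assumes p: "2 < p" "p < 3"
  shows "conv coulomb (npow p) e3 < \<infinity>"
proof -
  let ?B = "cball (0::real^3) 1" and ?V = "conv coulomb (npow p)"
  have rV: "rdec ?V" using p by (intro rdec_conv rdec_coulomb rdec_npow) auto
  define K where "K = (\<integral>\<^sup>+x. npow 1 x * indicator ?B x \<partial>lborel)"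
  have K: "K < \<infinity>" unfolding K_def by (rule nn_integral_npow_inside) auto
  define C where "C = 2 * K + 2 * ennreal (unit_ball_vol 3)"
  have C: "C < \<infinity>" using K by (simp add: C_def ennreal_mult_less_top)
  have h0: "conv coulomb (indicator ?B) y \<le> K" for y
  proof -
    have "conv coulomb (indicator ?B) y \<le> conv coulomb (indicator ?B) 0"
      by (intro rdecD[OF rdec_conv] rdec_coulomb rdec_indicator_cball) simp
    also have "\<dots> = K" unfolding conv_def K_def
    proof (intro nn_integral_cong_AE)
      show "AE y in lborel. coulomb (0 - y) * indicator ?B y = npow 1 y * indicator ?B y"
        using AE_lborel_singleton[of 0] by eventually_elim (simp add: coulomb_npow npow_def)
    qed
    finally show ?thesis .
  qed
  \<comment> \<open>Up to norm 2 the uniform bound K already is a multiple of 1/|y|. Beyond that,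
    points of the unit ball have distance at least |y| / 2 from y.\<close>
  have h1: "conv coulomb (indicator ?B) y \<le> C * npow 1 y" if y: "norm y \<ge> 1" for y
  proof -
    have y0: "y \<noteq> 0" using y by auto
    show ?thesis
    proof (cases "norm y \<le> 2")
      case True
      have "conv coulomb (indicator ?B) y \<le> K" by (rule h0)
      also have "\<dots> \<le> K * ennreal (2 / norm y)"
      proof -
        have "1 \<le> ennreal (2 / norm y)" using True y0 by (simp add: ennreal_ge_1)
        from mult_left_mono[OF this, of K] show ?thesis by simp
      qed
      also have "\<dots> = 2 * K * npow 1 y"
        using y0 ennreal_mult[of 2 "1 / norm y"] by (simp add: npow_def powr_minus_divide mult_ac)
      also have "\<dots> \<le> C * npow 1 y" unfolding C_def by (intro mult_right_mono) simp_all
      finally show ?thesis .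
    next
      case False
      have "conv coulomb (indicator ?B) y \<le> (\<integral>\<^sup>+z. ennreal (2 / norm y) * indicator ?B z \<partial>lborel)"
        unfolding conv_def
      proof (intro nn_integral_mono)
        fix z
        show "coulomb (y - z) * indicator ?B z \<le> ennreal (2 / norm y) * indicator ?B z"
        proof (cases "z \<in> ?B")
          case z: True
          then have "norm (y - z) \<ge> norm y - 1"
            using norm_triangle_ineq2[of y z] by simp
          then have n: "norm (y - z) \<ge> norm y / 2" using False by simp
          then have "coulomb (y - z) = ennreal (1 / norm (y - z))"
            using False by (intro coulomb_eq) auto
          also have "\<dots> \<le> ennreal (2 / norm y)"
          proof -
            have "1 / norm (y - z) \<le> 1 / (norm y / 2)"
              using n False by (intro divide_left_mono mult_pos_pos) auto
            then show ?thesis by (intro ennreal_leI) simp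
          qed
          finally show ?thesis using z by simp
        qed simp
      qed
      also have "\<dots> = ennreal (2 / norm y) * ennreal (unit_ball_vol 3)"
        by (simp add: nn_integral_cmult_indicator emeasure_cball_3)
      also have "\<dots> = 2 * ennreal (unit_ball_vol 3) * npow 1 y"
        using y0 ennreal_mult[of 2 "1 / norm y"] by (simp add: npow_def powr_minus_divide mult_ac)
      also have "\<dots> \<le> C * npow 1 y" unfolding C_def by (intro mult_right_mono) simp_all
      finally show ?thesis .
    qed
  qed
  have "(\<integral>\<^sup>+x. ?V x * indicator ?B x \<partial>lborel) = energy (\<lambda>_. inverse coulomb_mass) (indicator ?B) (npow p)"
    by (subst energy_eq) (simp_all add: rdec_measurable rdec_indicator_cball coulomb_def mult.commute)
  \<comment> \<open>The potential is shifted from the power to the indicator of the ball.\<close>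
  also have "\<dots> = (\<integral>\<^sup>+y. npow p y * conv coulomb (indicator ?B) y \<partial>lborel)"
    by (subst energy_commute, subst energy_eq) (simp_all add: rdec_measurable rdec_indicator_cball coulomb_def)
  also have "\<dots> \<le> (\<integral>\<^sup>+y. K * (npow p y * indicator ?B y) + C * (npow (p + 1) y * indicator (- ?B) y) \<partial>lborel)"
  proof (intro nn_integral_mono)
    fix y
    show "npow p y * conv coulomb (indicator ?B) y \<le> K * (npow p y * indicator ?B y) + C * (npow (p + 1) y * indicator (- ?B) y)"
    proof (cases "y \<in> ?B")
      case True
      then show ?thesis using mult_left_mono[OF h0[of y], of "npow p y"] by (simp add: mult.commute)
    next
      case False
      then show ?thesis using mult_left_mono[OF h1[of y], of "npow p y"]
        by (simp add: mult_ac npow_mult[symmetric])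
    qed
  qed
  also have "\<dots> = K * (\<integral>\<^sup>+y. npow p y * indicator ?B y \<partial>lborel) + C * (\<integral>\<^sup>+y. npow (p + 1) y * indicator (- ?B) y \<partial>lborel)"
  proof -
    have m: "(\<lambda>y. npow p y * indicator ?B y) \<in> borel_measurable lborel"
      "(\<lambda>y. npow (p + 1) y * indicator (- ?B) y) \<in> borel_measurable lborel"
      by measurable
    then show ?thesis by (simp add: nn_integral_add nn_integral_cmult)
  qed
  also have "\<dots> < \<infinity>"
    using p K C nn_integral_npow_inside[of p] nn_integral_npow_outside[of "p + 1"]
    by (simp add: ennreal_mult_less_top)
  finally have fin: "(\<integral>\<^sup>+x. ?V x * indicator ?B x \<partial>lborel) < \<infinity>" .
  have "AE x in lborel. ?V x * indicator ?B x \<noteq> \<infinity>"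
    using fin by (intro nn_integral_PInf_AE) (auto simp: rdec_measurable[OF rV])
  then have AE: "AE x in lborel. x \<noteq> 0 \<and> ?V x * indicator ?B x \<noteq> \<infinity>"
    using AE_lborel_singleton[of "0::real^3"] by eventually_elim auto
  have "\<exists>x\<in>?B. x \<noteq> 0 \<and> ?V x < \<infinity>"
  proof (rule ccontr)
    assume *: "\<not> ?thesis"
    have "AE x in lborel. x \<notin> ?B"
      using AE
    proof eventually_elim
      fix x
      assume "x \<noteq> 0 \<and> ?V x * indicator ?B x \<noteq> \<infinity>"
      then show "x \<notin> ?B" using * by (cases "x \<in> ?B") (auto simp: less_top)
    qed
    then have "?B \<in> null_sets lborel"
      by (subst AE_iff_null_sets) auto
    then have "emeasure lborel ?B = 0"
      by (rule null_setsD1)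
    then show False using unit_ball_vol_pos[of 3] by (simp add: emeasure_cball_3)
  qed
  then obtain x where x: "x \<in> ?B" "x \<noteq> 0" "?V x < \<infinity>" by blast
  then have "?V e3 \<le> ?V x" by (intro rdecD[OF rV]) simp
  with x show ?thesis by (simp add: le_less_trans)
qed

text \<open>Both sides are radial and homogeneous of degree 2 - p, so the value at \<open>e3\<close>
  decides. Adding 1 makes the constant nonzero, so that the bound is infinite at the origin, where
  \<open>npow\<close> is.\<close>

lemma conv_coulomb_npow:
  assumes p: "2 < p" "p < 3"
  shows "conv coulomb (npow p) x \<le> (conv coulomb (npow p) e3 + 1) * npow (p - 2) x"
proof (cases "x = 0")
  case False
  let ?V = "conv coulomb (npow p)"
  have rV: "rdec ?V" using p by (intro rdec_conv rdec_coulomb rdec_npow) auto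
  have "?V x = ?V (norm x *\<^sub>R e3)" by (rule rdec_eq[OF rV]) simp
  also have "\<dots> = ennreal ((norm x)\<^sup>2) * (ennreal (norm x powr - p) * ?V e3)"
    using False by (subst conv_coulomb_scale) (simp_all add: npow_scale conv_cmult)
  also have "\<dots> = npow (p - 2) x * ?V e3"
  proof -
    have "(norm x)\<^sup>2 * norm x powr - p = norm x powr (2 - p)"
      using False by (simp add: powr_diff powr_minus_divide)
    then show ?thesis using False
      by (simp add: npow_def ennreal_mult[symmetric] mult.assoc[symmetric])
  qed
  also have "\<dots> \<le> npow (p - 2) x * (?V e3 + 1)" by (intro mult_left_mono) auto
  finally show ?thesis by (simp add: mult.commute)
qed (simp add: npow_def ennreal_mult_top)

section \<open>The resolvent kernel\<close>

text \<open>The inverse Laplace transform of 1 / (1 + sqrt(a + \<mu>^2)) in a. It combines 1 / (1 +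
  sqrt b) = (2/pi) times the integral of v^2 / ((1 + v^2)(b + v^2)) over v >= 0 with the
  representation of 1 / (b + v^2) as the integral of exp(-u (b + v^2)) over u > 0.\<close>

definition res_weight :: "real \<Rightarrow> real \<Rightarrow> ennreal" where
  "res_weight \<mu> u = ennreal (exp (- u * \<mu>\<^sup>2)) *
     (\<integral>\<^sup>+v. ennreal (2 / pi * (v\<^sup>2 / (1 + v\<^sup>2)) * exp (- u * v\<^sup>2)) * indicator {0..} v \<partial>lborel)"

text \<open>The convolution kernel of $(\sqrt{-\Delta + \mu^2} + 1)^{-1}$.\<close>

definition res_kernel :: "real \<Rightarrow> real^3 \<Rightarrow> ennreal" where
  "res_kernel \<mu> = mix (res_weight \<mu>)"

lemma measurable_res_weight [measurable]: "res_weight \<mu> \<in> borel_measurable borel"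
  unfolding res_weight_def by measurable

lemma measurable_res_kernel [measurable]: "res_kernel \<mu> \<in> borel_measurable borel"
  unfolding res_kernel_def by measurable

lemma rdec_res_kernel: "rdec (res_kernel \<mu>)"
  unfolding res_kernel_def by (rule rdec_mix)

lemma res_weight_antimono: "\<bar>\<nu>\<bar> \<le> \<bar>\<mu>\<bar> \<Longrightarrow> u \<ge> 0 \<Longrightarrow> res_weight \<mu> u \<le> res_weight \<nu> u"
  unfolding res_weight_def
  by (intro mult_right_mono ennreal_leI) (auto simp: abs_le_square_iff mult_left_mono)

lemma res_kernel_antimono:
  assumes "\<bar>\<nu>\<bar> \<le> \<bar>\<mu>\<bar>"
  shows "res_kernel \<mu> z \<le> res_kernel \<nu> z"
  unfolding res_kernel_def mix_def
proof (intro nn_integral_mono)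
  fix u
  show "res_weight \<mu> u * ennreal (heat u z) \<le> res_weight \<nu> u * ennreal (heat u z)"
    by (cases "u \<ge> 0") (auto intro!: mult_right_mono res_weight_antimono assms)
qed

lemma nn_integral_exp_neg:
  assumes "b > 0"
  shows "(\<integral>\<^sup>+u. ennreal (exp (- u * b)) * indicator {0<..} u \<partial>lborel) = ennreal (1 / b)"
proof -
  have "(\<integral>\<^sup>+u. ennreal (exp (- u * b)) * indicator {0<..} u \<partial>lborel)
      = (\<integral>\<^sup>+u. ennreal (exp (- u * b)) * indicator {0..} u \<partial>lborel)"
    using AE_lborel_singleton[of "0::real"]
    by (intro nn_integral_cong_AE) (auto elim!: eventually_mono split: split_indicator)
  also have "\<dots> = ennreal (0 - (- exp (- 0 * b) / b))"
  proof (rule nn_integral_FTC_atLeast)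
    show "((\<lambda>u. - exp (- u * b) / b) \<longlongrightarrow> 0) at_top"
      using assms by real_asymp
  qed (use assms in \<open>auto intro!: derivative_eq_intros\<close>)
  finally show ?thesis by simp
qed

lemma nn_integral_inverse_quadratic:
  assumes "c > 0"
  shows "(\<integral>\<^sup>+v. ennreal (2 / pi * (1 / (1 + (c * v)\<^sup>2))) * indicator {0..} v \<partial>lborel) = ennreal (1 / c)"
proof -
  have "(\<integral>\<^sup>+v. ennreal (2 / pi * (1 / (1 + (c * v)\<^sup>2))) * indicator {0..} v \<partial>lborel)
     = ennreal (1 / c - 2 / pi * (arctan (c * 0) / c))"
  proof (rule nn_integral_FTC_atLeast)
    show "((\<lambda>v. 2 / pi * (arctan (c * v) / c)) \<longlongrightarrow> 1 / c) at_top"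
    proof -
      have "((\<lambda>v. arctan (c * v)) \<longlongrightarrow> pi / 2) at_top"
        using assms
        by (intro filterlim_compose[OF tendsto_arctan_at_top] filterlim_tendsto_pos_mult_at_top[OF tendsto_const] filterlim_ident)
      then have "((\<lambda>v. 2 / pi * (arctan (c * v) / c)) \<longlongrightarrow> 2 / pi * (pi / 2 / c)) at_top"
        by (intro tendsto_intros) (use assms in auto)
      then show ?thesis by simp
    qed
    show "((\<lambda>v. 2 / pi * (arctan (c * v) / c)) has_real_derivative 2 / pi * (1 / (1 + (c * x)\<^sup>2))) (at x)" for x
      using assms by (auto intro!: derivative_eq_intros simp: divide_inverse)
  qed (auto simp: add_nonneg_nonneg)
  then show ?thesis by simp
qed

lemma exp_neg_le_inverse: "0 \<le> x \<Longrightarrow> exp (- x) \<le> 1 / (1 + x)" for x :: real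
  using exp_ge_add_one_self[of x] by (simp add: exp_minus field_simps)

text \<open>Bounding v^2 / (1 + v^2) by 1 and exp(-x) by 1 / (1 + x) leaves an arctangent integral.
  The rate is that of the massless operator for small u.\<close>

lemma res_weight_le:
  assumes u: "u > 0"
  shows "res_weight \<mu> u \<le> ennreal (1 / sqrt u)"
proof -
  have "res_weight \<mu> u \<le> ennreal 1 * (\<integral>\<^sup>+v. ennreal (2 / pi * (1 / (1 + (sqrt u * v)\<^sup>2))) * indicator {0..} v \<partial>lborel)"
    unfolding res_weight_def
  proof (rule mult_mono)
    show "ennreal (exp (- u * \<mu>\<^sup>2)) \<le> ennreal 1" using u by (intro ennreal_leI) simp
    show "(\<integral>\<^sup>+v. ennreal (2 / pi * (v\<^sup>2 / (1 + v\<^sup>2)) * exp (- u * v\<^sup>2)) * indicator {0..} v \<partial>lborel)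
      \<le> (\<integral>\<^sup>+v. ennreal (2 / pi * (1 / (1 + (sqrt u * v)\<^sup>2))) * indicator {0..} v \<partial>lborel)"
    proof (intro nn_integral_mono mult_right_mono ennreal_leI)
    fix v :: real
    have "v\<^sup>2 / (1 + v\<^sup>2) * exp (- (u * v\<^sup>2)) \<le> 1 * (1 / (1 + u * v\<^sup>2))"
      using u by (intro mult_mono exp_neg_le_inverse) (auto simp: divide_le_eq_1 add_pos_nonneg)
    then have "2 / pi * (v\<^sup>2 / (1 + v\<^sup>2) * exp (- (u * v\<^sup>2))) \<le> 2 / pi * (1 * (1 / (1 + u * v\<^sup>2)))"
      by (rule mult_left_mono) simp
    then show "2 / pi * (v\<^sup>2 / (1 + v\<^sup>2)) * exp (- u * v\<^sup>2) \<le> 2 / pi * (1 / (1 + (sqrt u * v)\<^sup>2))"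
      using u by (simp add: power_mult_distrib)
    qed auto
  qed auto
  also have "\<dots> = ennreal (1 / sqrt u)"
    using u by (subst nn_integral_inverse_quadratic) auto
  finally show ?thesis .
qed

definition stieltjes :: "real \<Rightarrow> ennreal" where
  "stieltjes a = (\<integral>\<^sup>+v. ennreal (2 / pi * (v\<^sup>2 / ((1 + v\<^sup>2) * (a + v\<^sup>2)))) * indicator {0..} v \<partial>lborel)"

text \<open>Tonelli, with the integral in u carried out first. The single point v = 0 is left out,
  because there the exponential rate \<open>a + \<mu>\<^sup>2 + v\<^sup>2\<close> may
  vanish.\<close>

lemma res_weight_laplace:
  assumes "a \<ge> 0"
  shows "(\<integral>\<^sup>+u. res_weight \<mu> u * ennreal (exp (- u * a)) * indicator {0<..} u \<partial>lborel) = stieltjes (a + \<mu>\<^sup>2)"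
proof -
  let ?h = "\<lambda>v::real. 2 / pi * (v\<^sup>2 / (1 + v\<^sup>2))"
  have h: "0 \<le> ?h v" for v by simp
  have "(\<integral>\<^sup>+u. res_weight \<mu> u * ennreal (exp (- u * a)) * indicator {0<..} u \<partial>lborel)
    = (\<integral>\<^sup>+u. \<integral>\<^sup>+v. ennreal (?h v) * indicator {0..} v * (ennreal (exp (- u * (a + \<mu>\<^sup>2 + v\<^sup>2))) * indicator {0<..} u) \<partial>lborel \<partial>lborel)"
  proof (rule nn_integral_cong)
    fix u
    have "res_weight \<mu> u * ennreal (exp (- u * a)) * indicator {0<..} u =
      (\<integral>\<^sup>+v. ennreal (?h v * exp (- u * v\<^sup>2)) * indicator {0..} v \<partial>lborel) * (ennreal (exp (- u * \<mu>\<^sup>2)) * ennreal (exp (- u * a)) * indicator {0<..} u)"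
      unfolding res_weight_def by (simp only: mult_ac)
    also have "\<dots> = (\<integral>\<^sup>+v. ennreal (?h v * exp (- u * v\<^sup>2)) * indicator {0..} v * (ennreal (exp (- u * \<mu>\<^sup>2)) * ennreal (exp (- u * a)) * indicator {0<..} u) \<partial>lborel)"
      by (rule nn_integral_multc[symmetric]) measurable
    also have "\<dots> = (\<integral>\<^sup>+v. ennreal (?h v) * indicator {0..} v * (ennreal (exp (- u * (a + \<mu>\<^sup>2 + v\<^sup>2))) * indicator {0<..} u) \<partial>lborel)"
    proof (rule nn_integral_cong)
      fix v
      have "exp (- u * (a + \<mu>\<^sup>2 + v\<^sup>2)) = exp (- u * v\<^sup>2) * (exp (- u * \<mu>\<^sup>2) * exp (- u * a))"
        by (simp add: exp_add[symmetric] algebra_simps)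
      then have "ennreal (exp (- u * (a + \<mu>\<^sup>2 + v\<^sup>2))) = ennreal (exp (- u * v\<^sup>2)) * (ennreal (exp (- u * \<mu>\<^sup>2)) * ennreal (exp (- u * a)))"
        by (simp only: ennreal_mult exp_ge_zero mult_nonneg_nonneg)
      then show "ennreal (?h v * exp (- u * v\<^sup>2)) * indicator {0..} v * (ennreal (exp (- u * \<mu>\<^sup>2)) * ennreal (exp (- u * a)) * indicator {0<..} u)
        = ennreal (?h v) * indicator {0..} v * (ennreal (exp (- u * (a + \<mu>\<^sup>2 + v\<^sup>2))) * indicator {0<..} u)"
        unfolding ennreal_mult[OF h exp_ge_zero] by (simp only: mult_ac)
    qed
    finally show "res_weight \<mu> u * ennreal (exp (- u * a)) * indicator {0<..} u
      = (\<integral>\<^sup>+v. ennreal (?h v) * indicator {0..} v * (ennreal (exp (- u * (a + \<mu>\<^sup>2 + v\<^sup>2))) * indicator {0<..} u) \<partial>lborel)" .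
  qed
  also have "\<dots> = (\<integral>\<^sup>+v. \<integral>\<^sup>+u. ennreal (?h v) * indicator {0..} v * (ennreal (exp (- u * (a + \<mu>\<^sup>2 + v\<^sup>2))) * indicator {0<..} u) \<partial>lborel \<partial>lborel)"
    by (rule nn_integral_swap) measurable
  also have "\<dots> = stieltjes (a + \<mu>\<^sup>2)"
    unfolding stieltjes_def
  proof (rule nn_integral_cong_AE)
    show "AE v in lborel. (\<integral>\<^sup>+u. ennreal (?h v) * indicator {0..} v * (ennreal (exp (- u * (a + \<mu>\<^sup>2 + v\<^sup>2))) * indicator {0<..} u) \<partial>lborel)
      = ennreal (2 / pi * (v\<^sup>2 / ((1 + v\<^sup>2) * (a + \<mu>\<^sup>2 + v\<^sup>2)))) * indicator {0..} v"
      using AE_lborel_singleton[of "0::real"]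
    proof eventually_elim
      fix v :: real assume "v \<noteq> 0"
      then have pos: "0 < a + \<mu>\<^sup>2 + v\<^sup>2" using assms by (simp add: add_nonneg_pos)
      have "(\<integral>\<^sup>+u. ennreal (?h v) * indicator {0..} v * (ennreal (exp (- u * (a + \<mu>\<^sup>2 + v\<^sup>2))) * indicator {0<..} u) \<partial>lborel)
        = ennreal (?h v) * indicator {0..} v * ennreal (1 / (a + \<mu>\<^sup>2 + v\<^sup>2))"
        by (subst nn_integral_cmult, measurable) (simp only: nn_integral_exp_neg[OF pos])
      also have "\<dots> = ennreal (?h v * (1 / (a + \<mu>\<^sup>2 + v\<^sup>2))) * indicator {0..} v"
        using pos by (subst ennreal_mult[OF h]) (auto simp: mult_ac)
      finally show "(\<integral>\<^sup>+u. ennreal (?h v) * indicator {0..} v * (ennreal (exp (- u * (a + \<mu>\<^sup>2 + v\<^sup>2))) * indicator {0<..} u) \<partial>lborel)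
        = ennreal (2 / pi * (v\<^sup>2 / ((1 + v\<^sup>2) * (a + \<mu>\<^sup>2 + v\<^sup>2)))) * indicator {0..} v"
        by (simp add: mult.assoc)
    qed
  qed
  finally show ?thesis .
qed

text \<open>The closed form in \<open>stieltjes_eq\<close> leaves out a = 0 and a = 1, but the mass
  of the resolvent kernel is the value at a = \<mu>^2, where both occur. Hence a direct comparison
  with the arctangent integral.\<close>

lemma stieltjes_le_1: "a \<ge> 0 \<Longrightarrow> stieltjes a \<le> 1"
proof -
  assume a: "a \<ge> 0"
  have "stieltjes a \<le> (\<integral>\<^sup>+v. ennreal (2 / pi * (1 / (1 + (1 * v)\<^sup>2))) * indicator {0..} v \<partial>lborel)"
    unfolding stieltjes_def
  proof (intro nn_integral_mono mult_right_mono ennreal_leI mult_left_mono)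
    fix v :: real
    have "v\<^sup>2 / (a + v\<^sup>2) \<le> 1" using a zero_le_power2[of v] by (simp only: divide_le_eq_1) linarith
    then have "v\<^sup>2 / (a + v\<^sup>2) * (1 / (1 + v\<^sup>2)) \<le> 1 * (1 / (1 + v\<^sup>2))" by (rule mult_right_mono) simp
    then show "v\<^sup>2 / ((1 + v\<^sup>2) * (a + v\<^sup>2)) \<le> 1 / (1 + (1 * v)\<^sup>2)" by (simp add: mult.commute)
  qed auto
  also have "\<dots> = 1" by (subst nn_integral_inverse_quadratic) auto
  finally show ?thesis .
qed

text \<open>Partial fractions split the integrand into two arctangent derivatives with the factor 1
  / (a - 1), which degenerates at a = 1. Later only almost every frequency matters, so that value
  may be left out.\<close>

lemma stieltjes_eq:
  assumes "a > 0" "a \<noteq> 1"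
  shows "stieltjes a = ennreal (1 / (1 + sqrt a))"
proof -
  let ?F = "\<lambda>v. 2 / pi * ((sqrt a * arctan (v / sqrt a) - arctan v) / (a - 1))"
  have "stieltjes a = ennreal (1 / (1 + sqrt a) - ?F 0)"
    unfolding stieltjes_def
  proof (rule nn_integral_FTC_atLeast)
    have "((\<lambda>v. arctan (v / sqrt a)) \<longlongrightarrow> pi / 2) at_top"
      using assms by (intro filterlim_compose[OF tendsto_arctan_at_top]) real_asymp
    then have "(?F \<longlongrightarrow> 2 / pi * ((sqrt a * (pi / 2) - pi / 2) / (a - 1))) at_top"
      using assms by (intro tendsto_intros tendsto_arctan_at_top) auto
    also have "2 / pi * ((sqrt a * (pi / 2) - pi / 2) / (a - 1)) = 1 / (1 + sqrt a)"
    proof -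
      have 1: "sqrt a * (pi / 2) - pi / 2 = pi / 2 * (sqrt a - 1)" by (simp add: algebra_simps)
      have 2: "a - 1 = (sqrt a - 1) * (1 + sqrt a)"
        using assms by (simp add: algebra_simps)
      have "2 / pi * ((pi / 2 * (t - 1)) / ((t - 1) * (1 + t))) = 1 / (1 + t)" if "t - 1 \<noteq> 0" for t
        using that by (auto simp: divide_simps)
      moreover have "sqrt a - 1 \<noteq> 0" using assms by simp
      ultimately show ?thesis unfolding 1 2 .
    qed
    finally show "(?F \<longlongrightarrow> 1 / (1 + sqrt a)) at_top" .
    fix v :: real
    show "(?F has_real_derivative 2 / pi * (v\<^sup>2 / ((1 + v\<^sup>2) * (a + v\<^sup>2)))) (at v)"
    proof -
      have "(?F has_real_derivative 2 / pi * ((sqrt a * (1 / sqrt a * inverse (1 + (v / sqrt a)\<^sup>2)) - inverse (1 + v\<^sup>2)) / (a - 1))) (at v)"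
        using assms by (auto intro!: derivative_eq_intros simp: mult.assoc)
      also have "(sqrt a * (1 / sqrt a * inverse (1 + (v / sqrt a)\<^sup>2)) - inverse (1 + v\<^sup>2)) / (a - 1) = v\<^sup>2 / ((1 + v\<^sup>2) * (a + v\<^sup>2))"
      proof -
        have p: "0 < 1 + v\<^sup>2" "0 < a + v\<^sup>2" using assms by (auto intro: add_pos_nonneg)
        have e1: "sqrt a * (1 / sqrt a * inverse (1 + (v / sqrt a)\<^sup>2)) = a / (a + v\<^sup>2)"
        proof -
          have "sqrt a * (1 / sqrt a * inverse (1 + (v / sqrt a)\<^sup>2)) = inverse (1 + v\<^sup>2 / a)"
            using assms by (simp add: power_divide)
          also have "\<dots> = a / (a + v\<^sup>2)" using assms by (simp add: field_simps)
          finally show ?thesis .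
        qed
        have "a / (a + v\<^sup>2) - inverse (1 + v\<^sup>2) = (a * (1 + v\<^sup>2) - 1 * (a + v\<^sup>2)) / ((a + v\<^sup>2) * (1 + v\<^sup>2))"
          unfolding inverse_eq_divide using p by (intro diff_frac_eq) auto
        also have "a * (1 + v\<^sup>2) - 1 * (a + v\<^sup>2) = (a - 1) * v\<^sup>2" by (simp add: algebra_simps)
        finally show ?thesis unfolding e1 using assms by (simp add: mult.commute)
      qed
      finally show ?thesis .
    qed
  qed (use assms in auto)
  then show ?thesis by simp
qed

lemma nn_integral_res_kernel: "(\<integral>\<^sup>+z. res_kernel \<mu> z \<partial>lborel) \<le> 1"
  unfolding res_kernel_def
  using res_weight_laplace[of 0 \<mu>] stieltjes_le_1[of "\<mu>\<^sup>2"] by (simp add: nn_integral_mix)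

text \<open>The centre is the worst point. The mixture is split at u = r^2: below, each heat kernel
  has mass 1 and the weight u^(-1/2) integrates to 2r; above, the kernel is at most u^(-3/2), so the
  volume of the ball times the integral of u^(-2) gives a multiple of r.\<close>

lemma conv_res_kernel_ball:
  assumes r: "r > 0"
  shows "conv (res_kernel \<mu>) (indicator (cball 0 r)) x \<le> ennreal ((2 + unit_ball_vol 3) * r)"
proof -
  let ?B = "cball (0::real^3) r" and ?\<omega> = "unit_ball_vol 3"
  have "conv (res_kernel \<mu>) (indicator ?B) x \<le> conv (res_kernel \<mu>) (indicator ?B) 0"
    by (intro rdecD[OF rdec_conv] rdec_res_kernel rdec_indicator_cball) simp
  also have "\<dots> = (\<integral>\<^sup>+z. \<integral>\<^sup>+u. res_weight \<mu> u * ennreal (heat u (0 - z)) * indicator ?B z \<partial>lborel \<partial>lborel)"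
    unfolding conv_def res_kernel_def mix_def by (simp add: nn_integral_multc)
  also have "\<dots> = (\<integral>\<^sup>+u. \<integral>\<^sup>+z. res_weight \<mu> u * ennreal (heat u (0 - z)) * indicator ?B z \<partial>lborel \<partial>lborel)"
    by (rule nn_integral_swap) measurable
  also have "\<dots> \<le> (\<integral>\<^sup>+u. ennreal (u powr (- 1/2)) * indicator {0..r\<^sup>2} u + ennreal (?\<omega> * r ^ 3) * (ennreal (u powr - 2) * indicator {r\<^sup>2..} u) \<partial>lborel)"
  proof (intro nn_integral_mono)
    fix u :: real
    show "(\<integral>\<^sup>+z. res_weight \<mu> u * ennreal (heat u (0 - z)) * indicator ?B z \<partial>lborel)
      \<le> ennreal (u powr (- 1/2)) * indicator {0..r\<^sup>2} u + ennreal (?\<omega> * r ^ 3) * (ennreal (u powr - 2) * indicator {r\<^sup>2..} u)"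
    proof (cases "u > 0")
      case u: True
      have w: "res_weight \<mu> u \<le> ennreal (u powr (- 1/2))"
        using res_weight_le[OF u, of \<mu>] u by (simp add: powr_minus_divide[of u "1/2"] powr_half_sqrt)
      have eq: "(\<integral>\<^sup>+z. res_weight \<mu> u * ennreal (heat u (0 - z)) * indicator ?B z \<partial>lborel)
        = res_weight \<mu> u * (\<integral>\<^sup>+z. ennreal (heat u (0 - z)) * indicator ?B z \<partial>lborel)"
        by (subst nn_integral_cmult[symmetric]) (auto simp: mult.assoc)
      show ?thesis
      proof (cases "u \<le> r\<^sup>2")
        case True
        have "(\<integral>\<^sup>+z. ennreal (heat u (0 - z)) * indicator ?B z \<partial>lborel) \<le> (\<integral>\<^sup>+z. ennreal (heat u (0 - z)) \<partial>lborel)"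
          by (intro nn_integral_mono) (auto split: split_indicator)
        also have "\<dots> = 1"
          using u by (subst nn_integral_reflect[of "\<lambda>z. ennreal (heat u z)"]) (auto simp: nn_integral_heat)
        finally have "res_weight \<mu> u * (\<integral>\<^sup>+z. ennreal (heat u (0 - z)) * indicator ?B z \<partial>lborel) \<le> ennreal (u powr (- 1/2)) * 1"
          by (intro mult_mono w) auto
        also have "\<dots> \<le> ennreal (u powr (- 1/2)) * indicator {0..r\<^sup>2} u + ennreal (?\<omega> * r ^ 3) * (ennreal (u powr - 2) * indicator {r\<^sup>2..} u)"
          using True u by (simp add: add_increasing2)
        finally show ?thesis unfolding eq .
      next
        case False
        have h: "heat u z \<le> u powr (- 3/2)" for z
        proof -
          have "u powr (3/2) = (u powr (1/2)) powr 3" by (simp only: powr_powr) simp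
          also have "\<dots> = sqrt u ^ 3" using u by (simp add: powr_half_sqrt)
          also have "\<dots> \<le> sqrt (4 * pi * u) ^ 3"
            using u pi_gt3 by (intro power_mono) auto
          finally have "exp (- (norm z)\<^sup>2 / (4 * u)) / sqrt (4 * pi * u) ^ 3 \<le> 1 / u powr (3/2)"
            using u by (intro frac_le) auto
          then show ?thesis using u by (simp add: heat_def powr_minus_divide[of u "3/2"])
        qed
        have "(\<integral>\<^sup>+z. ennreal (heat u (0 - z)) * indicator ?B z \<partial>lborel) \<le> (\<integral>\<^sup>+z. ennreal (u powr (- 3/2)) * indicator ?B z \<partial>lborel)"
          using h by (intro nn_integral_mono mult_right_mono ennreal_leI) auto
        also have "\<dots> = ennreal (u powr (- 3/2)) * ennreal (?\<omega> * r ^ 3)"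
          using r by (simp add: nn_integral_cmult_indicator emeasure_cball_3)
        finally have "res_weight \<mu> u * (\<integral>\<^sup>+z. ennreal (heat u (0 - z)) * indicator ?B z \<partial>lborel)
           \<le> ennreal (u powr (- 1/2)) * (ennreal (u powr (- 3/2)) * ennreal (?\<omega> * r ^ 3))"
          by (intro mult_mono w) auto
        also have "\<dots> = ennreal (?\<omega> * r ^ 3) * ennreal (u powr - 2)"
        proof -
          have "u powr (- 1/2) * u powr (- 3/2) = u powr - 2" by (simp only: powr_add[symmetric]) simp
          then have "ennreal (u powr (- 1/2)) * ennreal (u powr (- 3/2)) = ennreal (u powr - 2)"
            by (simp only: ennreal_mult[symmetric] powr_ge_zero)
          then show ?thesis by (simp only: mult.assoc[symmetric]) (simp only: mult.commute)
        qed
        also have "\<dots> \<le> ennreal (u powr (- 1/2)) * indicator {0..r\<^sup>2} u + ennreal (?\<omega> * r ^ 3) * (ennreal (u powr - 2) * indicator {r\<^sup>2..} u)"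
          using False u by simp
        finally show ?thesis unfolding eq .
      qed
    qed simp
  qed
  also have "\<dots> = ennreal (2 * r) + ennreal (?\<omega> * r ^ 3) * ennreal (1 / r\<^sup>2)"
  proof -
    have "(r\<^sup>2) powr (1/2) = r" using r by (simp add: powr_half_sqrt)
    then have a: "(\<integral>\<^sup>+u. ennreal (u powr (- 1/2)) * indicator {0..r\<^sup>2} u \<partial>lborel) = ennreal (2 * r)"
      using nn_integral_powr_from_0[of "- 1/2" "r\<^sup>2"] by simp
    have "(r\<^sup>2) powr (- 1) = 1 / r\<^sup>2" using r by (simp add: powr_minus_divide)
    then have b: "(\<integral>\<^sup>+u. ennreal (u powr - 2) * indicator {r\<^sup>2..} u \<partial>lborel) = ennreal (1 / r\<^sup>2)"
      using nn_integral_powr_to_inf[of "- 2" "r\<^sup>2"] r by simp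
    show ?thesis
      by (subst nn_integral_add, measurable, subst nn_integral_cmult, measurable) (simp only: a b)
  qed
  also have "\<dots> = ennreal ((2 + ?\<omega>) * r)"
    using r by (simp add: ennreal_mult[symmetric] ennreal_plus[symmetric] power2_eq_square power3_eq_cube distrib_right
       del: ennreal_plus)
  finally show ?thesis .
qed

section \<open>The Hartree nonlinearity\<close>

text \<open>The distance |a - b| with truncated subtraction. Equal values are treated separately
  because infinity minus infinity is infinite in \<open>ennreal\<close>.\<close>

definition edist :: "ennreal \<Rightarrow> ennreal \<Rightarrow> ennreal" where
  "edist a b = (if a = b then 0 else (a - b) + (b - a))"

lemma edist_ennreal: "0 \<le> r \<Longrightarrow> 0 \<le> s \<Longrightarrow> edist (ennreal r) (ennreal s) = ennreal \<bar>r - s\<bar>"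
  by (cases "r \<le> s") (auto simp: edist_def ennreal_minus ennreal_neg)

lemma edist_top: "edist top (ennreal r) = top" "edist (ennreal r) top = top" "edist top top = 0"
  by (auto simp: edist_def)

lemma measurable_edist [measurable]:
  assumes [measurable]: "f \<in> borel_measurable M" "g \<in> borel_measurable M"
  shows "(\<lambda>x. edist (f x) (g x)) \<in> borel_measurable M"
  unfolding edist_def by measurable

lemma edist_self [simp]: "edist a a = 0"
  by (simp add: edist_def)

lemma edist_commute: "edist a b = edist b a"
  by (auto simp: edist_def add.commute)

lemma edist_le_add: "a \<le> b + edist a b"
  by (cases a; cases b) (auto simp: edist_ennreal edist_top ennreal_plus[symmetric] simp del: ennreal_plus intro!: ennreal_leI)

lemma edist_leI:
  assumes "a \<le> b + c" "b \<le> a + c"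
  shows "edist a b \<le> c"
proof (cases a; cases b; cases c)
  fix r s t assume "0 \<le> r" "a = ennreal r" "0 \<le> s" "b = ennreal s" "0 \<le> t" "c = ennreal t"
  with assms show ?thesis
    by (auto simp: edist_ennreal ennreal_plus[symmetric] abs_le_iff simp del: ennreal_plus intro!: ennreal_leI)
qed (use assms in \<open>auto simp: edist_top ennreal_plus[symmetric] top_unique simp del: ennreal_plus\<close>)

lemma edist_triangle: "edist a c \<le> edist a b + edist b c"
proof (rule edist_leI)
  have "a \<le> b + edist a b" "b \<le> c + edist b c" "c \<le> b + edist b c" "b \<le> a + edist a b"
    using edist_le_add edist_commute by metis+
  then have "a \<le> (c + edist b c) + edist a b" "c \<le> (a + edist a b) + edist b c"
    by (meson add_right_mono order_trans)+
  then show "a \<le> c + (edist a b + edist b c)" "c \<le> a + (edist a b + edist b c)"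
    by (simp_all add: add_ac)
qed

lemma edist_square_le: "(edist a b)\<^sup>2 \<le> a\<^sup>2 + b\<^sup>2"
proof (cases a; cases b)
  fix r s assume *: "0 \<le> r" "a = ennreal r" "0 \<le> s" "b = ennreal s"
  have "\<bar>r - s\<bar>\<^sup>2 \<le> r\<^sup>2 + s\<^sup>2" using * by (simp add: power2_diff)
  then have "ennreal (\<bar>r - s\<bar>\<^sup>2) \<le> ennreal (r\<^sup>2 + s\<^sup>2)" by (rule ennreal_leI)
  then show ?thesis using * by (simp add: edist_ennreal ennreal_power)
qed (auto simp: edist_top)

lemma edist_square:
  assumes "a \<noteq> top" "b \<noteq> top"
  shows "(edist a b)\<^sup>2 + 2 * (a * b) = a\<^sup>2 + b\<^sup>2"
proof (cases a; cases b)
  fix r s assume *: "0 \<le> r" "a = ennreal r" "0 \<le> s" "b = ennreal s"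
  have "\<bar>r - s\<bar>\<^sup>2 + 2 * (r * s) = r\<^sup>2 + s\<^sup>2" by (simp add: power2_diff)
  then have "ennreal (\<bar>r - s\<bar>\<^sup>2 + 2 * (r * s)) = ennreal (r\<^sup>2 + s\<^sup>2)" by simp
  then show ?thesis using * by (simp add: edist_ennreal ennreal_power ennreal_mult)
qed (use assms in auto)

lemma edist_eq_0_iff: "edist a b = 0 \<longleftrightarrow> a = b"
  using edist_le_add[of a b] edist_le_add[of b a] by (auto simp: edist_commute[of b a])

lemma tendsto_edist:
  assumes f: "(f \<longlongrightarrow> a) F" and g: "(g \<longlongrightarrow> b) F" and fin: "a \<noteq> top" "b \<noteq> top"
  shows "((\<lambda>x. edist (f x) (g x)) \<longlongrightarrow> edist a b) F"
proof -
  have e: "edist u v = (u - v) + (v - u)" if "u \<noteq> top" for u v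
    using that by (auto simp: edist_def)
  have "\<forall>\<^sub>F x in F. f x \<noteq> top"
    using order_tendstoD(2)[OF f, of top] fin by (auto simp: less_top elim: eventually_mono)
  then have "\<forall>\<^sub>F x in F. edist (f x) (g x) = (f x - g x) + (g x - f x)"
    by eventually_elim (rule e)
  moreover have "((\<lambda>x. (f x - g x) + (g x - f x)) \<longlongrightarrow> edist a b) F"
    unfolding e[OF fin(1)] by (intro tendsto_add tendsto_diff_ennreal f g fin)
  ultimately show ?thesis by (simp add: tendsto_cong)
qed

lemma edist_triangle_square: "(edist a c)\<^sup>2 \<le> 2 * (edist a b)\<^sup>2 + 2 * (edist b c)\<^sup>2"
proof -
  have sq: "(x + y)\<^sup>2 \<le> 2 * x\<^sup>2 + 2 * y\<^sup>2" for x y :: ennreal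
  proof (cases x; cases y)
    fix r s assume *: "0 \<le> r" "x = ennreal r" "0 \<le> s" "y = ennreal s"
    have "(r + s)\<^sup>2 \<le> 2 * r\<^sup>2 + 2 * s\<^sup>2" using sum_squares_bound[of r s] by (simp add: power2_sum)
    then have "ennreal ((r + s)\<^sup>2) \<le> ennreal (2 * r\<^sup>2 + 2 * s\<^sup>2)" by (rule ennreal_leI)
    moreover have "(x + y)\<^sup>2 = ennreal ((r + s)\<^sup>2)"
      using * by (simp add: ennreal_power ennreal_plus[symmetric] del: ennreal_plus)
    moreover have "2 * x\<^sup>2 + 2 * y\<^sup>2 = ennreal (2 * r\<^sup>2 + 2 * s\<^sup>2)"
      using * by (simp add: ennreal_power ennreal_mult)
    ultimately show ?thesis by simp
  qed (auto simp: ennreal_mult_top)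
  have "(edist a c)\<^sup>2 \<le> (edist a b + edist b c)\<^sup>2"
    by (intro power_mono edist_triangle) simp
  also note sq
  finally show ?thesis .
qed

lemma conv_edist:
  assumes [measurable]: "k \<in> borel_measurable borel" "f \<in> borel_measurable borel" "g \<in> borel_measurable borel"
  shows "edist (conv k f x) (conv k g x) \<le> conv k (\<lambda>y. edist (f y) (g y)) x"
proof (rule edist_leI)
  have "conv k f x \<le> conv k (\<lambda>y. g y + edist (f y) (g y)) x"
    by (intro conv_mono edist_le_add) simp
  then show "conv k f x \<le> conv k g x + conv k (\<lambda>y. edist (f y) (g y)) x"
    by (simp add: conv_add)
  have "conv k g x \<le> conv k (\<lambda>y. f y + edist (f y) (g y)) x"
    by (subst edist_commute) (intro conv_mono edist_le_add order_refl)
  then show "conv k g x \<le> conv k f x + conv k (\<lambda>y. edist (f y) (g y)) x"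
    by (simp add: conv_add)
qed

section \<open>Coulomb potential, Hartree term and quartic energy\<close>

definition pot :: "(real^3 \<Rightarrow> ennreal) \<Rightarrow> real^3 \<Rightarrow> ennreal" where
  "pot f = conv coulomb (\<lambda>y. (f y)\<^sup>2)"

definition hartree :: "(real^3 \<Rightarrow> ennreal) \<Rightarrow> real^3 \<Rightarrow> ennreal" where
  "hartree f x = pot f x * f x"

definition quart :: "(real^3 \<Rightarrow> ennreal) \<Rightarrow> ennreal" where
  "quart f = (\<integral>\<^sup>+x. pot f x * (f x)\<^sup>2 \<partial>lborel)"

lemma measurable_pot [measurable]: "f \<in> borel_measurable borel \<Longrightarrow> pot f \<in> borel_measurable borel"
  unfolding pot_def by measurable

lemma measurable_hartree [measurable]: "f \<in> borel_measurable borel \<Longrightarrow> hartree f \<in> borel_measurable borel"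
  unfolding hartree_def[abs_def] by measurable

lemma pot_cong_AE: "(AE x in lborel. f x = g x) \<Longrightarrow> pot f x = pot g x"
  unfolding pot_def by (intro antisym conv_mono_AE) (auto elim: eventually_mono)

lemma hartree_cong_AE: "(AE x in lborel. f x = g x) \<Longrightarrow> AE x in lborel. hartree f x = hartree g x"
  unfolding hartree_def using pot_cong_AE[of f g] by (auto elim: eventually_mono)

lemma conv_cong_AE: "(AE x in lborel. f x = g x) \<Longrightarrow> conv k f x = conv k g x"
  by (intro antisym conv_mono_AE) (auto elim: eventually_mono)

lemma quart_cong_AE: "(AE x in lborel. f x = g x) \<Longrightarrow> quart f = quart g"
  unfolding quart_def using pot_cong_AE[of f g] by (intro nn_integral_cong_AE) (auto elim: eventually_mono)

lemma rdec_pot: "rdec f \<Longrightarrow> rdec (pot f)"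
  unfolding pot_def by (intro rdec_conv rdec_coulomb rdec_power2)

lemma rdec_hartree: "rdec f \<Longrightarrow> rdec (hartree f)"
  unfolding hartree_def[abs_def] by (intro rdec_mult rdec_pot)

lemma pot_cmult: "f \<in> borel_measurable borel \<Longrightarrow> pot (\<lambda>x. c * f x) x = c\<^sup>2 * pot f x"
  unfolding pot_def power_mult_distrib by (rule conv_cmult) auto

lemma hartree_cmult: "f \<in> borel_measurable borel \<Longrightarrow> hartree (\<lambda>x. c * f x) x = c ^ 3 * hartree f x"
  unfolding hartree_def by (simp add: pot_cmult power3_eq_cube power2_eq_square mult_ac)

lemma quart_cmult:
  assumes [measurable]: "f \<in> borel_measurable borel"
  shows "quart (\<lambda>x. c * f x) = c ^ 4 * quart f"
proof -
  have "quart (\<lambda>x. c * f x) = (\<integral>\<^sup>+x. c ^ 4 * (pot f x * (f x)\<^sup>2) \<partial>lborel)"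
  proof -
    have "c ^ 4 = c\<^sup>2 * c\<^sup>2" by (simp flip: power_add)
    then show ?thesis
      unfolding quart_def by (simp only: pot_cmult[OF assms] power_mult_distrib mult_ac)
  qed
  then show ?thesis unfolding quart_def by (simp add: nn_integral_cmult)
qed

lemma coulomb_energy:
  assumes [measurable]: "f \<in> borel_measurable borel" "g \<in> borel_measurable borel"
  shows "energy (\<lambda>_. inverse coulomb_mass) f g = (\<integral>\<^sup>+x. f x * conv coulomb g x \<partial>lborel)"
  by (simp add: energy_eq coulomb_def)

lemma res_energy:
  assumes [measurable]: "f \<in> borel_measurable borel" "g \<in> borel_measurable borel"
  shows "energy (res_weight \<mu>) f g = (\<integral>\<^sup>+x. f x * conv (res_kernel \<mu>) g x \<partial>lborel)"
  by (simp add: energy_eq res_kernel_def)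

text \<open>Cauchy-Schwarz twice: once with the weight \<open>pot q\<close>, which separates q from
  h, and once for the Coulomb form applied to the squares of h and q.\<close>

lemma hartree_Cauchy_Schwarz:
  assumes [measurable]: "q \<in> borel_measurable borel" "h \<in> borel_measurable borel"
  shows "(\<integral>\<^sup>+x. hartree q x * h x \<partial>lborel) ^ 4 \<le> quart q ^ 3 * quart h"
proof -
  let ?w = "\<lambda>_. inverse coulomb_mass"
  have en: "energy ?w (\<lambda>x. (f x)\<^sup>2) (\<lambda>x. (g x)\<^sup>2) = (\<integral>\<^sup>+x. pot g x * (f x)\<^sup>2 \<partial>lborel)"
    if [measurable]: "f \<in> borel_measurable borel" "g \<in> borel_measurable borel" for f g
    by (simp add: coulomb_energy pot_def mult.commute)
  have 1: "(\<integral>\<^sup>+x. hartree q x * h x \<partial>lborel)\<^sup>2 \<le> quart q * (\<integral>\<^sup>+x. pot q x * (h x)\<^sup>2 \<partial>lborel)"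
    using nn_integral_weighted_Cauchy_Schwarz[of "pot q" lborel q h]
    by (simp add: hartree_def quart_def mult_ac)
  have 2: "(\<integral>\<^sup>+x. pot q x * (h x)\<^sup>2 \<partial>lborel)\<^sup>2 \<le> quart h * quart q"
    using energy_Cauchy_Schwarz[of ?w "\<lambda>x. (h x)\<^sup>2" "\<lambda>x. (q x)\<^sup>2"] by (simp add: en quart_def)
  have "(\<integral>\<^sup>+x. hartree q x * h x \<partial>lborel) ^ 4 = ((\<integral>\<^sup>+x. hartree q x * h x \<partial>lborel)\<^sup>2)\<^sup>2"
    by (simp add: power_mult[symmetric])
  also have "\<dots> \<le> (quart q * (\<integral>\<^sup>+x. pot q x * (h x)\<^sup>2 \<partial>lborel))\<^sup>2"
    by (intro power_mono 1) simp
  also have "\<dots> \<le> (quart q)\<^sup>2 * (quart h * quart q)"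
    unfolding power_mult_distrib by (intro mult_left_mono 2) simp
  also have "\<dots> = quart q ^ 3 * quart h"
    by (simp add: power2_eq_square power3_eq_cube mult_ac)
  finally show ?thesis .
qed

section \<open>Uniform pointwise bounds\<close>

definition bound_const :: real where
  "bound_const = (3 + unit_ball_vol 3) / unit_ball_vol 3"

lemma bound_const_pos: "bound_const > 0"
  unfolding bound_const_def by (intro divide_pos_pos add_pos_pos) auto

text \<open>A majorant, the same for all \<mu>, of the square of
  \<open>conv (res_kernel \<mu>) f\<close> for f of energy at most 1. \<open>bound_const\<close>
  dominates 1 / \<omega> and (2 + \<omega>) / \<omega>, with \<omega> the volume of the unit ball,
  which come from the two estimates for the ball. The integral of this function diverges
  logarithmically at infinity.\<close>

definition bound_sq :: "real^3 \<Rightarrow> ennreal" where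
  "bound_sq x = ennreal bound_const * min (npow 2 x) (npow 3 x)"

lemma measurable_bound_sq [measurable]: "bound_sq \<in> borel_measurable borel"
  unfolding bound_sq_def[abs_def] by measurable

text \<open>Test \<open>conv (res_kernel \<mu>) f\<close> against the indicator of the ball of radius \<open>norm x\<close>.\<close>

lemma conv_res_kernel_square_le:
  assumes f: "rdec f" and en: "energy (res_weight \<mu>) f f \<le> 1"
  shows "(conv (res_kernel \<mu>) f x)\<^sup>2 \<le> bound_sq x"
proof (cases "x = 0")
  case False
  note [measurable] = rdec_measurable[OF f]
  let ?\<omega> = "unit_ball_vol (3::real)" and ?q = "conv (res_kernel \<mu>) f"
  define r where "r = norm x"
  have r: "r > 0" using False by (simp add: r_def)
  have \<omega>: "?\<omega> > 0" by simp
  let ?B = "indicator (cball 0 r) :: real^3 \<Rightarrow> ennreal"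
  have rq: "rdec ?q" using f by (intro rdec_conv rdec_res_kernel)
  have [measurable]: "?B \<in> borel_measurable borel" by measurable
  have vol: "(\<integral>\<^sup>+y. ?B y \<partial>lborel) = ennreal (?\<omega> * r ^ 3)"
    using r by (simp add: emeasure_cball_3)
  have "?q x * ennreal (?\<omega> * r ^ 3) = (\<integral>\<^sup>+y. ?q x * ?B y \<partial>lborel)"
    by (simp add: nn_integral_cmult vol)
  also have "\<dots> \<le> (\<integral>\<^sup>+y. ?B y * ?q y \<partial>lborel)"
    by (intro nn_integral_mono) (auto simp: r_def split: split_indicator intro: rdecD[OF rq])
  also have "\<dots> = energy (res_weight \<mu>) ?B f"
    by (simp add: res_energy)
  finally have "(?q x * ennreal (?\<omega> * r ^ 3))\<^sup>2 \<le> (energy (res_weight \<mu>) ?B f)\<^sup>2"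
    by (intro power_mono) auto
  also have "\<dots> \<le> energy (res_weight \<mu>) ?B ?B * energy (res_weight \<mu>) f f"
    by (rule energy_Cauchy_Schwarz) auto
  also have "\<dots> \<le> energy (res_weight \<mu>) ?B ?B * 1"
    by (intro mult_left_mono en) simp
  finally have main: "(?q x * ennreal (?\<omega> * r ^ 3))\<^sup>2 \<le> energy (res_weight \<mu>) ?B ?B" by simp
  \<comment> \<open>The energy is at most the squared L2 norm of the indicator; this yields the
    decay |x|^(-3).\<close>
  have e1: "energy (res_weight \<mu>) ?B ?B \<le> ennreal (?\<omega> * r ^ 3)"
  proof -
    have "energy (res_weight \<mu>) ?B ?B \<le> (\<integral>\<^sup>+y. (?B y)\<^sup>2 \<partial>lborel)"
      using nn_integral_res_kernel[of \<mu>] by (intro energy_le) (auto simp: res_kernel_def)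
    also have "\<dots> = (\<integral>\<^sup>+y. ?B y \<partial>lborel)"
      by (intro nn_integral_cong) (auto split: split_indicator)
    finally show ?thesis by (simp only: vol)
  qed
  \<comment> \<open>The potential of the ball is at most a multiple of r, better for small r; this
    yields the milder singularity |x|^(-2).\<close>
  have e2: "energy (res_weight \<mu>) ?B ?B \<le> ennreal (?\<omega> * (2 + ?\<omega>) * r ^ 4)"
  proof -
    have "energy (res_weight \<mu>) ?B ?B = (\<integral>\<^sup>+y. ?B y * conv (res_kernel \<mu>) ?B y \<partial>lborel)"
      by (simp add: res_energy)
    also have "\<dots> \<le> (\<integral>\<^sup>+y. ?B y * ennreal ((2 + ?\<omega>) * r) \<partial>lborel)"
      using r by (intro nn_integral_mono mult_left_mono conv_res_kernel_ball) auto
    also have "\<dots> = ennreal (?\<omega> * r ^ 3) * ennreal ((2 + ?\<omega>) * r)"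
      by (subst nn_integral_multc) (simp_all only: vol, simp)
    also have "\<dots> = ennreal (?\<omega> * (2 + ?\<omega>) * r ^ 4)"
      using r \<omega> by (simp add: ennreal_mult[symmetric] power4_eq_xxxx power3_eq_cube mult_ac)
    finally show ?thesis .
  qed
  have fin: "?q x \<noteq> top"
  proof
    assume "?q x = top"
    then have "top \<le> energy (res_weight \<mu>) ?B ?B"
      using main r \<omega> by (simp add: ennreal_top_mult)
    also note e1
    finally show False by (simp add: top_unique)
  qed
  then obtain q where q: "?q x = ennreal q" "q \<ge> 0" by (cases "?q x") auto
  have eq: "ennreal ((q * (?\<omega> * r ^ 3))\<^sup>2) = (?q x * ennreal (?\<omega> * r ^ 3))\<^sup>2"
    using q r by (simp add: ennreal_mult ennreal_power[symmetric])
  have "ennreal ((q * (?\<omega> * r ^ 3))\<^sup>2) \<le> ennreal (?\<omega> * r ^ 3)"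
       "ennreal ((q * (?\<omega> * r ^ 3))\<^sup>2) \<le> ennreal (?\<omega> * (2 + ?\<omega>) * r ^ 4)"
    unfolding eq by (rule order_trans[OF main e1], rule order_trans[OF main e2])
  then have m: "(q * (?\<omega> * r ^ 3))\<^sup>2 \<le> ?\<omega> * r ^ 3" "(q * (?\<omega> * r ^ 3))\<^sup>2 \<le> ?\<omega> * (2 + ?\<omega>) * r ^ 4"
    using r \<omega> by (simp_all add: ennreal_le_iff)
  have b1: "q\<^sup>2 \<le> bound_const * (1 / r ^ 3)"
  proof -
    have "(?\<omega> * r ^ 3) * (q\<^sup>2 * (?\<omega> * r ^ 3)) \<le> (?\<omega> * r ^ 3) * 1"
      using m(1) by (simp add: power2_eq_square mult_ac)
    then have "q\<^sup>2 * (?\<omega> * r ^ 3) \<le> 1"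
      using r \<omega> by (subst (asm) mult_le_cancel_left_pos) auto
    then have "q\<^sup>2 \<le> 1 / (?\<omega> * r ^ 3)" using r \<omega> by (simp add: pos_le_divide_eq)
    also have "\<dots> \<le> bound_const * (1 / r ^ 3)"
    proof -
      have "1 / ?\<omega> \<le> bound_const" using \<omega> unfolding bound_const_def by (intro divide_right_mono) auto
      from mult_right_mono[OF this, of "1 / r ^ 3"] r show ?thesis by simp
    qed
    finally show ?thesis .
  qed
  have b2: "q\<^sup>2 \<le> bound_const * (1 / r ^ 2)"
  proof -
    have "(?\<omega> * r ^ 4) * (q\<^sup>2 * (?\<omega> * r ^ 2)) \<le> (?\<omega> * r ^ 4) * (2 + ?\<omega>)"
      using m(2) by (simp add: power2_eq_square power3_eq_cube power4_eq_xxxx mult_ac)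
    then have "q\<^sup>2 * (?\<omega> * r ^ 2) \<le> 2 + ?\<omega>"
      using r \<omega> by (subst (asm) mult_le_cancel_left_pos) auto
    then have "q\<^sup>2 \<le> (2 + ?\<omega>) / (?\<omega> * r ^ 2)" using r \<omega> by (simp add: pos_le_divide_eq)
    also have "\<dots> \<le> bound_const * (1 / r ^ 2)"
    proof -
      have "(2 + ?\<omega>) / ?\<omega> \<le> bound_const" using \<omega> unfolding bound_const_def by (intro divide_right_mono) auto
      from mult_right_mono[OF this, of "1 / r ^ 2"] r show ?thesis by simp
    qed
    finally show ?thesis .
  qed
  have bc: "bound_const \<ge> 0" using \<omega> by (simp add: bound_const_def)
  have np: "npow 3 x = ennreal (1 / r ^ 3)" "npow 2 x = ennreal (1 / r ^ 2)"
    using False r by (simp_all add: npow_def r_def powr_minus_divide)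
  have "(?q x)\<^sup>2 = ennreal (q\<^sup>2)" using q by (simp add: ennreal_power)
  moreover have "ennreal (q\<^sup>2) \<le> ennreal bound_const * npow 2 x" "ennreal (q\<^sup>2) \<le> ennreal bound_const * npow 3 x"
    using b1 b2 bc r unfolding np by (simp_all add: ennreal_mult[symmetric] ennreal_leI)
  ultimately show ?thesis
    unfolding bound_sq_def by (auto simp: min_def)
qed (use bound_const_pos in \<open>simp add: bound_sq_def npow_def ennreal_mult_top\<close>)

lemma bound_sq_le_npow:
  assumes "2 \<le> s" "s \<le> 3"
  shows "bound_sq x \<le> ennreal bound_const * npow s x"
proof -
  have "min (npow 2 x) (npow 3 x) \<le> npow s x"
  proof (cases "x = 0")
    case False
    show ?thesis
    proof (cases "norm x \<ge> 1")
      case True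
      then have "npow 3 x \<le> npow s x"
        using assms False unfolding npow_def by (auto intro!: ennreal_leI powr_mono)
      then show ?thesis by (rule min.coboundedI2)
    next
      case nx: False
      then have "npow 2 x \<le> npow s x"
        using assms False unfolding npow_def by (auto intro!: ennreal_leI powr_mono')
      then show ?thesis by (rule min.coboundedI1)
    qed
  qed (simp add: npow_def)
  then show ?thesis unfolding bound_sq_def by (intro mult_left_mono) auto
qed

definition bound_pot :: "real^3 \<Rightarrow> ennreal" where
  "bound_pot = conv coulomb bound_sq"

lemma measurable_bound_pot [measurable]: "bound_pot \<in> borel_measurable borel"
  unfolding bound_pot_def by measurable

text \<open>The exponent 9/4 lies between 2 and 3, so both regimes of \<open>bound_sq\<close> are
  below a multiple of that power, whose Coulomb potential has exponent 1/4. It is below 5/2 so that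
  the square of the potential, of exponent 1/2, still satisfies the condition of
  \<open>nn_integral_npow_bound_sq\<close>.\<close>

lemma bound_pot_le:
  obtains K where "K < \<infinity>" "\<And>x. bound_pot x \<le> K * npow (1/4) x"
proof
  let ?k = "conv coulomb (npow (9/4)) e3 + 1"
  show "ennreal bound_const * ?k < \<infinity>"
    using conv_coulomb_npow_finite[of "9/4"] by (simp add: ennreal_mult_less_top)
  fix x
  have "bound_pot x \<le> conv coulomb (\<lambda>y. ennreal bound_const * npow (9/4) y) x"
    unfolding bound_pot_def by (intro conv_mono bound_sq_le_npow) auto
  also have "\<dots> = ennreal bound_const * conv coulomb (npow (9/4)) x"
    by (rule conv_cmult) auto
  also have "\<dots> \<le> ennreal bound_const * (?k * npow (9/4 - 2) x)"
    by (intro mult_left_mono conv_coulomb_npow) auto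
  finally show "bound_pot x \<le> ennreal bound_const * ?k * npow (1/4) x"
    by (simp add: mult.assoc)
qed

lemma bound_pot_finite: "x \<noteq> 0 \<Longrightarrow> bound_pot x < \<infinity>"
proof -
  assume x: "x \<noteq> 0"
  obtain K where K: "K < \<infinity>" "\<And>x. bound_pot x \<le> K * npow (1/4) x" using bound_pot_le by blast
  have "K * npow (1/4) x < \<infinity>" using K(1) x by (simp add: npow_def ennreal_mult_less_top)
  with K(2)[of x] show ?thesis by (rule le_less_trans)
qed

lemma bound_sq_finite: "x \<noteq> 0 \<Longrightarrow> bound_sq x < \<infinity>"
  by (simp add: bound_sq_def npow_def ennreal_mult_less_top min_def)

text \<open>The extra power repairs the divergence of \<open>bound_sq\<close> at infinity, where the
  exponent becomes a + 3 > 3, and at the origin a + 2 stays below 3.\<close>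

lemma nn_integral_npow_bound_sq:
  assumes a: "0 < a" "a < 1"
  shows "(\<integral>\<^sup>+x. npow a x * bound_sq x \<partial>lborel) < \<infinity>"
proof -
  let ?B = "cball (0::real^3) 1"
  have "(\<integral>\<^sup>+x. npow a x * bound_sq x \<partial>lborel)
     \<le> (\<integral>\<^sup>+x. ennreal bound_const * (npow (a + 2) x * indicator ?B x + npow (a + 3) x * indicator (- ?B) x) \<partial>lborel)"
  proof (intro nn_integral_mono)
    fix x
    have "npow a x * bound_sq x \<le> ennreal bound_const * (npow a x * npow s x)" if "2 \<le> s" "s \<le> 3" for s
      using mult_left_mono[OF bound_sq_le_npow[OF that, of x], of "npow a x"] by (simp add: mult_ac)
    from this[of 2] this[of 3]
    show "npow a x * bound_sq x \<le> ennreal bound_const * (npow (a + 2) x * indicator ?B x + npow (a + 3) x * indicator (- ?B) x)"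
      by (simp add: npow_mult split: split_indicator)
  qed
  also have "\<dots> = ennreal bound_const * ((\<integral>\<^sup>+x. npow (a + 2) x * indicator ?B x \<partial>lborel) + (\<integral>\<^sup>+x. npow (a + 3) x * indicator (- ?B) x \<partial>lborel))"
    by (subst nn_integral_cmult, measurable, subst nn_integral_add, measurable)
  also have "\<dots> < \<infinity>"
    using a nn_integral_npow_inside[of "a + 2"] nn_integral_npow_outside[of "a + 3"]
    by (simp add: ennreal_mult_less_top)
  finally show ?thesis .
qed

lemma nn_integral_bound_pot: "(\<integral>\<^sup>+x. bound_pot x * bound_sq x \<partial>lborel) < \<infinity>"
proof -
  obtain K where K: "K < \<infinity>" "\<And>x. bound_pot x \<le> K * npow (1/4) x" using bound_pot_le by blast
  have "(\<integral>\<^sup>+x. bound_pot x * bound_sq x \<partial>lborel) \<le> (\<integral>\<^sup>+x. K * (npow (1/4) x * bound_sq x) \<partial>lborel)"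
    using K by (intro nn_integral_mono) (auto simp: mult.assoc[symmetric] intro!: mult_right_mono)
  also have "\<dots> < \<infinity>"
    using nn_integral_npow_bound_sq[of "1/4"] K by (simp add: nn_integral_cmult ennreal_mult_less_top)
  finally show ?thesis .
qed

lemma nn_integral_bound_pot_square: "(\<integral>\<^sup>+x. (bound_pot x)\<^sup>2 * bound_sq x \<partial>lborel) < \<infinity>"
proof -
  obtain K where K: "K < \<infinity>" "\<And>x. bound_pot x \<le> K * npow (1/4) x" using bound_pot_le by blast
  have "(\<integral>\<^sup>+x. (bound_pot x)\<^sup>2 * bound_sq x \<partial>lborel) \<le> (\<integral>\<^sup>+x. K\<^sup>2 * (npow (1/2) x * bound_sq x) \<partial>lborel)"
  proof (intro nn_integral_mono)
    fix x
    have "(bound_pot x)\<^sup>2 \<le> (K * npow (1/4) x)\<^sup>2" by (intro power_mono K(2)) simp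
    also have "\<dots> = K\<^sup>2 * npow (1/2) x" 
    proof -
      have "(K * npow (1/4) x)\<^sup>2 = K\<^sup>2 * (npow (1/4) x * npow (1/4) x)"
        by (simp add: power2_eq_square mult_ac)
      then show ?thesis by (simp add: npow_mult)
    qed
    finally show "(bound_pot x)\<^sup>2 * bound_sq x \<le> K\<^sup>2 * (npow (1/2) x * bound_sq x)"
      by (simp add: mult.assoc[symmetric] mult_right_mono)
  qed
  also have "\<dots> < \<infinity>"
    using nn_integral_npow_bound_sq[of "1/2"] K by (simp add: nn_integral_cmult ennreal_mult_less_top power_less_top_ennreal)
  finally show ?thesis .
qed

text \<open>The bound is required almost everywhere only, because it has to survive passage to the
  limit in Helly's theorem and changes on null sets.\<close>

definition controlled :: "ennreal \<Rightarrow> (real^3 \<Rightarrow> ennreal) \<Rightarrow> bool" where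
  "controlled C f \<longleftrightarrow> rdec f \<and> (AE x in lborel. (f x)\<^sup>2 \<le> C * bound_sq x)"

lemma controlled_measurable: "controlled C f \<Longrightarrow> f \<in> borel_measurable borel"
  by (auto simp: controlled_def intro: rdec_measurable)

lemma controlled_pot:
  assumes "controlled C f"
  shows "pot f x \<le> C * bound_pot x"
proof -
  have "pot f x \<le> conv coulomb (\<lambda>y. C * bound_sq y) x"
    unfolding pot_def using assms by (intro conv_mono_AE) (simp add: controlled_def)
  then show ?thesis unfolding bound_pot_def by (subst (asm) conv_cmult) auto
qed

lemma controlled_hartree:
  assumes "controlled C f"
  shows "AE x in lborel. (hartree f x)\<^sup>2 \<le> C ^ 3 * ((bound_pot x)\<^sup>2 * bound_sq x)"
proof -
  have "AE x in lborel. (f x)\<^sup>2 \<le> C * bound_sq x" using assms by (simp add: controlled_def)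
  then show ?thesis
proof eventually_elim
  fix x assume f: "(f x)\<^sup>2 \<le> C * bound_sq x"
  have "(hartree f x)\<^sup>2 \<le> (C * bound_pot x)\<^sup>2 * (C * bound_sq x)"
    unfolding hartree_def power_mult_distrib[of "pot f x"]
    by (intro mult_mono power_mono controlled_pot assms f) auto
  then show "(hartree f x)\<^sup>2 \<le> C ^ 3 * ((bound_pot x)\<^sup>2 * bound_sq x)"
    by (simp add: power2_eq_square power3_eq_cube mult_ac)
qed
qed

lemma controlled_quart_integrand:
  assumes "controlled C f"
  shows "AE x in lborel. pot f x * (f x)\<^sup>2 \<le> C\<^sup>2 * (bound_pot x * bound_sq x)"
proof -
  have "AE x in lborel. (f x)\<^sup>2 \<le> C * bound_sq x" using assms by (simp add: controlled_def)
  then show ?thesis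
proof eventually_elim
  fix x assume f: "(f x)\<^sup>2 \<le> C * bound_sq x"
  have "pot f x * (f x)\<^sup>2 \<le> (C * bound_pot x) * (C * bound_sq x)"
    by (intro mult_mono controlled_pot assms f) auto
  then show "pot f x * (f x)\<^sup>2 \<le> C\<^sup>2 * (bound_pot x * bound_sq x)"
    by (simp add: power2_eq_square mult_ac)
qed
qed

lemma controlled_quart:
  "controlled C f \<Longrightarrow> quart f \<le> C\<^sup>2 * (\<integral>\<^sup>+x. bound_pot x * bound_sq x \<partial>lborel)"
  unfolding quart_def
  by (subst nn_integral_cmult[symmetric]) (auto intro!: nn_integral_mono_AE controlled_quart_integrand)

lemma controlled_hartree_L2:
  assumes "controlled C f" "C < \<infinity>"
  shows "(\<integral>\<^sup>+x. (hartree f x)\<^sup>2 \<partial>lborel) < \<infinity>"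
proof -
  have "(\<integral>\<^sup>+x. (hartree f x)\<^sup>2 \<partial>lborel) \<le> (\<integral>\<^sup>+x. C ^ 3 * ((bound_pot x)\<^sup>2 * bound_sq x) \<partial>lborel)"
    by (intro nn_integral_mono_AE controlled_hartree assms)
  also have "\<dots> < \<infinity>"
    using assms nn_integral_bound_pot_square
    by (simp add: nn_integral_cmult ennreal_mult_less_top power_less_top_ennreal)
  finally show ?thesis .
qed

lemma controlled_finite:
  assumes "controlled C f" "C < \<infinity>"
  shows "AE x in lborel. f x < \<infinity> \<and> pot f x < \<infinity> \<and> x \<noteq> 0"
proof -
  have "AE x in lborel. (f x)\<^sup>2 \<le> C * bound_sq x" using assms by (simp add: controlled_def)
  with AE_lborel_singleton[of 0] show ?thesis
  proof eventually_elim
    fix x :: "real^3" assume x: "x \<noteq> 0" "(f x)\<^sup>2 \<le> C * bound_sq x"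
    have "(f x)\<^sup>2 < \<infinity>"
      using x(2) bound_sq_finite[OF x(1)] assms(2) by (auto intro: le_less_trans simp: ennreal_mult_less_top)
    moreover have "pot f x < \<infinity>"
      using controlled_pot[OF assms(1), of x] bound_pot_finite[OF x(1)] assms(2)
      by (auto intro: le_less_trans simp: ennreal_mult_less_top)
    ultimately show "f x < \<infinity> \<and> pot f x < \<infinity> \<and> x \<noteq> 0" using x by (simp add: power_less_top_ennreal)
  qed
qed

text \<open>Helly's theorem gives a limit almost everywhere; dominated convergence with
  \<open>bound_sq\<close> inside the potential, and then with the integrable majorants of the
  Hartree square and of the quartic integrand, gives the rest. Convergence of the functions in L2 is
  out of reach here, since \<open>bound_sq\<close> is not integrable.\<close>

lemma controlled_compact:
  fixes F :: "nat \<Rightarrow> real^3 \<Rightarrow> ennreal"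
  assumes F: "\<And>n. controlled C (F n)" and C: "C < \<infinity>"
  obtains s G where "strict_mono s" "controlled C G" "AE x in lborel. (\<lambda>n. F (s n) x) \<longlonglongrightarrow> G x"
    "(\<lambda>n. \<integral>\<^sup>+x. (edist (hartree (F (s n)) x) (hartree G x))\<^sup>2 \<partial>lborel) \<longlonglongrightarrow> 0"
    "(\<lambda>n. quart (F (s n))) \<longlonglongrightarrow> quart G"
proof -
  have "\<And>n. rdec (F n)" using F by (simp add: controlled_def)
  then obtain s G where s: "strict_mono s" and G: "rdec G" and lim: "AE x in lborel. (\<lambda>n. F (s n) x) \<longlonglongrightarrow> G x"
    using rdec_Helly[of F] by blast
  note [measurable] = controlled_measurable[OF F] rdec_measurable[OF G]
  have "AE x in lborel. \<forall>n. (F n x)\<^sup>2 \<le> C * bound_sq x"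
    using F by (simp add: controlled_def AE_all_countable)
  with lim have "AE x in lborel. (G x)\<^sup>2 \<le> C * bound_sq x"
  proof eventually_elim
    fix x assume *: "(\<lambda>n. F (s n) x) \<longlonglongrightarrow> G x" "\<forall>n. (F n x)\<^sup>2 \<le> C * bound_sq x"
    have "(\<lambda>n. (F (s n) x)\<^sup>2) \<longlonglongrightarrow> (G x)\<^sup>2"
      unfolding power2_eq_square by (intro tendsto_mult_ennreal *) auto
    then show "(G x)\<^sup>2 \<le> C * bound_sq x"
      by (rule LIMSEQ_le_const2) (use * in auto)
  qed
  with G have CG: "controlled C G" by (simp add: controlled_def)
  \<comment> \<open>Away from the origin the majorant integrates to a multiple of the finite number
    \<open>bound_pot x\<close>.\<close>
  have lim_pot: "(\<lambda>n. pot (F (s n)) x) \<longlonglongrightarrow> pot G x" if x: "x \<noteq> 0" for x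
    unfolding pot_def conv_def
  proof (rule nn_integral_dominated_convergence[where w = "\<lambda>y. C * (coulomb (x - y) * bound_sq y)"])
    fix n
    have "AE y in lborel. (F (s n) y)\<^sup>2 \<le> C * bound_sq y" using F by (simp add: controlled_def)
    then show "AE y in lborel. coulomb (x - y) * (F (s n) y)\<^sup>2 \<le> C * (coulomb (x - y) * bound_sq y)"
    proof eventually_elim
      fix y assume "(F (s n) y)\<^sup>2 \<le> C * bound_sq y"
      from mult_left_mono[OF this, of "coulomb (x - y)"]
      show "coulomb (x - y) * (F (s n) y)\<^sup>2 \<le> C * (coulomb (x - y) * bound_sq y)" by (simp add: mult_ac)
    qed
  next
    have "(\<integral>\<^sup>+y. C * (coulomb (x - y) * bound_sq y) \<partial>lborel) = C * bound_pot x"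
      unfolding bound_pot_def conv_def by (rule nn_integral_cmult) measurable
    then show "(\<integral>\<^sup>+y. C * (coulomb (x - y) * bound_sq y) \<partial>lborel) < \<infinity>"
      using bound_pot_finite[OF x] C by (simp add: ennreal_mult_less_top)
    show "AE y in lborel. (\<lambda>n. coulomb (x - y) * (F (s n) y)\<^sup>2) \<longlonglongrightarrow> coulomb (x - y) * (G y)\<^sup>2"
      using lim AE_lborel_singleton[of x]
    proof eventually_elim
      fix y assume *: "(\<lambda>n. F (s n) y) \<longlonglongrightarrow> G y" "y \<noteq> x"
      have "(\<lambda>n. (F (s n) y)\<^sup>2) \<longlonglongrightarrow> (G y)\<^sup>2"
        unfolding power2_eq_square by (intro tendsto_mult_ennreal *) auto
      then show "(\<lambda>n. coulomb (x - y) * (F (s n) y)\<^sup>2) \<longlonglongrightarrow> coulomb (x - y) * (G y)\<^sup>2"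
        using * by (intro ennreal_tendsto_cmult) (simp_all add: coulomb_eq)
    qed
  qed measurable
  have AE_all: "AE x in lborel. (\<lambda>n. F (s n) x) \<longlonglongrightarrow> G x \<and> (\<lambda>n. pot (F (s n)) x) \<longlonglongrightarrow> pot G x \<and> G x < \<infinity> \<and> pot G x < \<infinity>"
    using lim controlled_finite[OF CG C] by eventually_elim (auto intro: lim_pot)
  have "(\<lambda>n. \<integral>\<^sup>+x. (edist (hartree (F (s n)) x) (hartree G x))\<^sup>2 \<partial>lborel) \<longlonglongrightarrow> (\<integral>\<^sup>+x. 0 \<partial>(lborel :: (real^3) measure))"
  proof (rule nn_integral_dominated_convergence[where w = "\<lambda>x. 2 * (C ^ 3 * ((bound_pot x)\<^sup>2 * bound_sq x))"])
    fix n
    show "AE x in lborel. (edist (hartree (F (s n)) x) (hartree G x))\<^sup>2 \<le> 2 * (C ^ 3 * ((bound_pot x)\<^sup>2 * bound_sq x))"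
      using controlled_hartree[OF CG] controlled_hartree[OF F[of "s n"]]
    proof eventually_elim
      fix x
      assume *: "(hartree G x)\<^sup>2 \<le> C ^ 3 * ((bound_pot x)\<^sup>2 * bound_sq x)"
         "(hartree (F (s n)) x)\<^sup>2 \<le> C ^ 3 * ((bound_pot x)\<^sup>2 * bound_sq x)"
      show "(edist (hartree (F (s n)) x) (hartree G x))\<^sup>2 \<le> 2 * (C ^ 3 * ((bound_pot x)\<^sup>2 * bound_sq x))"
        unfolding mult_2 by (rule order_trans[OF edist_square_le add_mono[OF *(2) *(1)]])
    qed
  next
    show "(\<integral>\<^sup>+x. 2 * (C ^ 3 * ((bound_pot x)\<^sup>2 * bound_sq x)) \<partial>lborel) < \<infinity>"
      using C nn_integral_bound_pot_square
      by (simp add: nn_integral_cmult ennreal_mult_less_top power_less_top_ennreal)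
    show "AE x in lborel. (\<lambda>n. (edist (hartree (F (s n)) x) (hartree G x))\<^sup>2) \<longlonglongrightarrow> 0"
      using AE_all
    proof eventually_elim
      fix x
      assume *: "(\<lambda>n. F (s n) x) \<longlonglongrightarrow> G x \<and> (\<lambda>n. pot (F (s n)) x) \<longlonglongrightarrow> pot G x \<and> G x < \<infinity> \<and> pot G x < \<infinity>"
      then have fin: "hartree G x \<noteq> top" unfolding hartree_def by (auto simp: ennreal_mult_eq_top_iff)
      have "(\<lambda>n. hartree (F (s n)) x) \<longlonglongrightarrow> hartree G x"
        unfolding hartree_def using * by (intro tendsto_mult_ennreal) auto
      from tendsto_edist[OF this tendsto_const fin fin]
      have e: "(\<lambda>n. edist (hartree (F (s n)) x) (hartree G x)) \<longlonglongrightarrow> 0" by simp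
      have "(\<lambda>n. edist (hartree (F (s n)) x) (hartree G x) * edist (hartree (F (s n)) x) (hartree G x)) \<longlonglongrightarrow> 0 * 0"
        by (intro tendsto_mult_ennreal e) auto
      then show "(\<lambda>n. (edist (hartree (F (s n)) x) (hartree G x))\<^sup>2) \<longlonglongrightarrow> 0"
        by (simp add: power2_eq_square)
    qed
  qed measurable
  then have h: "(\<lambda>n. \<integral>\<^sup>+x. (edist (hartree (F (s n)) x) (hartree G x))\<^sup>2 \<partial>lborel) \<longlonglongrightarrow> 0" by simp
  have q: "(\<lambda>n. quart (F (s n))) \<longlonglongrightarrow> quart G"
    unfolding quart_def
  proof (rule nn_integral_dominated_convergence[where w = "\<lambda>x. C\<^sup>2 * (bound_pot x * bound_sq x)"])
    show "(\<integral>\<^sup>+x. C\<^sup>2 * (bound_pot x * bound_sq x) \<partial>lborel) < \<infinity>"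
      using C nn_integral_bound_pot
      by (simp add: nn_integral_cmult ennreal_mult_less_top power_less_top_ennreal)
    show "AE x in lborel. (\<lambda>n. pot (F (s n)) x * (F (s n) x)\<^sup>2) \<longlonglongrightarrow> pot G x * (G x)\<^sup>2"
      using AE_all
    proof eventually_elim
      fix x
      assume *: "(\<lambda>n. F (s n) x) \<longlonglongrightarrow> G x \<and> (\<lambda>n. pot (F (s n)) x) \<longlonglongrightarrow> pot G x \<and> G x < \<infinity> \<and> pot G x < \<infinity>"
      have "(\<lambda>n. (F (s n) x)\<^sup>2) \<longlonglongrightarrow> (G x)\<^sup>2"
        unfolding power2_eq_square using * by (intro tendsto_mult_ennreal) auto
      then show "(\<lambda>n. pot (F (s n)) x * (F (s n) x)\<^sup>2) \<longlonglongrightarrow> pot G x * (G x)\<^sup>2"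
        using * by (intro tendsto_mult_ennreal) (auto simp: power2_eq_square ennreal_mult_eq_top_iff)
    qed
  qed (measurable, rule controlled_quart_integrand[OF F])
  show ?thesis by (rule that[OF s CG lim h q])
qed

section \<open>Ground states\<close>

text \<open>With A = sqrt(-Laplacian + \<mu>^2) and u = (A + 1)^(-1) f, the energy of f is the
  quadratic form of A + 1 at u. So this is the problem of maximising the quartic energy at bounded
  H^(1/2) norm, written in terms of f, which keeps u positive and radially decreasing.\<close>

definition admissible :: "real \<Rightarrow> (real^3 \<Rightarrow> ennreal) \<Rightarrow> bool" where
  "admissible \<mu> f \<longleftrightarrow> rdec f \<and> (\<integral>\<^sup>+x. (f x)\<^sup>2 \<partial>lborel) < \<infinity> \<and> energy (res_weight \<mu>) f f \<le> 1"

definition best :: "real \<Rightarrow> ennreal" where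
  "best \<mu> = (SUP f\<in>{f. admissible \<mu> f}. quart (conv (res_kernel \<mu>) f))"

lemma admissible_controlled:
  assumes "admissible \<mu> f"
  shows "controlled 1 (conv (res_kernel \<mu>) f)"
  using assms unfolding controlled_def admissible_def
  by (auto intro!: rdec_conv rdec_res_kernel conv_res_kernel_square_le)

lemma quart_le_best: "admissible \<mu> f \<Longrightarrow> quart (conv (res_kernel \<mu>) f) \<le> best \<mu>"
  unfolding best_def by (intro SUP_upper) auto

definition quart_bound :: ennreal where
  "quart_bound = (\<integral>\<^sup>+x. bound_pot x * bound_sq x \<partial>lborel)"

lemma quart_bound_finite: "quart_bound < \<infinity>"
  unfolding quart_bound_def by (rule nn_integral_bound_pot)

lemma best_le: "best \<mu> \<le> quart_bound"
  unfolding best_def quart_bound_def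
  using controlled_quart[OF admissible_controlled] by (intro SUP_least) fastforce

text \<open>Normalised in L2, so that its energy is at most 1 for every \<mu> at once.\<close>

definition trial :: "real^3 \<Rightarrow> ennreal" where
  "trial x = ennreal (1 / sqrt (unit_ball_vol 3)) * indicator (cball 0 1) x"

lemma rdec_trial: "rdec trial"
  unfolding trial_def[abs_def] by (intro rdec_mult rdec_const rdec_indicator_cball)

lemma nn_integral_trial_square: "(\<integral>\<^sup>+x. (trial x)\<^sup>2 \<partial>lborel) = 1"
proof -
  have \<omega>: "(unit_ball_vol 3 :: real) > 0" by simp
  have "(trial x)\<^sup>2 = ennreal (1 / unit_ball_vol 3) * indicator (cball 0 1) x" for x
    unfolding trial_def using \<omega> by (auto simp: ennreal_power power_divide split: split_indicator)
  then have "(\<integral>\<^sup>+x. (trial x)\<^sup>2 \<partial>lborel) = ennreal (1 / unit_ball_vol 3) * ennreal (unit_ball_vol 3)"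
    by (simp add: nn_integral_cmult_indicator emeasure_cball_3)
  also have "\<dots> = 1" using \<omega> by (simp add: ennreal_mult[symmetric] less_imp_neq[OF \<omega>, symmetric])
  finally show ?thesis .
qed

lemma admissible_trial: "admissible \<mu> trial"
proof -
  have "energy (res_weight \<mu>) trial trial \<le> (\<integral>\<^sup>+x. (trial x)\<^sup>2 \<partial>lborel)"
    using nn_integral_res_kernel[of \<mu>] rdec_measurable[OF rdec_trial]
    by (intro energy_le) (auto simp: res_kernel_def)
  then show ?thesis unfolding admissible_def by (simp add: rdec_trial nn_integral_trial_square)
qed

text \<open>The kernels decrease in |\<mu>|, so the value at \<mu> = 1 is a lower bound for the
  supremum at every |\<mu>| <= 1.\<close>

definition quart_low :: ennreal where
  "quart_low = quart (conv (res_kernel 1) trial)"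

lemma quart_mono: "(\<And>x. f x \<le> g x) \<Longrightarrow> quart f \<le> quart g"
  unfolding quart_def pot_def by (intro nn_integral_mono mult_mono conv_mono power_mono) auto

lemma best_ge:
  assumes "\<bar>\<mu>\<bar> \<le> 1"
  shows "quart_low \<le> best \<mu>"
proof -
  have "quart_low \<le> quart (conv (res_kernel \<mu>) trial)"
    unfolding quart_low_def using assms by (intro quart_mono conv_mono res_kernel_antimono) auto
  also have "\<dots> \<le> best \<mu>" by (intro quart_le_best admissible_trial)
  finally show ?thesis .
qed

lemma nn_integral_pos:
  fixes f :: "real^3 \<Rightarrow> ennreal"
  assumes [measurable]: "f \<in> borel_measurable borel" and pos: "\<And>x. norm x \<le> 1 \<Longrightarrow> 0 < f x"
  shows "0 < (\<integral>\<^sup>+x. f x \<partial>lborel)"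
proof -
  have "(\<integral>\<^sup>+x. f x \<partial>lborel) \<noteq> 0"
  proof
    assume "(\<integral>\<^sup>+x. f x \<partial>lborel) = 0"
    then have "AE x in lborel. f x = 0" by (subst (asm) nn_integral_0_iff_AE) auto
    then have "AE x in lborel. x \<notin> cball (0::real^3) 1"
      by (rule eventually_mono) (use pos in force)
    then have "cball (0::real^3) 1 \<in> null_sets lborel"
      by (subst AE_iff_null_sets) auto
    then have "emeasure lborel (cball (0::real^3) 1) = 0" by (rule null_setsD1)
    then show False using unit_ball_vol_pos[of 3] by (simp add: emeasure_cball_3)
  qed
  then show ?thesis by (simp add: zero_less_iff_neq_zero)
qed

lemma nn_integral_pos_real:
  fixes f :: "real \<Rightarrow> ennreal"
  assumes [measurable]: "f \<in> borel_measurable borel" and pos: "\<And>x. 0 < x \<Longrightarrow> x < 1 \<Longrightarrow> 0 < f x"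
  shows "0 < (\<integral>\<^sup>+x. f x \<partial>lborel)"
proof -
  have "(\<integral>\<^sup>+x. f x \<partial>lborel) \<noteq> 0"
  proof
    assume "(\<integral>\<^sup>+x. f x \<partial>lborel) = 0"
    then have "AE x in lborel. f x = 0" by (subst (asm) nn_integral_0_iff_AE) auto
    then have "AE x in lborel. x \<notin> {0<..<1::real}"
      by (rule eventually_mono) (use pos in force)
    then have "{0<..<1::real} \<in> null_sets lborel"
      by (subst AE_iff_null_sets) auto
    then have "emeasure lborel {0<..<1::real} = 0" by (rule null_setsD1)
    then show False by simp
  qed
  then show ?thesis by (simp add: zero_less_iff_neq_zero)
qed

lemma mix_pos:
  assumes [measurable]: "w \<in> borel_measurable borel" and "\<And>u. 0 < u \<Longrightarrow> 0 < w u"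
  shows "0 < mix w z"
  unfolding mix_def
  by (rule nn_integral_pos_real) (auto simp: ennreal_zero_less_mult_iff assms(2) heat_pos)

lemma res_kernel_pos: "0 < res_kernel \<mu> z"
  unfolding res_kernel_def
proof (rule mix_pos)
  fix u :: real
  have "0 < (\<integral>\<^sup>+v. ennreal (2 / pi * (v\<^sup>2 / (1 + v\<^sup>2)) * exp (- u * v\<^sup>2)) * indicator {0..} v \<partial>lborel)"
    by (rule nn_integral_pos_real) (auto simp: ennreal_zero_less_mult_iff intro!: divide_pos_pos mult_pos_pos add_pos_nonneg)
  then show "0 < res_weight \<mu> u"
    unfolding res_weight_def by (simp add: ennreal_zero_less_mult_iff)
qed simp

lemma coulomb_pos: "0 < coulomb z"
  unfolding coulomb_def
  using coulomb_mass_finite by (intro mix_pos) (auto simp: zero_less_iff_neq_zero less_top)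

lemma conv_pos:
  fixes f :: "real^3 \<Rightarrow> ennreal"
  assumes [measurable]: "k \<in> borel_measurable borel" "f \<in> borel_measurable borel"
    and "\<And>z. 0 < k z" "\<And>x. norm x \<le> 1 \<Longrightarrow> 0 < f x"
  shows "0 < conv k f x"
  unfolding conv_def by (rule nn_integral_pos) (use assms in \<open>auto simp: ennreal_zero_less_mult_iff\<close>)

lemma quart_low_pos: "0 < quart_low"
proof -
  note [measurable] = rdec_measurable[OF rdec_trial]
  have "0 < trial x" if "norm x \<le> 1" for x
    using that unit_ball_vol_pos[of "3::real"] by (simp add: trial_def)
  then have Q: "0 < conv (res_kernel 1) trial x" for x
    by (intro conv_pos res_kernel_pos) auto
  then have "0 < pot (conv (res_kernel 1) trial) x" for x
    unfolding pot_def by (intro conv_pos coulomb_pos) (auto simp: power2_eq_square ennreal_zero_less_mult_iff)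
  then show ?thesis
    unfolding quart_low_def quart_def
    by (intro nn_integral_pos) (auto simp: power2_eq_square ennreal_zero_less_mult_iff Q)
qed

lemma ennreal_pow4_le:
  fixes e d :: ennreal
  assumes "e ^ 4 \<le> d ^ 4 * e\<^sup>2" "e < \<infinity>"
  shows "e \<le> d\<^sup>2"
proof (cases "e = 0")
  case False
  have "e\<^sup>2 * e\<^sup>2 \<le> e\<^sup>2 * (d\<^sup>2)\<^sup>2"
    using assms(1) by (simp add: power_add[symmetric] power_mult[symmetric] mult.commute)
  moreover have "e\<^sup>2 \<noteq> 0" "e\<^sup>2 \<noteq> top"
    using False assms(2) by (auto simp: power2_eq_square ennreal_mult_eq_top_iff)
  ultimately have "e\<^sup>2 \<le> (d\<^sup>2)\<^sup>2" by (subst (asm) ennreal_mult_le_mult_iff)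
  then show ?thesis by (rule ennreal_square_le_imp_le)
qed simp

lemma energy_cmult:
  assumes [measurable]: "f \<in> borel_measurable borel"
  shows "energy (res_weight \<mu>) (\<lambda>x. c * f x) (\<lambda>x. c * f x) = c\<^sup>2 * energy (res_weight \<mu>) f f"
proof -
  have "energy (res_weight \<mu>) (\<lambda>x. c * f x) (\<lambda>x. c * f x) = (\<integral>\<^sup>+x. c\<^sup>2 * (f x * conv (res_kernel \<mu>) f x) \<partial>lborel)"
    by (simp add: res_energy conv_cmult power2_eq_square mult_ac)
  then show ?thesis by (simp add: nn_integral_cmult res_energy)
qed

text \<open>Let E be the energy of g and d the supremum. E is the integral of the Hartree term
  against the potential of g, so E^4 is at most d^3 times the quartic energy of that potential. As g
  is again radially decreasing and in L2, g / sqrt E is a competitor, and homogeneity of degree 4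
  bounds that quartic energy by d E^2. Hence E^4 <= d^4 E^2.\<close>

lemma energy_hartree_le:
  assumes f: "admissible \<mu> f"
  defines "g \<equiv> hartree (conv (res_kernel \<mu>) f)"
  shows "energy (res_weight \<mu>) g g \<le> (best \<mu>)\<^sup>2"
proof (rule ennreal_pow4_le)
  let ?Q = "conv (res_kernel \<mu>) f" and ?E = "energy (res_weight \<mu>) g g"
  have cQ: "controlled 1 ?Q" using f by (rule admissible_controlled)
  have rg: "rdec g" unfolding g_def using cQ by (intro rdec_hartree) (simp add: controlled_def)
  note [measurable] = rdec_measurable[OF rg] controlled_measurable[OF cQ]
  have L2: "(\<integral>\<^sup>+x. (g x)\<^sup>2 \<partial>lborel) < \<infinity>"
    unfolding g_def using cQ by (rule controlled_hartree_L2) simp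
  have "?E \<le> (\<integral>\<^sup>+x. (g x)\<^sup>2 \<partial>lborel)"
    using nn_integral_res_kernel[of \<mu>] by (intro energy_le) (auto simp: res_kernel_def)
  with L2 show fin: "?E < \<infinity>" by (rule le_less_trans[rotated])
  have "?E ^ 4 = (\<integral>\<^sup>+x. hartree ?Q x * conv (res_kernel \<mu>) g x \<partial>lborel) ^ 4"
    by (simp add: res_energy g_def[symmetric])
  also have "\<dots> \<le> quart ?Q ^ 3 * quart (conv (res_kernel \<mu>) g)"
    by (rule hartree_Cauchy_Schwarz) auto
  also have "\<dots> \<le> (best \<mu>) ^ 3 * quart (conv (res_kernel \<mu>) g)"
    by (intro mult_right_mono power_mono quart_le_best f) auto
  finally have main: "?E ^ 4 \<le> (best \<mu>) ^ 3 * quart (conv (res_kernel \<mu>) g)" .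
  show "?E ^ 4 \<le> (best \<mu>) ^ 4 * ?E\<^sup>2"
  proof (cases "?E = 0")
    case False
    then obtain e where e: "?E = ennreal e" "e > 0"
      using fin by (cases ?E) (auto simp: less_le)
    define c where "c = ennreal (1 / sqrt e)"
    have c2: "c\<^sup>2 = ennreal (1 / e)" using e by (simp add: c_def ennreal_power power_divide)
    have c4: "c ^ 4 = ennreal (1 / e\<^sup>2)"
    proof -
      have "c ^ 4 = c\<^sup>2 * c\<^sup>2" by (simp flip: power_add)
      then show ?thesis using e unfolding c2 by (simp add: ennreal_mult[symmetric] power2_eq_square)
    qed
    have "admissible \<mu> (\<lambda>x. c * g x)"
      unfolding admissible_def
    proof (intro conjI)
      show "rdec (\<lambda>x. c * g x)" using rg by (intro rdec_mult rdec_const)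
      show "(\<integral>\<^sup>+x. (c * g x)\<^sup>2 \<partial>lborel) < \<infinity>"
        using L2 by (simp add: power_mult_distrib nn_integral_cmult c2 ennreal_mult_less_top)
      have "energy (res_weight \<mu>) (\<lambda>x. c * g x) (\<lambda>x. c * g x) = 1"
        using e by (subst energy_cmult) (simp_all add: c2 ennreal_mult[symmetric])
      then show "energy (res_weight \<mu>) (\<lambda>x. c * g x) (\<lambda>x. c * g x) \<le> 1" by simp
    qed
    from quart_le_best[OF this] have "quart (\<lambda>x. c * conv (res_kernel \<mu>) g x) \<le> best \<mu>"
    proof -
      have "conv (res_kernel \<mu>) (\<lambda>x. c * g x) = (\<lambda>x. c * conv (res_kernel \<mu>) g x)"
        by (rule ext) (rule conv_cmult; simp)
      then show ?thesis using \<open>quart (conv (res_kernel \<mu>) (\<lambda>x. c * g x)) \<le> best \<mu>\<close> by simp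
    qed
    then have "ennreal (1 / e\<^sup>2) * quart (conv (res_kernel \<mu>) g) \<le> best \<mu>"
      by (simp add: quart_cmult c4)
    then have "ennreal (e\<^sup>2) * (ennreal (1 / e\<^sup>2) * quart (conv (res_kernel \<mu>) g)) \<le> ennreal (e\<^sup>2) * best \<mu>"
      by (rule mult_left_mono) simp
    also have "ennreal (e\<^sup>2) * (ennreal (1 / e\<^sup>2) * quart (conv (res_kernel \<mu>) g)) = quart (conv (res_kernel \<mu>) g)"
      using e by (simp add: mult.assoc[symmetric] ennreal_mult[symmetric])
    also have "ennreal (e\<^sup>2) = ?E\<^sup>2" using e by (simp add: ennreal_power)
    finally have "(best \<mu>) ^ 3 * quart (conv (res_kernel \<mu>) g) \<le> (best \<mu>) ^ 3 * (?E\<^sup>2 * best \<mu>)"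
      by (rule mult_left_mono) simp
    also have "\<dots> = (best \<mu>) ^ 4 * ?E\<^sup>2"
      by (simp add: power4_eq_xxxx power3_eq_cube mult_ac)
    finally show ?thesis using main by (rule order_trans[rotated])
  qed simp
qed

text \<open>
  Almost maximisers almost solve the Euler--Lagrange equation: with \<open>J = smoothing\<close>,
  $\|Jg - dJf\|^2 = E(g,g) - 2dE(f,g) + d^2E(f,f) \le 2d(d - D)$, where $d$ is the supremum and
  $D = E(f,g)$ is the value at \<open>f\<close>.
\<close>

lemma almost_maximiser:
  assumes f: "admissible \<mu> f"
  defines "Q \<equiv> conv (res_kernel \<mu>) f"
  shows "(\<integral>\<^sup>+x. (edist (conv (res_kernel \<mu>) (hartree Q) x) (best \<mu> * Q x))\<^sup>2 \<partial>lborel)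
    + 2 * (best \<mu> * quart Q) \<le> 2 * (best \<mu>)\<^sup>2"
proof -
  let ?w = "res_weight \<mu>" and ?d = "best \<mu>" and ?k = "res_kernel \<mu>"
  let ?M = "wmeas ?w"
  have d: "?d < \<infinity>" using best_le quart_bound_finite by (rule le_less_trans)
  define g where "g = hartree Q"
  have cQ: "controlled 1 Q" unfolding Q_def using f by (rule admissible_controlled)
  have rf: "rdec f" using f by (simp add: admissible_def)
  note [measurable] = rdec_measurable[OF rf] controlled_measurable[OF cQ]
  have [measurable]: "g \<in> borel_measurable borel" unfolding g_def by measurable
  define a where "a = smoothing g"
  define b where "b p = ?d * smoothing f p" for p
  have [measurable]: "a \<in> borel_measurable borel" "b \<in> borel_measurable borel"
    unfolding a_def b_def[abs_def] by measurable
  have aa: "(\<integral>\<^sup>+p. (a p)\<^sup>2 \<partial>?M) \<le> ?d\<^sup>2"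
    using energy_hartree_le[OF f] unfolding a_def g_def Q_def energy_def by (simp add: power2_eq_square)
  have ff: "(\<integral>\<^sup>+p. (smoothing f p)\<^sup>2 \<partial>?M) \<le> 1"
    using f unfolding admissible_def energy_def by (simp add: power2_eq_square)
  have "(\<integral>\<^sup>+p. (b p)\<^sup>2 \<partial>?M) = ?d\<^sup>2 * (\<integral>\<^sup>+p. (smoothing f p)\<^sup>2 \<partial>?M)"
    unfolding b_def power_mult_distrib by (rule nn_integral_cmult) measurable
  also have "\<dots> \<le> ?d\<^sup>2 * 1" by (intro mult_left_mono ff) simp
  finally have bb: "(\<integral>\<^sup>+p. (b p)\<^sup>2 \<partial>?M) \<le> ?d\<^sup>2" by simp
  have ab: "(\<integral>\<^sup>+p. a p * b p \<partial>?M) = ?d * quart Q"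
  proof -
    have "(\<integral>\<^sup>+p. a p * b p \<partial>?M) = (\<integral>\<^sup>+p. ?d * (smoothing g p * smoothing f p) \<partial>?M)"
      by (simp add: a_def b_def mult_ac)
    also have "\<dots> = ?d * energy ?w g f"
      unfolding energy_def by (rule nn_integral_cmult) measurable
    also have "energy ?w g f = quart Q"
      by (simp add: res_energy Q_def[symmetric]) (simp add: g_def hartree_def quart_def power2_eq_square mult_ac)
    finally show ?thesis .
  qed
  have d2: "?d\<^sup>2 < \<infinity>" using d by (simp add: power_less_top_ennreal)
  have "AE p in ?M. (a p)\<^sup>2 \<noteq> \<infinity>" "AE p in ?M. (b p)\<^sup>2 \<noteq> \<infinity>"
    using le_less_trans[OF aa d2] le_less_trans[OF bb d2] by (intro nn_integral_PInf_AE; simp)+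
  then have "AE p in ?M. (edist (a p) (b p))\<^sup>2 + 2 * (a p * b p) = (a p)\<^sup>2 + (b p)\<^sup>2"
    by eventually_elim (intro edist_square; auto simp: power2_eq_square ennreal_mult_eq_top_iff)
  then have "(\<integral>\<^sup>+p. (edist (a p) (b p))\<^sup>2 + 2 * (a p * b p) \<partial>?M) = (\<integral>\<^sup>+p. (a p)\<^sup>2 + (b p)\<^sup>2 \<partial>?M)"
    by (rule nn_integral_cong_AE)
  then have "(\<integral>\<^sup>+p. (edist (a p) (b p))\<^sup>2 \<partial>?M) + 2 * (?d * quart Q) = (\<integral>\<^sup>+p. (a p)\<^sup>2 \<partial>?M) + (\<integral>\<^sup>+p. (b p)\<^sup>2 \<partial>?M)"
    by (simp add: nn_integral_add nn_integral_cmult ab)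
  also have "\<dots> \<le> 2 * ?d\<^sup>2" unfolding mult_2 by (intro add_mono aa bb)
  finally have main: "(\<integral>\<^sup>+p. (edist (a p) (b p))\<^sup>2 \<partial>?M) + 2 * (?d * quart Q) \<le> 2 * ?d\<^sup>2" .
  have adj_a: "smoothing_adj ?w a x = conv ?k g x" for x
    unfolding a_def res_kernel_def by (rule smoothing_adj_smoothing) auto
  have adj_b: "smoothing_adj ?w b x = ?d * Q x" for x
  proof -
    have "smoothing_adj ?w b x = ?d * smoothing_adj ?w (smoothing f) x"
      unfolding smoothing_adj_def b_def
      by (subst nn_integral_cmult[symmetric]) (auto simp: mult_ac)
    then show ?thesis by (simp add: smoothing_adj_smoothing Q_def res_kernel_def)
  qed
  have adj_add: "smoothing_adj ?w (\<lambda>p. u p + v p) x = smoothing_adj ?w u x + smoothing_adj ?w v x"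
    if [measurable]: "u \<in> borel_measurable borel" "v \<in> borel_measurable borel" for u v x
    unfolding smoothing_adj_def by (simp add: distrib_left nn_integral_add)
  have adj_mono: "smoothing_adj ?w u x \<le> smoothing_adj ?w v x" if "\<And>p. u p \<le> v p" for u v x
    unfolding smoothing_adj_def by (intro nn_integral_mono mult_left_mono that) simp
  let ?e = "\<lambda>p. edist (a p) (b p)"
  \<comment> \<open>The estimate on the half space is brought back by the adjoint of the smoothing
    operator, which is positive, so that it respects distances pointwise, and an L2
    contraction.\<close>
  have "edist (conv ?k g x) (?d * Q x) \<le> smoothing_adj ?w ?e x" for x
  proof (rule edist_leI)
    have "smoothing_adj ?w a x \<le> smoothing_adj ?w (\<lambda>p. b p + ?e p) x"
      by (intro adj_mono edist_le_add)
    then show "conv ?k g x \<le> ?d * Q x + smoothing_adj ?w ?e x"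
      by (simp add: adj_add adj_a adj_b)
    have "smoothing_adj ?w b x \<le> smoothing_adj ?w (\<lambda>p. a p + ?e p) x"
      by (subst edist_commute) (intro adj_mono edist_le_add)
    then show "?d * Q x \<le> conv ?k g x + smoothing_adj ?w ?e x"
      by (simp add: adj_add adj_a adj_b)
  qed
  then have "(\<integral>\<^sup>+x. (edist (conv ?k g x) (?d * Q x))\<^sup>2 \<partial>lborel) \<le> (\<integral>\<^sup>+x. (smoothing_adj ?w ?e x)\<^sup>2 \<partial>lborel)"
    by (intro nn_integral_mono power_mono) auto
  also have "\<dots> \<le> (\<integral>\<^sup>+p. (?e p)\<^sup>2 \<partial>?M)"
    using nn_integral_res_kernel[of \<mu>] by (intro nn_integral_smoothing_adj_square_le) (auto simp: res_kernel_def)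
  finally have "(\<integral>\<^sup>+x. (edist (conv ?k g x) (?d * Q x))\<^sup>2 \<partial>lborel) + 2 * (?d * quart Q) \<le> 2 * ?d\<^sup>2"
    using main by (meson add_right_mono order_trans)
  then show ?thesis by (simp add: g_def)
qed

lemma ennreal_inverse_antimono: "a \<le> b \<Longrightarrow> inverse b \<le> inverse a" for a b :: ennreal
proof -
  assume ab: "a \<le> b"
  show ?thesis
  proof (cases "a = 0 \<or> b = top")
    case False
    with ab obtain r t where "a = ennreal r" "0 < r" "b = ennreal t" "r \<le> t"
      by (cases a; cases b) (auto simp: less_le top_unique)
    then show ?thesis by (simp add: inverse_ennreal ennreal_leI le_imp_inverse_le)
  qed auto
qed

lemma nn_integral_conv_edist_le:
  assumes [measurable]: "f \<in> borel_measurable borel" "g \<in> borel_measurable borel"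
  shows "(\<integral>\<^sup>+x. (edist (conv (res_kernel \<mu>) f x) (conv (res_kernel \<mu>) g x))\<^sup>2 \<partial>lborel)
    \<le> (\<integral>\<^sup>+x. (edist (f x) (g x))\<^sup>2 \<partial>lborel)"
proof -
  have "(\<integral>\<^sup>+x. (edist (conv (res_kernel \<mu>) f x) (conv (res_kernel \<mu>) g x))\<^sup>2 \<partial>lborel)
     \<le> (\<integral>\<^sup>+x. (conv (res_kernel \<mu>) (\<lambda>y. edist (f y) (g y)) x)\<^sup>2 \<partial>lborel)"
    by (intro nn_integral_mono power_mono conv_edist) auto
  also have "\<dots> \<le> (\<integral>\<^sup>+x. res_kernel \<mu> x \<partial>lborel)\<^sup>2 * (\<integral>\<^sup>+x. (edist (f x) (g x))\<^sup>2 \<partial>lborel)"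
    by (rule nn_integral_conv_square_le) auto
  also have "\<dots> \<le> 1\<^sup>2 * (\<integral>\<^sup>+x. (edist (f x) (g x))\<^sup>2 \<partial>lborel)"
    by (intro mult_right_mono power_mono nn_integral_res_kernel) auto
  finally show ?thesis by simp
qed

lemma conv_res_kernel_L2:
  assumes [measurable]: "f \<in> borel_measurable borel"
  shows "(\<integral>\<^sup>+x. (conv (res_kernel \<mu>) f x)\<^sup>2 \<partial>lborel) \<le> (\<integral>\<^sup>+x. (f x)\<^sup>2 \<partial>lborel)"
proof -
  have "(\<integral>\<^sup>+x. (conv (res_kernel \<mu>) f x)\<^sup>2 \<partial>lborel) \<le> (\<integral>\<^sup>+x. res_kernel \<mu> x \<partial>lborel)\<^sup>2 * (\<integral>\<^sup>+x. (f x)\<^sup>2 \<partial>lborel)"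
    by (rule nn_integral_conv_square_le) auto
  also have "\<dots> \<le> 1\<^sup>2 * (\<integral>\<^sup>+x. (f x)\<^sup>2 \<partial>lborel)"
    by (intro mult_right_mono power_mono nn_integral_res_kernel) auto
  finally show ?thesis by simp
qed

lemma AE_finite_of_L2:
  assumes [measurable]: "f \<in> borel_measurable lborel" and "(\<integral>\<^sup>+x. (f x)\<^sup>2 \<partial>lborel) < \<infinity>"
  shows "AE x in lborel. f x \<noteq> top"
proof -
  have "AE x in lborel. (f x)\<^sup>2 \<noteq> \<infinity>"
    using assms by (intro nn_integral_PInf_AE) auto
  then show ?thesis by (rule eventually_mono) (auto simp: power2_eq_square)
qed

text \<open>For a maximising sequence f the potentials q = \<open>conv (res_kernel \<mu>) f\<close>
  converge along a subsequence; the f themselves need not. By \<open>almost_maximiser\<close> the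
  defect in the Euler-Lagrange equation for q tends to 0 in L2, and the Hartree terms converge in
  L2, so the equation passes to the limit Q without reference to a limit of the f.\<close>

lemma maximiser_exists:
  obtains Q where "controlled 1 Q" "quart Q = best \<mu>"
    "AE x in lborel. best \<mu> * Q x = conv (res_kernel \<mu>) (hartree Q) x"
proof -
  let ?k = "res_kernel \<mu>" and ?d = "best \<mu>"
  have d: "?d < \<infinity>" using best_le quart_bound_finite by (rule le_less_trans)
  let ?A = "(\<lambda>f. quart (conv ?k f)) ` {f. admissible \<mu> f}"
  have "?A \<noteq> {}" using admissible_trial by auto
  from ennreal_Sup_countable_SUP[OF this] obtain v :: "nat \<Rightarrow> ennreal"
    where v: "incseq v" "range v \<subseteq> ?A" "Sup ?A = (SUP i. v i)" by blast
  have "\<forall>n. \<exists>f. admissible \<mu> f \<and> v n = quart (conv ?k f)" using v(2) by blast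
  then obtain f where f: "\<And>n. admissible \<mu> (f n)" "\<And>n. v n = quart (conv ?k (f n))" by metis
  define q where "q n = conv ?k (f n)" for n
  have "v \<longlonglongrightarrow> ?d" unfolding best_def v(3) using v(1) by (rule LIMSEQ_SUP)
  moreover have "v = (\<lambda>n. quart (q n))" by (rule ext) (simp add: f(2) q_def)
  ultimately have lim_d: "(\<lambda>n. quart (q n)) \<longlonglongrightarrow> ?d" by simp
  have cq: "controlled 1 (q n)" for n
    unfolding q_def using f(1) by (rule admissible_controlled)
  obtain s Q where s: "strict_mono s" and cQ: "controlled 1 Q"
    and lim_q: "AE x in lborel. (\<lambda>n. q (s n) x) \<longlonglongrightarrow> Q x"
    and lim_h: "(\<lambda>n. \<integral>\<^sup>+x. (edist (hartree (q (s n)) x) (hartree Q x))\<^sup>2 \<partial>lborel) \<longlonglongrightarrow> 0"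
    and lim_quart: "(\<lambda>n. quart (q (s n))) \<longlonglongrightarrow> quart Q"
    by (rule controlled_compact[of 1 q, OF cq]) auto
  note [measurable] = controlled_measurable[OF cq] controlled_measurable[OF cQ]
  have one_less_infinity: "(1::ennreal) < \<infinity>" by simp
  have sub: "(\<lambda>n. quart (q (s n))) \<longlonglongrightarrow> ?d"
    using LIMSEQ_subseq_LIMSEQ[OF lim_d s] by (simp add: o_def)
  with lim_quart have quart: "quart Q = ?d" by (rule LIMSEQ_unique)
  let ?X = "conv ?k (hartree Q)"
  define r where "r n = (\<integral>\<^sup>+x. (edist (conv ?k (hartree (q (s n))) x) (?d * q (s n) x))\<^sup>2 \<partial>lborel)" for n
  have r: "r n + 2 * (?d * quart (q (s n))) \<le> 2 * ?d\<^sup>2" for n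
    unfolding r_def q_def by (rule almost_maximiser[OF f(1)])
  have d2: "2 * ?d\<^sup>2 < top" using d by (simp add: ennreal_mult_less_top power_less_top_ennreal)
  have "(\<lambda>n. 2 * ?d\<^sup>2 - 2 * (?d * quart (q (s n)))) \<longlonglongrightarrow> 2 * ?d\<^sup>2 - 2 * (?d * ?d)"
    using d d2 by (intro tendsto_diff_ennreal tendsto_const ennreal_tendsto_cmult sub) (auto simp: power2_eq_square)
  also have "2 * ?d\<^sup>2 - 2 * (?d * ?d) = 0"
    using d2 by (simp add: power2_eq_square)
  finally have lim0: "(\<lambda>n. 2 * ?d\<^sup>2 - 2 * (?d * quart (q (s n)))) \<longlonglongrightarrow> 0" .
  have "r n \<le> 2 * ?d\<^sup>2 - 2 * (?d * quart (q (s n)))" for n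
  proof -
    have "2 * (?d * quart (q (s n))) < top"
      using le_less_trans[OF r[of n] d2] by simp
    then have "r n = r n + 2 * (?d * quart (q (s n))) - 2 * (?d * quart (q (s n)))"
      by simp
    also have "\<dots> \<le> 2 * ?d\<^sup>2 - 2 * (?d * quart (q (s n)))"
      by (intro ennreal_minus_mono r order_refl)
    finally show ?thesis .
  qed
  then have lim_r: "r \<longlonglongrightarrow> 0"
    using tendsto_sandwich[OF _ _ tendsto_const lim0, of r] by simp
  define t where "t n = (\<integral>\<^sup>+x. (edist (?X x) (?d * q (s n) x))\<^sup>2 \<partial>lborel)" for n
  have t_le: "t n \<le> 2 * (\<integral>\<^sup>+x. (edist (hartree (q (s n)) x) (hartree Q x))\<^sup>2 \<partial>lborel) + 2 * r n" for n
  proof -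
    have "t n \<le> (\<integral>\<^sup>+x. 2 * (edist (?X x) (conv ?k (hartree (q (s n))) x))\<^sup>2
        + 2 * (edist (conv ?k (hartree (q (s n))) x) (?d * q (s n) x))\<^sup>2 \<partial>lborel)"
      unfolding t_def by (intro nn_integral_mono edist_triangle_square)
    also have "\<dots> = 2 * (\<integral>\<^sup>+x. (edist (?X x) (conv ?k (hartree (q (s n))) x))\<^sup>2 \<partial>lborel) + 2 * r n"
      unfolding r_def by (simp add: nn_integral_add nn_integral_cmult)
    also have "(\<integral>\<^sup>+x. (edist (?X x) (conv ?k (hartree (q (s n))) x))\<^sup>2 \<partial>lborel)
        \<le> (\<integral>\<^sup>+x. (edist (hartree Q x) (hartree (q (s n)) x))\<^sup>2 \<partial>lborel)"
      by (rule nn_integral_conv_edist_le) auto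
    finally show ?thesis by (simp add: edist_commute add_right_mono mult_left_mono)
  qed
  have "(\<lambda>n. 2 * (\<integral>\<^sup>+x. (edist (hartree (q (s n)) x) (hartree Q x))\<^sup>2 \<partial>lborel) + 2 * r n) \<longlonglongrightarrow> 2 * 0 + 2 * 0"
    by (intro tendsto_add ennreal_tendsto_cmult lim_h lim_r) auto
  then have lim_u: "(\<lambda>n. 2 * (\<integral>\<^sup>+x. (edist (hartree (q (s n)) x) (hartree Q x))\<^sup>2 \<partial>lborel) + 2 * r n) \<longlonglongrightarrow> 0"
    by simp
  have lim_t: "t \<longlonglongrightarrow> 0"
    by (rule tendsto_sandwich[OF _ _ tendsto_const lim_u]) (simp_all add: t_le)
  have X_fin: "AE x in lborel. ?X x \<noteq> top"
  proof (rule AE_finite_of_L2)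
    have "(\<integral>\<^sup>+x. (?X x)\<^sup>2 \<partial>lborel) \<le> (\<integral>\<^sup>+x. (hartree Q x)\<^sup>2 \<partial>lborel)"
      by (rule conv_res_kernel_L2) auto
    also have "\<dots> < \<infinity>" by (rule controlled_hartree_L2[OF cQ]) simp
    finally show "(\<integral>\<^sup>+x. (?X x)\<^sup>2 \<partial>lborel) < \<infinity>" .
  qed simp
  have "(\<integral>\<^sup>+x. (edist (?X x) (?d * Q x))\<^sup>2 \<partial>lborel)
      \<le> (\<integral>\<^sup>+x. liminf (\<lambda>n. (edist (?X x) (?d * q (s n) x))\<^sup>2) \<partial>lborel)"
  proof (rule nn_integral_mono_AE)
    show "AE x in lborel. (edist (?X x) (?d * Q x))\<^sup>2 \<le> liminf (\<lambda>n. (edist (?X x) (?d * q (s n) x))\<^sup>2)"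
      using lim_q X_fin controlled_finite[OF cQ one_less_infinity]
    proof eventually_elim
      fix x assume *: "(\<lambda>n. q (s n) x) \<longlonglongrightarrow> Q x" "?X x \<noteq> top" "Q x < \<infinity> \<and> pot Q x < \<infinity> \<and> x \<noteq> 0"
      have "(\<lambda>n. ?d * q (s n) x) \<longlonglongrightarrow> ?d * Q x"
        using d * by (intro ennreal_tendsto_cmult) auto
      then have e: "(\<lambda>n. edist (?X x) (?d * q (s n) x)) \<longlonglongrightarrow> edist (?X x) (?d * Q x)"
        using d * by (intro tendsto_edist tendsto_const) (auto simp: ennreal_mult_eq_top_iff)
      have "(\<lambda>n. (edist (?X x) (?d * q (s n) x))\<^sup>2) \<longlonglongrightarrow> (edist (?X x) (?d * Q x))\<^sup>2"
        unfolding power2_eq_square by (intro tendsto_mult_ennreal e) auto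
      then have "liminf (\<lambda>n. (edist (?X x) (?d * q (s n) x))\<^sup>2) = (edist (?X x) (?d * Q x))\<^sup>2"
        by (intro lim_imp_Liminf) auto
      then show "(edist (?X x) (?d * Q x))\<^sup>2 \<le> liminf (\<lambda>n. (edist (?X x) (?d * q (s n) x))\<^sup>2)" by simp
    qed
  qed
  \<comment> \<open>Fatou's lemma: q is known to converge almost everywhere only, whereas its
    distance from the fixed function \<open>?X\<close> tends to 0 in L2.\<close>
  also have "\<dots> \<le> liminf t"
    unfolding t_def by (rule nn_integral_liminf) measurable
  also have "\<dots> = 0" using lim_t by (intro lim_imp_Liminf) auto
  finally have "AE x in lborel. (edist (?X x) (?d * Q x))\<^sup>2 = 0"
    by (subst nn_integral_0_iff_AE[symmetric]) auto
  then have "AE x in lborel. ?d * Q x = ?X x"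
    by (rule eventually_mono) (simp add: edist_eq_0_iff)
  from that[OF cQ quart this] show ?thesis .
qed

text \<open>The constants are the same for all |\<mu>| <= 1, which is what makes the family of all
  profiles precompact and bounded away from 0.\<close>

definition ground_state :: "real \<Rightarrow> (real^3 \<Rightarrow> ennreal) \<Rightarrow> bool" where
  "ground_state \<mu> P \<longleftrightarrow> controlled (inverse quart_low) P \<and>
     (\<forall>x. P x = conv (res_kernel \<mu>) (hartree P) x) \<and> inverse quart_bound \<le> quart P"

lemma ground_state_exists:
  assumes "\<bar>\<mu>\<bar> \<le> 1"
  shows "\<exists>P. ground_state \<mu> P"
proof -
  let ?d = "best \<mu>" and ?k = "res_kernel \<mu>"
  obtain Q where cQ: "controlled 1 Q" and quart: "quart Q = ?d"
    and eq: "AE x in lborel. ?d * Q x = conv ?k (hartree Q) x" by (rule maximiser_exists)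
  note [measurable] = controlled_measurable[OF cQ]
  have "0 < ?d" using quart_low_pos best_ge[OF assms] by (rule less_le_trans)
  moreover have "?d < \<infinity>" using best_le quart_bound_finite by (rule le_less_trans)
  ultimately obtain \<delta> where \<delta>: "?d = ennreal \<delta>" "0 < \<delta>" by (cases ?d) auto
  \<comment> \<open>If d Q = K(hartree Q), with K the resolvent, then c Q solves the equation with
    factor 1 exactly when c^2 d = 1, the nonlinearity being cubic.\<close>
  define c where "c = ennreal (1 / sqrt \<delta>)"
  have c2: "c\<^sup>2 = ennreal (1 / \<delta>)" using \<delta> by (simp add: c_def ennreal_power power_divide)
  have inv: "inverse ?d = ennreal (1 / \<delta>)" using \<delta> by (simp add: inverse_ennreal inverse_eq_divide)
  have c2d: "c\<^sup>2 * ?d = 1" using \<delta> by (simp add: c2 ennreal_mult[symmetric])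
  define P0 where "P0 x = c * Q x" for x
  have [measurable]: "P0 \<in> borel_measurable borel" unfolding P0_def[abs_def] by measurable
  \<comment> \<open>One application of the resolvent picks the representative for which the equation
    holds at every point, so that the pointwise bound in \<open>ground_state_le\<close> holds
    everywhere.\<close>
  define P where "P = conv ?k (hartree P0)"
  have [measurable]: "P \<in> borel_measurable borel" unfolding P_def by measurable
  have hP0: "hartree P0 = (\<lambda>x. c ^ 3 * hartree Q x)"
    unfolding P0_def[abs_def] by (rule ext) (simp add: hartree_cmult)
  have "AE x in lborel. P x = P0 x"
    using eq
  proof eventually_elim
    fix x assume e: "?d * Q x = conv ?k (hartree Q) x"
    have "P x = c ^ 3 * conv ?k (hartree Q) x"
      unfolding P_def hP0 by (rule conv_cmult) auto
    also have "\<dots> = c * (c\<^sup>2 * ?d) * Q x"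
      unfolding e[symmetric] by (simp add: power2_eq_square power3_eq_cube mult_ac)
    finally show "P x = P0 x" by (simp add: c2d P0_def)
  qed
  then have P: "AE x in lborel. P x = P0 x" .
  have "controlled (inverse quart_low) P"
    unfolding controlled_def
  proof
    show "rdec P"
      unfolding P_def P0_def[abs_def] using cQ
      by (intro rdec_conv rdec_res_kernel rdec_hartree rdec_mult rdec_const) (simp add: controlled_def)
    have "AE x in lborel. (Q x)\<^sup>2 \<le> 1 * bound_sq x" using cQ by (simp add: controlled_def)
    with P show "AE x in lborel. (P x)\<^sup>2 \<le> inverse quart_low * bound_sq x"
    proof eventually_elim
      fix x assume *: "P x = P0 x" "(Q x)\<^sup>2 \<le> 1 * bound_sq x"
      have "(P x)\<^sup>2 = inverse ?d * (Q x)\<^sup>2" using * by (simp add: P0_def power_mult_distrib c2 inv)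
      also have "\<dots> \<le> inverse quart_low * bound_sq x"
        using * best_ge[OF assms] by (intro mult_mono ennreal_inverse_antimono) auto
      finally show "(P x)\<^sup>2 \<le> inverse quart_low * bound_sq x" .
    qed
  qed
  moreover have "P x = conv ?k (hartree P) x" for x
  proof -
    have "conv ?k (hartree P) x = conv ?k (hartree P0) x"
      by (intro conv_cong_AE hartree_cong_AE P)
    then show ?thesis by (simp add: P_def)
  qed
  moreover have "inverse quart_bound \<le> quart P"
  proof -
    have "quart P = quart P0" by (intro quart_cong_AE P)
    also have "\<dots> = c ^ 4 * ?d" unfolding P0_def[abs_def] by (simp add: quart_cmult quart)
    also have "\<dots> = inverse ?d"
    proof -
      have c4: "c ^ 4 = c\<^sup>2 * c\<^sup>2" by (simp flip: power_add)
      show ?thesis unfolding c4 mult.assoc c2d unfolding c2 inv by simp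
    qed
    finally show ?thesis using ennreal_inverse_antimono[OF best_le] by simp
  qed
  ultimately show ?thesis unfolding ground_state_def by blast
qed

text \<open>The bound for the potential times the square root of the bound for P^2. The root is
  taken in the reals, which is faithful away from the origin, where \<open>bound_sq\<close> is
  finite.\<close>

definition hartree_bound :: "real^3 \<Rightarrow> ennreal" where
  "hartree_bound x = inverse quart_low * bound_pot x * ennreal (sqrt (enn2real (inverse quart_low * bound_sq x)))"

lemma measurable_hartree_bound [measurable]: "hartree_bound \<in> borel_measurable borel"
  unfolding hartree_bound_def[abs_def] by measurable

lemma inverse_quart_low_finite: "inverse quart_low < \<infinity>"
proof (cases quart_low)
  case (real r)
  then have "0 < r" using quart_low_pos by (simp add: real)
  then show ?thesis unfolding real by (simp add: inverse_ennreal)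
qed simp

lemma hartree_bound_square:
  assumes "x \<noteq> 0"
  shows "(hartree_bound x)\<^sup>2 = inverse quart_low ^ 3 * ((bound_pot x)\<^sup>2 * bound_sq x)"
    and "f\<^sup>2 \<le> inverse quart_low * bound_sq x \<Longrightarrow> f \<le> ennreal (sqrt (enn2real (inverse quart_low * bound_sq x)))"
proof -
  let ?a = "inverse quart_low * bound_sq x"
  have "?a < top" using inverse_quart_low_finite bound_sq_finite[OF assms] by (simp add: ennreal_mult_less_top)
  then have sq: "(ennreal (sqrt (enn2real ?a)))\<^sup>2 = ?a"
    by (simp add: ennreal_power)
  show "(hartree_bound x)\<^sup>2 = inverse quart_low ^ 3 * ((bound_pot x)\<^sup>2 * bound_sq x)"
    unfolding hartree_bound_def power_mult_distrib sq by (simp add: power2_eq_square power3_eq_cube mult_ac)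
  show "f \<le> ennreal (sqrt (enn2real ?a))" if "f\<^sup>2 \<le> ?a"
    by (rule ennreal_square_le_imp_le) (simp only: sq that)
qed

lemma hartree_bound_L2: "(\<integral>\<^sup>+x. (hartree_bound x)\<^sup>2 \<partial>lborel) < \<infinity>"
proof -
  have "(\<integral>\<^sup>+x. (hartree_bound x)\<^sup>2 \<partial>lborel) = (\<integral>\<^sup>+x. inverse quart_low ^ 3 * ((bound_pot x)\<^sup>2 * bound_sq x) \<partial>lborel)"
    using AE_lborel_singleton[of 0]
    by (intro nn_integral_cong_AE) (auto elim!: eventually_mono simp: hartree_bound_square)
  also have "\<dots> < \<infinity>"
    using inverse_quart_low_finite nn_integral_bound_pot_square
    by (simp add: nn_integral_cmult ennreal_mult_less_top power_less_top_ennreal)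
  finally show ?thesis .
qed

lemma hartree_le_bound:
  assumes "controlled (inverse quart_low) P"
  shows "AE x in lborel. hartree P x \<le> hartree_bound x"
proof -
  have "AE x in lborel. (P x)\<^sup>2 \<le> inverse quart_low * bound_sq x"
    using assms by (simp add: controlled_def)
  with AE_lborel_singleton[of 0] show ?thesis
  proof eventually_elim
    fix x :: "real^3" assume "x \<noteq> 0" "(P x)\<^sup>2 \<le> inverse quart_low * bound_sq x"
    then show "hartree P x \<le> hartree_bound x"
      unfolding hartree_def hartree_bound_def
      by (intro mult_mono controlled_pot assms hartree_bound_square) auto
  qed
qed

text \<open>The equation turns the L2 majorant of the Hartree term into an L2 majorant of the
  profiles themselves; the massless kernel dominates all the others.\<close>

definition ground_bound :: "real^3 \<Rightarrow> ennreal" where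
  "ground_bound = conv (res_kernel 0) hartree_bound"

lemma measurable_ground_bound [measurable]: "ground_bound \<in> borel_measurable borel"
  unfolding ground_bound_def by measurable

lemma ground_bound_L2: "(\<integral>\<^sup>+x. (ground_bound x)\<^sup>2 \<partial>lborel) < \<infinity>"
  unfolding ground_bound_def
  by (rule le_less_trans[OF conv_res_kernel_L2 hartree_bound_L2]) simp

lemma ground_state_le:
  assumes "ground_state \<mu> P"
  shows "P x \<le> ground_bound x"
proof -
  have "P x = conv (res_kernel \<mu>) (hartree P) x" using assms by (simp add: ground_state_def)
  also have "\<dots> \<le> conv (res_kernel \<mu>) hartree_bound x"
    using assms by (intro conv_mono_AE hartree_le_bound) (simp add: ground_state_def)
  also have "\<dots> \<le> ground_bound x"
    unfolding ground_bound_def by (intro conv_mono res_kernel_antimono) auto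
  finally show ?thesis .
qed

lemma ground_state_L2:
  assumes "ground_state \<mu> P"
  shows "(\<integral>\<^sup>+x. (P x)\<^sup>2 \<partial>lborel) \<le> (\<integral>\<^sup>+x. (ground_bound x)\<^sup>2 \<partial>lborel)"
  using ground_state_le[OF assms] by (intro nn_integral_mono power_mono) auto

lemma ground_state_measurable: "ground_state \<mu> P \<Longrightarrow> P \<in> borel_measurable borel"
  by (auto simp: ground_state_def dest: controlled_measurable)

text \<open>Helly's theorem again, now with \<open>ground_bound\<close> as a dominating function,
  which upgrades the convergence to L2. The masses \<mu> may vary along the sequence.\<close>

lemma ground_state_compact:
  fixes P :: "nat \<Rightarrow> real^3 \<Rightarrow> ennreal"
  assumes P: "\<And>n. ground_state (\<mu> n) (P n)"
  obtains s G where "strict_mono s" "G \<in> borel_measurable borel"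
    "(\<lambda>n. \<integral>\<^sup>+x. (edist (P (s n) x) (G x))\<^sup>2 \<partial>lborel) \<longlonglongrightarrow> 0"
proof -
  have cP: "controlled (inverse quart_low) (P n)" for n
    using P by (auto simp: ground_state_def)
  obtain s G where s: "strict_mono s" and cG: "controlled (inverse quart_low) G"
    and lim: "AE x in lborel. (\<lambda>n. P (s n) x) \<longlonglongrightarrow> G x"
    by (rule controlled_compact[OF cP inverse_quart_low_finite])
  note [measurable] = controlled_measurable[OF cP] controlled_measurable[OF cG]
  have "(\<lambda>n. \<integral>\<^sup>+x. (edist (P (s n) x) (G x))\<^sup>2 \<partial>lborel) \<longlonglongrightarrow> (\<integral>\<^sup>+x. 0 \<partial>(lborel :: (real^3) measure))"
  proof (rule nn_integral_dominated_convergence[where w = "\<lambda>x. 2 * (ground_bound x)\<^sup>2"])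
    show "(\<integral>\<^sup>+x. 2 * (ground_bound x)\<^sup>2 \<partial>lborel) < \<infinity>"
      using ground_bound_L2 by (simp add: nn_integral_cmult ennreal_mult_less_top)
    fix n
    show "AE x in lborel. (edist (P (s n) x) (G x))\<^sup>2 \<le> 2 * (ground_bound x)\<^sup>2"
      using lim
    proof eventually_elim
      fix x assume "(\<lambda>n. P (s n) x) \<longlonglongrightarrow> G x"
      then have "G x \<le> ground_bound x"
        by (rule LIMSEQ_le_const2) (use ground_state_le[OF P] in auto)
      then have "(edist (P (s n) x) (G x))\<^sup>2 \<le> (ground_bound x)\<^sup>2 + (ground_bound x)\<^sup>2"
        using ground_state_le[OF P]
        by (intro order_trans[OF edist_square_le] add_mono power_mono) auto
      then show "(edist (P (s n) x) (G x))\<^sup>2 \<le> 2 * (ground_bound x)\<^sup>2" by (simp add: mult_2)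
    qed
  next
    show "AE x in lborel. (\<lambda>n. (edist (P (s n) x) (G x))\<^sup>2) \<longlonglongrightarrow> 0"
      using lim controlled_finite[OF cG inverse_quart_low_finite]
    proof eventually_elim
      fix x assume *: "(\<lambda>n. P (s n) x) \<longlonglongrightarrow> G x" "G x < \<infinity> \<and> pot G x < \<infinity> \<and> x \<noteq> 0"
      have "(\<lambda>n. edist (P (s n) x) (G x)) \<longlonglongrightarrow> edist (G x) (G x)"
        using * by (intro tendsto_edist tendsto_const) auto
      then have e: "(\<lambda>n. edist (P (s n) x) (G x)) \<longlonglongrightarrow> 0" by simp
      have "(\<lambda>n. edist (P (s n) x) (G x) * edist (P (s n) x) (G x)) \<longlonglongrightarrow> 0 * 0"
        by (intro tendsto_mult_ennreal e) auto
      then show "(\<lambda>n. (edist (P (s n) x) (G x))\<^sup>2) \<longlonglongrightarrow> 0" by (simp add: power2_eq_square)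
    qed
  qed measurable
  then show ?thesis using that[OF s controlled_measurable[OF cG]] by simp
qed

text \<open>The quartic energy is the pairing of P with its Hartree term, so Cauchy-Schwarz turns
  its lower bound into one for the mass.\<close>

lemma ground_state_L2_lower:
  assumes P: "ground_state \<mu> P"
  shows "(inverse quart_bound)\<^sup>2 \<le> (\<integral>\<^sup>+x. (hartree_bound x)\<^sup>2 \<partial>lborel) * (\<integral>\<^sup>+x. (P x)\<^sup>2 \<partial>lborel)"
proof -
  note [measurable] = ground_state_measurable[OF P]
  have "(inverse quart_bound)\<^sup>2 \<le> (quart P)\<^sup>2"
    using P by (intro power_mono) (auto simp: ground_state_def)
  also have "quart P = (\<integral>\<^sup>+x. hartree P x * P x \<partial>lborel)"
    unfolding quart_def hartree_def by (simp add: power2_eq_square mult.assoc)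
  also have "\<dots>\<^sup>2 \<le> (\<integral>\<^sup>+x. (hartree P x)\<^sup>2 \<partial>lborel) * (\<integral>\<^sup>+x. (P x)\<^sup>2 \<partial>lborel)"
    by (rule nn_integral_Cauchy_Schwarz) auto
  also have "(\<integral>\<^sup>+x. (hartree P x)\<^sup>2 \<partial>lborel) \<le> (\<integral>\<^sup>+x. (hartree_bound x)\<^sup>2 \<partial>lborel)"
    using hartree_le_bound[of P] P
    by (intro nn_integral_mono_AE) (auto simp: ground_state_def elim!: eventually_mono intro: power_mono)
  finally show ?thesis by (simp add: mult_right_mono)
qed

section \<open>The Fourier--Plancherel transform\<close>

definition nsq :: "(real^3 \<Rightarrow> complex) \<Rightarrow> ennreal" where
  "nsq f = (\<integral>\<^sup>+x. ennreal ((cmod (f x))\<^sup>2) \<partial>lborel)"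

text \<open>The factor 2 is the price of a triangle inequality for squared norms without square
  roots; it only affects constants.\<close>

lemma nsq_add_le:
  assumes [measurable]: "f \<in> borel_measurable borel" "g \<in> borel_measurable borel"
  shows "nsq (\<lambda>x. f x + g x) \<le> 2 * nsq f + 2 * nsq g"
proof -
  have "nsq (\<lambda>x. f x + g x) \<le> (\<integral>\<^sup>+x. 2 * ennreal ((cmod (f x))\<^sup>2) + 2 * ennreal ((cmod (g x))\<^sup>2) \<partial>lborel)"
    unfolding nsq_def
  proof (rule nn_integral_mono)
    fix x
    have "(cmod (f x + g x))\<^sup>2 \<le> (cmod (f x) + cmod (g x))\<^sup>2"
      by (intro power_mono norm_triangle_ineq) simp
    also have "\<dots> \<le> 2 * (cmod (f x))\<^sup>2 + 2 * (cmod (g x))\<^sup>2"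
      using sum_squares_bound[of "cmod (f x)" "cmod (g x)"] by (simp add: power2_sum)
    finally have "ennreal ((cmod (f x + g x))\<^sup>2) \<le> ennreal (2 * (cmod (f x))\<^sup>2 + 2 * (cmod (g x))\<^sup>2)"
      by (rule ennreal_leI)
    then show "ennreal ((cmod (f x + g x))\<^sup>2) \<le> 2 * ennreal ((cmod (f x))\<^sup>2) + 2 * ennreal ((cmod (g x))\<^sup>2)"
      by (simp add: ennreal_mult)
  qed
  also have "\<dots> = 2 * nsq f + 2 * nsq g"
    unfolding nsq_def by (simp add: nn_integral_add nn_integral_cmult)
  finally show ?thesis .
qed

lemma nsq_triangle:
  assumes [measurable]: "f \<in> borel_measurable borel" "g \<in> borel_measurable borel" "h \<in> borel_measurable borel"
  shows "nsq (\<lambda>x. f x - g x) \<le> 2 * nsq (\<lambda>x. f x - h x) + 2 * nsq (\<lambda>x. h x - g x)"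
  using nsq_add_le[of "\<lambda>x. f x - h x" "\<lambda>x. h x - g x"] by simp

lemma nsq_minus_commute: "nsq (\<lambda>x. f x - g x) = nsq (\<lambda>x. g x - f x)"
  unfolding nsq_def by (simp add: norm_minus_commute)

lemma nsq_cong_AE: "(AE x in lborel. f x = g x) \<Longrightarrow> nsq f = nsq g"
  unfolding nsq_def by (intro nn_integral_cong_AE) (auto elim: eventually_mono)

lemma nsq_eq_0:
  assumes [measurable]: "f \<in> borel_measurable borel" and "nsq f = 0"
  shows "AE x in lborel. f x = 0"
proof -
  have "AE x in lborel. ennreal ((cmod (f x))\<^sup>2) = 0"
    using assms(2) unfolding nsq_def by (subst (asm) nn_integral_0_iff_AE) auto
  then show ?thesis by (rule eventually_mono) simp
qed

lemma L2_iff: "f \<in> L2 \<longleftrightarrow> f \<in> borel_measurable borel \<and> nsq f < \<infinity>"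
  unfolding L2_def nsq_def by (auto simp: integrable_iff_bounded)

lemma L2_measurable: "f \<in> L2 \<Longrightarrow> f \<in> borel_measurable borel"
  by (simp add: L2_iff)

lemma integrable_cis_mult:
  fixes f :: "real^3 \<Rightarrow> complex"
  assumes "integrable lborel f"
  shows "integrable lborel (\<lambda>x. cis (g x) * f x) \<longleftrightarrow> (\<lambda>x. cis (g x) * f x) \<in> borel_measurable borel"
  using assms by (auto simp: integrable_iff_bounded norm_mult)

lemma measurable_fourier_L1 [measurable]:
  assumes [measurable]: "f \<in> borel_measurable borel"
  shows "fourier_L1 f \<in> borel_measurable borel"
  unfolding fourier_L1_def[abs_def] by measurable

lemma fourier_integral_swap:
  fixes f h :: "real^3 \<Rightarrow> complex"
  assumes f: "integrable lborel f" and h: "integrable lborel h"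
  shows "(LINT \<xi>|lborel. h \<xi> * (LINT x|lborel. cis (- (x \<bullet> \<xi>)) * f x))
    = (LINT x|lborel. f x * (LINT \<xi>|lborel. cis (- (x \<bullet> \<xi>)) * h \<xi>))"
proof -
  have [measurable]: "f \<in> borel_measurable borel" "h \<in> borel_measurable borel"
    using f h by auto
  have int: "integrable (lborel \<Otimes>\<^sub>M lborel) (\<lambda>(x, \<xi>). f x * (cis (- (x \<bullet> \<xi>)) * h \<xi>))"
  proof (rule lborel_pair.Fubini_integrable)
    show "integrable lborel (\<lambda>x. LINT \<xi>|lborel. norm (case (x, \<xi>) of (x, \<xi>) \<Rightarrow> f x * (cis (- (x \<bullet> \<xi>)) * h \<xi>)))"
      using f by (simp add: norm_mult)
    show "AE x in lborel. integrable lborel (\<lambda>\<xi>. case (x, \<xi>) of (x, \<xi>) \<Rightarrow> f x * (cis (- (x \<bullet> \<xi>)) * h \<xi>))"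
      using integrable_cis_mult[OF h] by (intro AE_I2) simp
  qed measurable
  have "(LINT \<xi>|lborel. h \<xi> * (LINT x|lborel. cis (- (x \<bullet> \<xi>)) * f x))
     = (LINT \<xi>|lborel. LINT x|lborel. f x * (cis (- (x \<bullet> \<xi>)) * h \<xi>))"
    by (simp add: integral_mult_right_zero[symmetric] mult_ac del: integral_mult_right_zero)
  also have "\<dots> = (LINT x|lborel. LINT \<xi>|lborel. f x * (cis (- (x \<bullet> \<xi>)) * h \<xi>))"
    by (rule lborel_pair.Fubini_integral) (use int in simp)
  also have "\<dots> = (LINT x|lborel. f x * (LINT \<xi>|lborel. cis (- (x \<bullet> \<xi>)) * h \<xi>))"
    by simp
  finally show ?thesis .
qed

text \<open>A Gaussian in frequency is a multiple of the heat kernel at time 1 / (4 \<epsilon>), so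
  \<open>fourier_heat\<close> applies; the constants combine to (2 pi)^3.\<close>

lemma fourier_gaussian:
  assumes "\<epsilon> > 0"
  shows "(LINT \<xi>|lborel. cis (- (\<xi> \<bullet> z)) * of_real (exp (- \<epsilon> * (norm \<xi>)\<^sup>2)))
      = of_real ((2 * pi) ^ 3 * heat \<epsilon> z)"
    and "integrable lborel (\<lambda>\<xi>::real^3. complex_of_real (exp (- \<epsilon> * (norm \<xi>)\<^sup>2)))"
proof -
  define u where "u = 1 / (4 * \<epsilon>)"
  have u: "u > 0" using assms by (simp add: u_def)
  have g: "exp (- \<epsilon> * (norm \<xi>)\<^sup>2) = sqrt (pi / \<epsilon>) ^ 3 * heat u \<xi>" for \<xi> :: "real^3"
    using assms u by (simp add: heat_def) (simp add: u_def)
  have "(LINT \<xi>|lborel. cis (- (\<xi> \<bullet> z)) * of_real (exp (- \<epsilon> * (norm \<xi>)\<^sup>2)))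
     = of_real (sqrt (pi / \<epsilon>) ^ 3) * (LINT \<xi>|lborel. cis (- (\<xi> \<bullet> z)) * of_real (heat u \<xi>))"
    by (subst integral_mult_right_zero[symmetric]) (simp only: g of_real_mult mult_ac)
  also have "\<dots> = of_real (sqrt (pi / \<epsilon>) ^ 3 * exp (- u * (norm z)\<^sup>2))"
    by (simp add: fourier_heat[OF u])
  also have "sqrt (pi / \<epsilon>) ^ 3 * exp (- u * (norm z)\<^sup>2) = (2 * pi) ^ 3 * heat \<epsilon> z"
  proof -
    have "sqrt (pi / \<epsilon>) * sqrt (4 * pi * \<epsilon>) = 2 * pi"
    proof -
      have "sqrt (pi / \<epsilon>) * sqrt (4 * pi * \<epsilon>) = sqrt ((2 * pi)\<^sup>2)"
        unfolding real_sqrt_mult[symmetric] using assms by (simp add: power2_eq_square)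
      also have "\<dots> = 2 * pi" by (simp only: real_sqrt_abs) simp
      finally show ?thesis .
    qed
    then have "sqrt (pi / \<epsilon>) ^ 3 * sqrt (4 * pi * \<epsilon>) ^ 3 = (2 * pi) ^ 3"
      by (simp only: power_mult_distrib[symmetric])
    moreover have "sqrt (4 * pi * \<epsilon>) ^ 3 \<noteq> 0" using assms by simp
    ultimately show ?thesis using assms by (simp add: heat_def u_def field_simps)
  qed
  finally show "(LINT \<xi>|lborel. cis (- (\<xi> \<bullet> z)) * of_real (exp (- \<epsilon> * (norm \<xi>)\<^sup>2)))
      = of_real ((2 * pi) ^ 3 * heat \<epsilon> z)" .
  show "integrable lborel (\<lambda>\<xi>::real^3. complex_of_real (exp (- \<epsilon> * (norm \<xi>)\<^sup>2)))"
  proof (rule integrableI_bounded)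
    have "(\<integral>\<^sup>+\<xi>. ennreal (norm (complex_of_real (exp (- \<epsilon> * (norm \<xi>)\<^sup>2)))) \<partial>(lborel :: (real^3) measure))
       = (\<integral>\<^sup>+\<xi>. ennreal (sqrt (pi / \<epsilon>) ^ 3) * ennreal (heat u \<xi>) \<partial>lborel)"
      unfolding norm_of_real g using assms by (simp add: ennreal_mult[symmetric])
    also have "\<dots> < \<infinity>" using u by (simp add: nn_integral_cmult nn_integral_heat)
    finally show "(\<integral>\<^sup>+\<xi>. ennreal (norm (complex_of_real (exp (- \<epsilon> * (norm \<xi>)\<^sup>2)))) \<partial>(lborel :: (real^3) measure)) < \<infinity>" .
  qed simp
qed

lemma measurable_cnj [measurable]:
  assumes [measurable]: "f \<in> borel_measurable M"
  shows "(\<lambda>x. cnj (f x)) \<in> borel_measurable M"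
proof -
  have "cnj \<in> borel_measurable borel"
    by (intro borel_measurable_continuous_onI continuous_intros)
  then show ?thesis by measurable
qed

lemma distr_uminus_lborel: "distr lborel borel uminus = (lborel :: (real^3) measure)"
  by (rule distr_orthogonal_transformation) (simp add: orthogonal_transformation_def linear_iff)

lemma norm_fourier_integral_le:
  fixes f :: "real^3 \<Rightarrow> complex"
  shows "cmod (LINT x|lborel. cis (g x) * f x) \<le> (LINT x|lborel. cmod (f x))"
  using integral_norm_bound[of lborel "\<lambda>x. cis (g x) * f x"] by (simp add: norm_mult)

text \<open>
  From
  $\int e^{-\epsilon|\xi|^2} |\hat f|^2 = \iint f(x) \overline{f(y)}\,G_\epsilon(x - y)$ with the
  heat kernel $G_\epsilon$, whose mass is at most 1.
\<close>

lemma fourier_L1_gaussian_le: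
  assumes f: "integrable lborel f" and \<epsilon>: "\<epsilon> > 0"
  shows "(\<integral>\<^sup>+\<xi>. ennreal (exp (- \<epsilon> * (norm \<xi>)\<^sup>2) * (cmod (fourier_L1 f \<xi>))\<^sup>2) \<partial>lborel) \<le> nsq f"
proof -
  have [measurable]: "f \<in> borel_measurable borel" using f by auto
  let ?g = "\<lambda>\<xi>::real^3. complex_of_real (exp (- \<epsilon> * (norm \<xi>)\<^sup>2))"
  define I where "I \<xi> = (LINT x|lborel. cis (- (x \<bullet> \<xi>)) * f x)" for \<xi>
  have [measurable]: "I \<in> borel_measurable borel" unfolding I_def[abs_def] by measurable
  define A where "A = (LINT x|lborel. cmod (f x))"
  have I_le: "cmod (I \<xi>) \<le> A" for \<xi> unfolding I_def A_def by (rule norm_fourier_integral_le)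
  define h where "h \<xi> = ?g \<xi> * cnj (I \<xi>)" for \<xi>
  have h: "integrable lborel h"
  proof (rule Bochner_Integration.integrable_bound)
    show "integrable lborel (\<lambda>\<xi>. of_real A * ?g \<xi>)" using fourier_gaussian(2)[OF \<epsilon>] by simp
    show "h \<in> borel_measurable lborel" unfolding h_def[abs_def] by measurable
    show "AE \<xi> in lborel. norm (h \<xi>) \<le> norm (of_real A * ?g \<xi>)"
      using I_le by (intro AE_I2) (auto simp: h_def norm_mult mult.commute intro!: mult_left_mono order_trans[OF I_le abs_ge_self])
  qed
  have cnj_f: "integrable lborel (\<lambda>y. cnj (f y))" using f by simp
  have cnj_I: "cnj (I \<xi>) = (LINT y|lborel. cis (y \<bullet> \<xi>) * cnj (f y))" for \<xi>
    unfolding I_def using Bochner_Integration.integral_cnj[of lborel "\<lambda>x. cis (- (x \<bullet> \<xi>)) * f x"] by (simp add: cis_cnj)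
  have H: "(LINT \<xi>|lborel. cis (- (x \<bullet> \<xi>)) * h \<xi>) = (LINT y|lborel. cnj (f y) * of_real ((2 * pi) ^ 3 * heat \<epsilon> (x - y)))" for x
  proof -
    have gx: "integrable lborel (\<lambda>\<xi>. cis (- (x \<bullet> \<xi>)) * ?g \<xi>)"
      by (subst integrable_cis_mult[OF fourier_gaussian(2)[OF \<epsilon>]]) measurable
    \<comment> \<open>Substituting -y for y writes the conjugate of the Fourier integral of f as a
      Fourier integral, to which \<open>fourier_integral_swap\<close> applies.\<close>
    have "(LINT \<xi>|lborel. cis (- (x \<bullet> \<xi>)) * h \<xi>)
        = (LINT \<xi>|lborel. (cis (- (x \<bullet> \<xi>)) * ?g \<xi>) * (LINT y|lborel. cis (- (y \<bullet> \<xi>)) * cnj (f (- y))))"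
    proof -
      have "(LINT y|lborel. cis (y \<bullet> \<xi>) * cnj (f y)) = (LINT y|lborel. cis (- (y \<bullet> \<xi>)) * cnj (f (- y)))" for \<xi>
      proof -
        have "(LINT y|lborel. cis (- (y \<bullet> \<xi>)) * cnj (f (- y))) = (LINT y|distr lborel borel uminus. cis (y \<bullet> \<xi>) * cnj (f y))"
          by (subst integral_distr) auto
        also note distr_uminus_lborel
        finally show ?thesis by simp
      qed
      then show ?thesis unfolding h_def cnj_I by (simp add: mult_ac)
    qed
    also have "\<dots> = (LINT y|lborel. cnj (f (- y)) * (LINT \<xi>|lborel. cis (- (y \<bullet> \<xi>)) * (cis (- (x \<bullet> \<xi>)) * ?g \<xi>)))"
    proof (rule fourier_integral_swap[OF _ gx])
      have "integrable (distr lborel borel (uminus :: real^3 \<Rightarrow> real^3)) (\<lambda>y. cnj (f y))"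
        using cnj_f by (simp add: distr_uminus_lborel)
      then show "integrable lborel (\<lambda>y. cnj (f (- y)))"
        by (subst (asm) integrable_distr_eq) auto
    qed
    also have "\<dots> = (LINT y|lborel. cnj (f (- y)) * of_real ((2 * pi) ^ 3 * heat \<epsilon> (x - (- y))))"
    proof (rule Bochner_Integration.integral_cong[OF refl])
      fix y
      have "(LINT \<xi>|lborel. cis (- (y \<bullet> \<xi>)) * (cis (- (x \<bullet> \<xi>)) * ?g \<xi>)) = (LINT \<xi>|lborel. cis (- (\<xi> \<bullet> (x - (- y)))) * ?g \<xi>)"
        by (simp add: mult.assoc[symmetric] cis_mult inner_add_right inner_commute add.commute)
      then show "cnj (f (- y)) * (LINT \<xi>|lborel. cis (- (y \<bullet> \<xi>)) * (cis (- (x \<bullet> \<xi>)) * ?g \<xi>))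
         = cnj (f (- y)) * of_real ((2 * pi) ^ 3 * heat \<epsilon> (x - (- y)))"
        by (simp only: fourier_gaussian(1)[OF \<epsilon>])
    qed
    also have "\<dots> = (LINT y|distr lborel borel uminus. cnj (f y) * of_real ((2 * pi) ^ 3 * heat \<epsilon> (x - y)))"
      by (subst integral_distr) auto
    also note distr_uminus_lborel
    finally show ?thesis .
  qed
  let ?F = "\<lambda>x. ennreal (cmod (f x))" and ?G = "\<lambda>z. ennreal (heat \<epsilon> z)"
  have H_le: "ennreal (cmod (LINT \<xi>|lborel. cis (- (x \<bullet> \<xi>)) * h \<xi>)) \<le> ennreal ((2 * pi) ^ 3) * conv ?G ?F x" for x
  proof -
    have "ennreal (cmod (LINT \<xi>|lborel. cis (- (x \<bullet> \<xi>)) * h \<xi>))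
       \<le> (\<integral>\<^sup>+y. ennreal (cmod (cnj (f y) * of_real ((2 * pi) ^ 3 * heat \<epsilon> (x - y)))) \<partial>lborel)"
      unfolding H
      by (cases "integrable lborel (\<lambda>y. cnj (f y) * of_real ((2 * pi) ^ 3 * heat \<epsilon> (x - y)))")
         (auto intro: integral_norm_bound_ennreal simp: not_integrable_integral_eq)
    also have "\<dots> = (\<integral>\<^sup>+y. ennreal ((2 * pi) ^ 3) * (?G (x - y) * ?F y) \<partial>lborel)"
      by (intro nn_integral_cong) (simp add: norm_mult norm_power ennreal_mult[symmetric] mult_ac)
    also have "\<dots> = ennreal ((2 * pi) ^ 3) * conv ?G ?F x"
      unfolding conv_def by (rule nn_integral_cmult) measurable
    finally show ?thesis .
  qed
  let ?c = "(2 * pi) powr (-(3/2))"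
  \<comment> \<open>The normalisation of the transform cancels the factor (2 pi)^3 of the Gaussian
    integral.\<close>
  have c: "?c\<^sup>2 * (2 * pi) ^ 3 = 1"
  proof -
    have "?c\<^sup>2 = (2 * pi) powr (-(3/2) + -(3/2))" by (simp only: power2_eq_square powr_add)
    also have "\<dots> = 1 / (2 * pi) ^ 3" by (simp add: powr_minus_divide)
    finally show ?thesis by simp
  qed
  have int_eq: "(LINT \<xi>|lborel. exp (- \<epsilon> * (norm \<xi>)\<^sup>2) * (cmod (I \<xi>))\<^sup>2) = cmod (LINT \<xi>|lborel. h \<xi> * I \<xi>)"
  proof -
    have "h \<xi> * I \<xi> = of_real (exp (- \<epsilon> * (norm \<xi>)\<^sup>2) * (cmod (I \<xi>))\<^sup>2)" for \<xi>
      using complex_norm_square[of "I \<xi>"] by (simp add: h_def mult_ac)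
    then have "(LINT \<xi>|lborel. h \<xi> * I \<xi>) = of_real (LINT \<xi>|lborel. exp (- \<epsilon> * (norm \<xi>)\<^sup>2) * (cmod (I \<xi>))\<^sup>2)"
      by (simp only: integral_complex_of_real)
    then show ?thesis by (simp add: integral_nonneg_AE)
  qed
  have int_I: "integrable lborel (\<lambda>\<xi>. exp (- \<epsilon> * (norm \<xi>)\<^sup>2) * (cmod (I \<xi>))\<^sup>2)"
  proof (rule Bochner_Integration.integrable_bound)
    show "integrable lborel (\<lambda>\<xi>. of_real (A\<^sup>2) * ?g \<xi>)" using fourier_gaussian(2)[OF \<epsilon>] by simp
    show "AE \<xi> in lborel. norm (exp (- \<epsilon> * (norm \<xi>)\<^sup>2) * (cmod (I \<xi>))\<^sup>2) \<le> norm (of_real (A\<^sup>2) * ?g \<xi>)"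
      using I_le by (intro AE_I2) (auto simp: norm_mult norm_power mult.commute intro!: mult_left_mono power_mono order_trans[OF I_le abs_ge_self])
  qed measurable
  have "(\<integral>\<^sup>+\<xi>. ennreal (exp (- \<epsilon> * (norm \<xi>)\<^sup>2) * (cmod (fourier_L1 f \<xi>))\<^sup>2) \<partial>lborel)
     = (\<integral>\<^sup>+\<xi>. ennreal (?c\<^sup>2) * ennreal (exp (- \<epsilon> * (norm \<xi>)\<^sup>2) * (cmod (I \<xi>))\<^sup>2) \<partial>lborel)"
    unfolding fourier_L1_def I_def[symmetric]
    by (intro nn_integral_cong) (simp add: norm_mult power_mult_distrib ennreal_mult[symmetric] mult_ac)
  also have "\<dots> = ennreal (?c\<^sup>2) * ennreal (cmod (LINT \<xi>|lborel. h \<xi> * I \<xi>))"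
  proof -
    have "(\<integral>\<^sup>+\<xi>. ennreal (exp (- \<epsilon> * (norm \<xi>)\<^sup>2) * (cmod (I \<xi>))\<^sup>2) \<partial>lborel) = ennreal (cmod (LINT \<xi>|lborel. h \<xi> * I \<xi>))"
      unfolding int_eq[symmetric] by (rule nn_integral_eq_integral[OF int_I]) simp
    then show ?thesis by (subst nn_integral_cmult, measurable)
  qed
  also have "(LINT \<xi>|lborel. h \<xi> * I \<xi>) = (LINT x|lborel. f x * (LINT \<xi>|lborel. cis (- (x \<bullet> \<xi>)) * h \<xi>))"
    unfolding I_def by (rule fourier_integral_swap[OF f h])
  also have "ennreal (cmod \<dots>) \<le> (\<integral>\<^sup>+x. ennreal (cmod (f x * (LINT \<xi>|lborel. cis (- (x \<bullet> \<xi>)) * h \<xi>))) \<partial>lborel)"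
    by (cases "integrable lborel (\<lambda>x. f x * (LINT \<xi>|lborel. cis (- (x \<bullet> \<xi>)) * h \<xi>))")
       (auto intro: integral_norm_bound_ennreal simp: not_integrable_integral_eq)
  also have "\<dots> \<le> (\<integral>\<^sup>+x. ?F x * (ennreal ((2 * pi) ^ 3) * conv ?G ?F x) \<partial>lborel)"
  proof (rule nn_integral_mono)
    fix x
    show "ennreal (cmod (f x * (LINT \<xi>|lborel. cis (- (x \<bullet> \<xi>)) * h \<xi>))) \<le> ?F x * (ennreal ((2 * pi) ^ 3) * conv ?G ?F x)"
      using mult_left_mono[OF H_le[of x], of "?F x"] by (simp only: norm_mult ennreal_mult norm_ge_zero zero_le)
  qed
  also have "\<dots> = ennreal ((2 * pi) ^ 3) * (\<integral>\<^sup>+x. ?F x * conv ?G ?F x \<partial>lborel)"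
    by (subst nn_integral_cmult[symmetric]) (auto simp: mult_ac)
  also have "(\<integral>\<^sup>+x. ?F x * conv ?G ?F x \<partial>lborel) \<le> nsq f"
  proof (rule ennreal_square_le_imp_le)
    have nsq: "nsq f = (\<integral>\<^sup>+x. (?F x)\<^sup>2 \<partial>lborel)" unfolding nsq_def by (simp add: ennreal_power)
    have "(\<integral>\<^sup>+x. ?F x * conv ?G ?F x \<partial>lborel)\<^sup>2 \<le> nsq f * (\<integral>\<^sup>+x. (conv ?G ?F x)\<^sup>2 \<partial>lborel)"
      unfolding nsq by (rule nn_integral_Cauchy_Schwarz) auto
    also have "(\<integral>\<^sup>+x. (conv ?G ?F x)\<^sup>2 \<partial>lborel) \<le> (\<integral>\<^sup>+x. ?G x \<partial>lborel)\<^sup>2 * (\<integral>\<^sup>+x. (?F x)\<^sup>2 \<partial>lborel)"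
      by (rule nn_integral_conv_square_le) auto
    also have "\<dots> = nsq f" using \<epsilon> by (simp add: nn_integral_heat nsq)
    finally show "(\<integral>\<^sup>+x. ?F x * conv ?G ?F x \<partial>lborel)\<^sup>2 \<le> (nsq f)\<^sup>2"
      by (simp add: power2_eq_square mult_left_mono)
  qed
  finally have "(\<integral>\<^sup>+\<xi>. ennreal (exp (- \<epsilon> * (norm \<xi>)\<^sup>2) * (cmod (fourier_L1 f \<xi>))\<^sup>2) \<partial>lborel)
      \<le> ennreal (?c\<^sup>2) * (ennreal ((2 * pi) ^ 3) * nsq f)"
    by (simp add: mult_left_mono)
  also have "\<dots> = nsq f"
  proof -
    have "ennreal (?c\<^sup>2) * ennreal ((2 * pi) ^ 3) = ennreal (?c\<^sup>2 * (2 * pi) ^ 3)"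
      by (rule ennreal_mult[symmetric]) simp_all
    also have "\<dots> = 1" unfolding c by simp
    finally show ?thesis unfolding mult.assoc[symmetric] by simp
  qed
  finally show ?thesis .
qed

text \<open>Removing the Gaussian regularisation with Fatou's lemma gives the inequality half of
  Plancherel's theorem: the transform is a contraction, which is what its extension to L2 by density
  requires.\<close>

lemma nsq_fourier_L1_le:
  assumes f: "integrable lborel f"
  shows "nsq (fourier_L1 f) \<le> nsq f"
proof -
  have [measurable]: "f \<in> borel_measurable borel" using f by auto
  let ?u = "\<lambda>n \<xi>. ennreal (exp (- (1 / real (Suc n)) * (norm \<xi>)\<^sup>2) * (cmod (fourier_L1 f \<xi>))\<^sup>2)"
  have "nsq (fourier_L1 f) = (\<integral>\<^sup>+\<xi>. liminf (\<lambda>n. ?u n \<xi>) \<partial>lborel)"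
    unfolding nsq_def
  proof (rule nn_integral_cong)
    fix \<xi> :: "real^3"
    have "(\<lambda>n. 1 / real (Suc n)) \<longlonglongrightarrow> 0" by (rule LIMSEQ_Suc[OF lim_1_over_n])
    then have "(\<lambda>n. exp (- (1 / real (Suc n)) * (norm \<xi>)\<^sup>2) * (cmod (fourier_L1 f \<xi>))\<^sup>2)
        \<longlonglongrightarrow> exp (- 0 * (norm \<xi>)\<^sup>2) * (cmod (fourier_L1 f \<xi>))\<^sup>2"
      by (intro tendsto_intros)
    then have "(\<lambda>n. ?u n \<xi>) \<longlonglongrightarrow> ennreal ((cmod (fourier_L1 f \<xi>))\<^sup>2)"
      using tendsto_ennrealI by fastforce
    then show "ennreal ((cmod (fourier_L1 f \<xi>))\<^sup>2) = liminf (\<lambda>n. ?u n \<xi>)"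
      by (intro lim_imp_Liminf[symmetric]) auto
  qed
  also have "\<dots> \<le> liminf (\<lambda>n. \<integral>\<^sup>+\<xi>. ?u n \<xi> \<partial>lborel)"
    by (rule nn_integral_liminf) measurable
  also have "\<dots> \<le> nsq f"
  proof (rule Liminf_le)
    have "(\<integral>\<^sup>+\<xi>. ?u n \<xi> \<partial>lborel) \<le> nsq f" for n
      by (rule fourier_L1_gaussian_le[OF f]) simp
    then show "\<forall>\<^sub>F n in sequentially. (\<integral>\<^sup>+\<xi>. ?u n \<xi> \<partial>lborel) \<le> nsq f"
      by (intro always_eventually allI)
  qed simp
  finally show ?thesis .
qed

section \<open>Extension of the transform to L2\<close>

abbreviation cutoff :: "nat \<Rightarrow> (real^3 \<Rightarrow> complex) \<Rightarrow> real^3 \<Rightarrow> complex" where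
  "cutoff n f \<equiv> (\<lambda>x. indicator (cball 0 (real n)) x * f x)"

lemma integrable_cutoff:
  assumes "f \<in> L2"
  shows "integrable lborel (cutoff n f)"
proof (rule integrableI_bounded)
  have [measurable]: "f \<in> borel_measurable borel" using assms by (rule L2_measurable)
  show "cutoff n f \<in> borel_measurable lborel" by simp
  have "(\<integral>\<^sup>+x. ennreal (norm (cutoff n f x)) \<partial>lborel)
     \<le> (\<integral>\<^sup>+x. indicator (cball 0 (real n)) x + ennreal ((cmod (f x))\<^sup>2) \<partial>lborel)"
  proof (rule nn_integral_mono)
    fix x
    have "cmod (f x) \<le> 1 + (cmod (f x))\<^sup>2"
      using sum_squares_bound[of 1 "cmod (f x)"] by (simp add: power2_eq_square)
        (smt (verit) norm_ge_zero)
    then have "ennreal (cmod (f x)) \<le> ennreal (1 + (cmod (f x))\<^sup>2)" by (rule ennreal_leI)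
    then show "ennreal (norm (cutoff n f x)) \<le> indicator (cball 0 (real n)) x + ennreal ((cmod (f x))\<^sup>2)"
      by (simp add: norm_mult split: split_indicator)
  qed
  also have "\<dots> = emeasure lborel (cball (0::real^3) (real n)) + nsq f"
    unfolding nsq_def by (subst nn_integral_add) auto
  also have "\<dots> < \<infinity>"
    using assms by (simp add: L2_iff emeasure_cball_3)
  finally show "(\<integral>\<^sup>+x. ennreal (norm (cutoff n f x)) \<partial>lborel) < \<infinity>" .
qed

lemma fourier_L1_diff:
  assumes "integrable lborel f" "integrable lborel g"
  shows "fourier_L1 (\<lambda>x. f x - g x) \<xi> = fourier_L1 f \<xi> - fourier_L1 g \<xi>"
proof -
  have [measurable]: "f \<in> borel_measurable borel" "g \<in> borel_measurable borel" using assms by auto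
  have "integrable lborel (\<lambda>x. cis (- (x \<bullet> \<xi>)) * f x)" "integrable lborel (\<lambda>x. cis (- (x \<bullet> \<xi>)) * g x)"
    using integrable_cis_mult[OF assms(1)] integrable_cis_mult[OF assms(2)] by simp_all
  then show ?thesis unfolding fourier_L1_def by (simp add: right_diff_distrib)
qed

lemma nsq_cutoff_tendsto:
  assumes "f \<in> L2"
  shows "(\<lambda>n. nsq (\<lambda>x. f x - cutoff n f x)) \<longlonglongrightarrow> 0"
proof -
  have [measurable]: "f \<in> borel_measurable borel" using assms by (rule L2_measurable)
  have "(\<lambda>n. nsq (\<lambda>x. f x - cutoff n f x)) \<longlonglongrightarrow> (\<integral>\<^sup>+x. 0 \<partial>(lborel :: (real^3) measure))"
    unfolding nsq_def
  proof (rule nn_integral_dominated_convergence[where w = "\<lambda>x. ennreal ((cmod (f x))\<^sup>2)"])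
    show "(\<integral>\<^sup>+x. ennreal ((cmod (f x))\<^sup>2) \<partial>lborel) < \<infinity>"
      using assms by (simp add: L2_iff nsq_def)
    show "AE x in lborel. ennreal ((cmod (f x - cutoff n f x))\<^sup>2) \<le> ennreal ((cmod (f x))\<^sup>2)" for n
      by (auto split: split_indicator)
    show "AE x in lborel. (\<lambda>n. ennreal ((cmod (f x - cutoff n f x))\<^sup>2)) \<longlonglongrightarrow> 0"
    proof (rule AE_I2)
      fix x :: "real^3"
      have "\<forall>\<^sub>F n in sequentially. norm x \<le> real n"
        using eventually_ge_at_top[of "nat \<lceil>norm x\<rceil>"] by eventually_elim linarith
      then have "\<forall>\<^sub>F n in sequentially. ennreal ((cmod (f x - cutoff n f x))\<^sup>2) = 0"
        by eventually_elim (simp split: split_indicator)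
      then show "(\<lambda>n. ennreal ((cmod (f x - cutoff n f x))\<^sup>2)) \<longlonglongrightarrow> 0"
        by (rule tendsto_eventually)
    qed
  qed measurable
  then show ?thesis by simp
qed

text \<open>
  An $L^2$ sequence whose consecutive distances decay geometrically converges almost everywhere:
  the weights $2^k$ make $\sum_k 2^k |G_{k+1} - G_k|^2$ integrable.
\<close>

lemma L2_fast_Cauchy_convergent:
  fixes G :: "nat \<Rightarrow> real^3 \<Rightarrow> complex"
  assumes [measurable]: "\<And>n. G n \<in> borel_measurable borel"
    and le: "\<And>n. nsq (\<lambda>x. G (Suc n) x - G n x) \<le> ennreal ((1/4) ^ n)"
  shows "AE x in lborel. convergent (\<lambda>n. G n x)"
proof -
  let ?a = "\<lambda>n x. cmod (G (Suc n) x - G n x)"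
  have "(\<integral>\<^sup>+x. (\<Sum>n. ennreal (2 ^ n) * ennreal ((?a n x)\<^sup>2)) \<partial>lborel)
      = (\<Sum>n. \<integral>\<^sup>+x. ennreal (2 ^ n) * ennreal ((?a n x)\<^sup>2) \<partial>lborel)"
    by (rule nn_integral_suminf) measurable
  also have "\<dots> = (\<Sum>n. ennreal (2 ^ n) * nsq (\<lambda>x. G (Suc n) x - G n x))"
    unfolding nsq_def by (intro arg_cong[where f = suminf] ext nn_integral_cmult) measurable
  also have "\<dots> \<le> (\<Sum>n. ennreal ((1/2) ^ n))"
  proof (rule suminf_le)
    fix n
    have "ennreal (2 ^ n) * nsq (\<lambda>x. G (Suc n) x - G n x) \<le> ennreal (2 ^ n) * ennreal ((1/4) ^ n)"
      by (intro mult_left_mono le) simp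
    also have "\<dots> = ennreal ((1/2) ^ n)"
    proof -
      have "(2::real) ^ n * (1/4) ^ n = (1/2) ^ n" by (simp flip: power_mult_distrib)
      then show ?thesis by (simp flip: ennreal_mult)
    qed
    finally show "ennreal (2 ^ n) * nsq (\<lambda>x. G (Suc n) x - G n x) \<le> ennreal ((1/2) ^ n)" .
  qed auto
  also have "\<dots> < \<infinity>"
    by (subst suminf_ennreal2) auto
  finally have "AE x in lborel. (\<Sum>n. ennreal (2 ^ n) * ennreal ((?a n x)\<^sup>2)) \<noteq> \<infinity>"
    by (intro nn_integral_PInf_AE) auto
  then show ?thesis
  proof eventually_elim
    fix x assume fin: "(\<Sum>n. ennreal (2 ^ n) * ennreal ((?a n x)\<^sup>2)) \<noteq> \<infinity>"
    then obtain C where C: "(\<Sum>n. ennreal (2 ^ n) * ennreal ((?a n x)\<^sup>2)) = ennreal C" "0 \<le> C"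
      by (cases "(\<Sum>n. ennreal (2 ^ n) * ennreal ((?a n x)\<^sup>2))") auto
    have term_le: "?a n x \<le> sqrt C * (sqrt (1/2)) ^ n" for n
    proof -
      have "ennreal (2 ^ n) * ennreal ((?a n x)\<^sup>2) \<le> ennreal C"
        unfolding C(1)[symmetric] using sum_le_suminf[of "\<lambda>n. ennreal (2 ^ n) * ennreal ((?a n x)\<^sup>2)" "{n}"] by simp
      then have "2 ^ n * (?a n x)\<^sup>2 \<le> C"
        using C(2) by (simp flip: ennreal_mult)
      then have "(?a n x)\<^sup>2 \<le> C * (1/2) ^ n" by (simp add: field_simps)
      then have "sqrt ((?a n x)\<^sup>2) \<le> sqrt (C * (1/2) ^ n)" by (rule real_sqrt_le_mono)
      then show ?thesis by (simp add: real_sqrt_mult real_sqrt_power)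
    qed
    have "summable (\<lambda>n. sqrt C * (sqrt (1/2)) ^ n)"
      by (intro summable_mult summable_geometric) simp
    then have "summable (\<lambda>n. G (Suc n) x - G n x)"
      by (rule summable_comparison_test'[where N = 0]) (use term_le in auto)
    then have "convergent (\<lambda>n. \<Sum>i<n. G (Suc i) x - G i x)"
      by (simp add: summable_iff_convergent)
    then have "convergent (\<lambda>n. G n x - G 0 x)" using sum_lessThan_telescope[of "\<lambda>n. G n x"] by simp
    then have "convergent (\<lambda>n. (G n x - G 0 x) + G 0 x)"
      by (intro convergent_add convergent_const)
    then show "convergent (\<lambda>n. G n x)" by simp
  qed
qed

text \<open>The property by which \<open>fourier_L2\<close> is chosen, as a predicate, so that
  existence and uniqueness can be stated for it.\<close>

definition fourier_limit :: "(real^3 \<Rightarrow> complex) \<Rightarrow> (real^3 \<Rightarrow> complex) \<Rightarrow> bool" where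
  "fourier_limit f g \<longleftrightarrow> g \<in> L2 \<and> (\<lambda>n. nsq (\<lambda>\<xi>. fourier_L1 (cutoff n f) \<xi> - g \<xi>)) \<longlonglongrightarrow> 0"

lemma nsq_fourier_cutoff_diff_le:
  assumes f: "f \<in> L2" and nm: "n \<le> m"
  shows "nsq (\<lambda>\<xi>. fourier_L1 (cutoff n f) \<xi> - fourier_L1 (cutoff m f) \<xi>) \<le> nsq (\<lambda>x. f x - cutoff n f x)"
proof -
  have "nsq (\<lambda>\<xi>. fourier_L1 (cutoff n f) \<xi> - fourier_L1 (cutoff m f) \<xi>)
     = nsq (fourier_L1 (\<lambda>x. cutoff n f x - cutoff m f x))"
    using integrable_cutoff[OF f] by (subst fourier_L1_diff[symmetric]) auto
  also have "\<dots> \<le> nsq (\<lambda>x. cutoff n f x - cutoff m f x)"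
    using integrable_cutoff[OF f] by (intro nsq_fourier_L1_le) auto
  also have "\<dots> \<le> nsq (\<lambda>x. f x - cutoff n f x)"
    unfolding nsq_def using nm
    by (intro nn_integral_mono ennreal_leI power_mono) (auto split: split_indicator)
  finally show ?thesis .
qed

text \<open>The transforms of the cutoffs are Cauchy in L2 by contraction. A fast subsequence
  converges almost everywhere, and Fatou's lemma bounds the L2 distance of each term from that limit
  by the tail of f.\<close>

lemma fourier_limit_exists:
  assumes f: "f \<in> L2"
  shows "\<exists>g. fourier_limit f g"
proof -
  have [measurable]: "f \<in> borel_measurable borel" using f by (rule L2_measurable)
  let ?F = "\<lambda>n. fourier_L1 (cutoff n f)"
  let ?tail = "\<lambda>n. nsq (\<lambda>x. f x - cutoff n f x)"
  have tail: "?tail \<longlonglongrightarrow> 0" by (rule nsq_cutoff_tendsto[OF f])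
  have "\<exists>N. \<forall>n\<ge>N. ?tail n \<le> ennreal ((1/4) ^ k)" for k
  proof -
    have "\<forall>\<^sub>F n in sequentially. ?tail n < ennreal ((1/4) ^ k)"
      by (rule order_tendstoD(2)[OF tail]) simp
    then show ?thesis unfolding eventually_sequentially by (auto intro: less_imp_le)
  qed
  then obtain N where N: "\<And>k n. n \<ge> N k \<Longrightarrow> ?tail n \<le> ennreal ((1/4) ^ k)" by metis
  \<comment> \<open>The sum makes \<open>s k\<close> at least \<open>N k\<close> and s monotone; the
    summand k makes s unbounded.\<close>
  define s where "s k = (\<Sum>i\<le>k. N i) + k" for k
  have s_ge: "N k \<le> s k" for k
    unfolding s_def by (rule trans_le_add1) (rule member_le_sum, auto)
  have s_Suc: "s k \<le> s (Suc k)" for k unfolding s_def by simp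
  have s_id: "k \<le> s k" for k unfolding s_def by simp
  have "AE \<xi> in lborel. convergent (\<lambda>k. ?F (s k) \<xi>)"
  proof (rule L2_fast_Cauchy_convergent)
    fix k
    have "nsq (\<lambda>\<xi>. ?F (s (Suc k)) \<xi> - ?F (s k) \<xi>) \<le> ?tail (s k)"
      by (subst nsq_minus_commute) (rule nsq_fourier_cutoff_diff_le[OF f s_Suc])
    also have "\<dots> \<le> ennreal ((1/4) ^ k)" by (rule N[OF s_ge])
    finally show "nsq (\<lambda>\<xi>. ?F (s (Suc k)) \<xi> - ?F (s k) \<xi>) \<le> ennreal ((1/4) ^ k)" .
  qed measurable
  define g where "g \<xi> = lim (\<lambda>k. ?F (s k) \<xi>)" for \<xi>
  have [measurable]: "g \<in> borel_measurable borel"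
    unfolding g_def[abs_def] by (rule borel_measurable_lim_metric) measurable
  have lim: "AE \<xi> in lborel. (\<lambda>k. ?F (s k) \<xi>) \<longlonglongrightarrow> g \<xi>"
    using \<open>AE \<xi> in lborel. convergent (\<lambda>k. ?F (s k) \<xi>)\<close>
    by (rule eventually_mono) (simp add: g_def convergent_LIMSEQ_iff)
  have le: "nsq (\<lambda>\<xi>. ?F n \<xi> - g \<xi>) \<le> ?tail n" for n
  proof -
    have "nsq (\<lambda>\<xi>. ?F n \<xi> - g \<xi>) \<le> (\<integral>\<^sup>+\<xi>. liminf (\<lambda>k. ennreal ((cmod (?F n \<xi> - ?F (s k) \<xi>))\<^sup>2)) \<partial>lborel)"
      unfolding nsq_def
    proof (rule nn_integral_mono_AE)
      show "AE \<xi> in lborel. ennreal ((cmod (?F n \<xi> - g \<xi>))\<^sup>2) \<le> liminf (\<lambda>k. ennreal ((cmod (?F n \<xi> - ?F (s k) \<xi>))\<^sup>2))"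
        using lim
      proof eventually_elim
        fix \<xi> assume "(\<lambda>k. ?F (s k) \<xi>) \<longlonglongrightarrow> g \<xi>"
        then have "(\<lambda>k. ennreal ((cmod (?F n \<xi> - ?F (s k) \<xi>))\<^sup>2)) \<longlonglongrightarrow> ennreal ((cmod (?F n \<xi> - g \<xi>))\<^sup>2)"
          by (intro tendsto_intros)
        then have "liminf (\<lambda>k. ennreal ((cmod (?F n \<xi> - ?F (s k) \<xi>))\<^sup>2)) = ennreal ((cmod (?F n \<xi> - g \<xi>))\<^sup>2)"
          by (intro lim_imp_Liminf) auto
        then show "ennreal ((cmod (?F n \<xi> - g \<xi>))\<^sup>2) \<le> liminf (\<lambda>k. ennreal ((cmod (?F n \<xi> - ?F (s k) \<xi>))\<^sup>2))" by simp
      qed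
    qed
    also have "\<dots> \<le> liminf (\<lambda>k. nsq (\<lambda>\<xi>. ?F n \<xi> - ?F (s k) \<xi>))"
      unfolding nsq_def by (rule nn_integral_liminf) measurable
    also have "\<dots> \<le> ?tail n"
    proof (rule Liminf_le)
      show "\<forall>\<^sub>F k in sequentially. nsq (\<lambda>\<xi>. ?F n \<xi> - ?F (s k) \<xi>) \<le> ?tail n"
        using eventually_ge_at_top[of n]
        by eventually_elim (intro nsq_fourier_cutoff_diff_le[OF f], use s_id order_trans in blast)
    qed simp
    finally show ?thesis .
  qed
  have "nsq g < \<infinity>"
  proof -
    have "nsq g = nsq (\<lambda>\<xi>. (g \<xi> - ?F 0 \<xi>) + ?F 0 \<xi>)" by simp
    also have "\<dots> \<le> 2 * nsq (\<lambda>\<xi>. g \<xi> - ?F 0 \<xi>) + 2 * nsq (?F 0)"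
      by (rule nsq_add_le) auto
    also have "\<dots> \<le> 2 * ?tail 0 + 2 * nsq (cutoff 0 f)"
      using le[of 0] nsq_minus_commute[of g "?F 0"] nsq_fourier_L1_le[OF integrable_cutoff[OF f, of 0]]
      by (intro add_mono mult_left_mono) auto
    also have "\<dots> \<le> 2 * nsq f + 2 * nsq f"
      unfolding nsq_def by (intro add_mono mult_left_mono nn_integral_mono) (auto split: split_indicator)
    also have "\<dots> < \<infinity>" using f by (simp add: L2_iff ennreal_mult_less_top)
    finally show ?thesis .
  qed
  moreover have "(\<lambda>n. nsq (\<lambda>\<xi>. ?F n \<xi> - g \<xi>)) \<longlonglongrightarrow> 0"
    by (rule tendsto_sandwich[OF _ _ tendsto_const tail]) (simp_all add: le)
  ultimately show ?thesis unfolding fourier_limit_def by (intro exI[of _ g]) (simp add: L2_iff)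
qed

lemma fourier_L2_limit: "f \<in> L2 \<Longrightarrow> fourier_limit f (fourier_L2 f)"
  using someI_ex[OF fourier_limit_exists] unfolding fourier_L2_def fourier_limit_def nsq_def .

lemma fourier_L2_in_L2: "f \<in> L2 \<Longrightarrow> fourier_L2 f \<in> L2"
  using fourier_L2_limit by (simp add: fourier_limit_def)

lemma nsq_le_tendsto_0:
  assumes "\<And>n. nsq f \<le> 2 * a n + 2 * b n" "a \<longlonglongrightarrow> 0" "b \<longlonglongrightarrow> 0"
  shows "nsq f = 0"
proof -
  have "(\<lambda>n. 2 * a n + 2 * b n) \<longlonglongrightarrow> 2 * 0 + 2 * 0"
    by (intro tendsto_add ennreal_tendsto_cmult assms) auto
  then have "nsq f \<le> 0" by (intro LIMSEQ_le_const) (use assms(1) in auto)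
  then show ?thesis by simp
qed

text \<open>Because \<open>fourier_L2\<close> is an arbitrary choice of representative, every
  identity for it is obtained by exhibiting another limit and holds almost everywhere.\<close>

lemma fourier_limit_unique:
  assumes g: "fourier_limit f g" and h: "fourier_limit f h" and f: "f \<in> L2"
  shows "AE \<xi> in lborel. g \<xi> = h \<xi>"
proof -
  have [measurable]: "f \<in> borel_measurable borel" "g \<in> borel_measurable borel" "h \<in> borel_measurable borel"
    using g h f by (auto simp: fourier_limit_def L2_iff)
  have "nsq (\<lambda>\<xi>. g \<xi> - h \<xi>) = 0"
  proof (rule nsq_le_tendsto_0)
    fix n
    show "nsq (\<lambda>\<xi>. g \<xi> - h \<xi>) \<le> 2 * nsq (\<lambda>\<xi>. fourier_L1 (cutoff n f) \<xi> - g \<xi>) + 2 * nsq (\<lambda>\<xi>. fourier_L1 (cutoff n f) \<xi> - h \<xi>)"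
      by (subst (2) nsq_minus_commute) (rule nsq_triangle, auto)
  qed (use g h in \<open>auto simp: fourier_limit_def\<close>)
  then have "AE \<xi> in lborel. g \<xi> - h \<xi> = 0" by (intro nsq_eq_0) auto
  then show ?thesis by (rule eventually_mono) simp
qed

lemma fourier_L2_cmult:
  assumes f: "f \<in> L2"
  shows "AE \<xi> in lborel. fourier_L2 (\<lambda>x. c * f x) \<xi> = c * fourier_L2 f \<xi>"
proof (rule fourier_limit_unique[of "\<lambda>x. c * f x"])
  have [measurable]: "f \<in> borel_measurable borel" using f by (rule L2_measurable)
  have nsq_c: "nsq (\<lambda>x. c * u x) = ennreal ((cmod c)\<^sup>2) * nsq u" if [measurable]: "u \<in> borel_measurable borel" for u
    unfolding nsq_def by (subst nn_integral_cmult[symmetric]) (auto simp: norm_mult power_mult_distrib ennreal_mult)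
  show cf: "(\<lambda>x. c * f x) \<in> L2" using f by (simp add: L2_iff nsq_c ennreal_mult_less_top)
  then show "fourier_limit (\<lambda>x. c * f x) (fourier_L2 (\<lambda>x. c * f x))" by (rule fourier_L2_limit)
  have F: "fourier_L2 f \<in> L2" "(\<lambda>n. nsq (\<lambda>\<xi>. fourier_L1 (cutoff n f) \<xi> - fourier_L2 f \<xi>)) \<longlonglongrightarrow> 0"
    using fourier_L2_limit[OF f] by (auto simp: fourier_limit_def)
  have [measurable]: "fourier_L2 f \<in> borel_measurable borel" using F(1) by (rule L2_measurable)
  have "fourier_L1 (cutoff n (\<lambda>x. c * f x)) \<xi> = c * fourier_L1 (cutoff n f) \<xi>" for n \<xi>
  proof -
    have "fourier_L1 (cutoff n (\<lambda>x. c * f x)) \<xi> = of_real ((2 * pi) powr (-(3/2))) * (LINT x|lborel. c * (cis (- (x \<bullet> \<xi>)) * cutoff n f x))"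
      unfolding fourier_L1_def by (simp only: mult_ac)
    then show ?thesis unfolding fourier_L1_def by simp
  qed
  then have "nsq (\<lambda>\<xi>. fourier_L1 (cutoff n (\<lambda>x. c * f x)) \<xi> - c * fourier_L2 f \<xi>)
      = ennreal ((cmod c)\<^sup>2) * nsq (\<lambda>\<xi>. fourier_L1 (cutoff n f) \<xi> - fourier_L2 f \<xi>)" for n
    by (simp add: right_diff_distrib[symmetric] nsq_c)
  moreover have "(\<lambda>n. ennreal ((cmod c)\<^sup>2) * nsq (\<lambda>\<xi>. fourier_L1 (cutoff n f) \<xi> - fourier_L2 f \<xi>)) \<longlonglongrightarrow> ennreal ((cmod c)\<^sup>2) * 0"
    by (intro ennreal_tendsto_cmult F) simp
  ultimately show "fourier_limit (\<lambda>x. c * f x) (\<lambda>\<xi>. c * fourier_L2 f \<xi>)"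
    using F(1) by (simp add: fourier_limit_def L2_iff nsq_c ennreal_mult_less_top)
qed

text \<open>Lets the transform be computed from any integrable approximation, not only from cutoffs.
  The 4 stems from two uses of the triangle inequality with factor 2.\<close>

lemma fourier_L2_approx:
  assumes f: "f \<in> L2" and h: "integrable lborel h" "h \<in> L2"
  shows "nsq (\<lambda>\<xi>. fourier_L2 f \<xi> - fourier_L1 h \<xi>) \<le> 4 * nsq (\<lambda>x. f x - h x)"
proof -
  have [measurable]: "f \<in> borel_measurable borel" "h \<in> borel_measurable borel"
    using f h by (auto simp: L2_iff)
  have F: "fourier_L2 f \<in> L2" "(\<lambda>n. nsq (\<lambda>\<xi>. fourier_L1 (cutoff n f) \<xi> - fourier_L2 f \<xi>)) \<longlonglongrightarrow> 0"
    using fourier_L2_limit[OF f] by (auto simp: fourier_limit_def)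
  have [measurable]: "fourier_L2 f \<in> borel_measurable borel" using F(1) by (rule L2_measurable)
  have "nsq (\<lambda>\<xi>. fourier_L2 f \<xi> - fourier_L1 h \<xi>)
     \<le> 2 * nsq (\<lambda>\<xi>. fourier_L1 (cutoff n f) \<xi> - fourier_L2 f \<xi>)
       + 2 * (2 * nsq (\<lambda>x. f x - cutoff n f x) + 2 * nsq (\<lambda>x. f x - h x))" for n
  proof -
    have "nsq (\<lambda>\<xi>. fourier_L2 f \<xi> - fourier_L1 h \<xi>)
       \<le> 2 * nsq (\<lambda>\<xi>. fourier_L2 f \<xi> - fourier_L1 (cutoff n f) \<xi>) + 2 * nsq (\<lambda>\<xi>. fourier_L1 (cutoff n f) \<xi> - fourier_L1 h \<xi>)"
      by (rule nsq_triangle) auto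
    also have "nsq (\<lambda>\<xi>. fourier_L1 (cutoff n f) \<xi> - fourier_L1 h \<xi>) \<le> nsq (\<lambda>x. cutoff n f x - h x)"
    proof -
      have "fourier_L1 (\<lambda>x. cutoff n f x - h x) = (\<lambda>\<xi>. fourier_L1 (cutoff n f) \<xi> - fourier_L1 h \<xi>)"
        by (intro ext fourier_L1_diff integrable_cutoff f h)
      moreover have "integrable lborel (\<lambda>x. cutoff n f x - h x)"
        by (intro Bochner_Integration.integrable_diff integrable_cutoff f h)
      ultimately show ?thesis using nsq_fourier_L1_le[of "\<lambda>x. cutoff n f x - h x"] by simp
    qed
    also have "nsq (\<lambda>x. cutoff n f x - h x) \<le> 2 * nsq (\<lambda>x. cutoff n f x - f x) + 2 * nsq (\<lambda>x. f x - h x)"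
      by (rule nsq_triangle) auto
    finally show ?thesis
      by (simp add: nsq_minus_commute[of "fourier_L2 f"] nsq_minus_commute[of "cutoff n f" f] add_left_mono mult_left_mono)
  qed
  moreover have "(\<lambda>n. 2 * nsq (\<lambda>\<xi>. fourier_L1 (cutoff n f) \<xi> - fourier_L2 f \<xi>)
       + 2 * (2 * nsq (\<lambda>x. f x - cutoff n f x) + 2 * nsq (\<lambda>x. f x - h x)))
     \<longlonglongrightarrow> 2 * 0 + 2 * (2 * 0 + 2 * nsq (\<lambda>x. f x - h x))"
    by (intro tendsto_add ennreal_tendsto_cmult F nsq_cutoff_tendsto[OF f] tendsto_const) auto
  ultimately have "nsq (\<lambda>\<xi>. fourier_L2 f \<xi> - fourier_L1 h \<xi>) \<le> 2 * 0 + 2 * (2 * 0 + 2 * nsq (\<lambda>x. f x - h x))"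
    by (intro LIMSEQ_le_const) auto
  then show ?thesis by (simp add: mult.assoc[symmetric])
qed

section \<open>Nonnegative functions as complex ones, and the convolution theorem\<close>

abbreviation cx :: "('a \<Rightarrow> ennreal) \<Rightarrow> 'a \<Rightarrow> complex" where
  "cx f \<equiv> (\<lambda>x. complex_of_real (enn2real (f x)))"

text \<open>Only an inequality, as \<open>enn2real\<close> sends infinity to 0.\<close>

lemma nsq_cx_le: "nsq (cx f) \<le> (\<integral>\<^sup>+x. (f x)\<^sup>2 \<partial>lborel)"
  unfolding nsq_def
proof (rule nn_integral_mono)
  fix x
  show "ennreal ((cmod (cx f x))\<^sup>2) \<le> (f x)\<^sup>2"
    by (cases "f x") (auto simp: ennreal_power)
qed

lemma nsq_cx:
  assumes "AE x in lborel. f x \<noteq> top"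
  shows "nsq (cx f) = (\<integral>\<^sup>+x. (f x)\<^sup>2 \<partial>lborel)"
  unfolding nsq_def
proof (rule nn_integral_cong_AE)
  show "AE x in lborel. ennreal ((cmod (cx f x))\<^sup>2) = (f x)\<^sup>2"
    using assms
  proof eventually_elim
    fix x assume "f x \<noteq> top"
    then show "ennreal ((cmod (cx f x))\<^sup>2) = (f x)\<^sup>2" by (cases "f x") (auto simp: ennreal_power)
  qed
qed

lemma nsq_cx_diff:
  assumes "AE x in lborel. f x \<noteq> top" "AE x in lborel. g x \<noteq> top"
  shows "nsq (\<lambda>x. cx f x - cx g x) = (\<integral>\<^sup>+x. (edist (f x) (g x))\<^sup>2 \<partial>lborel)"
  unfolding nsq_def
proof (rule nn_integral_cong_AE)
  show "AE x in lborel. ennreal ((cmod (cx f x - cx g x))\<^sup>2) = (edist (f x) (g x))\<^sup>2"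
    using assms
  proof eventually_elim
    fix x assume "f x \<noteq> top" "g x \<noteq> top"
    then show "ennreal ((cmod (cx f x - cx g x))\<^sup>2) = (edist (f x) (g x))\<^sup>2"
      by (cases "f x"; cases "g x") (auto simp: edist_ennreal ennreal_power simp flip: of_real_diff)
  qed
qed

lemma cx_L2:
  assumes [measurable]: "f \<in> borel_measurable borel" and "(\<integral>\<^sup>+x. (f x)\<^sup>2 \<partial>lborel) < \<infinity>"
  shows "cx f \<in> L2"
proof -
  have "cx f \<in> borel_measurable borel" by measurable
  then show ?thesis using le_less_trans[OF nsq_cx_le assms(2)] by (simp add: L2_iff)
qed

text \<open>Fubini for a bounded oscillating factor against an extended nonnegative kernel. The
  finite total mass makes the inner integral finite almost everywhere, and there the default value
  of \<open>enn2real\<close> does not intervene.\<close>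

lemma cx_integral_swap:
  fixes k :: "'a::euclidean_space \<Rightarrow> 'b::euclidean_space \<Rightarrow> ennreal" and e :: "'a \<Rightarrow> complex"
  assumes [measurable]: "case_prod k \<in> borel_measurable (borel \<Otimes>\<^sub>M borel)" "e \<in> borel_measurable borel"
    and e: "\<And>x. cmod (e x) \<le> 1"
    and fin: "(\<integral>\<^sup>+x. \<integral>\<^sup>+y. k x y \<partial>lborel \<partial>lborel) < \<infinity>"
  shows "(LINT x|lborel. e x * of_real (enn2real (\<integral>\<^sup>+y. k x y \<partial>lborel)))
    = (LINT y|lborel. LINT x|lborel. e x * of_real (enn2real (k x y)))"
proof -
  have "AE x in lborel. (\<integral>\<^sup>+y. k x y \<partial>lborel) \<noteq> \<infinity>"
    using fin by (intro nn_integral_PInf_AE) auto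
  then have AE: "AE x in lborel. e x * of_real (enn2real (\<integral>\<^sup>+y. k x y \<partial>lborel)) = (LINT y|lborel. e x * complex_of_real (enn2real (k x y)))"
  proof eventually_elim
    fix x assume "(\<integral>\<^sup>+y. k x y \<partial>lborel) \<noteq> \<infinity>"
    then have "AE y in lborel. k x y \<noteq> \<infinity>" by (intro nn_integral_PInf_AE) auto
    then have "(\<integral>\<^sup>+y. k x y \<partial>lborel) = (\<integral>\<^sup>+y. ennreal (enn2real (k x y)) \<partial>lborel)"
      by (intro nn_integral_cong_AE) (auto elim!: eventually_mono simp: less_top)
    then have "enn2real (\<integral>\<^sup>+y. k x y \<partial>lborel) = (LINT y|lborel. enn2real (k x y))"
      by (subst integral_eq_nn_integral) auto
    then show "e x * of_real (enn2real (\<integral>\<^sup>+y. k x y \<partial>lborel)) = (LINT y|lborel. e x * complex_of_real (enn2real (k x y)))"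
      by simp
  qed
  have meas: "(\<lambda>p. e (fst p) * complex_of_real (enn2real (k (fst p) (snd p)))) \<in> borel_measurable (lborel \<Otimes>\<^sub>M lborel)"
    using assms(1) by (simp add: case_prod_beta)
  have int: "integrable (lborel \<Otimes>\<^sub>M lborel) (\<lambda>(x, y). e x * complex_of_real (enn2real (k x y)))"
  proof (rule integrableI_bounded)
    show "(\<lambda>(x, y). e x * complex_of_real (enn2real (k x y))) \<in> borel_measurable (lborel \<Otimes>\<^sub>M lborel)"
      using meas by (simp add: case_prod_beta)
    have "(\<integral>\<^sup>+p. ennreal (norm (case p of (x, y) \<Rightarrow> e x * complex_of_real (enn2real (k x y)))) \<partial>(lborel \<Otimes>\<^sub>M lborel))
       = (\<integral>\<^sup>+x. \<integral>\<^sup>+y. ennreal (norm (e x * complex_of_real (enn2real (k x y)))) \<partial>lborel \<partial>lborel)"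
      using meas by (subst lborel.nn_integral_fst[symmetric]) (auto simp: case_prod_beta)
    also have "\<dots> \<le> (\<integral>\<^sup>+x. \<integral>\<^sup>+y. k x y \<partial>lborel \<partial>lborel)"
    proof (intro nn_integral_mono)
      fix x y
      have "norm (e x * complex_of_real (enn2real (k x y))) \<le> 1 * enn2real (k x y)"
        unfolding norm_mult using e by (intro mult_mono) auto
      then have "ennreal (norm (e x * complex_of_real (enn2real (k x y)))) \<le> ennreal (enn2real (k x y))"
        by (intro ennreal_leI) simp
      also have "\<dots> \<le> k x y" by (cases "k x y") auto
      finally show "ennreal (norm (e x * complex_of_real (enn2real (k x y)))) \<le> k x y" .
    qed
    also note fin
    finally show "(\<integral>\<^sup>+p. ennreal (norm (case p of (x, y) \<Rightarrow> e x * complex_of_real (enn2real (k x y)))) \<partial>(lborel \<Otimes>\<^sub>M lborel)) < \<infinity>" .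
  qed
  have "(LINT x|lborel. e x * of_real (enn2real (\<integral>\<^sup>+y. k x y \<partial>lborel)))
     = (LINT x|lborel. LINT y|lborel. e x * complex_of_real (enn2real (k x y)))"
  proof (rule integral_cong_AE[OF _ _ AE])
    show "(\<lambda>x. e x * of_real (enn2real (\<integral>\<^sup>+y. k x y \<partial>lborel))) \<in> borel_measurable lborel" by measurable
    show "(\<lambda>x. LINT y|lborel. e x * complex_of_real (enn2real (k x y))) \<in> borel_measurable lborel"
      by (rule lborel.borel_measurable_lebesgue_integral) (use meas in \<open>simp add: case_prod_beta\<close>)
  qed
  also have "\<dots> = (LINT y|lborel. LINT x|lborel. e x * complex_of_real (enn2real (k x y)))"
    by (rule lborel_pair.Fubini_integral[symmetric]) (rule int)
  finally show ?thesis .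
qed

text \<open>The Fourier integral without the factor (2 pi)^(-3/2): in this form it is the multiplier
  of convolution with K.\<close>

definition khat :: "(real^3 \<Rightarrow> ennreal) \<Rightarrow> real^3 \<Rightarrow> complex" where
  "khat K \<xi> = (LINT z|lborel. cis (- (z \<bullet> \<xi>)) * cx K z)"

lemma measurable_khat [measurable]:
  assumes [measurable]: "K \<in> borel_measurable borel"
  shows "khat K \<in> borel_measurable borel"
  unfolding khat_def[abs_def] by measurable

lemma integral_shift:
  fixes f :: "'a::euclidean_space \<Rightarrow> complex"
  assumes [measurable]: "f \<in> borel_measurable borel"
  shows "(LINT x|lborel. f (x - y)) = (LINT x|lborel. f x)"
proof -
  have "(LINT x|lborel. f (x - y)) = (LINT x|distr lborel borel ((+) (- y)). f x)"
    by (subst integral_distr) auto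
  then show ?thesis by (simp only: lborel_distr_plus)
qed

lemma fourier_L1_conv:
  assumes [measurable]: "K \<in> borel_measurable borel" "H \<in> borel_measurable borel"
    and "(\<integral>\<^sup>+x. K x \<partial>lborel) < \<infinity>" "(\<integral>\<^sup>+x. H x \<partial>lborel) < \<infinity>"
  shows "fourier_L1 (cx (conv K H)) \<xi> = khat K \<xi> * fourier_L1 (cx H) \<xi>"
proof -
  have "(LINT x|lborel. cis (- (x \<bullet> \<xi>)) * of_real (enn2real (\<integral>\<^sup>+y. K (x - y) * H y \<partial>lborel)))
     = (LINT y|lborel. LINT x|lborel. cis (- (x \<bullet> \<xi>)) * of_real (enn2real (K (x - y) * H y)))"
  proof (rule cx_integral_swap[where k = "\<lambda>x y. K (x - y) * H y" and e = "\<lambda>x. cis (- (x \<bullet> \<xi>))"])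
    show "(\<lambda>(x, y). K (x - y) * H y) \<in> borel_measurable (borel \<Otimes>\<^sub>M borel)"
      and "(\<lambda>x. cis (- (x \<bullet> \<xi>))) \<in> borel_measurable borel" by measurable
    have "(\<integral>\<^sup>+x. \<integral>\<^sup>+y. K (x - y) * H y \<partial>lborel \<partial>lborel) = (\<integral>\<^sup>+x. K x \<partial>lborel) * (\<integral>\<^sup>+x. H x \<partial>lborel)"
      using nn_integral_conv[of K H] by (simp add: conv_def)
    also have "\<dots> < \<infinity>" using assms by (simp add: ennreal_mult_less_top)
    finally show "(\<integral>\<^sup>+x. \<integral>\<^sup>+y. K (x - y) * H y \<partial>lborel \<partial>lborel) < \<infinity>" .
  qed simp
  also have "\<dots> = (LINT y|lborel. khat K \<xi> * (cis (- (y \<bullet> \<xi>)) * cx H y))"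
  proof (rule Bochner_Integration.integral_cong[OF refl])
    fix y
    have "(LINT x|lborel. cis (- (x \<bullet> \<xi>)) * of_real (enn2real (K (x - y) * H y)))
       = (LINT x|lborel. (cis (- (y \<bullet> \<xi>)) * cx H y) * (cis (- ((x - y) \<bullet> \<xi>)) * cx K (x - y)))"
    proof (rule Bochner_Integration.integral_cong[OF refl])
      fix x
      have "cis (- (x \<bullet> \<xi>)) = cis (- (y \<bullet> \<xi>)) * cis (- ((x - y) \<bullet> \<xi>))"
        by (simp add: cis_mult inner_diff_left)
      then show "cis (- (x \<bullet> \<xi>)) * of_real (enn2real (K (x - y) * H y))
        = (cis (- (y \<bullet> \<xi>)) * cx H y) * (cis (- ((x - y) \<bullet> \<xi>)) * cx K (x - y))"
        by (simp add: enn2real_mult mult_ac)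
    qed
    also have "\<dots> = (cis (- (y \<bullet> \<xi>)) * cx H y) * (LINT x|lborel. cis (- ((x - y) \<bullet> \<xi>)) * cx K (x - y))"
      by simp
    also have "(LINT x|lborel. cis (- ((x - y) \<bullet> \<xi>)) * cx K (x - y)) = khat K \<xi>"
      unfolding khat_def by (rule integral_shift[of "\<lambda>x. cis (- (x \<bullet> \<xi>)) * cx K x"]) measurable
    finally show "(LINT x|lborel. cis (- (x \<bullet> \<xi>)) * of_real (enn2real (K (x - y) * H y))) = khat K \<xi> * (cis (- (y \<bullet> \<xi>)) * cx H y)"
      by (simp add: mult_ac)
  qed
  finally show ?thesis unfolding fourier_L1_def conv_def by simp
qed

lemma khat_le:
  assumes [measurable]: "K \<in> borel_measurable borel" and "(\<integral>\<^sup>+x. K x \<partial>lborel) \<le> 1"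
  shows "cmod (khat K \<xi>) \<le> 1"
proof -
  have "ennreal (cmod (khat K \<xi>)) \<le> (\<integral>\<^sup>+z. ennreal (cmod (cis (- (z \<bullet> \<xi>)) * cx K z)) \<partial>lborel)"
    unfolding khat_def
    by (cases "integrable lborel (\<lambda>z. cis (- (z \<bullet> \<xi>)) * cx K z)")
       (auto intro: integral_norm_bound_ennreal simp: not_integrable_integral_eq)
  also have "\<dots> \<le> (\<integral>\<^sup>+z. K z \<partial>lborel)"
  proof (rule nn_integral_mono)
    fix z show "ennreal (cmod (cis (- (z \<bullet> \<xi>)) * cx K z)) \<le> K z"
      by (cases "K z") (auto simp: norm_mult)
  qed
  also note assms(2)
  finally show ?thesis by (simp add: ennreal_le_1)
qed

lemma nsq_khat_mult_le:
  assumes "K \<in> borel_measurable borel" "(\<integral>\<^sup>+x. K x \<partial>lborel) \<le> 1"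
  shows "nsq (\<lambda>\<xi>. khat K \<xi> * u \<xi>) \<le> nsq u"
  unfolding nsq_def
proof (intro nn_integral_mono ennreal_leI power_mono)
  fix \<xi>
  show "cmod (khat K \<xi> * u \<xi>) \<le> cmod (u \<xi>)"
    unfolding norm_mult using khat_le[OF assms] by (simp add: mult_left_le_one_le)
qed auto

text \<open>For the cutoffs of H the identity is the L1 convolution theorem. Convolution with K and
  multiplication by \<open>khat K\<close> are both L2 contractions, as the mass of K is at most 1,
  so the identity passes to the limit.\<close>

lemma fourier_L2_conv:
  assumes [measurable]: "K \<in> borel_measurable borel" "H \<in> borel_measurable borel"
    and K: "(\<integral>\<^sup>+x. K x \<partial>lborel) \<le> 1" and H: "(\<integral>\<^sup>+x. (H x)\<^sup>2 \<partial>lborel) < \<infinity>"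
  shows "AE \<xi> in lborel. fourier_L2 (cx (conv K H)) \<xi> = khat K \<xi> * fourier_L2 (cx H) \<xi>"
proof -
  have L2: "(\<integral>\<^sup>+x. (conv K f x)\<^sup>2 \<partial>lborel) \<le> (\<integral>\<^sup>+x. (f x)\<^sup>2 \<partial>lborel)" if [measurable]: "f \<in> borel_measurable borel" for f
  proof -
    have "(\<integral>\<^sup>+x. (conv K f x)\<^sup>2 \<partial>lborel) \<le> (\<integral>\<^sup>+x. K x \<partial>lborel)\<^sup>2 * (\<integral>\<^sup>+x. (f x)\<^sup>2 \<partial>lborel)"
      by (rule nn_integral_conv_square_le) auto
    also have "\<dots> \<le> 1\<^sup>2 * (\<integral>\<^sup>+x. (f x)\<^sup>2 \<partial>lborel)"
      by (intro mult_right_mono power_mono K) auto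
    finally show ?thesis by simp
  qed
  define Hn where "Hn n x = indicator (cball 0 (real n)) x * H x" for n x
  have [measurable]: "Hn n \<in> borel_measurable borel" for n unfolding Hn_def[abs_def] by measurable
  have cut: "cx (Hn n) = cutoff n (cx H)" for n
    by (rule ext) (simp add: Hn_def split: split_indicator)
  have Hn_L2: "(\<integral>\<^sup>+x. (Hn n x)\<^sup>2 \<partial>lborel) < \<infinity>" for n
  proof -
    have "(\<integral>\<^sup>+x. (Hn n x)\<^sup>2 \<partial>lborel) \<le> (\<integral>\<^sup>+x. (H x)\<^sup>2 \<partial>lborel)"
      by (intro nn_integral_mono) (auto simp: Hn_def split: split_indicator)
    then show ?thesis using H by (rule le_less_trans)
  qed
  have Hn_L1: "(\<integral>\<^sup>+x. Hn n x \<partial>lborel) < \<infinity>" for n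
  proof -
    have "(\<integral>\<^sup>+x. Hn n x \<partial>lborel)\<^sup>2 \<le> (\<integral>\<^sup>+x. (indicator (cball (0::real^3) (real n)) x)\<^sup>2 \<partial>lborel) * (\<integral>\<^sup>+x. (H x)\<^sup>2 \<partial>lborel)"
      unfolding Hn_def by (rule nn_integral_Cauchy_Schwarz) auto
    also have "(\<integral>\<^sup>+x. (indicator (cball (0::real^3) (real n)) x)\<^sup>2 \<partial>lborel) = (\<integral>\<^sup>+x. indicator (cball (0::real^3) (real n)) x \<partial>lborel)"
      by (intro nn_integral_cong) (auto split: split_indicator)
    also have "\<dots> * (\<integral>\<^sup>+x. (H x)\<^sup>2 \<partial>lborel) < \<infinity>"
      using H by (simp add: emeasure_cball_3 ennreal_mult_less_top)
    finally show ?thesis by (simp add: power_less_top_ennreal)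
  qed
  have fin: "AE x in lborel. f x \<noteq> top" if "f \<in> borel_measurable borel" "(\<integral>\<^sup>+x. (f x)\<^sup>2 \<partial>lborel) < \<infinity>" for f :: "real^3 \<Rightarrow> ennreal"
    using that by (intro AE_finite_of_L2) auto
  have conv_L2: "(\<integral>\<^sup>+x. (conv K H x)\<^sup>2 \<partial>lborel) < \<infinity>" "(\<integral>\<^sup>+x. (conv K (Hn n) x)\<^sup>2 \<partial>lborel) < \<infinity>" for n
    using le_less_trans[OF L2 H] le_less_trans[OF L2 Hn_L2[of n]] by simp_all
  have memb: "cx H \<in> L2" "cx (conv K H) \<in> L2" "cx (conv K (Hn n)) \<in> L2" for n
    using H conv_L2 by (auto intro!: cx_L2)
  have [measurable]: "fourier_L2 (cx H) \<in> borel_measurable borel" "fourier_L2 (cx (conv K H)) \<in> borel_measurable borel"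
    using memb by (auto intro!: L2_measurable fourier_L2_in_L2)
  have int: "integrable lborel (cx (conv K (Hn n)))" for n
  proof (rule integrableI_bounded)
    have "(\<integral>\<^sup>+x. ennreal (norm (cx (conv K (Hn n)) x)) \<partial>lborel) \<le> (\<integral>\<^sup>+x. conv K (Hn n) x \<partial>lborel)"
    proof (rule nn_integral_mono)
      fix x show "ennreal (norm (cx (conv K (Hn n)) x)) \<le> conv K (Hn n) x"
        by (cases "conv K (Hn n) x") auto
    qed
    also have "\<dots> = (\<integral>\<^sup>+x. K x \<partial>lborel) * (\<integral>\<^sup>+x. Hn n x \<partial>lborel)" by (rule nn_integral_conv) auto
    also have "\<dots> < \<infinity>" using le_less_trans[OF K] Hn_L1[of n] by (simp add: ennreal_mult_less_top)
    finally show "(\<integral>\<^sup>+x. ennreal (norm (cx (conv K (Hn n)) x)) \<partial>lborel) < \<infinity>" .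
  qed measurable
  let ?d = "\<lambda>n. nsq (\<lambda>x. cx H x - cutoff n (cx H) x)"
  have d: "nsq (\<lambda>x. cx (conv K H) x - cx (conv K (Hn n)) x) \<le> ?d n" for n
  proof -
    have "nsq (\<lambda>x. cx (conv K H) x - cx (conv K (Hn n)) x) = (\<integral>\<^sup>+x. (edist (conv K H x) (conv K (Hn n) x))\<^sup>2 \<partial>lborel)"
      using conv_L2 by (intro nsq_cx_diff fin) auto
    also have "\<dots> \<le> (\<integral>\<^sup>+x. (conv K (\<lambda>y. edist (H y) (Hn n y)) x)\<^sup>2 \<partial>lborel)"
      by (intro nn_integral_mono power_mono conv_edist) auto
    also have "\<dots> \<le> (\<integral>\<^sup>+x. (edist (H x) (Hn n x))\<^sup>2 \<partial>lborel)" by (rule L2) measurable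
    also have "\<dots> = nsq (\<lambda>x. cx H x - cx (Hn n) x)"
      using H Hn_L2 by (intro nsq_cx_diff[symmetric] fin) auto
    finally show ?thesis by (simp only: fun_cong[OF cut])
  qed
  let ?u = "\<lambda>n. nsq (\<lambda>\<xi>. fourier_L1 (cutoff n (cx H)) \<xi> - fourier_L2 (cx H) \<xi>)"
  have "nsq (\<lambda>\<xi>. fourier_L2 (cx (conv K H)) \<xi> - khat K \<xi> * fourier_L2 (cx H) \<xi>) = 0"
  proof (rule nsq_le_tendsto_0)
    fix n
    have eq: "fourier_L1 (cx (conv K (Hn n))) \<xi> = khat K \<xi> * fourier_L1 (cutoff n (cx H)) \<xi>" for \<xi>
      using le_less_trans[OF K] Hn_L1[of n] by (subst fourier_L1_conv) (auto simp: cut)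
    have "nsq (\<lambda>\<xi>. fourier_L2 (cx (conv K H)) \<xi> - khat K \<xi> * fourier_L2 (cx H) \<xi>)
      \<le> 2 * nsq (\<lambda>\<xi>. fourier_L2 (cx (conv K H)) \<xi> - fourier_L1 (cx (conv K (Hn n))) \<xi>)
       + 2 * nsq (\<lambda>\<xi>. fourier_L1 (cx (conv K (Hn n))) \<xi> - khat K \<xi> * fourier_L2 (cx H) \<xi>)"
      by (rule nsq_triangle) measurable
    also have "nsq (\<lambda>\<xi>. fourier_L1 (cx (conv K (Hn n))) \<xi> - khat K \<xi> * fourier_L2 (cx H) \<xi>) \<le> ?u n"
      unfolding eq right_diff_distrib[symmetric] by (rule nsq_khat_mult_le) (use K in auto)
    also have "nsq (\<lambda>\<xi>. fourier_L2 (cx (conv K H)) \<xi> - fourier_L1 (cx (conv K (Hn n))) \<xi>)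
       \<le> 4 * nsq (\<lambda>x. cx (conv K H) x - cx (conv K (Hn n)) x)"
      by (rule fourier_L2_approx) (use memb int in auto)
    also have "\<dots> \<le> 4 * ?d n" by (intro mult_left_mono d) simp
    finally show "nsq (\<lambda>\<xi>. fourier_L2 (cx (conv K H)) \<xi> - khat K \<xi> * fourier_L2 (cx H) \<xi>) \<le> 2 * (4 * ?d n) + 2 * ?u n"
      by (simp add: add_mono mult_left_mono)
  next
    have "(\<lambda>n. 4 * ?d n) \<longlonglongrightarrow> 4 * 0"
      by (intro ennreal_tendsto_cmult nsq_cutoff_tendsto memb) simp
    then show "(\<lambda>n. 4 * ?d n) \<longlonglongrightarrow> 0" by simp
    show "?u \<longlonglongrightarrow> 0" using fourier_L2_limit[OF memb(1)] by (simp add: fourier_limit_def)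
  qed
  then have "AE \<xi> in lborel. fourier_L2 (cx (conv K H)) \<xi> - khat K \<xi> * fourier_L2 (cx H) \<xi> = 0"
    by (intro nsq_eq_0) auto
  then show ?thesis by (rule eventually_mono) simp
qed

text \<open>Each heat kernel contributes exp(-u |\<xi>|^2), so the transform of the mixture is the
  Laplace transform of the weight.\<close>

lemma khat_mix:
  assumes [measurable]: "w \<in> borel_measurable borel" and mass: "(\<integral>\<^sup>+z. mix w z \<partial>lborel) \<le> 1"
  shows "khat (mix w) \<xi> = of_real (enn2real (\<integral>\<^sup>+u. w u * ennreal (exp (- u * (norm \<xi>)\<^sup>2)) * indicator {0<..} u \<partial>lborel))"
proof -
  let ?g = "\<lambda>u. w u * ennreal (exp (- u * (norm \<xi>)\<^sup>2)) * indicator {0<..} u"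
  have fin: "(\<integral>\<^sup>+u. w u * indicator {0<..} u \<partial>lborel) < \<infinity>"
    using mass unfolding nn_integral_mix[OF assms(1)] by (rule le_less_trans) simp
  have "khat (mix w) \<xi> = (LINT u|lborel. LINT z|lborel. cis (- (z \<bullet> \<xi>)) * of_real (enn2real (w u * ennreal (heat u z))))"
    unfolding khat_def mix_def
  proof (rule cx_integral_swap[where k = "\<lambda>z u. w u * ennreal (heat u z)" and e = "\<lambda>z. cis (- (z \<bullet> \<xi>))"])
    show "(\<lambda>(z, u). w u * ennreal (heat u z)) \<in> borel_measurable (borel \<Otimes>\<^sub>M borel)"
      and "(\<lambda>z. cis (- (z \<bullet> \<xi>))) \<in> borel_measurable borel" by measurable
    show "(\<integral>\<^sup>+z. \<integral>\<^sup>+u. w u * ennreal (heat u z) \<partial>lborel \<partial>lborel) < \<infinity>"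
      using le_less_trans[OF mass] unfolding mix_def by simp
  qed simp
  also have "\<dots> = (LINT u|lborel. complex_of_real (enn2real (?g u)))"
  proof (rule Bochner_Integration.integral_cong[OF refl])
    fix u
    show "(LINT z|lborel. cis (- (z \<bullet> \<xi>)) * of_real (enn2real (w u * ennreal (heat u z)))) = complex_of_real (enn2real (?g u))"
    proof (cases "u > 0")
      case True
      have "(LINT z|lborel. cis (- (z \<bullet> \<xi>)) * of_real (enn2real (w u * ennreal (heat u z))))
          = (LINT z|lborel. of_real (enn2real (w u)) * (cis (- (z \<bullet> \<xi>)) * of_real (heat u z)))"
        by (simp add: enn2real_mult mult_ac)
      also have "\<dots> = of_real (enn2real (w u)) * of_real (exp (- u * (norm \<xi>)\<^sup>2))"
        by (simp add: fourier_heat[OF True])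
      finally show ?thesis using True by (simp add: enn2real_mult)
    qed simp
  qed
  also have "\<dots> = of_real (LINT u|lborel. enn2real (?g u))" by simp
  also have "(LINT u|lborel. enn2real (?g u)) = enn2real (\<integral>\<^sup>+u. ?g u \<partial>lborel)"
  proof -
    have "AE u in lborel. w u * indicator {0<..} u \<noteq> \<infinity>"
      using fin by (intro nn_integral_PInf_AE) auto
    then have "AE u in lborel. ennreal (enn2real (?g u)) = ?g u"
    proof eventually_elim
      fix u :: real assume *: "w u * indicator {0<..} u \<noteq> \<infinity>"
      have "?g u = (w u * indicator {0<..} u) * ennreal (exp (- u * (norm \<xi>)\<^sup>2))" by (simp only: mult_ac)
      also have "\<dots> < top" using * by (simp add: ennreal_mult_less_top less_top)
      finally show "ennreal (enn2real (?g u)) = ?g u" by simp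
    qed
    then have "(\<integral>\<^sup>+u. ennreal (enn2real (?g u)) \<partial>lborel) = (\<integral>\<^sup>+u. ?g u \<partial>lborel)"
      by (rule nn_integral_cong_AE)
    then show ?thesis by (subst integral_eq_nn_integral) auto
  qed
  finally show ?thesis .
qed

text \<open>For \<open>\<mu> = m / \<kappa>\<close>, \<open>mix (dil_weight \<kappa> \<mu>)\<close> is the kernel of $(\sqrt{-\Delta + m^2} + \kappa)^{-1}$.\<close>

definition dil_weight :: "real \<Rightarrow> real \<Rightarrow> real \<Rightarrow> ennreal" where
  "dil_weight \<kappa> \<mu> v = ennreal \<kappa> * res_weight \<mu> (\<kappa>\<^sup>2 * v)"

lemma measurable_dil_weight [measurable]: "dil_weight \<kappa> \<mu> \<in> borel_measurable borel"
  unfolding dil_weight_def[abs_def] by measurable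

text \<open>The substitution u = \<kappa>^2 v with the parabolic scaling of the heat kernel. The
  operator identity behind it is that sqrt(-Laplacian + m^2) + \<kappa> is \<kappa> times a dilated
  copy of the operator with mass \<mu> = m / \<kappa> and shift 1.\<close>

lemma mix_dil_weight:
  assumes \<kappa>: "\<kappa> > 0"
  shows "mix (dil_weight \<kappa> \<mu>) z = ennreal (\<kappa>\<^sup>2) * res_kernel \<mu> (\<kappa> *\<^sub>R z)"
proof -
  have "res_kernel \<mu> (\<kappa> *\<^sub>R z) = ennreal \<bar>\<kappa>\<^sup>2\<bar> * (\<integral>\<^sup>+v. res_weight \<mu> (0 + \<kappa>\<^sup>2 * v) * ennreal (heat (0 + \<kappa>\<^sup>2 * v) (\<kappa> *\<^sub>R z)) \<partial>lborel)"
    unfolding res_kernel_def mix_def using \<kappa> by (subst nn_integral_real_affine[of _ "\<kappa>\<^sup>2" 0]) auto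
  also have "\<dots> = ennreal (\<kappa>\<^sup>2) * (\<integral>\<^sup>+v. ennreal (1 / \<kappa> ^ 4) * (dil_weight \<kappa> \<mu> v * ennreal (heat v z)) \<partial>lborel)"
  proof -
    have "res_weight \<mu> (0 + \<kappa>\<^sup>2 * v) * ennreal (heat (0 + \<kappa>\<^sup>2 * v) (\<kappa> *\<^sub>R z))
      = ennreal (1 / \<kappa> ^ 4) * (dil_weight \<kappa> \<mu> v * ennreal (heat v z))" for v
    proof -
      have "ennreal (heat (\<kappa>\<^sup>2 * v) (\<kappa> *\<^sub>R z)) = ennreal (1 / \<kappa> ^ 4) * ennreal \<kappa> * ennreal (heat v z)"
        using \<kappa> by (simp add: heat_scale ennreal_mult[symmetric] power4_eq_xxxx power3_eq_cube)
      then show ?thesis by (simp add: dil_weight_def mult_ac)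
    qed
    then show ?thesis using \<kappa> by simp
  qed
  also have "\<dots> = ennreal (\<kappa>\<^sup>2) * ennreal (1 / \<kappa> ^ 4) * mix (dil_weight \<kappa> \<mu>) z"
    unfolding mix_def by (subst nn_integral_cmult) (auto simp: mult.assoc)
  finally have "ennreal (\<kappa>\<^sup>2) * res_kernel \<mu> (\<kappa> *\<^sub>R z) = (ennreal (\<kappa>\<^sup>2) * (ennreal (\<kappa>\<^sup>2) * ennreal (1 / \<kappa> ^ 4))) * mix (dil_weight \<kappa> \<mu>) z"
    by (simp add: mult.assoc)
  also have "ennreal (\<kappa>\<^sup>2) * (ennreal (\<kappa>\<^sup>2) * ennreal (1 / \<kappa> ^ 4)) = 1"
    using \<kappa> by (simp add: ennreal_mult[symmetric] power4_eq_xxxx power2_eq_square)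
  finally show ?thesis by simp
qed

lemma dil_weight_laplace:
  assumes \<kappa>: "\<kappa> > 0" and a: "a \<ge> 0"
  shows "(\<integral>\<^sup>+u. dil_weight \<kappa> \<mu> u * ennreal (exp (- u * a)) * indicator {0<..} u \<partial>lborel)
    = ennreal (1 / \<kappa>) * stieltjes (a / \<kappa>\<^sup>2 + \<mu>\<^sup>2)"
proof -
  have "stieltjes (a / \<kappa>\<^sup>2 + \<mu>\<^sup>2) = (\<integral>\<^sup>+u. res_weight \<mu> u * ennreal (exp (- u * (a / \<kappa>\<^sup>2))) * indicator {0<..} u \<partial>lborel)"
    using a by (intro res_weight_laplace[symmetric]) simp
  also have "\<dots> = ennreal \<bar>\<kappa>\<^sup>2\<bar> * (\<integral>\<^sup>+v. res_weight \<mu> (0 + \<kappa>\<^sup>2 * v) * ennreal (exp (- (0 + \<kappa>\<^sup>2 * v) * (a / \<kappa>\<^sup>2))) * indicator {0<..} (0 + \<kappa>\<^sup>2 * v) \<partial>lborel)"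
    using \<kappa> by (subst nn_integral_real_affine[of _ "\<kappa>\<^sup>2" 0]) auto
  also have "\<dots> = ennreal (\<kappa>\<^sup>2) * (\<integral>\<^sup>+v. res_weight \<mu> (\<kappa>\<^sup>2 * v) * ennreal (exp (- v * a)) * indicator {0<..} v \<partial>lborel)"
    using \<kappa> by (simp add: zero_less_mult_iff indicator_def)
  finally have "ennreal (1 / \<kappa>) * stieltjes (a / \<kappa>\<^sup>2 + \<mu>\<^sup>2)
     = (ennreal (1 / \<kappa>) * ennreal (\<kappa>\<^sup>2)) * (\<integral>\<^sup>+v. res_weight \<mu> (\<kappa>\<^sup>2 * v) * ennreal (exp (- v * a)) * indicator {0<..} v \<partial>lborel)"
    by (simp add: mult.assoc)
  also have "ennreal (1 / \<kappa>) * ennreal (\<kappa>\<^sup>2) = ennreal \<kappa>"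
    using \<kappa> by (simp add: ennreal_mult[symmetric] power2_eq_square)
  also have "ennreal \<kappa> * (\<integral>\<^sup>+v. res_weight \<mu> (\<kappa>\<^sup>2 * v) * ennreal (exp (- v * a)) * indicator {0<..} v \<partial>lborel)
     = (\<integral>\<^sup>+u. dil_weight \<kappa> \<mu> u * ennreal (exp (- u * a)) * indicator {0<..} u \<partial>lborel)"
    unfolding dil_weight_def by (subst nn_integral_cmult[symmetric]) (auto simp: mult_ac)
  finally show ?thesis ..
qed

text \<open>The mass is the multiplier at frequency 0, at most 1 / \<kappa>; here \<kappa> >= 1
  makes convolution a contraction.\<close>

lemma nn_integral_mix_dil_weight:
  assumes \<kappa>: "\<kappa> \<ge> 1"
  shows "(\<integral>\<^sup>+z. mix (dil_weight \<kappa> \<mu>) z \<partial>lborel) \<le> 1"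
proof -
  have "(\<integral>\<^sup>+z. mix (dil_weight \<kappa> \<mu>) z \<partial>lborel) = ennreal (1 / \<kappa>) * stieltjes (\<mu>\<^sup>2)"
    using dil_weight_laplace[of \<kappa> 0 \<mu>] \<kappa> by (simp add: nn_integral_mix)
  also have "\<dots> \<le> 1 * 1"
    using \<kappa> by (intro mult_mono stieltjes_le_1) (auto simp: ennreal_le_1)
  finally show ?thesis by simp
qed

lemma khat_dil:
  assumes \<kappa>: "\<kappa> \<ge> 1"
  shows "AE \<xi> in lborel. khat (mix (dil_weight \<kappa> (m / \<kappa>))) \<xi> = of_real (1 / (\<kappa> + sqrt_symbol m \<xi>))"
proof -
  \<comment> \<open>On this sphere the argument of \<open>stieltjes\<close> equals 1, and at the
    origin it vanishes if m = 0; both values are outside the scope of \<open>stieltjes_eq\<close>,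
    and both sets are null.\<close>
  have "sphere (0::real^3) (sqrt (\<kappa>\<^sup>2 - m\<^sup>2)) \<in> null_sets lborel"
    using negligible_sphere by (auto simp: negligible_iff_null_sets null_sets_completion_iff)
  then have "AE \<xi> in lborel. \<xi> \<notin> sphere (0::real^3) (sqrt (\<kappa>\<^sup>2 - m\<^sup>2))" by (rule AE_not_in)
  with AE_lborel_singleton[of 0] show ?thesis
  proof eventually_elim
    fix \<xi> :: "real^3"
    assume \<xi>: "\<xi> \<noteq> 0" "\<xi> \<notin> sphere 0 (sqrt (\<kappa>\<^sup>2 - m\<^sup>2))"
    let ?a = "(norm \<xi>)\<^sup>2 / \<kappa>\<^sup>2 + (m / \<kappa>)\<^sup>2"
    have a_eq: "?a = ((norm \<xi>)\<^sup>2 + m\<^sup>2) / \<kappa>\<^sup>2" by (simp add: power_divide add_divide_distrib)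
    have a: "?a > 0" using \<xi> \<kappa> by (intro add_pos_nonneg divide_pos_pos) auto
    have a1: "?a \<noteq> 1"
    proof
      assume "?a = 1"
      then have "(norm \<xi>)\<^sup>2 = \<kappa>\<^sup>2 - m\<^sup>2" using \<kappa> by (simp add: a_eq field_simps)
      then have "norm \<xi> = sqrt (\<kappa>\<^sup>2 - m\<^sup>2)" by (metis norm_ge_zero real_sqrt_unique)
      then show False using \<xi> by simp
    qed
    have "khat (mix (dil_weight \<kappa> (m / \<kappa>))) \<xi> = of_real (enn2real (\<integral>\<^sup>+u. dil_weight \<kappa> (m / \<kappa>) u * ennreal (exp (- u * (norm \<xi>)\<^sup>2)) * indicator {0<..} u \<partial>lborel))"
      by (rule khat_mix[OF measurable_dil_weight nn_integral_mix_dil_weight[OF \<kappa>]])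
    also have "(\<integral>\<^sup>+u. dil_weight \<kappa> (m / \<kappa>) u * ennreal (exp (- u * (norm \<xi>)\<^sup>2)) * indicator {0<..} u \<partial>lborel) = ennreal (1 / \<kappa>) * stieltjes ?a"
      using \<kappa> by (intro dil_weight_laplace) auto
    also have "stieltjes ?a = ennreal (1 / (1 + sqrt ?a))" by (rule stieltjes_eq[OF a a1])
    also have "ennreal (1 / \<kappa>) * ennreal (1 / (1 + sqrt ?a)) = ennreal (1 / \<kappa> * (1 / (1 + sqrt ?a)))"
      using \<kappa> a by (intro ennreal_mult[symmetric]) auto
    also have "1 / \<kappa> * (1 / (1 + sqrt ?a)) = 1 / (\<kappa> + sqrt_symbol m \<xi>)"
    proof -
      have "sqrt ?a = sqrt_symbol m \<xi> / \<kappa>"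
        using \<kappa> unfolding a_eq sqrt_symbol_def by (simp add: real_sqrt_divide)
      then have "\<kappa> * (1 + sqrt ?a) = \<kappa> + sqrt_symbol m \<xi>" using \<kappa> by (simp add: field_simps)
      then show ?thesis by simp
    qed
    finally show "khat (mix (dil_weight \<kappa> (m / \<kappa>))) \<xi> = of_real (1 / (\<kappa> + sqrt_symbol m \<xi>))"
      using \<kappa> by (simp add: sqrt_symbol_def add_nonneg_nonneg)
  qed
qed

section \<open>Solitary waves\<close>

text \<open>The exponent 3/2 preserves the L2 norm in three dimensions.\<close>

definition dilate :: "real \<Rightarrow> (real^3 \<Rightarrow> ennreal) \<Rightarrow> real^3 \<Rightarrow> ennreal" where
  "dilate \<kappa> P x = ennreal (\<kappa> powr (3/2)) * P (\<kappa> *\<^sub>R x)"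

lemma measurable_dilate [measurable]:
  assumes [measurable]: "P \<in> borel_measurable borel"
  shows "dilate \<kappa> P \<in> borel_measurable borel"
  unfolding dilate_def[abs_def] by measurable

lemma rdec_dilate:
  assumes "rdec P"
  shows "rdec (dilate \<kappa> P)"
  unfolding dilate_def[abs_def]
  by (intro rdecI mult_left_mono rdecD[OF assms]) (auto intro: mult_left_mono)

lemma dilate_dilate:
  assumes "\<kappa> > 0" "\<sigma> > 0"
  shows "dilate \<kappa> (dilate \<sigma> P) = dilate (\<kappa> * \<sigma>) P"
  using assms by (auto simp: dilate_def fun_eq_iff powr_mult ennreal_mult mult_ac)

lemma powr_three_halves_square: "0 < \<kappa> \<Longrightarrow> (\<kappa> powr (3/2))\<^sup>2 = \<kappa> ^ 3" for \<kappa> :: real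
  by (simp add: powr_power powr_numeral)

lemma powr_five_halves_square: "0 < \<kappa> \<Longrightarrow> (\<kappa> powr (5/2))\<^sup>2 = \<kappa>\<^sup>2 * \<kappa> ^ 3" for \<kappa> :: real
  by (simp add: powr_power powr_numeral flip: power_add)

lemma edist_cmult:
  assumes "0 < c"
  shows "edist (ennreal c * a) (ennreal c * b) = ennreal c * edist a b"
proof (cases a; cases b)
  fix r s assume *: "0 \<le> r" "a = ennreal r" "0 \<le> s" "b = ennreal s"
  have "\<bar>c * r - c * s\<bar> = c * \<bar>r - s\<bar>"
    using assms by (simp add: abs_mult flip: right_diff_distrib)
  then show ?thesis using * assms by (simp add: edist_ennreal ennreal_mult[symmetric])
qed (use assms in \<open>auto simp: edist_top ennreal_mult_top ennreal_mult[symmetric]\<close>)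

lemma nn_integral_dilate_square:
  assumes [measurable]: "f \<in> borel_measurable borel" and "\<kappa> > 0"
  shows "(\<integral>\<^sup>+x. (dilate \<kappa> f x)\<^sup>2 \<partial>lborel) = (\<integral>\<^sup>+x. (f x)\<^sup>2 \<partial>lborel)"
proof -
  have "(\<integral>\<^sup>+x. (dilate \<kappa> f x)\<^sup>2 \<partial>lborel) = ennreal (\<kappa> ^ 3) * (\<integral>\<^sup>+x. (f (\<kappa> *\<^sub>R x))\<^sup>2 \<partial>lborel)"
    using assms(2) by (subst nn_integral_cmult[symmetric])
      (auto simp: dilate_def power_mult_distrib ennreal_power powr_three_halves_square)
  also have "\<dots> = (\<integral>\<^sup>+x. (f x)\<^sup>2 \<partial>lborel)"
    using assms(2) by (subst nn_integral_scale[where c = \<kappa> and f = "\<lambda>x. (f x)\<^sup>2"]) auto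
  finally show ?thesis .
qed

lemma nn_integral_dilate_edist:
  assumes [measurable]: "f \<in> borel_measurable borel" "g \<in> borel_measurable borel" and "\<kappa> > 0"
  shows "(\<integral>\<^sup>+x. (edist (dilate \<kappa> f x) (dilate \<kappa> g x))\<^sup>2 \<partial>lborel) = (\<integral>\<^sup>+x. (edist (f x) (g x))\<^sup>2 \<partial>lborel)"
proof -
  have "edist (dilate \<kappa> f x) (dilate \<kappa> g x) = dilate \<kappa> (\<lambda>x. edist (f x) (g x)) x" for x
    using assms(3) by (simp add: dilate_def edist_cmult)
  then show ?thesis using nn_integral_dilate_square[of "\<lambda>x. edist (f x) (g x)" \<kappa>] assms(3) by simp
qed

lemma pot_dilate:
  assumes [measurable]: "P \<in> borel_measurable borel" and "\<kappa> > 0"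
  shows "pot (dilate \<kappa> P) x = ennreal \<kappa> * pot P (\<kappa> *\<^sub>R x)"
proof -
  have "pot (dilate \<kappa> P) x = (ennreal (\<kappa> powr (3/2)))\<^sup>2 * pot (\<lambda>x. P (\<kappa> *\<^sub>R x)) x"
    unfolding dilate_def[abs_def] by (rule pot_cmult) measurable
  also have "(ennreal (\<kappa> powr (3/2)))\<^sup>2 = ennreal \<kappa> * ennreal (\<kappa>\<^sup>2)"
  proof -
    have "(ennreal (\<kappa> powr (3/2)))\<^sup>2 = ennreal (\<kappa> ^ 3)"
      using assms(2) by (simp add: ennreal_power powr_three_halves_square)
    also have "\<kappa> ^ 3 = \<kappa> * \<kappa>\<^sup>2" by (simp add: eval_nat_numeral)
    finally show ?thesis using assms(2) by (simp add: ennreal_mult)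
  qed
  also have "\<dots> * pot (\<lambda>x. P (\<kappa> *\<^sub>R x)) x = ennreal \<kappa> * pot P (\<kappa> *\<^sub>R x)"
    unfolding pot_def mult.assoc using assms(2)
    by (subst conv_coulomb_scale[where f = "\<lambda>y. (P y)\<^sup>2"]) auto
  finally show ?thesis .
qed

lemma hartree_dilate:
  assumes "P \<in> borel_measurable borel" and "\<kappa> > 0"
  shows "hartree (dilate \<kappa> P) x = ennreal (\<kappa> powr (5/2)) * hartree P (\<kappa> *\<^sub>R x)"
proof -
  have "\<kappa> powr (5/2) = \<kappa> * \<kappa> powr (3/2)"
    using assms(2) powr_add[of \<kappa> 1 "3/2"] by simp
  then show ?thesis
    using assms by (simp add: hartree_def pot_dilate dilate_def ennreal_mult mult_ac)
qed

lemma hartree_dilate_L2: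
  assumes [measurable]: "P \<in> borel_measurable borel" and "\<kappa> > 0"
  shows "(\<integral>\<^sup>+x. (hartree (dilate \<kappa> P) x)\<^sup>2 \<partial>lborel) = ennreal (\<kappa>\<^sup>2) * (\<integral>\<^sup>+x. (hartree P x)\<^sup>2 \<partial>lborel)"
proof -
  have "(\<integral>\<^sup>+x. (hartree (dilate \<kappa> P) x)\<^sup>2 \<partial>lborel) = (ennreal (\<kappa>\<^sup>2) * ennreal (\<kappa> ^ 3)) * (\<integral>\<^sup>+x. (hartree P (\<kappa> *\<^sub>R x))\<^sup>2 \<partial>lborel)"
  proof -
    have "(ennreal (\<kappa> powr (5/2)))\<^sup>2 = ennreal (\<kappa>\<^sup>2) * ennreal (\<kappa> ^ 3)"
      unfolding ennreal_power[OF powr_ge_zero] powr_five_halves_square[OF assms(2)]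
      using assms(2) by (intro ennreal_mult) auto
    then show ?thesis
      using assms by (simp add: hartree_dilate power_mult_distrib nn_integral_cmult)
  qed
  also have "\<dots> = ennreal (\<kappa>\<^sup>2) * (\<integral>\<^sup>+x. (hartree P x)\<^sup>2 \<partial>lborel)"
    using assms(2) by (subst nn_integral_scale[where c = \<kappa> and f = "\<lambda>x. (hartree P x)\<^sup>2"]) (auto simp: mult.assoc)
  finally show ?thesis .
qed

text \<open>The powers balance: 3/2 from the dilation and 3 from the change of variables, against 2
  from the dilated kernel and 5/2 from the Hartree term. This is the L2-critical scaling.\<close>

lemma dilate_ground_state:
  assumes P: "ground_state \<mu> P" and \<kappa>: "\<kappa> > 0"
  shows "dilate \<kappa> P = conv (mix (dil_weight \<kappa> \<mu>)) (hartree (dilate \<kappa> P))"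
proof
  fix x
  note [measurable] = ground_state_measurable[OF P]
  have c: "\<kappa> powr (3/2) * \<kappa> ^ 3 = \<kappa>\<^sup>2 * \<kappa> powr (5/2)"
  proof -
    have "\<kappa> powr (3/2) * \<kappa> ^ 3 = \<kappa> powr (3/2 + 3)" "\<kappa>\<^sup>2 * \<kappa> powr (5/2) = \<kappa> powr (2 + 5/2)"
      unfolding powr_add using \<kappa> by (simp_all add: powr_numeral)
    then show ?thesis by simp
  qed
  have "dilate \<kappa> P x = ennreal (\<kappa> powr (3/2)) * conv (res_kernel \<mu>) (hartree P) (\<kappa> *\<^sub>R x)"
    using P by (simp add: dilate_def ground_state_def)
  also have "\<dots> = ennreal (\<kappa> powr (3/2)) * (ennreal (\<kappa> ^ 3) * (\<integral>\<^sup>+y. res_kernel \<mu> (\<kappa> *\<^sub>R x - \<kappa> *\<^sub>R y) * hartree P (\<kappa> *\<^sub>R y) \<partial>lborel))"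
    unfolding conv_def using \<kappa> by (subst nn_integral_scale[where c = \<kappa>]) auto
  also have "\<dots> = ennreal (\<kappa>\<^sup>2 * \<kappa> powr (5/2)) * (\<integral>\<^sup>+y. res_kernel \<mu> (\<kappa> *\<^sub>R (x - y)) * hartree P (\<kappa> *\<^sub>R y) \<partial>lborel)"
    using \<kappa> by (simp add: ennreal_mult[symmetric] mult.assoc[symmetric] c scaleR_diff_right)
  also have "\<dots> = conv (mix (dil_weight \<kappa> \<mu>)) (hartree (dilate \<kappa> P)) x"
    unfolding conv_def using \<kappa> by (subst nn_integral_cmult[symmetric])
      (auto simp: mix_dil_weight hartree_dilate ennreal_mult mult_ac)
  finally show "dilate \<kappa> P x = conv (mix (dil_weight \<kappa> \<mu>)) (hartree (dilate \<kappa> P)) x" .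
qed

text \<open>The kernels disagree at most at y = x, a null set. Both sides use the same default:
  where the potential is infinite, the Bochner integral and \<open>enn2real\<close> both give 0, so
  the equality holds at every x.\<close>

lemma hartree_term_cx:
  assumes [measurable]: "Q \<in> borel_measurable borel" and fin: "AE x in lborel. Q x \<noteq> top"
  shows "hartree_term (cx Q) = cx (hartree Q)"
proof
  fix x
  have "hartree_potential (cx Q) x = enn2real (\<integral>\<^sup>+y. ennreal ((cmod (cx Q y))\<^sup>2 / norm (x - y)) \<partial>lborel)"
    unfolding hartree_potential_def by (rule integral_eq_nn_integral) auto
  also have "(\<integral>\<^sup>+y. ennreal ((cmod (cx Q y))\<^sup>2 / norm (x - y)) \<partial>lborel) = pot Q x"
    unfolding pot_def conv_def
  proof (rule nn_integral_cong_AE)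
    show "AE y in lborel. ennreal ((cmod (cx Q y))\<^sup>2 / norm (x - y)) = coulomb (x - y) * (Q y)\<^sup>2"
      using fin AE_lborel_singleton[of x]
    proof eventually_elim
      fix y assume "Q y \<noteq> top" "y \<noteq> x"
      then show "ennreal ((cmod (cx Q y))\<^sup>2 / norm (x - y)) = coulomb (x - y) * (Q y)\<^sup>2"
        by (cases "Q y") (auto simp: coulomb_eq ennreal_power ennreal_mult[symmetric])
    qed
  qed
  finally show "hartree_term (cx Q) x = cx (hartree Q) x"
    by (simp add: hartree_term_def hartree_def enn2real_mult)
qed

lemma dilate_ground_state_L2:
  assumes P: "ground_state \<mu> P" and \<kappa>: "\<kappa> > 0"
  shows "(\<integral>\<^sup>+x. (dilate \<kappa> P x)\<^sup>2 \<partial>lborel) \<le> (\<integral>\<^sup>+x. (ground_bound x)\<^sup>2 \<partial>lborel)"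
    and "(\<integral>\<^sup>+x. (dilate \<kappa> P x)\<^sup>2 \<partial>lborel) < \<infinity>"
    and "AE x in lborel. dilate \<kappa> P x \<noteq> top"
    and "(\<integral>\<^sup>+x. (hartree (dilate \<kappa> P) x)\<^sup>2 \<partial>lborel) < \<infinity>"
proof -
  note [measurable] = ground_state_measurable[OF P]
  show le: "(\<integral>\<^sup>+x. (dilate \<kappa> P x)\<^sup>2 \<partial>lborel) \<le> (\<integral>\<^sup>+x. (ground_bound x)\<^sup>2 \<partial>lborel)"
    using ground_state_L2[OF P] \<kappa> by (simp add: nn_integral_dilate_square)
  show fin: "(\<integral>\<^sup>+x. (dilate \<kappa> P x)\<^sup>2 \<partial>lborel) < \<infinity>"
    using le ground_bound_L2 by (rule le_less_trans)
  show "AE x in lborel. dilate \<kappa> P x \<noteq> top"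
    by (rule AE_finite_of_L2[OF _ fin]) measurable
  have "(\<integral>\<^sup>+x. (hartree P x)\<^sup>2 \<partial>lborel) < \<infinity>"
    using P inverse_quart_low_finite by (intro controlled_hartree_L2) (auto simp: ground_state_def)
  then show "(\<integral>\<^sup>+x. (hartree (dilate \<kappa> P) x)\<^sup>2 \<partial>lborel) < \<infinity>"
    using \<kappa> by (simp add: hartree_dilate_L2 ennreal_mult_less_top)
qed

lemma dilate_ground_state_memb:
  assumes P: "ground_state \<mu> P" and \<kappa>: "\<kappa> > 0"
  shows "cx (dilate \<kappa> P) \<in> L2" "hartree_term (cx (dilate \<kappa> P)) \<in> L2" "cx (dilate \<kappa> P) \<in> L2_rad"
proof -
  note [measurable] = ground_state_measurable[OF P]
  note fin = dilate_ground_state_L2[OF P \<kappa>]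
  show L2: "cx (dilate \<kappa> P) \<in> L2" by (rule cx_L2[OF _ fin(2)]) measurable
  show "hartree_term (cx (dilate \<kappa> P)) \<in> L2"
    unfolding hartree_term_cx[OF measurable_dilate[OF ground_state_measurable[OF P]] fin(3)]
    by (rule cx_L2[OF _ fin(4)]) measurable
  have "rdec (dilate \<kappa> P)" using P by (auto simp: ground_state_def controlled_def intro: rdec_dilate)
  then have "dilate \<kappa> P x = dilate \<kappa> P (norm x *\<^sub>R e3)" for x by (rule rdec_eq) simp
  then have "AE x in lborel. cx (dilate \<kappa> P) x = cx (dilate \<kappa> P) (norm x *\<^sub>R e3)" by simp
  then show "cx (dilate \<kappa> P) \<in> L2_rad" using L2 unfolding L2_rad_def
    by (auto intro!: exI[of _ "\<lambda>r. cx (dilate \<kappa> P) (r *\<^sub>R e3)"])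
qed

text \<open>The convolution equation of \<open>dilate_ground_state\<close> read on the Fourier side,
  with the multiplier from \<open>khat_dil\<close>.\<close>

lemma dilate_ground_state_equation:
  assumes P: "ground_state (m / \<kappa>) P" and \<kappa>: "\<kappa> \<ge> 1"
  shows "AE \<xi> in lborel. fourier_L2 (cx (dilate \<kappa> P)) \<xi>
    = of_real (1 / (\<kappa> + sqrt_symbol m \<xi>)) * fourier_L2 (hartree_term (cx (dilate \<kappa> P))) \<xi>"
proof -
  have \<kappa>': "\<kappa> > 0" using \<kappa> by simp
  note [measurable] = ground_state_measurable[OF P]
  note fin = dilate_ground_state_L2[OF P \<kappa>']
  have "AE \<xi> in lborel. fourier_L2 (cx (conv (mix (dil_weight \<kappa> (m / \<kappa>))) (hartree (dilate \<kappa> P)))) \<xi>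
     = khat (mix (dil_weight \<kappa> (m / \<kappa>))) \<xi> * fourier_L2 (cx (hartree (dilate \<kappa> P))) \<xi>"
    by (rule fourier_L2_conv) (use fin nn_integral_mix_dil_weight[OF \<kappa>] in auto)
  with khat_dil[OF \<kappa>, of m] show ?thesis
    unfolding dilate_ground_state[OF P \<kappa>', symmetric]
      hartree_term_cx[OF measurable_dilate[OF ground_state_measurable[OF P]] fin(3)]
    by eventually_elim simp
qed

section \<open>Sobolev regularity and the evolution equation\<close>

lemma sobolev_sq_cong_AE: "(AE \<xi> in lborel. v \<xi> = w \<xi>) \<Longrightarrow> sobolev_sq s v = sobolev_sq s w"
  unfolding sobolev_sq_def by (intro nn_integral_cong_AE) (auto elim: eventually_mono)

lemma sobolev_sq_cmult:
  assumes [measurable]: "v \<in> borel_measurable borel"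
  shows "sobolev_sq s (\<lambda>\<xi>. c * v \<xi>) = ennreal ((cmod c)\<^sup>2) * sobolev_sq s v"
  unfolding sobolev_sq_def
  by (subst nn_integral_cmult[symmetric])
     (auto simp: norm_mult power_mult_distrib ennreal_mult[symmetric] mult_ac)

lemma sobolev_sq_mono: "s \<le> s' \<Longrightarrow> sobolev_sq s v \<le> sobolev_sq s' v"
  unfolding sobolev_sq_def
  by (intro nn_integral_mono ennreal_leI mult_right_mono powr_mono) auto

text \<open>The resolvent gains a whole derivative: the weight (1 + |\<xi>|^2)^(1/2) is at most the
  square of \<kappa> plus the symbol, so the norm is bounded by the L2 norm of the Hartree
  term.\<close>

lemma dilate_ground_state_H_half:
  assumes P: "ground_state (m / \<kappa>) P" and \<kappa>: "\<kappa> \<ge> 1"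
  shows "cx (dilate \<kappa> P) \<in> H_half"
proof -
  let ?q = "cx (dilate \<kappa> P)"
  have \<kappa>': "\<kappa> > 0" using \<kappa> by simp
  note memb = dilate_ground_state_memb[OF P \<kappa>']
  let ?w = "fourier_L2 (hartree_term ?q)"
  have "sobolev_sq (1/2) (fourier_L2 ?q) = sobolev_sq (1/2) (\<lambda>\<xi>. of_real (1 / (\<kappa> + sqrt_symbol m \<xi>)) * ?w \<xi>)"
    by (rule sobolev_sq_cong_AE[OF dilate_ground_state_equation[OF P \<kappa>]])
  also have "\<dots> \<le> nsq ?w"
    unfolding sobolev_sq_def nsq_def
  proof (intro nn_integral_mono ennreal_leI)
    fix \<xi> :: "real^3"
    let ?D = "\<kappa> + sqrt_symbol m \<xi>"
    have nm: "norm \<xi> \<le> sqrt_symbol m \<xi>" unfolding sqrt_symbol_def by (rule real_le_rsqrt) simp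
    have D: "1 + norm \<xi> \<le> ?D" using nm \<kappa> by simp
    then have D0: "?D > 0" by (smt (verit) norm_ge_zero)
    have "(1 + (norm \<xi>)\<^sup>2) powr (1/2) \<le> (1 + (norm \<xi>)\<^sup>2) powr 1" by (rule powr_mono) auto
    also have "\<dots> \<le> (1 + norm \<xi>)\<^sup>2" by (simp add: power2_sum)
    also have "\<dots> \<le> ?D\<^sup>2" using D by (intro power_mono) auto
    finally have le: "(1 + (norm \<xi>)\<^sup>2) powr (1/2) * (1 / ?D)\<^sup>2 \<le> 1"
      using D0 by (simp add: power_divide)
    have "(1 + (norm \<xi>)\<^sup>2) powr (1/2) * (cmod (of_real (1 / ?D) * ?w \<xi>))\<^sup>2
       = ((1 + (norm \<xi>)\<^sup>2) powr (1/2) * (1 / ?D)\<^sup>2) * (cmod (?w \<xi>))\<^sup>2"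
      by (simp only: norm_mult norm_of_real power_mult_distrib power2_abs mult.assoc)
    also have "\<dots> \<le> 1 * (cmod (?w \<xi>))\<^sup>2" by (rule mult_right_mono[OF le]) simp
    finally show "(1 + (norm \<xi>)\<^sup>2) powr (1/2) * (cmod (of_real (1 / ?D) * ?w \<xi>))\<^sup>2 \<le> (cmod (?w \<xi>))\<^sup>2"
      by simp
  qed
  also have "\<dots> < \<infinity>" using fourier_L2_in_L2[OF memb(2)] by (simp add: L2_iff)
  finally show ?thesis using memb(1) by (simp add: H_half_def)
qed

lemma hartree_term_phase:
  assumes "cmod c = 1"
  shows "hartree_term (\<lambda>x. c * q x) = (\<lambda>x. c * hartree_term q x)"
  using assms by (simp add: fun_eq_iff hartree_term_def hartree_potential_def norm_mult)

lemma cis_difference_quotient: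
  "((\<lambda>s. (cis (\<kappa> * s) - cis (\<kappa> * t)) / of_real (s - t)) \<longlongrightarrow> \<i> * of_real \<kappa> * cis (\<kappa> * t)) (at t within S)"
proof -
  let ?f = "\<lambda>z. exp (\<i> * of_real \<kappa> * z)"
  have "(?f has_field_derivative (\<i> * of_real \<kappa> * ?f (of_real t))) (at (of_real t))"
    by (auto intro!: derivative_eq_intros)
  then have "((\<lambda>z. (?f z - ?f (of_real t)) / (z - of_real t)) \<longlongrightarrow> \<i> * of_real \<kappa> * ?f (of_real t)) (at (of_real t))"
    by (simp add: has_field_derivative_iff)
  moreover have "filterlim complex_of_real (at (of_real t)) (at t within S)"
    unfolding filterlim_at by (auto intro!: tendsto_intros simp: eventually_at_filter)
  ultimately have "((\<lambda>s. (?f (of_real s) - ?f (of_real t)) / (of_real s - of_real t)) \<longlongrightarrow> \<i> * of_real \<kappa> * ?f (of_real t)) (at t within S)"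
    by (rule filterlim_compose)
  then show ?thesis by (simp add: cis_conv_exp mult.assoc)
qed

text \<open>For u = exp(i \<kappa> t) q one has i u' = -\<kappa> u, so the stationary equation with
  +\<kappa> is the right one. A constant phase commutes with the transform and the Hartree term, so
  every norm in question is a scalar function of time times a fixed Sobolev norm of q.\<close>

lemma solitary_wave:
  assumes q: "q \<in> H_half" "hartree_term q \<in> L2"
    and eq: "AE \<xi> in lborel. (of_real \<kappa> + of_real (sqrt_symbol m \<xi>)) * fourier_L2 q \<xi> = fourier_L2 (hartree_term q) \<xi>"
  shows "H_half_solution m T q (\<lambda>t x. cis (\<kappa> * t) * q x)"
proof -
  have qL2: "q \<in> L2" and S: "sobolev_sq (1/2) (fourier_L2 q) < \<infinity>" using q by (auto simp: H_half_def)
  have S': "sobolev_sq (-(1/2)) (fourier_L2 q) < \<infinity>" using sobolev_sq_mono S by (rule le_less_trans) simp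
  have [measurable]: "q \<in> borel_measurable borel" "fourier_L2 q \<in> borel_measurable borel"
    using qL2 by (auto intro!: L2_measurable fourier_L2_in_L2)
  have F: "AE \<xi> in lborel. fourier_L2 (\<lambda>x. c * q x) \<xi> = c * fourier_L2 q \<xi>" for c
    by (rule fourier_L2_cmult[OF qL2])
  have G: "AE \<xi> in lborel. fourier_L2 (hartree_term (\<lambda>x. cis a * q x)) \<xi> = cis a * fourier_L2 (hartree_term q) \<xi>" for a
    using fourier_L2_cmult[OF q(2), of "cis a"] by (simp add: hartree_term_phase)
  \<comment> \<open>Finiteness of A matters: in \<open>ennreal\<close>, 0 times infinity is 0 but
    the limit along nonzero scalars would be infinite.\<close>
  have lim: "((\<lambda>s. ennreal ((cmod (c s))\<^sup>2) * A) \<longlongrightarrow> 0) F'"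
    if "A < \<infinity>" "(c \<longlongrightarrow> 0) F'" for c :: "real \<Rightarrow> complex" and A F'
  proof -
    have "((\<lambda>s. (cmod (c s))\<^sup>2) \<longlongrightarrow> (cmod 0)\<^sup>2) F'" using that(2) by (intro tendsto_intros)
    then have "((\<lambda>s. ennreal ((cmod (c s))\<^sup>2)) \<longlongrightarrow> ennreal ((cmod 0)\<^sup>2)) F'" by (rule tendsto_ennrealI)
    then have "((\<lambda>s. A * ennreal ((cmod (c s))\<^sup>2)) \<longlongrightarrow> A * ennreal ((cmod 0)\<^sup>2)) F'"
      using that(1) by (intro ennreal_tendsto_cmult) auto
    then show ?thesis by (simp add: mult.commute)
  qed
  have cond1: "(\<lambda>x. cis (\<kappa> * t) * q x) \<in> H_half" for t
  proof -
    have "nsq (\<lambda>x. cis (\<kappa> * t) * q x) = nsq q" by (simp add: nsq_def norm_mult)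
    then have "(\<lambda>x. cis (\<kappa> * t) * q x) \<in> L2" using qL2 by (simp add: L2_iff)
    moreover have "sobolev_sq (1/2) (fourier_L2 (\<lambda>x. cis (\<kappa> * t) * q x)) = sobolev_sq (1/2) (fourier_L2 q)"
      by (subst sobolev_sq_cong_AE[OF F]) (simp add: sobolev_sq_cmult)
    ultimately show ?thesis using S by (simp add: H_half_def)
  qed
  have cond2: "((\<lambda>s. sobolev_sq (1/2) (\<lambda>\<xi>. fourier_L2 (\<lambda>x. cis (\<kappa> * s) * q x) \<xi> - fourier_L2 (\<lambda>x. cis (\<kappa> * t) * q x) \<xi>)) \<longlongrightarrow> 0)
        (at t within {0..T})" for t
  proof -
    have "sobolev_sq (1/2) (\<lambda>\<xi>. fourier_L2 (\<lambda>x. cis (\<kappa> * s) * q x) \<xi> - fourier_L2 (\<lambda>x. cis (\<kappa> * t) * q x) \<xi>)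
       = ennreal ((cmod (cis (\<kappa> * s) - cis (\<kappa> * t)))\<^sup>2) * sobolev_sq (1/2) (fourier_L2 q)" for s
    proof -
      have "AE \<xi> in lborel. fourier_L2 (\<lambda>x. cis (\<kappa> * s) * q x) \<xi> - fourier_L2 (\<lambda>x. cis (\<kappa> * t) * q x) \<xi>
          = (cis (\<kappa> * s) - cis (\<kappa> * t)) * fourier_L2 q \<xi>"
        using F[of "cis (\<kappa> * s)"] F[of "cis (\<kappa> * t)"] by eventually_elim (simp add: left_diff_distrib)
      then show ?thesis by (subst sobolev_sq_cong_AE) (auto simp: sobolev_sq_cmult)
    qed
    moreover have "((\<lambda>s. cis (\<kappa> * s) - cis (\<kappa> * t)) \<longlongrightarrow> 0) (at t within {0..T})"
    proof -
      have "((\<lambda>s. cis (\<kappa> * s) - cis (\<kappa> * t)) \<longlongrightarrow> cis (\<kappa> * t) - cis (\<kappa> * t)) (at t within {0..T})"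
        by (intro tendsto_intros)
      then show ?thesis by simp
    qed
    ultimately show ?thesis by (simp add: lim[OF S])
  qed
  have cond3: "((\<lambda>s. sobolev_sq (-(1/2)) (\<lambda>\<xi>.
          \<i> * ((fourier_L2 (\<lambda>x. cis (\<kappa> * s) * q x) \<xi> - fourier_L2 (\<lambda>x. cis (\<kappa> * t) * q x) \<xi>) / of_real (s - t))
          - (of_real (sqrt_symbol m \<xi>) * fourier_L2 (\<lambda>x. cis (\<kappa> * t) * q x) \<xi>
             - fourier_L2 (hartree_term (\<lambda>x. cis (\<kappa> * t) * q x)) \<xi>))) \<longlongrightarrow> 0)
        (at t within {0..T})" (is "(?S \<longlongrightarrow> 0) _") for t
  proof -
    \<comment> \<open>By the stationary equation the defect is this scalar times the transform of q;
      it tends to i (i \<kappa>) + \<kappa> = 0 times the phase.\<close>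
    let ?c = "\<lambda>s. \<i> * ((cis (\<kappa> * s) - cis (\<kappa> * t)) / of_real (s - t)) + of_real \<kappa> * cis (\<kappa> * t)"
    have "?S s = ennreal ((cmod (?c s))\<^sup>2) * sobolev_sq (-(1/2)) (fourier_L2 q)" for s
    proof -
      have "AE \<xi> in lborel. \<i> * ((fourier_L2 (\<lambda>x. cis (\<kappa> * s) * q x) \<xi> - fourier_L2 (\<lambda>x. cis (\<kappa> * t) * q x) \<xi>) / of_real (s - t))
          - (of_real (sqrt_symbol m \<xi>) * fourier_L2 (\<lambda>x. cis (\<kappa> * t) * q x) \<xi>
             - fourier_L2 (hartree_term (\<lambda>x. cis (\<kappa> * t) * q x)) \<xi>) = ?c s * fourier_L2 q \<xi>"
        using F[of "cis (\<kappa> * s)"] F[of "cis (\<kappa> * t)"] G[of "\<kappa> * t"] eq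
      proof eventually_elim
        case (elim \<xi>)
        show ?case unfolding elim(1-3) elim(4)[symmetric]
          by (simp only: left_diff_distrib[symmetric]) (simp add: algebra_simps diff_divide_distrib)
      qed
      then show ?thesis by (subst sobolev_sq_cong_AE) (auto simp: sobolev_sq_cmult)
    qed
    moreover have "(?c \<longlongrightarrow> 0) (at t within {0..T})"
    proof -
      have "(?c \<longlongrightarrow> \<i> * (\<i> * of_real \<kappa> * cis (\<kappa> * t)) + of_real \<kappa> * cis (\<kappa> * t)) (at t within {0..T})"
        by (intro tendsto_add tendsto_mult tendsto_const cis_difference_quotient)
      moreover have "\<i> * (\<i> * of_real \<kappa> * cis (\<kappa> * t)) + of_real \<kappa> * cis (\<kappa> * t) = 0"
        by (simp flip: mult.assoc)
      ultimately show ?thesis by metis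
    qed
    ultimately show ?thesis by (simp add: lim[OF S'])
  qed
  show ?thesis
    unfolding H_half_solution_def using cond1 cond2 cond3 by simp
qed

lemma dilate_ground_state_solution:
  assumes P: "ground_state (m / \<kappa>) P" and \<kappa>: "\<kappa> \<ge> 1"
  shows "H_half_solution m T (cx (dilate \<kappa> P)) (\<lambda>t x. cis (\<kappa> * t) * cx (dilate \<kappa> P) x)"
proof (rule solitary_wave)
  have \<kappa>': "\<kappa> > 0" using \<kappa> by simp
  show "cx (dilate \<kappa> P) \<in> H_half" by (rule dilate_ground_state_H_half[OF P \<kappa>])
  show "hartree_term (cx (dilate \<kappa> P)) \<in> L2" by (rule dilate_ground_state_memb[OF P \<kappa>'])
  show "AE \<xi> in lborel. (of_real \<kappa> + of_real (sqrt_symbol m \<xi>)) * fourier_L2 (cx (dilate \<kappa> P)) \<xi>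
     = fourier_L2 (hartree_term (cx (dilate \<kappa> P))) \<xi>"
    using dilate_ground_state_equation[OF P \<kappa>]
  proof eventually_elim
    case (elim \<xi>)
    have "\<kappa> + sqrt_symbol m \<xi> > 0" using \<kappa> by (intro add_pos_nonneg) (auto simp: sqrt_symbol_def)
    then have "complex_of_real (\<kappa> + sqrt_symbol m \<xi>) * of_real (1 / (\<kappa> + sqrt_symbol m \<xi>)) = 1"
      by (simp flip: of_real_mult del: of_real_add)
    then show ?case unfolding elim by (simp only: of_real_add[symmetric] mult.assoc[symmetric]) simp
  qed
qed

section \<open>Nearby solitary waves with drifting phases\<close>

text \<open>Otherwise, greedily picking an element unrelated to all those picked before produces a
  sequence with no related pair. It converts sequential compactness into total boundedness.\<close>

lemma finite_net:
  fixes R :: "'a \<Rightarrow> 'a \<Rightarrow> bool"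
  assumes "\<And>s :: nat \<Rightarrow> 'a. \<exists>i j. i < j \<and> R (s i) (s j)"
  shows "\<exists>F. finite F \<and> (\<forall>k. \<exists>i\<in>F. R i k)"
proof (rule ccontr)
  assume "\<not> ?thesis"
  then have "\<forall>F. \<exists>k. finite F \<longrightarrow> (\<forall>i\<in>F. \<not> R i k)" by blast
  then obtain pick where pick: "\<And>F i. finite F \<Longrightarrow> i \<in> F \<Longrightarrow> \<not> R i (pick F)" by metis
  define F where "F = rec_nat {} (\<lambda>_ A. insert (pick A) A)"
  have [simp]: "F 0 = {}" "F (Suc n) = insert (pick (F n)) (F n)" for n by (simp_all add: F_def)
  have "finite (F n)" for n by (induction n) auto
  moreover have "mono F" by (rule mono_iff_le_Suc[THEN iffD2]) auto
  then have "pick (F i) \<in> F j" if "i < j" for i j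
    using monoD[of F "Suc i" j] that by auto
  ultimately show False using assms[of "\<lambda>n. pick (F n)"] pick by blast
qed

lemma nn_integral_edist_triangle:
  assumes [measurable]: "f \<in> borel_measurable borel" "g \<in> borel_measurable borel" "h \<in> borel_measurable borel"
  shows "(\<integral>\<^sup>+x. (edist (f x) (h x))\<^sup>2 \<partial>lborel)
    \<le> 2 * (\<integral>\<^sup>+x. (edist (f x) (g x))\<^sup>2 \<partial>lborel) + 2 * (\<integral>\<^sup>+x. (edist (g x) (h x))\<^sup>2 \<partial>lborel)"
proof -
  have "(\<integral>\<^sup>+x. (edist (f x) (h x))\<^sup>2 \<partial>lborel) \<le> (\<integral>\<^sup>+x. 2 * (edist (f x) (g x))\<^sup>2 + 2 * (edist (g x) (h x))\<^sup>2 \<partial>lborel)"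
    by (intro nn_integral_mono edist_triangle_square)
  then show ?thesis by (simp add: nn_integral_add nn_integral_cmult)
qed

lemma ennreal_double_add_le:
  assumes "a \<le> ennreal (\<eta> / 4)" "b \<le> ennreal (\<eta> / 4)" "\<eta> > 0"
  shows "2 * a + 2 * b \<le> ennreal \<eta>"
proof -
  have "2 * a + 2 * b \<le> 2 * ennreal (\<eta> / 4) + 2 * ennreal (\<eta> / 4)"
    using assms by (intro add_mono mult_left_mono) auto
  also have "\<dots> = ennreal \<eta>"
    using assms by (simp add: ennreal_plus[symmetric] ennreal_mult[symmetric] flip: ennreal_numeral del: ennreal_plus)
  finally show ?thesis .
qed

text \<open>Let F be a finite net for the family, with a centre assigned to each index. Among card F
  + 1 consecutive indices two share a centre, so N = card F works for every n. Each of the two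
  triangle inequalities costs a factor 4, hence the tolerances \<eta> / 16 and \<eta> / 4.\<close>

lemma ground_state_pigeonhole:
  fixes P :: "nat \<Rightarrow> real^3 \<Rightarrow> ennreal"
  assumes P: "\<And>n. ground_state (\<mu> n) (P n)" and \<eta>: "\<eta> > 0"
  shows "\<exists>N. \<forall>n. \<exists>i j. n \<le> i \<and> i < j \<and> j \<le> n + N \<and> (\<integral>\<^sup>+x. (edist (P i x) (P j x))\<^sup>2 \<partial>lborel) \<le> ennreal \<eta>"
proof -
  let ?D = "\<lambda>f g. \<integral>\<^sup>+x. (edist (f x) (g x :: ennreal))\<^sup>2 \<partial>(lborel :: (real^3) measure)"
  note [measurable] = ground_state_measurable[OF P]
  let ?R = "\<lambda>i j. ?D (P i) (P j) \<le> ennreal (\<eta> / 4)"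
  have "\<exists>F. finite F \<and> (\<forall>k. \<exists>i\<in>F. ?R i k)"
  proof (rule finite_net)
    fix s :: "nat \<Rightarrow> nat"
    obtain r G where r: "strict_mono r" and [measurable]: "G \<in> borel_measurable borel"
      and lim: "(\<lambda>n. ?D (P (s (r n))) G) \<longlonglongrightarrow> 0"
      by (rule ground_state_compact[of "\<lambda>n. \<mu> (s n)" "\<lambda>n. P (s n)"]) (use P in auto)
    have "\<forall>\<^sub>F n in sequentially. ?D (P (s (r n))) G < ennreal (\<eta> / 16)"
      using \<eta> by (intro order_tendstoD(2)[OF lim]) simp
    then obtain n where "\<And>k. k \<ge> n \<Longrightarrow> ?D (P (s (r k))) G < ennreal (\<eta> / 16)"
      unfolding eventually_sequentially by blast
    then have "?D (P (s (r n))) G \<le> ennreal (\<eta> / 4 / 4)" "?D G (P (s (r (Suc n)))) \<le> ennreal (\<eta> / 4 / 4)"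
      by (simp_all add: edist_commute[of "G _"] less_imp_le)
    then have "2 * ?D (P (s (r n))) G + 2 * ?D G (P (s (r (Suc n)))) \<le> ennreal (\<eta> / 4)"
      using \<eta> by (intro ennreal_double_add_le) auto
    then have "?R (s (r n)) (s (r (Suc n)))"
      by (rule order_trans[OF nn_integral_edist_triangle, rotated 3]) measurable
    then show "\<exists>i j. i < j \<and> ?R (s i) (s j)"
      using strict_monoD[OF r, of n "Suc n"] by blast
  qed
  then obtain F where F: "finite F" "\<And>k. \<exists>i\<in>F. ?R i k" by blast
  then obtain c where c: "\<And>k. c k \<in> F" "\<And>k. ?R (c k) k" by metis
  have "\<exists>i j. n \<le> i \<and> i < j \<and> j \<le> n + card F \<and> ?D (P i) (P j) \<le> ennreal \<eta>" for n
  proof -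
    have "\<not> inj_on c {n..n + card F}"
    proof
      assume "inj_on c {n..n + card F}"
      then have "card {n..n + card F} \<le> card F" using F c by (intro card_inj_on_le) auto
      then show False by simp
    qed
    then obtain i j where ij: "i \<in> {n..n + card F}" "j \<in> {n..n + card F}" "c i = c j" "i < j"
      unfolding inj_on_def by (metis nat_neq_iff)
    have "?D (P i) (P j) \<le> 2 * ?D (P i) (P (c i)) + 2 * ?D (P (c i)) (P j)"
      by (rule nn_integral_edist_triangle) measurable
    also have "\<dots> \<le> ennreal \<eta>"
      using c(2)[of i] c(2)[of j] ij \<eta> by (intro ennreal_double_add_le) (auto simp: edist_commute)
    finally show ?thesis using ij by auto
  qed
  then show ?thesis by blast
qed

definition mass_bound :: real where
  "mass_bound = enn2real (\<integral>\<^sup>+x. (ground_bound x)\<^sup>2 \<partial>lborel)"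

lemma mass_bound: "mass_bound \<ge> 0" "(\<integral>\<^sup>+x. (ground_bound x)\<^sup>2 \<partial>lborel) = ennreal mass_bound"
  using ground_bound_L2 by (auto simp: mass_bound_def)

text \<open>Both functions have the same norm, so the squared distance is 2I - 2J, where I is the
  mass and J the inner product. Monotonicity, P(\<sigma> x) <= P(x), gives J >= \<sigma>^(-3/2) I.
  This yields continuity of dilations uniformly over all the profiles.\<close>

lemma ground_state_dilate_edist:
  assumes P: "ground_state \<mu> P" and \<sigma>: "\<sigma> \<ge> 1"
  shows "(\<integral>\<^sup>+x. (edist (P x) (dilate \<sigma> P x))\<^sup>2 \<partial>lborel) \<le> ennreal (2 * mass_bound * (1 - \<sigma> powr (-(3/2))))"
proof -
  note [measurable] = ground_state_measurable[OF P]
  let ?X = "\<integral>\<^sup>+x. (edist (P x) (dilate \<sigma> P x))\<^sup>2 \<partial>lborel"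
  let ?J = "\<integral>\<^sup>+x. P x * dilate \<sigma> P x \<partial>lborel" and ?I = "\<integral>\<^sup>+x. (P x)\<^sup>2 \<partial>lborel"
  let ?c = "\<sigma> powr (-(3/2))"
  have I: "?I \<le> ennreal mass_bound" using ground_state_L2[OF P] by (simp add: mass_bound)
  have I': "?I < \<infinity>" using I by (rule le_less_trans) simp
  have dil: "(\<integral>\<^sup>+x. (dilate \<sigma> P x)\<^sup>2 \<partial>lborel) = ?I"
    using \<sigma> by (intro nn_integral_dilate_square) auto
  have fin: "AE x in lborel. P x \<noteq> top" "AE x in lborel. dilate \<sigma> P x \<noteq> top"
    using I' dil by (auto intro!: AE_finite_of_L2)
  have "?X + 2 * ?J = (\<integral>\<^sup>+x. (edist (P x) (dilate \<sigma> P x))\<^sup>2 + 2 * (P x * dilate \<sigma> P x) \<partial>lborel)"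
    by (simp add: nn_integral_add nn_integral_cmult)
  also have "\<dots> = (\<integral>\<^sup>+x. (P x)\<^sup>2 + (dilate \<sigma> P x)\<^sup>2 \<partial>lborel)"
  proof (rule nn_integral_cong_AE)
    show "AE x in lborel. (edist (P x) (dilate \<sigma> P x))\<^sup>2 + 2 * (P x * dilate \<sigma> P x) = (P x)\<^sup>2 + (dilate \<sigma> P x)\<^sup>2"
      using fin by eventually_elim (rule edist_square)
  qed
  also have "\<dots> = 2 * ?I" by (simp add: nn_integral_add dil mult_2)
  finally have eq: "?X + 2 * ?J = 2 * ?I" .
  have "ennreal ?c * ?I = (\<integral>\<^sup>+x. ennreal ?c * (dilate \<sigma> P x)\<^sup>2 \<partial>lborel)"
    by (simp add: nn_integral_cmult dil)
  also have "\<dots> \<le> ?J"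
  proof (rule nn_integral_mono)
    fix x :: "real^3"
    have "rdec P" using P by (simp add: ground_state_def controlled_def)
    moreover have "norm x \<le> norm (\<sigma> *\<^sub>R x)" using \<sigma> by (simp add: mult_le_cancel_right1)
    ultimately have le: "P (\<sigma> *\<^sub>R x) \<le> P x" by (rule rdecD)
    have "ennreal ?c * ennreal (\<sigma> powr (3/2)) = 1"
      using \<sigma> by (simp add: ennreal_mult[symmetric] powr_add[symmetric])
    then have "ennreal ?c * dilate \<sigma> P x = P (\<sigma> *\<^sub>R x)" by (simp add: dilate_def mult.assoc[symmetric])
    then have "ennreal ?c * (dilate \<sigma> P x)\<^sup>2 = P (\<sigma> *\<^sub>R x) * dilate \<sigma> P x"
      by (simp add: power2_eq_square mult.assoc[symmetric])
    also have "\<dots> \<le> P x * dilate \<sigma> P x" using le by (rule mult_right_mono) simp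
    finally show "ennreal ?c * (dilate \<sigma> P x)\<^sup>2 \<le> P x * dilate \<sigma> P x" .
  qed
  finally have "?X + 2 * (ennreal ?c * ?I) \<le> 2 * ?I"
    unfolding eq[symmetric] by (intro add_mono mult_left_mono) auto
  moreover obtain r where r: "?I = ennreal r" "r \<ge> 0" using I' by (cases ?I) auto
  ultimately have "?X + ennreal (2 * (?c * r)) \<le> ennreal (2 * r)"
    by (simp add: ennreal_mult)
  moreover from this obtain y where y: "?X = ennreal y" "y \<ge> 0" by (cases ?X) (auto simp: top_unique)
  ultimately have "y + 2 * (?c * r) \<le> 2 * r"
    using r by (simp add: ennreal_plus[symmetric] del: ennreal_plus)
  then have "y \<le> 2 * r * (1 - ?c)" by (simp add: algebra_simps)
  moreover have "r \<le> mass_bound" using I r mass_bound(1) by simp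
  moreover have "?c \<le> 1" using \<sigma> powr_mono[of "-(3/2)" 0 \<sigma>] by simp
  ultimately have "y \<le> 2 * mass_bound * (1 - ?c)"
    using mult_right_mono[of "2 * r" "2 * mass_bound" "1 - ?c"] by linarith
  then show ?thesis unfolding y by (rule ennreal_leI)
qed

lemma ground_state_L2_lower_uniform:
  "\<exists>low>0. \<forall>\<mu> P. ground_state \<mu> P \<longrightarrow> ennreal low \<le> (\<integral>\<^sup>+x. (P x)\<^sup>2 \<partial>lborel)"
proof -
  \<comment> \<open>The minimum with 1 keeps the value finite even if \<open>quart_bound\<close>
    were 0; for the same reason h + 1 replaces h in the denominator below.\<close>
  define a where "a = enn2real (min 1 ((inverse quart_bound)\<^sup>2))"
  define h where "h = enn2real (\<integral>\<^sup>+x. (hartree_bound x)\<^sup>2 \<partial>lborel)"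
  have m: "min 1 ((inverse quart_bound)\<^sup>2) < top" by (simp add: min_less_iff_disj)
  have "inverse quart_bound \<noteq> 0" using quart_bound_finite by simp
  then have "min 1 ((inverse quart_bound)\<^sup>2) > 0" by (simp add: zero_less_iff_neq_zero)
  then have a: "a > 0" "ennreal a = min 1 ((inverse quart_bound)\<^sup>2)"
    using m unfolding a_def by (auto simp: enn2real_positive_iff)
  have h: "h \<ge> 0" "(\<integral>\<^sup>+x. (hartree_bound x)\<^sup>2 \<partial>lborel) = ennreal h"
    using hartree_bound_L2 by (auto simp: h_def)
  have "ennreal (a / (h + 1)) \<le> (\<integral>\<^sup>+x. (P x)\<^sup>2 \<partial>lborel)" if P: "ground_state \<mu> P" for \<mu> P
  proof (cases "\<integral>\<^sup>+x. (P x)\<^sup>2 \<partial>lborel")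
    case (real r)
    have "ennreal a \<le> ennreal h * ennreal r"
      using ground_state_L2_lower[OF P] unfolding a h real(2) by (rule min.coboundedI2)
    then have "ennreal a \<le> ennreal (h * r)" using h(1) real(1) by (simp only: ennreal_mult)
    then have "a \<le> h * r" using h(1) real(1) by simp
    also have "\<dots> \<le> r * (h + 1)" using real by (simp add: algebra_simps)
    finally have "a / (h + 1) \<le> r" using h by (simp add: pos_divide_le_eq)
    then show ?thesis unfolding real(2) by (rule ennreal_leI)
  qed simp
  moreover have "a / (h + 1) > 0" using a h by simp
  ultimately show ?thesis by blast
qed

text \<open>After undoing the dilation by \<open>\<kappa> i\<close>, the distance splits into that
  of the profiles, small by the pigeonhole argument, and the effect of dilating by
  \<open>\<kappa> j / \<kappa> i\<close>. Since the gap N is fixed before n is chosen, this ratio is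
  at most 1 + N / n.\<close>

lemma dilate_ground_states_close:
  fixes P :: "nat \<Rightarrow> real^3 \<Rightarrow> ennreal"
  assumes P: "\<And>n. ground_state (\<mu> n) (P n)" and \<kappa>: "\<And>n. \<kappa> n = real (k + n) * \<omega>"
    and pos: "k > 0" "\<omega> > 0" and e: "e > 0"
  shows "\<exists>i j. i < j \<and> (\<integral>\<^sup>+x. (edist (dilate (\<kappa> i) (P i) x) (dilate (\<kappa> j) (P j) x))\<^sup>2 \<partial>lborel) \<le> ennreal e"
proof -
  note [measurable] = ground_state_measurable[OF P]
  obtain N where N: "\<And>n. \<exists>i j. n \<le> i \<and> i < j \<and> j \<le> n + N \<and> (\<integral>\<^sup>+x. (edist (P i x) (P j x))\<^sup>2 \<partial>lborel) \<le> ennreal (e / 4)"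
    using ground_state_pigeonhole[of \<mu> P "e / 4"] P e by auto
  have "(\<lambda>n. 2 * mass_bound * (1 - (1 + real N / real n) powr (-(3/2)))) \<longlonglongrightarrow> 2 * mass_bound * (1 - (1 + 0) powr (-(3/2)))"
    by (intro tendsto_intros tendsto_divide_0[OF tendsto_const] filterlim_at_top_imp_at_infinity filterlim_real_sequentially) simp
  then have "\<forall>\<^sub>F n in sequentially. 2 * mass_bound * (1 - (1 + real N / real n) powr (-(3/2))) < e / 4"
    using e by (intro order_tendstoD(2)) auto
  then obtain n where n: "n > 0" "2 * mass_bound * (1 - (1 + real N / real n) powr (-(3/2))) < e / 4"
    by (metis (mono_tags, lifting) eventually_conj eventually_gt_at_top eventually_happens sequentially_bot)
  obtain i j where ij: "n \<le> i" "i < j" "j \<le> n + N"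
    and D: "(\<integral>\<^sup>+x. (edist (P i x) (P j x))\<^sup>2 \<partial>lborel) \<le> ennreal (e / 4)"
    using N by blast
  have \<kappa>i: "\<kappa> i > 0" using pos by (simp add: \<kappa>)
  let ?\<sigma> = "\<kappa> j / \<kappa> i"
  have \<sigma>_eq: "?\<sigma> = real (k + j) / real (k + i)" using pos by (simp add: \<kappa>)
  have \<sigma>: "?\<sigma> \<ge> 1" unfolding \<sigma>_eq using ij pos by (simp add: le_divide_eq)
  have "?\<sigma> \<le> (real (k + i) + real N) / real (k + i)"
    unfolding \<sigma>_eq using ij by (intro divide_right_mono) auto
  also have "\<dots> = 1 + real N / real (k + i)" using pos by (simp add: add_divide_distrib)
  also have "\<dots> \<le> 1 + real N / real n" using ij n pos by (intro add_left_mono divide_left_mono) auto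
  finally have "(1 + real N / real n) powr (-(3/2)) \<le> ?\<sigma> powr (-(3/2))"
    using \<sigma> by (intro powr_mono2') auto
  then have "2 * mass_bound * (1 - ?\<sigma> powr (-(3/2))) \<le> e / 4"
    using mass_bound(1) n(2) by (smt (verit) mult_left_mono)
  then have S: "(\<integral>\<^sup>+x. (edist (P j x) (dilate ?\<sigma> (P j) x))\<^sup>2 \<partial>lborel) \<le> ennreal (e / 4)"
    by (intro order_trans[OF ground_state_dilate_edist[OF P \<sigma>]] ennreal_leI)
  have "dilate (\<kappa> j) (P j) = dilate (\<kappa> i) (dilate ?\<sigma> (P j))"
    using \<kappa>i \<sigma> by (subst dilate_dilate) auto
  then have "(\<integral>\<^sup>+x. (edist (dilate (\<kappa> i) (P i) x) (dilate (\<kappa> j) (P j) x))\<^sup>2 \<partial>lborel)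
     = (\<integral>\<^sup>+x. (edist (P i x) (dilate ?\<sigma> (P j) x))\<^sup>2 \<partial>lborel)"
    using \<kappa>i by (simp add: nn_integral_dilate_edist)
  also have "\<dots> \<le> 2 * (\<integral>\<^sup>+x. (edist (P i x) (P j x))\<^sup>2 \<partial>lborel) + 2 * (\<integral>\<^sup>+x. (edist (P j x) (dilate ?\<sigma> (P j) x))\<^sup>2 \<partial>lborel)"
    by (rule nn_integral_edist_triangle) measurable
  also have "\<dots> \<le> ennreal e" using D S e by (rule ennreal_double_add_le)
  finally show ?thesis using ij by blast
qed

lemma L2_dist_eq:
  assumes "f \<in> L2" "g \<in> L2"
  shows "L2_dist f g = sqrt (enn2real (nsq (\<lambda>x. f x - g x)))"
proof -
  have [measurable]: "f \<in> borel_measurable borel" "g \<in> borel_measurable borel"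
    using assms by (auto intro: L2_measurable)
  show ?thesis unfolding L2_dist_def nsq_def by (subst integral_eq_nn_integral) auto
qed

lemma L2_rad_L2: "f \<in> L2_rad \<Longrightarrow> f \<in> L2"
  by (simp add: L2_rad_def)

text \<open>Opposite phases turn the difference into a sum of nonnegative numbers, so nothing
  cancels.\<close>

lemma cmod_cis_mult_diff_opposite:
  assumes "cis b = - cis a" "0 \<le> r" "0 \<le> s"
  shows "r \<le> cmod (cis a * of_real r - cis b * of_real s)"
proof -
  have "cis a * of_real r - cis b * of_real s = cis a * of_real (r + s)"
    by (simp add: assms(1) ring_distribs)
  then show ?thesis using assms by (simp add: norm_mult del: of_real_add)
qed

theorem theorem1p3:
  fixes m T :: real
    and \<Phi> :: "(real^3 \<Rightarrow> complex) \<Rightarrow> real \<Rightarrow> real^3 \<Rightarrow> complex"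
  assumes "m \<ge> 0" and "T > 0"
    and "flow_map m T \<Phi>"
  shows "\<not> locally_uniformly_continuous_flow T \<Phi>"
proof
  assume luc: "locally_uniformly_continuous_flow T \<Phi>"
  define \<omega> where "\<omega> = pi / T"
  have \<omega>: "\<omega> > 0" using \<open>T > 0\<close> by (simp add: \<omega>_def)
  \<comment> \<open>Large enough that every frequency is at least 1 and at least m, so that \<mu> =
    m / \<kappa> stays in [0, 1]; the successor makes k positive.\<close>
  define k where "k = Suc (nat \<lceil>max 1 m / \<omega>\<rceil>)"
  define \<kappa> where "\<kappa> n = real (k + n) * \<omega>" for n
  have \<kappa>: "\<kappa> n \<ge> max 1 m" for n
  proof -
    have "max 1 m / \<omega> \<le> real (k + n)" unfolding k_def by linarith
    then show ?thesis using \<omega> by (simp add: \<kappa>_def pos_divide_le_eq)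
  qed
  then have \<kappa>1: "\<kappa> n \<ge> 1" and \<kappa>m: "m \<le> \<kappa> n" for n by (simp_all add: max.bounded_iff)
  have "\<bar>m / \<kappa> n\<bar> \<le> 1" for n using \<kappa>1[of n] \<kappa>m[of n] \<open>m \<ge> 0\<close> by simp
  then have "\<forall>n. \<exists>P. ground_state (m / \<kappa> n) P" using ground_state_exists by blast
  then obtain P where P: "\<And>n. ground_state (m / \<kappa> n) (P n)" by metis
  have \<kappa>0: "\<kappa> n > 0" for n using \<kappa>1[of n] by simp
  define Q where "Q n = dilate (\<kappa> n) (P n)" for n
  have [measurable]: "P n \<in> borel_measurable borel" for n by (rule ground_state_measurable[OF P])
  have [measurable]: "Q n \<in> borel_measurable borel" for n unfolding Q_def by measurable
  have memb: "cx (Q n) \<in> L2" "cx (Q n) \<in> L2_rad" for n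
    unfolding Q_def by (rule dilate_ground_state_memb[OF P \<kappa>0])+
  have fin: "AE x in lborel. Q n x \<noteq> top" for n
    unfolding Q_def by (rule dilate_ground_state_L2[OF P \<kappa>0])
  have mass: "nsq (cx (Q n)) = (\<integral>\<^sup>+x. (P n x)\<^sup>2 \<partial>lborel)" for n
    using \<kappa>0 nsq_cx[OF fin] by (simp add: Q_def nn_integral_dilate_square)
  have mass_le: "nsq (cx (Q n)) \<le> ennreal mass_bound" for n
    unfolding mass using ground_state_L2[OF P[of n]] by (simp add: mass_bound)
  obtain low where low: "low > 0" "\<And>n. ennreal low \<le> nsq (cx (Q n))"
    using ground_state_L2_lower_uniform P unfolding mass by blast
  \<comment> \<open>The data lie in H^(1/2), so the last clause of \<open>flow_map\<close>
    identifies the flow with the explicit solitary wave.\<close>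
  have flow: "AE x in lborel. \<Phi> (cx (Q n)) t x = cis (\<kappa> n * t) * cx (Q n) x" if "t \<in> {0..T}" for n t
    using assms(3) memb(2) dilate_ground_state_H_half[OF P \<kappa>1] dilate_ground_state_solution[OF P \<kappa>1] that
    unfolding flow_map_def Q_def by blast
  have \<Phi>_L2: "\<Phi> (cx (Q n)) t \<in> L2" if "t \<in> {0..T}" for n t
  proof -
    have "\<Phi> (cx (Q n)) \<in> C_L2_rad T" using assms(3) memb(2) by (simp add: flow_map_def)
    then show ?thesis using that by (simp add: C_L2_rad_def L2_rad_L2)
  qed
  \<comment> \<open>The second fact guards against default values: it keeps \<open>enn2real\<close>
    faithful and bounds the set whose real supremum defines \<open>C_L2_dist\<close>.\<close>
  have dist_flow: "L2_dist (\<Phi> (cx (Q i)) t) (\<Phi> (cx (Q j)) t)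
      = sqrt (enn2real (nsq (\<lambda>x. cis (\<kappa> i * t) * cx (Q i) x - cis (\<kappa> j * t) * cx (Q j) x)))"
    and nsq_le: "nsq (\<lambda>x. cis (\<kappa> i * t) * cx (Q i) x - cis (\<kappa> j * t) * cx (Q j) x) \<le> ennreal (4 * mass_bound)"
    if t: "t \<in> {0..T}" for i j t
  proof -
    have "AE x in lborel. \<Phi> (cx (Q i)) t x - \<Phi> (cx (Q j)) t x = cis (\<kappa> i * t) * cx (Q i) x - cis (\<kappa> j * t) * cx (Q j) x"
      using flow[OF t, of i] flow[OF t, of j] by eventually_elim simp
    from nsq_cong_AE[OF this] show "L2_dist (\<Phi> (cx (Q i)) t) (\<Phi> (cx (Q j)) t)
      = sqrt (enn2real (nsq (\<lambda>x. cis (\<kappa> i * t) * cx (Q i) x - cis (\<kappa> j * t) * cx (Q j) x)))"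
      by (simp add: L2_dist_eq \<Phi>_L2[OF t])
    have "nsq (\<lambda>x. cis (\<kappa> i * t) * cx (Q i) x - cis (\<kappa> j * t) * cx (Q j) x)
       \<le> 2 * nsq (\<lambda>x. cis (\<kappa> i * t) * cx (Q i) x) + 2 * nsq (\<lambda>x. - (cis (\<kappa> j * t) * cx (Q j) x))"
      using nsq_add_le[of "\<lambda>x. cis (\<kappa> i * t) * cx (Q i) x" "\<lambda>x. - (cis (\<kappa> j * t) * cx (Q j) x)"] by simp
    also have "\<dots> = 2 * nsq (cx (Q i)) + 2 * nsq (cx (Q j))" by (simp add: nsq_def norm_mult)
    also have "\<dots> \<le> 2 * ennreal mass_bound + 2 * ennreal mass_bound"
      by (intro add_mono mult_left_mono mass_le) auto
    also have "\<dots> = ennreal (4 * mass_bound)"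
      using mass_bound(1) by (simp add: ennreal_mult flip: distrib_right)
    finally show "nsq (\<lambda>x. cis (\<kappa> i * t) * cx (Q i) x - cis (\<kappa> j * t) * cx (Q j) x) \<le> ennreal (4 * mass_bound)" .
  qed
  \<comment> \<open>The added 1 provides the strict inequality required by
    \<open>L2_rad_ball\<close>.\<close>
  let ?B = "L2_rad_ball (\<lambda>_. 0) (sqrt mass_bound + 1)"
  have ball: "cx (Q n) \<in> ?B" for n
  proof -
    have "L2_dist (\<lambda>_. 0) (cx (Q n)) = sqrt (enn2real (nsq (cx (Q n))))"
      using memb(1) by (subst L2_dist_eq) (auto simp: L2_iff nsq_def)
    also have "enn2real (nsq (cx (Q n))) \<le> mass_bound"
      using mass_le mass_bound(1) by (intro enn2real_leI)
    finally show ?thesis using memb(2) by (simp add: L2_rad_ball_def)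
  qed
  have "(\<lambda>_. 0) \<in> L2_rad" by (auto simp: L2_rad_def L2_def)
  moreover have "sqrt mass_bound + 1 > 0" using mass_bound(1) by (simp add: add_nonneg_pos)
  ultimately have "uniformly_continuous_flow_on T ?B \<Phi>"
    using luc unfolding locally_uniformly_continuous_flow_def by blast
  then obtain \<delta> where \<delta>: "\<delta> > 0" and uc: "\<And>f g. f \<in> ?B \<Longrightarrow> g \<in> ?B \<Longrightarrow> L2_dist f g < \<delta> \<Longrightarrow> C_L2_dist T (\<Phi> f) (\<Phi> g) < sqrt low"
    unfolding uniformly_continuous_flow_on_def using low(1) by (meson real_sqrt_gt_zero)
  \<comment> \<open>Half of \<delta> is used because closeness comes as a weak inequality, while
    uniform continuity asks for a strict one.\<close>
  obtain i j where "i < j" and close: "(\<integral>\<^sup>+x. (edist (Q i x) (Q j x))\<^sup>2 \<partial>lborel) \<le> ennreal ((\<delta> / 2)\<^sup>2)"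
    using dilate_ground_states_close[of "\<lambda>n. m / \<kappa> n" P \<kappa> k \<omega> "(\<delta> / 2)\<^sup>2"] P \<kappa>_def \<omega> \<delta>
    unfolding Q_def k_def by auto
  have "L2_dist (cx (Q i)) (cx (Q j)) = sqrt (enn2real (\<integral>\<^sup>+x. (edist (Q i x) (Q j x))\<^sup>2 \<partial>lborel))"
    by (simp add: L2_dist_eq memb(1) nsq_cx_diff[OF fin fin])
  also have "\<dots> \<le> sqrt ((\<delta> / 2)\<^sup>2)" using close by (intro real_sqrt_le_mono enn2real_leI) auto
  also have "\<dots> < \<delta>" using \<delta> by simp
  finally have lt: "C_L2_dist T (\<Phi> (cx (Q i))) (\<Phi> (cx (Q j))) < sqrt low" by (rule uc[OF ball ball])
  define t where "t = T / real (j - i)"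
  have "T * 1 \<le> T * real (j - i)" using \<open>i < j\<close> \<open>T > 0\<close> by (intro mult_left_mono) auto
  then have t: "t \<in> {0..T}" using \<open>i < j\<close> \<open>T > 0\<close> by (simp add: t_def pos_divide_le_eq)
  have "\<kappa> j * t = \<kappa> i * t + pi"
  proof -
    have "\<kappa> j = \<kappa> i + real (j - i) * \<omega>" using \<open>i < j\<close> by (simp add: \<kappa>_def of_nat_diff algebra_simps)
    moreover have "real (j - i) * \<omega> * t = pi" using \<open>i < j\<close> \<open>T > 0\<close> by (simp add: t_def \<omega>_def)
    ultimately show ?thesis by (simp add: distrib_right)
  qed
  then have opp: "cis (\<kappa> j * t) = - cis (\<kappa> i * t)" by (simp add: cis_mult[symmetric])
  let ?d = "\<lambda>x. cis (\<kappa> i * t) * cx (Q i) x - cis (\<kappa> j * t) * cx (Q j) x"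
  have "ennreal low \<le> nsq (cx (Q i))" by (rule low)
  also have "\<dots> \<le> nsq ?d"
    unfolding nsq_def
    by (intro nn_integral_mono ennreal_leI power_mono) (use cmod_cis_mult_diff_opposite[OF opp] in auto)
  finally have "low \<le> enn2real (nsq ?d)"
    using nsq_le[OF t, of i j] low(1) by (cases "nsq ?d") (auto simp: top_unique)
  then have "sqrt low \<le> L2_dist (\<Phi> (cx (Q i)) t) (\<Phi> (cx (Q j)) t)"
    unfolding dist_flow[OF t] by simp
  also have "\<dots> \<le> C_L2_dist T (\<Phi> (cx (Q i))) (\<Phi> (cx (Q j)))"
    unfolding C_L2_dist_def
  proof (rule cSUP_upper[OF t])
    have "L2_dist (\<Phi> (cx (Q i)) s) (\<Phi> (cx (Q j)) s) \<le> sqrt (4 * mass_bound)" if "s \<in> {0..T}" for s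
      unfolding dist_flow[OF that] using nsq_le[OF that, of i j] mass_bound(1)
      by (intro real_sqrt_le_mono enn2real_leI) auto
    then show "bdd_above ((\<lambda>t. L2_dist (\<Phi> (cx (Q i)) t) (\<Phi> (cx (Q j)) t)) ` {0..T})"
      by (rule bdd_aboveI2)
  qed
  finally show False using lt by simp
qed

end
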